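(* Let $\alpha>1$, $1<p<\infty$, $\frac1p+\frac1{p'}=1$. For $\varepsilon>0$ let $f^\varepsilon\in L^{p'}(R^\varepsilon)$ satisfy $|||f^\varepsilon|||_{L^{p'}(R^\varepsilon)}\le c$ for some $c>0$ independent of $\varepsilon$, and suppose that $$\hat f^\varepsilon(x)=\frac1\varepsilon\int_0^{\varepsilon g(x/\varepsilon^\alpha)}f^\varepsilon(x,y)\,dy$$ satisfies $\hat f^\varepsilon\rightharpoonup\hat f$ weakly in $L^{p'}(0,1)$ as $\varepsilon\to0$. Let $u_\varepsilon\in W^{1,p}(R^\varepsilon)$ be the solution of $$\int_{R^\varepsilon}\left\{|\nabla u_\varepsilon|^{p-2}\nabla u_\varepsilon\cdot\nabla\varphi+|u_\varepsilon|^{p-2}u_\varepsilon\varphi\right\}dxdy=\int_{R^\varepsilon}f^\varepsilon\varphi\,dxdy\qquad\forall\varphi\in W^{1,p}(R^\varepsilon),$$ let $u_\varepsilon^+=u_\varepsilon|_{R^\varepsilon_+}$, $u_\varepsilon^-=u_\varepsilon|_{R^\varepsilon_-}$, and let $u\in W^{1,p}(0,1)$ be the unique solution of $$\int_0^1\left(\frac{g_0}{\langle g\rangle_{(0,L)}}|u'|^{p-2}u'\varphi'+|u|^{p-2}u\varphi\right)dx=\int_0^1\frac{\hat f}{\langle g\rangle_{(0,L)}}\varphi\,dx\qquad\forall\varphi\in W^{1,p}(0,1).$$ Then, as $\varepsilon\to0$, $$\Pi_\varepsilon u_\varepsilon^-\to u\ \text{ strongly in } W^{1,p}(R_-),$$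 $$\Pi_\varepsilon\left(|\nabla u_\varepsilon^-|^{p-2}\partial_xu_\varepsilon^-\right)\to|u'|^{p-2}u'\ \text{ strongly in } L^{p'}(R_-),$$ $$\Pi_\varepsilon\left(|\nabla u_\varepsilon^-|^{p-2}\partial_yu_\varepsilon^-\right)\to0\ \text{ strongly in } L^{p'}(R_-),$$ $$T_\varepsilon^+\left(|\nabla u_\varepsilon^+|^{p-2}\partial_xu_\varepsilon^+\right)\to0\ \text{ strongly in } L^{p'}((0,1)\times Y^*_+),$$ $$T_\varepsilon^+\left(|\nabla u_\varepsilon^+|^{p-2}\partial_yu_\varepsilon^+\right)\to0\ \text{ strongly in } L^{p'}((0,1)\times Y^*_+).$$ Moreover, $$|||\nabla u_\varepsilon|||_{L^p(R^\varepsilon_+)}\to0.$$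
   Context: Standing assumptions on $g$: $g:\mathbb{R}\to\mathbb{R}$ is strictly positive, bounded, lower semicontinuous and $L$-periodic ($L>0$), with $g_0=\min_{\mathbb R}g>0$. $\langle h\rangle_{(0,L)}=\frac1L\int_0^Lh(s)\,ds$ denotes the average. Thin domain: $R^\varepsilon=\{(x,y)\in\mathbb{R}^2:0<x<1,\ 0<y<\varepsilon g(x/\varepsilon^\alpha)\}$, divided into $$R^\varepsilon_+=\{(x,y):x\in(0,1),\ \varepsilon g_0<y<\varepsilon g(x/\varepsilon^\alpha)\},\qquad R^\varepsilon_-=\{(x,y):x\in(0,1),\ 0<y<\varepsilon g_0\}.$$ Fixed sets: $Y^*_+=\{(y_1,y_2):0<y_1<L,\ g_0<y_2<g(y_1)\}$ and $R_-=\{(x,y):x\in(0,1),\ 0<y<g_0\}$. The variational problem has a unique solution for each $\varepsilon>0$. A function of $x\in(0,1)$ is also regarded as a function on $R_-$ independent of $y$. Rescaled norm: for $\mathcal O\subset R^\varepsilon$, $|||\varphi|||_{L^r(\mathcal O)}=\varepsilon^{-1/r}\|\varphi\|_{L^r(\mathcal O)}$ for $1\le r<\infty$. Rescaling operator: for $\varphi$ defined on $R^\varepsilon_-$, $\Pi_\varepsilon(\varphi)(x,y)=\varphi(x,\varepsilon y)$ for $(x,y)\in R_-$. Unfolding operator for $Y^*_+$: for $a\in\mathbb{R}$, $[a]_L$ is the unique integer with $a=[a]_LL+\{a\}_L$, $\{a\}_L\in[0,L)$. Let $N_\varepsilon$ be the largest integer with $\varepsilon^\alpha L(N_\varepsilon+1)\le1$,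 $I_\varepsilon=\mathrm{Int}\big(\bigcup_{k=0}^{N_\varepsilon}[kL\varepsilon^\alpha,(k+1)L\varepsilon^\alpha]\big)$, $\Lambda_\varepsilon=(0,1)\setminus I_\varepsilon$. For $\varphi$ Lebesgue measurable on $R^\varepsilon_+$, $T_\varepsilon^+\varphi(x,y_1,y_2)=\varphi(\varepsilon^\alpha[x/\varepsilon^\alpha]_LL+\varepsilon^\alpha y_1,\varepsilon y_2)$ for $(x,y_1,y_2)\in I_\varepsilon\times Y^*_+$ and $T_\varepsilon^+\varphi=0$ on $\Lambda_\varepsilon\times Y^*_+$. *)

theory Defs
  imports "HOL-Analysis.Analysis"
begin

section \<open>Lebesgue spaces on subsets of a Euclidean space\<close>

text \<open>Elements are functions rather than classes modulo null sets; values outside \<open>U\<close> are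
  irrelevant. The codomain norm is the Euclidean one, so vector fields are covered as well.\<close>

definition Lp_space :: "real \<Rightarrow> 'a::euclidean_space set \<Rightarrow> ('a \<Rightarrow> 'b::euclidean_space) set" where
  "Lp_space p U = {v \<in> borel_measurable (lebesgue_on U).
                     integrable (lebesgue_on U) (\<lambda>z. norm (v z) powr p)}"

definition Lp_norm :: "real \<Rightarrow> 'a::euclidean_space set \<Rightarrow> ('a \<Rightarrow> 'b::euclidean_space) \<Rightarrow> real" where
  "Lp_norm p U v = (LINT z|lebesgue_on U. norm (v z) powr p) powr (1 / p)"

text \<open>The Bochner integral of a non-integrable function is \<open>0\<close>, so membership has to be part of
  every notion of convergence.\<close>

definition Lp_tendsto ::
  "real \<Rightarrow> 'a::euclidean_space set \<Rightarrow> ('i \<Rightarrow> 'a \<Rightarrow> 'b::euclidean_space) \<Rightarrow> ('a \<Rightarrow> 'b) \<Rightarrow> 'i filter \<Rightarrow> bool"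
where
  "Lp_tendsto p U v w F \<longleftrightarrow>
     w \<in> Lp_space p U \<and> (\<forall>\<^sub>F i in F. v i \<in> Lp_space p U) \<and>
     ((\<lambda>i. Lp_norm p U (\<lambda>z. v i z - w z)) \<longlongrightarrow> 0) F"

text \<open>Weak convergence for \<open>1 < p < \<infinity>\<close>, the dual of \<open>L\<^sup>p\<close> being represented by \<open>L\<^sup>q\<close> with
  \<open>q = p / (p - 1)\<close>.\<close>

definition Lp_weak_tendsto ::
  "real \<Rightarrow> 'a::euclidean_space set \<Rightarrow> ('i \<Rightarrow> 'a \<Rightarrow> real) \<Rightarrow> ('a \<Rightarrow> real) \<Rightarrow> 'i filter \<Rightarrow> bool"
where
  "Lp_weak_tendsto p U v w F \<longleftrightarrow>
     w \<in> Lp_space p U \<and> (\<forall>\<^sub>F i in F. v i \<in> Lp_space p U) \<and>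
     (\<forall>\<psi> \<in> Lp_space (p / (p - 1)) U.
        ((\<lambda>i. LINT z|lebesgue_on U. v i z * \<psi> z) \<longlongrightarrow> (LINT z|lebesgue_on U. w z * \<psi> z)) F)"

section \<open>Weak gradients and first order Sobolev spaces\<close>

primrec Ck :: "nat \<Rightarrow> ('a::euclidean_space \<Rightarrow> real) \<Rightarrow> bool" where
  "Ck 0 \<phi> \<longleftrightarrow> continuous_on UNIV \<phi>"
| "Ck (Suc k) \<phi> \<longleftrightarrow>
     (\<forall>z. \<phi> differentiable (at z)) \<and> (\<forall>b\<in>Basis. Ck k (\<lambda>z. frechet_derivative \<phi> (at z) b))"

definition test_functions :: "'a::euclidean_space set \<Rightarrow> ('a \<Rightarrow> real) set" where
  "test_functions U =
     {\<phi>. (\<forall>k. Ck k \<phi>) \<and> compact (closure {z. \<phi> z \<noteq> 0}) \<and> closure {z. \<phi> z \<noteq> 0} \<subseteq> U}"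

definition locally_integrable :: "'a::euclidean_space set \<Rightarrow> ('a \<Rightarrow> 'b::euclidean_space) \<Rightarrow> bool" where
  "locally_integrable U v \<longleftrightarrow> (\<forall>K. compact K \<and> K \<subseteq> U \<longrightarrow> integrable (lebesgue_on K) v)"

definition weak_gradient :: "'a::euclidean_space set \<Rightarrow> ('a \<Rightarrow> real) \<Rightarrow> ('a \<Rightarrow> 'a) \<Rightarrow> bool" where
  "weak_gradient U v G \<longleftrightarrow>
     locally_integrable U v \<and> locally_integrable U G \<and>
     (\<forall>\<phi>\<in>test_functions U. \<forall>b\<in>Basis.
        (LINT z|lebesgue_on U. v z * frechet_derivative \<phi> (at z) b) =
        - (LINT z|lebesgue_on U. (G z \<bullet> b) * \<phi> z))"

text \<open>On an open set the weak gradient is unique up to a null set; \<open>wgrad\<close> picks a representative.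
  For \<open>'a = real\<close> it is the weak derivative.\<close>

definition wgrad :: "'a::euclidean_space set \<Rightarrow> ('a \<Rightarrow> real) \<Rightarrow> 'a \<Rightarrow> 'a" where
  "wgrad U v = (SOME G. weak_gradient U v G)"

definition W1p :: "real \<Rightarrow> 'a::euclidean_space set \<Rightarrow> ('a \<Rightarrow> real) set" where
  "W1p p U = {v \<in> Lp_space p U. \<exists>G\<in>Lp_space p U. weak_gradient U v G}"

definition W1p_norm :: "real \<Rightarrow> 'a::euclidean_space set \<Rightarrow> ('a \<Rightarrow> real) \<Rightarrow> real" where
  "W1p_norm p U v = (Lp_norm p U v powr p + Lp_norm p U (wgrad U v) powr p) powr (1 / p)"

definition W1p_tendsto ::
  "real \<Rightarrow> 'a::euclidean_space set \<Rightarrow> ('i \<Rightarrow> 'a \<Rightarrow> real) \<Rightarrow> ('a \<Rightarrow> real) \<Rightarrow> 'i filter \<Rightarrow> bool"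
where
  "W1p_tendsto p U v w F \<longleftrightarrow>
     w \<in> W1p p U \<and> (\<forall>\<^sub>F i in F. v i \<in> W1p p U) \<and>
     ((\<lambda>i. W1p_norm p U (\<lambda>z. v i z - w z)) \<longlongrightarrow> 0) F"

text \<open>The map \<open>\<xi> \<mapsto> |\<xi>|\<^sup>p\<^sup>-\<^sup>2 \<xi>\<close>, with value \<open>0\<close> at \<open>\<xi> = 0\<close> also for \<open>p \<le> 2\<close>.\<close>

definition pflux :: "real \<Rightarrow> 'b::euclidean_space \<Rightarrow> 'b" where
  "pflux p \<xi> = (norm \<xi> powr (p - 2)) *\<^sub>R \<xi>"

section \<open>The thin domain\<close>

definition lower_semicontinuous :: "('a::topological_space \<Rightarrow> real) \<Rightarrow> bool" where
  "lower_semicontinuous g \<longleftrightarrow> (\<forall>x. \<forall>a < g x. \<forall>\<^sub>F y in nhds x. a < g y)"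

definition period_average :: "real \<Rightarrow> (real \<Rightarrow> real) \<Rightarrow> real" where
  "period_average L h = (1 / L) * (LINT s|lebesgue_on {0<..<L}. h s)"

definition thin_domain :: "(real \<Rightarrow> real) \<Rightarrow> real \<Rightarrow> real \<Rightarrow> (real \<times> real) set" where
  "thin_domain g \<alpha> \<epsilon> = {(x, y). 0 < x \<and> x < 1 \<and> 0 < y \<and> y < \<epsilon> * g (x / \<epsilon> powr \<alpha>)}"

definition thin_upper :: "(real \<Rightarrow> real) \<Rightarrow> real \<Rightarrow> real \<Rightarrow> real \<Rightarrow> (real \<times> real) set" where
  "thin_upper g g0 \<alpha> \<epsilon> = {(x, y). x \<in> {0<..<1} \<and> \<epsilon> * g0 < y \<and> y < \<epsilon> * g (x / \<epsilon> powr \<alpha>)}"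

definition thin_lower :: "real \<Rightarrow> real \<Rightarrow> (real \<times> real) set" where
  "thin_lower g0 \<epsilon> = {(x, y). x \<in> {0<..<1} \<and> 0 < y \<and> y < \<epsilon> * g0}"

definition upper_cell :: "(real \<Rightarrow> real) \<Rightarrow> real \<Rightarrow> real \<Rightarrow> (real \<times> real) set" where
  "upper_cell g g0 L = {(y1, y2). 0 < y1 \<and> y1 < L \<and> g0 < y2 \<and> y2 < g y1}"

definition fixed_lower :: "real \<Rightarrow> (real \<times> real) set" where
  "fixed_lower g0 = {(x, y). x \<in> {0<..<1} \<and> 0 < y \<and> y < g0}"

definition rescaled_norm ::
  "real \<Rightarrow> real \<Rightarrow> (real \<times> real) set \<Rightarrow> (real \<times> real \<Rightarrow> 'b::euclidean_space) \<Rightarrow> real"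
where
  "rescaled_norm \<epsilon> r U v = \<epsilon> powr (- 1 / r) * Lp_norm r U v"

definition fibre_average ::
  "(real \<Rightarrow> real) \<Rightarrow> real \<Rightarrow> real \<Rightarrow> (real \<times> real \<Rightarrow> real) \<Rightarrow> real \<Rightarrow> real"
where
  "fibre_average g \<alpha> \<epsilon> f x =
     (1 / \<epsilon>) * (LINT y|lebesgue_on {0<..<\<epsilon> * g (x / \<epsilon> powr \<alpha>)}. f (x, y))"

section \<open>Rescaling and unfolding\<close>

definition rescale :: "real \<Rightarrow> (real \<times> real \<Rightarrow> 'b) \<Rightarrow> real \<times> real \<Rightarrow> 'b" where
  "rescale \<epsilon> v = (\<lambda>(x, y). v (x, \<epsilon> * y))"

definition cell_index :: "real \<Rightarrow> real \<Rightarrow> int" where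
  "cell_index L a = (THE k. a - of_int k * L \<in> {0..<L})"

text \<open>For \<open>\<epsilon>\<^sup>\<alpha> L > 1\<close> the index \<open>last_cell\<close> is \<open>-1\<close> and \<open>full_cells\<close> is empty.\<close>

definition last_cell :: "real \<Rightarrow> real \<Rightarrow> real \<Rightarrow> int" where
  "last_cell L \<alpha> \<epsilon> = (GREATEST N. \<epsilon> powr \<alpha> * L * (of_int N + 1) \<le> 1)"

definition full_cells :: "real \<Rightarrow> real \<Rightarrow> real \<Rightarrow> real set" where
  "full_cells L \<alpha> \<epsilon> =
     interior (\<Union>k\<in>{0..last_cell L \<alpha> \<epsilon>}. {of_int k * L * \<epsilon> powr \<alpha> .. (of_int k + 1) * L * \<epsilon> powr \<alpha>})"

text \<open>Only used on \<open>{0<..<1} \<times> upper_cell g g0 L\<close>, where \<open>v\<close> is evaluated in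
  \<open>thin_upper g g0 \<alpha> \<epsilon>\<close> only.\<close>

definition unfold_upper :: "real \<Rightarrow> real \<Rightarrow> real \<Rightarrow> (real \<times> real \<Rightarrow> real) \<Rightarrow> real \<times> real \<times> real \<Rightarrow> real" where
  "unfold_upper L \<alpha> \<epsilon> v = (\<lambda>(x, y1, y2).
     if x \<in> full_cells L \<alpha> \<epsilon>
     then v (\<epsilon> powr \<alpha> * of_int (cell_index L (x / \<epsilon> powr \<alpha>)) * L + \<epsilon> powr \<alpha> * y1, \<epsilon> * y2)
     else 0)"

end

theory Submission
  imports Defs
begin

text \<open>Write \<open>a \<xi> = |\<xi>|\<^sup>p\<^sup>-\<^sup>2 \<xi>\<close>. The proof is the monotonicity method of nonlinear elliptic equations with an
  explicit competitor in place of compactness. Three functions are compared with the solution \<open>u\<close> in the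
  domain of thickness \<open>\<epsilon>\<close>: the limit solution \<open>V\<close>, which depends on \<open>x\<close> only; the mean \<open>v\<close> of \<open>u\<close> over the
  vertical fibres of the lower part; and a recovery function \<open>W\<close> of \<open>V\<close>. The mean is close to \<open>u\<close> since
  fibres have length of order \<open>\<epsilon>\<close> (\<open>vertical_oscillation_powr\<close>), and it is a Sobolev function on the unit
  interval (\<open>lower_mean_sobolev\<close>), hence a test function for the limit equation.

  The recovery function uses \<open>\<alpha> > 1\<close>. Over the points \<open>x\<close> where \<open>g (x / \<epsilon>\<^sup>\<alpha>)\<close> attains its minimum \<open>g0\<close> the upper
  part of the domain is empty, and there is such a point in every interval of length \<open>\<epsilon>\<^sup>\<alpha> L\<close>, much shorter
  than the thickness \<open>\<epsilon>\<close>. So \<open>W\<close> may equal \<open>V\<close> in the lower part and, above a ramp layer of width \<open>\<epsilon>\<^sup>\<alpha>\<close>, be a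
  step function of \<open>x\<close> that jumps over these points only. It lies in the Sobolev space of the thin domain
  (\<open>recovery_sobolev\<close>), and its gradient in the upper part, confined to the ramp, tends to zero in the rescaled norm
  (\<open>recovery_grad_upper\<close>).

  Consider the rescaled excess, \<open>\<epsilon>\<^sup>-\<^sup>1\<close> times the integral of
  \<open>(a (\<nabla>u) - a (\<nabla>W)) \<bullet> (\<nabla>u - \<nabla>W) + (a u - a V) (u - V)\<close>, which is nonnegative. Testing the equation in the thin
  domain with \<open>u\<close> and \<open>W\<close>, and the limit equation with \<open>v\<close> and \<open>V\<close>, leaves errors that Hoelder's inequality
  makes small and two integrals over the unit interval: one of \<open>v - V\<close> against the difference of the fibre
  averages of the load and their weak limit, and one of \<open>a V (v - V)\<close> against \<open>g (x / \<epsilon>\<^sup>\<alpha>)\<close> minus the mean value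
  of \<open>g\<close> (\<open>excess_le\<close>). In both, one factor tends to zero weakly and the other is bounded and equicontinuous,
  because the derivatives of the means \<open>v\<close> have bounded \<open>p\<close>-norms; so the integrals tend to zero
  (\<open>integral_product_tendsto_0\<close>), and so does the excess (\<open>excess_tendsto\<close>).

  A homogeneity and compactness argument in finite dimension (\<open>controlled_by_monotonicity\<close>) turns this into
  convergence of \<open>\<nabla>u - \<nabla>W\<close>, of \<open>u - V\<close> and of the fluxes in the rescaled norms, for all \<open>p > 1\<close> at once. In
  the lower part the vertical rescaling maps these to norms on a fixed domain, where \<open>\<nabla>W\<close> is \<open>(V', 0)\<close>. In the
  upper part \<open>\<nabla>W\<close> tends to zero, hence so does \<open>\<nabla>u\<close>; and the unfolding operator is bounded with respect to
  the rescaled norm (\<open>nn_integral_unfold_le\<close>).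

  Functions in the given Lebesgue and Sobolev spaces are replaced throughout by Borel functions that
  vanish off their domain (\<open>borel_rep\<close>, \<open>sobolev_rep\<close>), so that all integrals are over whole spaces.\<close>

abbreviation Borel_fun :: "('a::topological_space \<Rightarrow> 'b::topological_space) set" where
  "Borel_fun \<equiv> borel_measurable borel"
abbreviation deriv_at :: "('a::real_normed_vector \<Rightarrow> real) \<Rightarrow> 'a \<Rightarrow> 'a \<Rightarrow> real" where
  "deriv_at f z \<equiv> frechet_derivative f (at z)"
lemmas integrable_dominated = Bochner_Integration.integrable_bound
lemmas integral_difference = Bochner_Integration.integral_diff

section \<open>Smooth test functions\<close>

lemma Ck_SucI:
  assumes "\<And>z. (f has_derivative D z) (at z)" "\<And>b. b \<in> Basis \<Longrightarrow> Ck k (\<lambda>z. D z b)"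
  shows "Ck (Suc k) f"
proof -
  have "deriv_at f z = D z" for z
    using assms(1) frechet_derivative_at by metis
  then show ?thesis
    using assms by (auto simp: differentiable_def)
qed

lemma Ck_SucD:
  assumes "Ck (Suc k) f"
  shows "(f has_derivative deriv_at f z) (at z)"
  using assms frechet_derivative_works by auto

lemma Ck_lower: "Ck (Suc k) f \<Longrightarrow> Ck k f"
proof (induction k arbitrary: f)
  case 0
  then show ?case
    by (auto intro!: continuous_at_imp_continuous_on differentiable_imp_continuous_within)
next
  case (Suc k)
  then show ?case by (metis Ck.simps(2))
qed

lemma Ck_const [simp]: "Ck k (\<lambda>_::'a::euclidean_space. c)"
proof (induction k arbitrary: c)
  case (Suc k)
  then show ?case by (intro Ck_SucI[where D = "\<lambda>_ _. 0"]) auto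
qed (auto)

lemma Ck_add: "Ck k f \<Longrightarrow> Ck k g \<Longrightarrow> Ck k (\<lambda>z. f z + g z)"
proof (induction k arbitrary: f g)
  case (Suc k)
  show ?case
    using Suc
    by (intro Ck_SucI[OF has_derivative_add[OF Ck_SucD[OF Suc.prems(1)] Ck_SucD[OF Suc.prems(2)]]]) auto
qed (auto intro: continuous_intros)

lemma Ck_mult: "Ck k f \<Longrightarrow> Ck k g \<Longrightarrow> Ck k (\<lambda>z. f z * g z)"
proof (induction k arbitrary: f g)
  case (Suc k)
  have "Ck k f" "Ck k g" using Suc.prems Ck_lower by auto
  then show ?case
    using Suc
    by (intro Ck_SucI[OF has_derivative_mult[OF Ck_SucD[OF Suc.prems(1)] Ck_SucD[OF Suc.prems(2)]]] Ck_add Suc.IH)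
       auto
qed (auto intro: continuous_intros)

lemma Ck_prod: "finite I \<Longrightarrow> (\<And>i. i \<in> I \<Longrightarrow> Ck k (f i)) \<Longrightarrow> Ck k (\<lambda>z. \<Prod>i\<in>I. f i z)"
  by (induction I rule: finite_induct) (auto intro: Ck_mult)

lemma frechet_derivative_real:
  "(f has_real_derivative d) (at t) \<Longrightarrow> deriv_at f t 1 = d"
  by (metis frechet_derivative_at has_field_derivative_def mult.right_neutral)

lemma differentiable_real_DERIV:
  "(f :: real \<Rightarrow> real) differentiable at t \<Longrightarrow> (f has_real_derivative deriv_at f t 1) (at t)"
  by (metis differentiable_def frechet_derivative_real real_differentiableE differentiableI)

lemma Ck_inner:
  fixes h :: "real \<Rightarrow> real" and c :: "'a::euclidean_space"
  shows "Ck k h \<Longrightarrow> Ck k (\<lambda>z. h (z \<bullet> c))"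
proof (induction k arbitrary: h)
  case 0
  then show ?case
    by (auto intro!: continuous_on_compose2[of UNIV h] continuous_intros)
next
  case (Suc k)
  define h' where "h' t = deriv_at h t 1" for t
  have d: "(h has_real_derivative h' t) (at t)" for t
    using Suc.prems by (auto simp: h'_def intro: differentiable_real_DERIV)
  show ?case
  proof (rule Ck_SucI)
    show "((\<lambda>z. h (z \<bullet> c)) has_derivative (\<lambda>v. h' (z \<bullet> c) * (v \<bullet> c))) (at z)" for z :: 'a
      by (rule has_derivative_compose[OF _ d[unfolded has_field_derivative_def], simplified])
         (auto intro!: derivative_eq_intros)
    show "Ck k (\<lambda>z. h' (z \<bullet> c) * (b \<bullet> c))" for b :: 'a
      using Suc by (intro Ck_mult Suc.IH) (auto simp: h'_def[abs_def])
  qed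
qed

text \<open>For a diagonal map the chain rule multiplies each partial derivative by a constant and mixes none of
  them, so the induction on the order of differentiation goes through. The maps in view rescale one
  coordinate.\<close>

lemma Ck_compose_diagonal:
  fixes A :: "'a::euclidean_space \<Rightarrow> 'a"
  assumes A: "bounded_linear A" and d: "\<And>b. b \<in> Basis \<Longrightarrow> A b = d b *\<^sub>R b"
  shows "Ck k f \<Longrightarrow> Ck k (\<lambda>z. f (A z))"
proof (induction k arbitrary: f)
  case 0
  then show ?case
    by (auto intro!: continuous_on_compose2[of UNIV f] linear_continuous_on[OF A])
next
  case (Suc k)
  have D: "((\<lambda>z. f (A z)) has_derivative (\<lambda>v. deriv_at f (A z) (A v))) (at z)" for z
    by (rule has_derivative_compose[OF bounded_linear_imp_has_derivative[OF A] Ck_SucD[OF Suc.prems]])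
  have "linear (deriv_at f z)" for z
    using Ck_SucD[OF Suc.prems] has_derivative_linear by blast
  then have "(\<lambda>z. deriv_at f (A z) (A b)) =
      (\<lambda>z. d b * deriv_at f (A z) b)" if "b \<in> Basis" for b
    using that d by (simp add: linear_cmul)
  then show ?case
    using Suc by (intro Ck_SucI[OF D]) (auto intro!: Ck_mult)
qed

text \<open>The functions \<open>P (1 / x) exp (- 1 / x)\<close>, extended by zero to the left, form a class that is closed
  under differentiation, which makes their smoothness a plain induction.\<close>

definition exp_bump :: "real poly \<Rightarrow> real \<Rightarrow> real" where
  "exp_bump P x = (if x > 0 then poly P (1 / x) * exp (- (1 / x)) else 0)"

lemma poly_over_exp_tendsto_0:
  "((\<lambda>t::real. t ^ n * poly P t / exp t) \<longlongrightarrow> 0) at_top"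
proof (induction P arbitrary: n)
  case (pCons a P)
  have "((\<lambda>t. a * (t ^ n / exp t) + t ^ Suc n * poly P t / exp t) \<longlongrightarrow> a * 0 + 0) at_top"
    by (intro tendsto_intros tendsto_power_div_exp_0 pCons.IH)
  then show ?case
    by (simp add: algebra_simps add_divide_distrib)
qed auto

lemma exp_bump_DERIV:
  "(exp_bump P has_real_derivative exp_bump ([:0,0,1:] * (P - pderiv P)) x) (at x)"
proof -
  consider "x > 0" | "x < 0" | "x = 0" by linarith
  then show ?thesis
  proof cases
    case 1
    have "((\<lambda>x. poly P (1 / x) * exp (- (1 / x))) has_real_derivative
        exp_bump ([:0,0,1:] * (P - pderiv P)) x) (at x)"
      using 1 unfolding exp_bump_def
      by (auto intro!: derivative_eq_intros simp: field_simps power2_eq_square)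
    then show ?thesis
      by (rule has_field_derivative_transform_within_open[where S = "{0<..}"])
        (use 1 in \<open>auto simp: exp_bump_def\<close>)
  next
    case 2
    have "((\<lambda>x. 0) has_real_derivative exp_bump ([:0,0,1:] * (P - pderiv P)) x) (at x)"
      using 2 unfolding exp_bump_def by auto
    then show ?thesis
      by (rule has_field_derivative_transform_within_open[where S = "{..<0}"])
        (use 2 in \<open>auto simp: exp_bump_def\<close>)
  next
    case 3
    have "((\<lambda>h. (exp_bump P (0 + h) - exp_bump P 0) / h) \<longlongrightarrow> 0) (at 0)"
    proof (rule filterlim_split_at)
      show "((\<lambda>h. (exp_bump P (0 + h) - exp_bump P 0) / h) \<longlongrightarrow> 0) (at_left 0)"
        by (rule tendsto_eventually)
           (auto simp: eventually_at_filter exp_bump_def)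
      have "((\<lambda>h. (inverse h) ^ 1 * poly P (inverse h) / exp (inverse h)) \<longlongrightarrow> 0) (at_right (0::real))"
        by (rule filterlim_compose[OF poly_over_exp_tendsto_0 filterlim_inverse_at_top_right])
      then show "((\<lambda>h. (exp_bump P (0 + h) - exp_bump P 0) / h) \<longlongrightarrow> 0) (at_right 0)"
        by (rule Lim_transform_eventually)
           (auto simp: eventually_at_filter exp_bump_def exp_minus field_simps)
    qed
    then show ?thesis
      using 3 by (simp add: DERIV_def exp_bump_def)
  qed
qed

lemma Ck_exp_bump: "Ck k (exp_bump P)"
proof (induction k arbitrary: P)
  case 0
  then show ?case
    using exp_bump_DERIV[THEN DERIV_isCont] by (simp add: continuous_at_imp_continuous_on)
next
  case (Suc k)
  show ?case
    by (rule Ck_SucI[OF exp_bump_DERIV[unfolded has_field_derivative_def]]) (auto simp: Suc)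
qed

text \<open>The shift by \<open>1\<close> keeps the support at distance \<open>1 / (n + 1)\<close> from the end points, hence compact
  in the open interval; the factor \<open>n + 1\<close> makes the bumps increase to the indicator of the interval.\<close>

definition interval_bump :: "real \<Rightarrow> real \<Rightarrow> nat \<Rightarrow> real \<Rightarrow> real" where
  "interval_bump a b n x =
     exp_bump 1 (real (Suc n) * (x - a) - 1) * exp_bump 1 (real (Suc n) * (b - x) - 1)"

lemma exp_bump_1: "0 \<le> exp_bump 1 x" "exp_bump 1 x \<le> 1"
  by (auto simp: exp_bump_def)

lemma interval_bump_bounds: "0 \<le> interval_bump a b n x" "interval_bump a b n x \<le> 1"
  using exp_bump_1 by (auto simp: interval_bump_def mult_le_one)

lemma interval_bump_support:
  assumes "interval_bump a b n x \<noteq> 0"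
  shows "a + 1 / real (Suc n) \<le> x" "x \<le> b - 1 / real (Suc n)"
proof -
  have "real (Suc n) * (x - a) - 1 > 0" "real (Suc n) * (b - x) - 1 > 0"
    using assms by (auto simp: interval_bump_def exp_bump_def split: if_splits)
  then show "a + 1 / real (Suc n) \<le> x" "x \<le> b - 1 / real (Suc n)"
    by (auto simp: field_simps)
qed

lemma interval_bump_tendsto:
  "(\<lambda>n. interval_bump a b n x) \<longlonglongrightarrow> indicator {a<..<b} x"
proof (cases "x \<in> {a<..<b}")
  case False
  have "interval_bump a b n x = 0" for n
  proof (rule ccontr)
    assume "interval_bump a b n x \<noteq> 0"
    moreover have "1 / real (Suc n) > 0" by simp
    ultimately show False
      using interval_bump_support[of a b n x] False unfolding greaterThanLessThan_iff by linarith
  qed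
  then show ?thesis using False by simp
next
  case True
  have lim: "filterlim (\<lambda>n. real (Suc n) * d - 1) at_top sequentially" if "d > 0" for d
    using that by real_asymp
  have "((\<lambda>t. exp_bump 1 t) \<longlongrightarrow> 1) at_top"
  proof (rule Lim_transform_eventually)
    show "((\<lambda>t::real. exp (- (1 / t))) \<longlongrightarrow> 1) at_top" by real_asymp
    show "\<forall>\<^sub>F t in at_top. exp (- (1 / t)) = exp_bump 1 t"
      using eventually_gt_at_top[of 0] by eventually_elim (simp add: exp_bump_def)
  qed
  from filterlim_compose[OF this lim] have
    "(\<lambda>n. interval_bump a b n x) \<longlonglongrightarrow> 1 * 1"
    unfolding interval_bump_def using True by (intro tendsto_mult) auto
  then show ?thesis using True by simp
qed

lemma Ck_interval_bump: "Ck k (interval_bump a b n)"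
proof -
  have 1: "Ck k (\<lambda>t. h (c * t + d))" if h: "\<And>k. Ck k h" for h :: "real \<Rightarrow> real" and c d k
    using h
  proof (induction k arbitrary: h)
    case 0
    then have "Ck 0 h" by blast
    then show ?case
      by (auto intro!: continuous_on_compose2[of UNIV h] continuous_intros)
  next
    case (Suc k)
    let ?h' = "\<lambda>t. deriv_at h t 1"
    have "\<And>k. Ck (Suc k) h" using Suc.prems by blast
    then have d: "(h has_real_derivative ?h' t) (at t)" "Ck k ?h'" for t k
      by (auto intro: differentiable_real_DERIV)
    have "((\<lambda>t. h (c * t + d)) has_derivative (\<lambda>v. ?h' (c * t + d) * (c * v))) (at t)" for t
      by (rule has_derivative_compose[OF _ d(1)[unfolded has_field_derivative_def], simplified])
         (auto intro!: derivative_eq_intros)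
    then show ?case
    proof (rule Ck_SucI)
      show "Ck k (\<lambda>t. ?h' (c * t + d) * (c * v))" for v
        using Suc.IH[OF d(2)] by (auto intro!: Ck_mult)
    qed
  qed
  have "Ck k (\<lambda>x. exp_bump 1 (real (Suc n) * x + (- real (Suc n) * a - 1)) *
      exp_bump 1 (- real (Suc n) * x + (real (Suc n) * b - 1)))"
    by (intro Ck_mult 1 Ck_exp_bump)
  then show ?thesis
    unfolding interval_bump_def[abs_def] by (simp add: algebra_simps)
qed

definition box_bump :: "'a::euclidean_space \<Rightarrow> 'a \<Rightarrow> nat \<Rightarrow> 'a \<Rightarrow> real" where
  "box_bump a b n z = (\<Prod>i\<in>Basis. interval_bump (a \<bullet> i) (b \<bullet> i) n (z \<bullet> i))"

lemma box_bump_bounds: "0 \<le> box_bump a b n z" "box_bump a b n z \<le> 1"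
  unfolding box_bump_def by (auto intro!: prod_nonneg prod_le_1 simp: interval_bump_bounds)

lemma box_bump_tendsto: "(\<lambda>n. box_bump a b n z) \<longlonglongrightarrow> indicator (box a b) z"
proof -
  have "(\<lambda>n. box_bump a b n z) \<longlonglongrightarrow> (\<Prod>i\<in>Basis. indicator {a \<bullet> i<..<b \<bullet> i} (z \<bullet> i))"
    unfolding box_bump_def by (intro tendsto_prod interval_bump_tendsto)
  also have "(\<Prod>i\<in>Basis. indicator {a \<bullet> i<..<b \<bullet> i} (z \<bullet> i)) = (indicator (box a b) z :: real)"
    by (auto simp: indicator_def box_def)
  finally show ?thesis .
qed

lemma test_functionsI:
  assumes "\<And>k. Ck k \<phi>" "compact K" "K \<subseteq> U" "\<And>z. \<phi> z \<noteq> 0 \<Longrightarrow> z \<in> K"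
  shows "\<phi> \<in> test_functions U"
proof -
  have "closure {z. \<phi> z \<noteq> 0} \<subseteq> K"
    using assms by (intro closure_minimal compact_imp_closed) auto
  then show ?thesis
    using assms unfolding test_functions_def
    by (auto simp: compact_closure intro: bounded_subset[OF compact_imp_bounded])
qed

lemma box_bump_test:
  assumes "box a b \<subseteq> U"
  shows "box_bump a b n \<in> test_functions U"
proof (rule test_functionsI)
  show "Ck k (box_bump a b n)" for k
    unfolding box_bump_def by (intro Ck_prod Ck_inner Ck_interval_bump) auto
  let ?e = "(1 / real (Suc n)) *\<^sub>R (One::'a)"
  show "compact (cbox (a + ?e) (b - ?e))" by (rule compact_cbox)
  have pos: "0 < 1 / real (Suc n)" by simp
  have "cbox (a + ?e) (b - ?e) \<subseteq> box a b"
  proof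
    fix z assume "z \<in> cbox (a + ?e) (b - ?e)"
    then have "a \<bullet> i + 1 / real (Suc n) \<le> z \<bullet> i \<and> z \<bullet> i \<le> b \<bullet> i - 1 / real (Suc n)"
      if "i \<in> Basis" for i
      using that by (simp add: mem_box inner_simps del: of_nat_Suc)
    moreover have "s < x \<and> x < t" if "0 < e" "s + e \<le> x \<and> x \<le> t - e" for s t x e :: real
      using that by linarith
    ultimately have "a \<bullet> i < z \<bullet> i \<and> z \<bullet> i < b \<bullet> i" if "i \<in> Basis" for i
      using pos that by blast
    then show "z \<in> box a b"
      unfolding mem_box by blast
  qed
  then show "cbox (a + ?e) (b - ?e) \<subseteq> U" using assms by auto
  show "z \<in> cbox (a + ?e) (b - ?e)" if "box_bump a b n z \<noteq> 0" for z
    using that interval_bump_support unfolding box_bump_def mem_box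
    by (auto simp: inner_simps)
qed

lemma test_functionsD:
  assumes "\<phi> \<in> test_functions U"
  shows test_continuous: "continuous_on S \<phi>"
    and test_derivative: "(\<phi> has_derivative deriv_at \<phi> z) (at z)"
    and test_partial_continuous: "b \<in> Basis \<Longrightarrow> continuous_on S (\<lambda>z. deriv_at \<phi> z b)"
    and test_zero: "z \<notin> U \<Longrightarrow> \<phi> z = 0"
    and test_partial_zero: "b \<in> Basis \<Longrightarrow> z \<notin> U \<Longrightarrow> deriv_at \<phi> z b = 0"
    and test_partial_zero': "b \<in> Basis \<Longrightarrow> z \<notin> closure {z. \<phi> z \<noteq> 0} \<Longrightarrow> deriv_at \<phi> z b = 0"
proof -
  have C: "Ck k \<phi>" for k using assms by (auto simp: test_functions_def)
  from C[of 0] show "continuous_on S \<phi>" by (auto intro: continuous_on_subset)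
  show "(\<phi> has_derivative deriv_at \<phi> z) (at z)"
    using Ck_SucD C by blast
  show "continuous_on S (\<lambda>z. deriv_at \<phi> z b)" if "b \<in> Basis"
    using C[of "Suc 0"] that by (auto intro: continuous_on_subset)
  have sub: "closure {z. \<phi> z \<noteq> 0} \<subseteq> U" using assms by (auto simp: test_functions_def)
  then show "\<phi> z = 0" if "z \<notin> U"
    using that closure_subset[of "{z. \<phi> z \<noteq> 0}"] by blast
  show *: "deriv_at \<phi> z b = 0" if "b \<in> Basis" "z \<notin> closure {z. \<phi> z \<noteq> 0}" for z
  proof -
    have "((\<lambda>_. 0) has_derivative (\<lambda>_. 0)) (at z)" by auto
    then have "(\<phi> has_derivative (\<lambda>_. 0)) (at z)"
    proof (rule has_derivative_transform_within_open[where s = "- closure {z. \<phi> z \<noteq> 0}"])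
      show "0 = \<phi> x" if "x \<in> - closure {z. \<phi> z \<noteq> 0}" for x
        using that closure_subset[of "{z. \<phi> z \<noteq> 0}"] by (metis (mono_tags) ComplD mem_Collect_eq subsetD)
    qed (use that in \<open>simp_all only: Compl_iff open_Compl closed_closure not_False_eq_True\<close>)
    then show ?thesis
      by (metis frechet_derivative_at)
  qed
  then show "b \<in> Basis \<Longrightarrow> z \<notin> U \<Longrightarrow> deriv_at \<phi> z b = 0"
    using sub by blast
qed

lemma compact_support_bounded:
  fixes h :: "'a::euclidean_space \<Rightarrow> real"
  assumes "continuous_on UNIV h" "compact K" "\<And>z. z \<notin> K \<Longrightarrow> h z = 0"
  obtains B where "B > 0" "\<And>z. \<bar>h z\<bar> \<le> B"
proof -
  have "bounded (h ` K)"
    using assms by (intro compact_imp_bounded compact_continuous_image) (auto intro: continuous_on_subset)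
  then obtain B where B: "B > 0" "\<forall>x\<in>h ` K. norm x \<le> B"
    using bounded_pos by metis
  show ?thesis
  proof (rule that)
    show "\<bar>h z\<bar> \<le> B" for z
      using B assms(3)[of z] by (cases "z \<in> K") auto
  qed fact
qed

lemma test_bounded:
  assumes "\<phi> \<in> test_functions U"
  obtains B where "B > 0" "\<And>z. \<bar>\<phi> z\<bar> \<le> B"
    "\<And>z b. b \<in> Basis \<Longrightarrow> \<bar>deriv_at \<phi> z b\<bar> \<le> B"
proof -
  let ?K = "closure {z. \<phi> z \<noteq> 0}"
  have K: "compact ?K" using assms by (auto simp: test_functions_def)
  have z: "z \<notin> ?K \<Longrightarrow> \<phi> z = 0" for z using closure_subset[of "{z. \<phi> z \<noteq> 0}"] by blast
  have "\<exists>B>0. \<forall>z. \<bar>\<phi> z\<bar> \<le> B"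
    by (rule compact_support_bounded[OF test_continuous[OF assms] K]) (erule z, blast)
  then obtain B where B: "B > 0" "\<And>z. \<bar>\<phi> z\<bar> \<le> B" by auto
  have "\<exists>B>0. \<forall>z. \<bar>deriv_at \<phi> z b\<bar> \<le> B" if "b \<in> Basis" for b
    by (rule compact_support_bounded[OF test_partial_continuous[OF assms that] K])
       (erule test_partial_zero'[OF assms that], blast)
  then obtain C where C: "\<And>b. b \<in> Basis \<Longrightarrow> C b > 0"
    "\<And>b z. b \<in> Basis \<Longrightarrow> \<bar>deriv_at \<phi> z b\<bar> \<le> C b"
  proof -
    assume *: "\<And>C. (\<And>b. b \<in> Basis \<Longrightarrow> 0 < C b) \<Longrightarrow>
      (\<And>b z. b \<in> Basis \<Longrightarrow> \<bar>deriv_at \<phi> z b\<bar> \<le> C b) \<Longrightarrow> thesis"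
    assume "\<And>b. b \<in> Basis \<Longrightarrow> \<exists>B>0. \<forall>z. \<bar>deriv_at \<phi> z b\<bar> \<le> B"
    then have "\<forall>b\<in>Basis. \<exists>B. B > 0 \<and> (\<forall>z. \<bar>deriv_at \<phi> z b\<bar> \<le> B)" by blast
    from bchoice[OF this] show thesis using * by blast
  qed
  show ?thesis
  proof (rule that)
    show "B + sum C Basis > 0" using B C by (intro add_pos_nonneg sum_nonneg) (auto intro: less_imp_le)
    show "\<bar>\<phi> z\<bar> \<le> B + sum C Basis" for z
      using B(2)[of z] sum_nonneg[of Basis C] C(1) by (smt (verit))
    show "\<bar>deriv_at \<phi> z b\<bar> \<le> B + sum C Basis" if "b \<in> Basis" for z b
    proof -
      have "C b \<le> sum C Basis" using that C(1) by (intro member_le_sum) (auto intro: less_imp_le)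
      then show ?thesis using C(2)[OF that, of z] B(1) by linarith
    qed
  qed
qed

section \<open>The fundamental lemma of the calculus of variations\<close>

text \<open>The hypothesis only involves the products of one dimensional bumps, so that it can also
  be verified when merely tensor product test functions are at hand. Letting the bumps increase
  to the indicators of boxes makes all box integrals vanish, and almost every point is a
  differentiation point of these integrals.\<close>

lemma AE_zero_if_orthogonal_to_bumps:
  fixes D :: "'a::euclidean_space \<Rightarrow> real"
  assumes U: "open U" and D: "locally_integrable U D"
    and ort: "\<And>a b n. cbox a b \<subseteq> U \<Longrightarrow> (LINT z|lebesgue_on U. D z * box_bump a b n z) = 0"
  shows "AE z in lebesgue_on U. D z = 0"
proof -
  have setsU [measurable]: "U \<in> sets lebesgue" using U by simp
  have int: "integrable lebesgue (\<lambda>z. indicator (cbox a b) z *\<^sub>R D z)" if "cbox a b \<subseteq> U" for a b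
    using D that unfolding locally_integrable_def
    by (subst integrable_restrict_space[symmetric]) auto
  have box0: "(LINT z|lebesgue. indicator (box a b) z * D z) = 0" if ab: "cbox a b \<subseteq> U" for a b
  proof -
    have meas: "(\<lambda>z. indicator (cbox a b) z *\<^sub>R D z) \<in> borel_measurable lebesgue"
      using int[OF ab] by auto
    have bm: "box_bump a b n \<in> borel_measurable lebesgue" for n
    proof -
      have "continuous_on UNIV (box_bump a b n)"
        using box_bump_test[of a b UNIV n] test_continuous by blast
      then show ?thesis
        by (intro measurable_completion) (simp add: borel_measurable_continuous_onI)
    qed
    have eq: "indicator (cbox a b) z *\<^sub>R D z * box_bump a b n z = indicator U z *\<^sub>R (D z * box_bump a b n z)" for z n
    proof (cases "box_bump a b n z = 0")
      case False
      then have "z \<in> cbox a b"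
        using box_bump_test[of a b "cbox a b" n] test_zero[of _ "cbox a b" z]
        by (meson box_subset_cbox)
      then show ?thesis using ab by auto
    qed auto
    have "(\<lambda>n. LINT z|lebesgue. indicator (cbox a b) z *\<^sub>R D z * box_bump a b n z) \<longlonglongrightarrow>
        (LINT z|lebesgue. indicator (cbox a b) z *\<^sub>R D z * indicator (box a b) z)"
    proof (rule integral_dominated_convergence)
      show "integrable lebesgue (\<lambda>z. norm (indicator (cbox a b) z *\<^sub>R D z))"
        using int[OF ab] by (rule integrable_norm)
      show "AE z in lebesgue. (\<lambda>n. indicator (cbox a b) z *\<^sub>R D z * box_bump a b n z) \<longlonglongrightarrow>
          indicator (cbox a b) z *\<^sub>R D z * indicator (box a b) z"
        by (auto intro!: tendsto_intros box_bump_tendsto)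
      show "AE z in lebesgue. norm (indicator (cbox a b) z *\<^sub>R D z * box_bump a b n z)
          \<le> norm (indicator (cbox a b) z *\<^sub>R D z)" for n
        by (auto simp: abs_mult abs_of_nonneg box_bump_bounds intro!: AE_I2 mult_left_le)
      show "(\<lambda>z. indicator (cbox a b) z *\<^sub>R D z * indicator (box a b) z) \<in> borel_measurable lebesgue"
        using meas by (intro borel_measurable_times borel_measurable_indicator) auto
      show "(\<lambda>z. indicator (cbox a b) z *\<^sub>R D z * box_bump a b n z) \<in> borel_measurable lebesgue" for n
        using meas bm by measurable
    qed
    moreover have "(LINT z|lebesgue. indicator (cbox a b) z *\<^sub>R D z * box_bump a b n z) = 0" for n
      unfolding eq using ort[OF ab, of n] by (subst (asm) integral_restrict_space) auto
    ultimately have "(LINT z|lebesgue. indicator (cbox a b) z *\<^sub>R D z * indicator (box a b) z) = 0"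
      using LIMSEQ_unique[OF _ tendsto_const] by simp
    moreover have "indicator (cbox a b) z *\<^sub>R D z * indicator (box a b) z = indicator (box a b) z * D z" for z
      using box_subset_cbox[of a b] by (auto simp: indicator_def)
    ultimately show ?thesis by (simp only:)
  qed
  have local: "\<exists>N. negligible N \<and> (\<forall>z\<in>cbox lo hi - N. D z = 0)" if sub: "cbox lo hi \<subseteq> U" for lo hi
  proof -
    define h where "h z = indicator (box lo hi) z * D z" for z
    have hint: "integrable lebesgue h"
    proof -
      have "integrable lebesgue (\<lambda>z. indicator (box lo hi) z *\<^sub>R (indicator (cbox lo hi) z *\<^sub>R D z))"
        by (intro integrable_mult_indicator[OF _ int[OF sub]]) auto
      moreover have "(\<lambda>z. indicator (box lo hi) z *\<^sub>R (indicator (cbox lo hi) z *\<^sub>R D z)) = h"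
        using box_subset_cbox[of lo hi] by (auto simp: h_def indicator_def fun_eq_iff)
      ultimately show ?thesis by simp
    qed
    have hab: "h absolutely_integrable_on cbox a b" for a b
      unfolding set_integrable_def by (intro integrable_mult_indicator[OF _ hint]) auto
    have zero: "integral (cbox a b) h = 0" for a b
    proof -
      have "integral (cbox a b) h = integral (box a b) h"
        by (rule integral_subset_negligible[OF box_subset_cbox negligible_frontier_interval, symmetric])
      also have "\<dots> = (LINT z|lebesgue. indicator (box a b) z * h z)"
      proof -
        have "h absolutely_integrable_on box a b"
          unfolding set_integrable_def by (intro integrable_mult_indicator[OF _ hint]) auto
        from set_lebesgue_integral_eq_integral(2)[OF this] show ?thesis
          by (simp add: set_lebesgue_integral_def)
      qed
      also have "\<dots> = 0"
      proof -
        obtain a' b' where ab': "box a b \<inter> box lo hi = box a' b'" using box_Int_box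
          by blast
        show ?thesis
        proof (cases "box a' b' = {}")
          case True
          then have "indicator (box a b) z * h z = 0" for z
            using ab' by (auto simp: h_def indicator_def)
          then show ?thesis by (simp only: Bochner_Integration.integral_zero)
        next
          case False
          have "closure (box a' b') \<subseteq> cbox lo hi"
            using ab' box_subset_cbox[of lo hi] by (intro closure_minimal) auto
          then have "cbox a' b' \<subseteq> cbox lo hi"
            using False by (simp add: closure_box)
          then have "(LINT z|lebesgue. indicator (box a' b') z * D z) = 0"
            using box0 sub by (meson order_trans)
          moreover have "indicator (box a b) z * h z = indicator (box a' b') z * D z" for z
            unfolding ab'[symmetric] by (auto simp: h_def indicator_def)
          ultimately show ?thesis by (simp only:)
        qed
      qed
      finally show ?thesis .
    qed
    \<comment> \<open>Differentiation of the indefinite integral along shrinking cubes.\<close>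
    obtain N where N: "negligible N"
      "\<And>x e. \<lbrakk>x \<notin> N; 0 < e\<rbrakk> \<Longrightarrow> \<exists>d>0. \<forall>k. 0 < k \<and> k < d \<longrightarrow>
         norm (integral (cbox x (x + k *\<^sub>R One)) h /\<^sub>R k ^ DIM('a) - h x) < e"
      using integrable_ccontinuous_explicit[OF set_lebesgue_integral_eq_integral(1)[OF hab]] by metis
    have h0: "h z = 0" if "z \<notin> N" for z
    proof (rule ccontr)
      assume nz: "h z \<noteq> 0"
      then obtain d where "d > 0" "\<forall>k. 0 < k \<and> k < d \<longrightarrow>
         norm (integral (cbox z (z + k *\<^sub>R One)) h /\<^sub>R k ^ DIM('a) - h z) < norm (h z)"
        using N(2)[of z "norm (h z)"] \<open>z \<notin> N\<close> nz by (metis zero_less_norm_iff)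
      then have "norm (integral (cbox z (z + (d/2) *\<^sub>R One)) h /\<^sub>R (d/2) ^ DIM('a) - h z) < norm (h z)"
        by auto
      then show False by (simp add: zero)
    qed
    have "negligible (N \<union> (cbox lo hi - box lo hi))"
      using N(1) negligible_frontier_interval by auto
    moreover have "D z = 0" if "z \<in> cbox lo hi - (N \<union> (cbox lo hi - box lo hi))" for z
      using that h0[of z] by (auto simp: h_def)
    ultimately show ?thesis by blast
  qed
  obtain \<D> where \<D>: "countable \<D>" "\<D> \<subseteq> Pow U" "\<And>X. X \<in> \<D> \<Longrightarrow> \<exists>a b. X = cbox a b" "\<Union>\<D> = U"
  proof -
    define a' where "a' f = (\<Sum>i\<in>Basis. fst (f i) *\<^sub>R i)" for f :: "'a \<Rightarrow> real \<times> real"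
    define b' where "b' f = (\<Sum>i\<in>Basis. snd (f i) *\<^sub>R i)" for f :: "'a \<Rightarrow> real \<times> real"
    define I where "I = {f \<in> Basis \<rightarrow>\<^sub>E \<rat> \<times> \<rat>. cbox (a' f) (b' f) \<subseteq> U}"
    have "U = (\<Union>f\<in>I. cbox (a' f) (b' f))"
      using open_UNION_cbox[OF U] unfolding a'_def b'_def I_def .
    moreover have "countable I"
      unfolding I_def
      by (intro countable_subset[OF _ countable_PiE[of Basis "\<lambda>_. \<rat> \<times> \<rat>"]] countable_SIGMA countable_rat) auto
    moreover have "(\<lambda>f. cbox (a' f) (b' f)) ` I \<subseteq> Pow U"
      unfolding I_def by auto
    ultimately show thesis
      by (intro that[of "(\<lambda>f. cbox (a' f) (b' f)) ` I"]) auto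
  qed
  have "\<exists>N. negligible N \<and> (\<forall>z\<in>X - N. D z = 0)" if "X \<in> \<D>" for X
    using local \<D>(3)[OF that] \<D>(2) that by blast
  then obtain N where N: "\<And>X. X \<in> \<D> \<Longrightarrow> negligible (N X)" "\<And>X z. X \<in> \<D> \<Longrightarrow> z \<in> X - N X \<Longrightarrow> D z = 0"
    by metis
  have neg: "(\<Union>X\<in>\<D>. N X) \<in> null_sets lebesgue"
    using N(1) \<D>(1) by (intro null_sets_UN') (auto simp: negligible_iff_null_sets)
  have "AE z in lebesgue. z \<in> U \<longrightarrow> D z = 0"
  proof (rule AE_I'[OF neg])
    show "{z \<in> space lebesgue. \<not> (z \<in> U \<longrightarrow> D z = 0)} \<subseteq> (\<Union>X\<in>\<D>. N X)"
      using N(2) \<D>(4) by blast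
  qed
  then show ?thesis
    by (subst AE_restrict_space_iff) auto
qed

section \<open>Borel representatives\<close>

text \<open>A Borel function that vanishes off \<open>U\<close> and represents \<open>v\<close> turns integrals over \<open>U\<close> with respect to
  the completed measure into integrals over the whole space with respect to the Borel measure, where
  Tonelli and Fubini arguments need no care about null sets in the factors.\<close>

definition borel_rep :: "'a::euclidean_space set \<Rightarrow> ('a \<Rightarrow> 'b::euclidean_space) \<Rightarrow> ('a \<Rightarrow> 'b) \<Rightarrow> bool" where
  "borel_rep U v F \<longleftrightarrow> F \<in> Borel_fun \<and> (\<forall>z. z \<notin> U \<longrightarrow> F z = 0) \<and>
     (AE z in lborel. z \<in> U \<longrightarrow> v z = F z)"

lemma AE_lebesgue_on:
  assumes "U \<in> sets borel"
  shows "(AE z in lebesgue_on U. P z) \<longleftrightarrow> (AE z in lborel. z \<in> U \<longrightarrow> P z)"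
  using assms by (subst AE_restrict_space_iff) (auto simp: AE_completion_iff)

lemma borel_rep_extension:
  fixes v F :: "'a::euclidean_space \<Rightarrow> 'b::euclidean_space"
  assumes "borel_rep U v F"
  shows "AE z in lborel. indicator U z *\<^sub>R v z = F z"
  using assms unfolding borel_rep_def by (auto elim!: eventually_mono simp: indicator_def)

lemma borel_measurable_AE_lebesgue:
  fixes f g :: "'a::euclidean_space \<Rightarrow> 'b::euclidean_space"
  assumes f: "f \<in> Borel_fun" and ae: "AE z in lborel. g z = f z"
  shows "g \<in> borel_measurable lebesgue"
proof (rule measurableI)
  fix A :: "'b set" assume A: "A \<in> sets borel"
  have "AE z in lebesgue. g z = f z" using ae by (simp add: AE_completion_iff)
  then have "AE z in lebesgue. z \<in> f -` A \<longleftrightarrow> z \<in> g -` A"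
    by eventually_elim auto
  moreover have "f -` A \<in> sets lebesgue"
    using measurable_sets[OF f A] by simp
  ultimately show "g -` A \<inter> space lebesgue \<in> sets lebesgue"
    using completion.in_sets_AE[where A = "f -` A" and B = "g -` A"] by simp
qed auto

lemma borel_rep_measurable:
  fixes v F :: "'a::euclidean_space \<Rightarrow> 'b::euclidean_space"
  assumes U: "U \<in> sets borel" and r: "borel_rep U v F"
  shows "v \<in> borel_measurable (lebesgue_on U)"
proof -
  have "(\<lambda>z. indicator U z *\<^sub>R v z) \<in> borel_measurable lebesgue"
    using borel_measurable_AE_lebesgue[OF _ borel_rep_extension[OF r]] r by (auto simp: borel_rep_def)
  then show ?thesis
    using U by (subst borel_measurable_restrict_space_iff) auto
qed

lemma borel_rep_integral:
  fixes v F :: "'a::euclidean_space \<Rightarrow> 'b::euclidean_space"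
  assumes U: "U \<in> sets borel" and r: "borel_rep U v F"
  shows "integrable (lebesgue_on U) v \<longleftrightarrow> integrable lborel F"
    and "(LINT z|lebesgue_on U. v z) = (LBINT z. F z)"
proof -
  have F [measurable]: "F \<in> Borel_fun" using r by (auto simp: borel_rep_def)
  have Fl: "F \<in> borel_measurable lebesgue"
    by (rule measurable_completion) simp
  have m: "(\<lambda>z. indicator U z *\<^sub>R v z) \<in> borel_measurable lebesgue"
    using borel_measurable_AE_lebesgue[OF F borel_rep_extension[OF r]] .
  have ae: "AE z in lebesgue. indicator U z *\<^sub>R v z = F z"
    using borel_rep_extension[OF r] by (simp add: AE_completion_iff)
  have "integrable (lebesgue_on U) v \<longleftrightarrow> integrable lebesgue (\<lambda>z. indicator U z *\<^sub>R v z)"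
    using U by (subst integrable_restrict_space) auto
  also have "\<dots> \<longleftrightarrow> integrable lebesgue F"
    by (rule integrable_cong_AE[OF m Fl ae])
  also have "\<dots> \<longleftrightarrow> integrable lborel F"
    by (rule integrable_completion) simp
  finally show "integrable (lebesgue_on U) v \<longleftrightarrow> integrable lborel F" .
  have "(LINT z|lebesgue_on U. v z) = (LINT z|lebesgue. indicator U z *\<^sub>R v z)"
    using U by (subst integral_restrict_space) auto
  also have "\<dots> = (LINT z|lebesgue. F z)"
    by (rule integral_cong_AE[OF m Fl ae])
  also have "\<dots> = (LBINT z. F z)"
    by (rule integral_completion) simp
  finally show "(LINT z|lebesgue_on U. v z) = (LBINT z. F z)" .
qed

lemma borel_rep_compose:
  assumes "borel_rep U v F" "h \<in> Borel_fun" "h 0 = 0"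
  shows "borel_rep U (\<lambda>z. h (v z)) (\<lambda>z. h (F z))"
  using assms unfolding borel_rep_def by (auto elim!: eventually_mono)

lemma borel_rep_compose2:
  fixes h :: "'b::euclidean_space \<Rightarrow> 'c::euclidean_space \<Rightarrow> 'd::euclidean_space"
  assumes "borel_rep U v F" "borel_rep U w G" "case_prod h \<in> Borel_fun" "h 0 0 = 0"
  shows "borel_rep U (\<lambda>z. h (v z) (w z)) (\<lambda>z. h (F z) (G z))"
  unfolding borel_rep_def
proof (intro conjI allI impI)
  have "(\<lambda>z. case_prod h (F z, G z)) \<in> Borel_fun"
    using assms unfolding borel_rep_def by (intro measurable_compose[OF borel_measurable_Pair assms(3)]) auto
  then show "(\<lambda>z. h (F z) (G z)) \<in> Borel_fun" by simp
  show "AE z in lborel. z \<in> U \<longrightarrow> h (v z) (w z) = h (F z) (G z)"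
    using assms(1,2) unfolding borel_rep_def by (auto elim: eventually_elim2)
qed (use assms in \<open>auto simp: borel_rep_def\<close>)

lemma borel_rep_restrict:
  assumes "borel_rep U v F" "V \<subseteq> U" "V \<in> sets borel"
  shows "borel_rep V v (\<lambda>z. indicator V z *\<^sub>R F z)"
  using assms unfolding borel_rep_def by (auto elim!: eventually_mono)

lemma borel_rep_self:
  assumes "F \<in> Borel_fun" "\<And>z. z \<notin> U \<Longrightarrow> F z = 0"
  shows "borel_rep U F F"
  using assms unfolding borel_rep_def by auto

lemma borel_rep_of_AE:
  assumes "borel_rep U v F" "AE z in lborel. z \<in> U \<longrightarrow> w z = v z"
  shows "borel_rep U w F"
  using assms unfolding borel_rep_def by (auto elim: eventually_elim2)

lemma ex_borel_rep:
  fixes v :: "'a::euclidean_space \<Rightarrow> 'b::euclidean_space"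
  assumes U: "U \<in> sets borel" and v: "v \<in> borel_measurable (lebesgue_on U)"
  shows "\<exists>F. borel_rep U v F"
proof -
  have m: "(\<lambda>z. indicator U z *\<^sub>R v z) \<in> borel_measurable lebesgue"
    using U v by (subst (asm) borel_measurable_restrict_space_iff) auto
  have "\<exists>g. g \<in> borel_measurable lborel \<and> (AE z in lborel. (indicator U z *\<^sub>R v z) \<bullet> b = g z)" for b :: 'b
    using completion_ex_borel_measurable_real[OF borel_measurable_inner[OF m borel_measurable_const], of b]
    by blast
  then obtain g where g: "\<And>b. g b \<in> borel_measurable lborel"
    "\<And>b::'b. AE z in lborel. (indicator U z *\<^sub>R v z) \<bullet> b = g b z"
    by metis
  have "AE z in lborel. \<forall>b\<in>Basis. (indicator U z *\<^sub>R v z) \<bullet> b = g b z"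
    using g(2) by (intro AE_finite_allI) auto
  then have "AE z in lborel. z \<in> U \<longrightarrow> v z = indicator U z *\<^sub>R (\<Sum>b\<in>Basis. g b z *\<^sub>R b)"
  proof eventually_elim
    case (elim z)
    show ?case
    proof
      assume "z \<in> U"
      then have "v z = (\<Sum>b\<in>Basis. ((indicator U z *\<^sub>R v z) \<bullet> b) *\<^sub>R b)"
        by (simp add: euclidean_representation)
      also have "\<dots> = (\<Sum>b\<in>Basis. g b z *\<^sub>R b)" using elim by simp
      finally show "v z = indicator U z *\<^sub>R (\<Sum>b\<in>Basis. g b z *\<^sub>R b)" using \<open>z \<in> U\<close> by simp
    qed
  qed
  moreover have "(\<lambda>z. indicator U z *\<^sub>R (\<Sum>b\<in>Basis. g b z *\<^sub>R b)) \<in> Borel_fun"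
    using g(1) U by auto
  ultimately show ?thesis
    unfolding borel_rep_def by (intro exI[of _ "\<lambda>z. indicator U z *\<^sub>R (\<Sum>b\<in>Basis. g b z *\<^sub>R b)"]) auto
qed

lemma borel_rep_norm_powr:
  assumes "borel_rep U v F"
  shows "borel_rep U (\<lambda>z. norm (v z) powr p) (\<lambda>z. norm (F z) powr p)"
  using borel_rep_compose[OF assms, of "\<lambda>x. norm x powr p"] by simp

lemma Lp_space_rep:
  assumes "U \<in> sets borel" "borel_rep U v F"
  shows "v \<in> Lp_space p U \<longleftrightarrow> integrable lborel (\<lambda>z. norm (F z) powr p)"
  using borel_rep_measurable[OF assms] borel_rep_integral(1)[OF assms(1) borel_rep_norm_powr[OF assms(2)]]
  by (auto simp: Lp_space_def)

lemma Lp_norm_rep: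
  assumes "U \<in> sets borel" "borel_rep U v F"
  shows "Lp_norm p U v = (LBINT z. norm (F z) powr p) powr (1 / p)"
  using borel_rep_integral(2)[OF assms(1) borel_rep_norm_powr[OF assms(2)]]
  by (simp add: Lp_norm_def)

lemma Lp_space_ex_rep:
  assumes "U \<in> sets borel" "v \<in> Lp_space p U"
  obtains F where "borel_rep U v F" "integrable lborel (\<lambda>z. norm (F z) powr p)"
  using assms ex_borel_rep[of U v] Lp_space_rep[OF assms(1)] unfolding Lp_space_def by blast

text \<open>On a bounded set \<open>norm (F z)\<close> is at most \<open>1 + norm (F z) powr p\<close>.\<close>

lemma integrable_of_powr:
  fixes F :: "'a::euclidean_space \<Rightarrow> 'b::euclidean_space"
  assumes "F \<in> Borel_fun" "\<And>z. z \<notin> U \<Longrightarrow> F z = 0" "bounded U" "1 \<le> p"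
    "integrable lborel (\<lambda>z. norm (F z) powr p)"
  shows "integrable lborel F"
proof -
  obtain a where a: "U \<subseteq> cbox (- a) a" using bounded_subset_cbox_symmetric[OF assms(3)] by blast
  show ?thesis
  proof (rule integrable_dominated)
    show "integrable lborel (\<lambda>z. indicator (cbox (-a) a) z + norm (F z) powr p)"
      using assms(5) emeasure_lborel_cbox_finite[of "-a" a]
      by (intro Bochner_Integration.integrable_add integrable_real_indicator) auto
    show "AE z in lborel. norm (F z) \<le> norm (indicator (cbox (-a) a) z + norm (F z) powr p)"
    proof (rule AE_I2)
      fix z
      show "norm (F z) \<le> norm (indicator (cbox (-a) a) z + norm (F z) powr p)"
      proof (cases "z \<in> U")
        case True
        have "norm (F z) \<le> 1 + norm (F z) powr p"
        proof (cases "norm (F z) \<le> 1")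
          case False
          then have "norm (F z) powr 1 \<le> norm (F z) powr p" using assms(4) by (intro powr_mono) auto
          then show ?thesis using False by auto
        qed (auto intro: add_increasing2)
        then show ?thesis using True a by (auto simp: indicator_def)
      qed (simp add: assms(2))
    qed
  qed (use assms in auto)
qed

section \<open>Sobolev functions\<close>

text \<open>The weak gradient relation between Borel functions that vanish off \<open>U\<close>, with plain
  Lebesgue integrals over the whole space, to which Fubini's theorem applies directly.\<close>

definition sobolev_rep :: "real \<Rightarrow> 'a::euclidean_space set \<Rightarrow> ('a \<Rightarrow> real) \<Rightarrow> ('a \<Rightarrow> 'a) \<Rightarrow> bool" where
  "sobolev_rep p U F H \<longleftrightarrow>
     F \<in> Borel_fun \<and> H \<in> Borel_fun \<and>
     (\<forall>z. z \<notin> U \<longrightarrow> F z = 0 \<and> H z = 0) \<and>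
     integrable lborel (\<lambda>z. \<bar>F z\<bar> powr p) \<and> integrable lborel (\<lambda>z. norm (H z) powr p) \<and>
     integrable lborel F \<and> integrable lborel H \<and>
     (\<forall>\<phi>\<in>test_functions U. \<forall>b\<in>Basis.
        (LBINT z. F z * deriv_at \<phi> z b) = - (LBINT z. (H z \<bullet> b) * \<phi> z))"

lemma test_borel [measurable_dest]:
  assumes "\<phi> \<in> test_functions U"
  shows "\<phi> \<in> Borel_fun"
  using test_continuous[OF assms] by (rule borel_measurable_continuous_onI)

lemma test_partial_borel:
  assumes "\<phi> \<in> test_functions U" "b \<in> Basis"
  shows "(\<lambda>z. deriv_at \<phi> z b) \<in> Borel_fun"
  using test_partial_continuous[OF assms] by (rule borel_measurable_continuous_onI)

lemma borel_rep_times_borel: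
  fixes v F :: "'a::euclidean_space \<Rightarrow> real"
  assumes "borel_rep U v F" "h \<in> Borel_fun"
  shows "borel_rep U (\<lambda>z. v z * h z) (\<lambda>z. F z * h z)"
  using assms unfolding borel_rep_def by (auto elim!: eventually_mono)

lemma borel_rep_inner:
  assumes "borel_rep U v F"
  shows "borel_rep U (\<lambda>z. v z \<bullet> b) (\<lambda>z. F z \<bullet> b)"
  using borel_rep_compose[OF assms, of "\<lambda>x. x \<bullet> b"] by simp

lemma locally_integrable_rep:
  assumes "U \<in> sets borel" "borel_rep U v F" "integrable lborel F"
  shows "locally_integrable U v"
  unfolding locally_integrable_def
proof (intro allI impI)
  fix K assume K: "compact K \<and> K \<subseteq> U"
  then have KB: "K \<in> sets borel" by (simp add: borel_compact)
  have "borel_rep K v (\<lambda>z. indicator K z *\<^sub>R F z)"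
    using borel_rep_restrict[OF assms(2)] K KB by auto
  from borel_rep_integral(1)[OF KB this] show "integrable (lebesgue_on K) v"
    using integrable_mult_indicator[OF _ assms(3)] KB by simp
qed

lemma weak_gradient_rep:
  assumes U: "U \<in> sets borel" and v: "borel_rep U v F" "integrable lborel F"
    and G: "borel_rep U G H" "integrable lborel H"
  shows "weak_gradient U v G \<longleftrightarrow> (\<forall>\<phi>\<in>test_functions U. \<forall>b\<in>Basis.
     (LBINT z. F z * deriv_at \<phi> z b) = - (LBINT z. (H z \<bullet> b) * \<phi> z))"
proof -
  have "(LINT z|lebesgue_on U. v z * deriv_at \<phi> z b) =
        (LBINT z. F z * deriv_at \<phi> z b)"
    if "\<phi> \<in> test_functions U" "b \<in> Basis" for \<phi> b
    by (rule borel_rep_integral(2)[OF U borel_rep_times_borel[OF v(1) test_partial_borel[OF that]]])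
  moreover have "(LINT z|lebesgue_on U. (G z \<bullet> b) * \<phi> z) = (LBINT z. (H z \<bullet> b) * \<phi> z)"
    if "\<phi> \<in> test_functions U" for \<phi> b
    by (rule borel_rep_integral(2)[OF U borel_rep_times_borel[OF borel_rep_inner[OF G(1)] test_borel[OF that]]])
  ultimately show ?thesis
    using locally_integrable_rep[OF U v] locally_integrable_rep[OF U G]
    unfolding weak_gradient_def by auto
qed

lemma locally_integrable_diff:
  "locally_integrable U v \<Longrightarrow> locally_integrable U w \<Longrightarrow> locally_integrable U (\<lambda>z. v z - w z)"
  unfolding locally_integrable_def by auto

lemma locally_integrable_inner:
  "locally_integrable U v \<Longrightarrow> locally_integrable U (\<lambda>z. v z \<bullet> b)"
  unfolding locally_integrable_def by auto

lemma locally_integrable_test: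
  fixes D :: "'a::euclidean_space \<Rightarrow> real"
  assumes U: "open U" and D: "locally_integrable U D" and \<phi>: "\<phi> \<in> test_functions U"
  shows "integrable (lebesgue_on U) (\<lambda>z. D z * \<phi> z)"
proof -
  let ?K = "closure {z. \<phi> z \<noteq> 0}"
  have K: "compact ?K" "?K \<subseteq> U" using \<phi> by (auto simp: test_functions_def)
  have KB: "?K \<in> sets lebesgue" "U \<in> sets lebesgue" using U by auto
  obtain B where B: "B > 0" "\<And>z. \<bar>\<phi> z\<bar> \<le> B" using test_bounded[OF \<phi>] by metis
  have 1: "integrable lebesgue (\<lambda>z. indicator ?K z *\<^sub>R D z)"
    using D K unfolding locally_integrable_def by (subst integrable_restrict_space[symmetric]) auto
  have "integrable lebesgue (\<lambda>z. (indicator ?K z *\<^sub>R D z) * \<phi> z)"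
  proof (rule integrable_dominated)
    show "integrable lebesgue (\<lambda>z. B * (indicator ?K z *\<^sub>R D z))" using 1 by simp
    have "\<phi> \<in> borel_measurable lebesgue"
      using test_borel[OF \<phi>] by (intro measurable_completion) simp
    then show "(\<lambda>z. (indicator ?K z *\<^sub>R D z) * \<phi> z) \<in> borel_measurable lebesgue"
      using 1 by (intro borel_measurable_times) auto
    have "\<bar>\<phi> z\<bar> * \<bar>D z\<bar> \<le> B * \<bar>D z\<bar>" for z using B by (intro mult_right_mono) auto
    then show "AE z in lebesgue. norm ((indicator ?K z *\<^sub>R D z) * \<phi> z) \<le> norm (B * (indicator ?K z *\<^sub>R D z))"
      using B(1) by (intro AE_I2) (auto simp: abs_mult indicator_def mult.commute)
  qed
  moreover have "(indicator ?K z *\<^sub>R D z) * \<phi> z = indicator U z *\<^sub>R (D z * \<phi> z)" for z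
    using K(2) closure_subset[of "{z. \<phi> z \<noteq> 0}"] by (cases "\<phi> z = 0") (auto simp: indicator_def)
  ultimately have "integrable lebesgue (\<lambda>z. indicator U z *\<^sub>R (D z * \<phi> z))" by (simp only:)
  then show ?thesis
    using KB by (subst integrable_restrict_space) auto
qed

lemma weak_gradient_unique:
  assumes U: "open U" and G: "weak_gradient U v G" "weak_gradient U v G'"
  shows "AE z in lebesgue_on U. G z = G' z"
proof -
  have lG: "locally_integrable U G" "locally_integrable U G'" using G by (auto simp: weak_gradient_def)
  have "AE z in lebesgue_on U. (G z \<bullet> b) - (G' z \<bullet> b) = 0" if b: "b \<in> Basis" for b
  proof (rule AE_zero_if_orthogonal_to_bumps[OF U])
    show "locally_integrable U (\<lambda>z. G z \<bullet> b - G' z \<bullet> b)"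
      using lG by (intro locally_integrable_diff locally_integrable_inner)
    fix l h n assume lh: "cbox l h \<subseteq> U"
    have t: "box_bump l h n \<in> test_functions U"
      using lh box_subset_cbox[of l h] by (intro box_bump_test) auto
    have "(LINT z|lebesgue_on U. (G z \<bullet> b) * box_bump l h n z) =
          (LINT z|lebesgue_on U. (G' z \<bullet> b) * box_bump l h n z)"
      using G t b unfolding weak_gradient_def by fastforce
    then show "(LINT z|lebesgue_on U. (G z \<bullet> b - G' z \<bullet> b) * box_bump l h n z) = 0"
      using locally_integrable_test[OF U locally_integrable_inner[OF lG(1)] t]
        locally_integrable_test[OF U locally_integrable_inner[OF lG(2)] t]
      by (simp add: left_diff_distrib)
  qed
  then have "AE z in lebesgue_on U. \<forall>b\<in>Basis. (G z \<bullet> b) - (G' z \<bullet> b) = 0"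
    by (intro AE_finite_allI) auto
  then show ?thesis
    by eventually_elim (auto intro: euclidean_eqI)
qed

lemma borel_rep_wgrad:
  assumes U: "open U" and G: "weak_gradient U v G" "borel_rep U G H"
  shows "borel_rep U (wgrad U v) H"
proof (rule borel_rep_of_AE[OF G(2)])
  have "weak_gradient U v (wgrad U v)"
    unfolding wgrad_def by (rule someI[of "weak_gradient U v", OF G(1)])
  from weak_gradient_unique[OF U this G(1)]
  show "AE z in lborel. z \<in> U \<longrightarrow> wgrad U v z = G z"
    using U by (subst AE_lebesgue_on[symmetric]) auto
qed

lemma W1p_ex_rep:
  assumes U: "open U" "bounded U" and p: "1 \<le> p" and v: "v \<in> W1p p U"
  obtains F H where "sobolev_rep p U F H" "borel_rep U v F" "borel_rep U (wgrad U v) H"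
proof -
  have UB: "U \<in> sets borel" using U by simp
  obtain G where G: "G \<in> Lp_space p U" "weak_gradient U v G" "v \<in> Lp_space p U"
    using v unfolding W1p_def by blast
  obtain F where F: "borel_rep U v F" "integrable lborel (\<lambda>z. norm (F z) powr p)"
    using Lp_space_ex_rep[OF UB G(3)] by blast
  obtain H where H: "borel_rep U G H" "integrable lborel (\<lambda>z. norm (H z) powr p)"
    using Lp_space_ex_rep[OF UB G(1)] by blast
  have F': "F \<in> Borel_fun" "\<And>z. z \<notin> U \<Longrightarrow> F z = 0"
    and H': "H \<in> Borel_fun" "\<And>z. z \<notin> U \<Longrightarrow> H z = 0"
    using F(1) H(1) unfolding borel_rep_def by blast+
  have FH: "integrable lborel F" "integrable lborel H"
    using integrable_of_powr[OF F' U(2) p F(2)] integrable_of_powr[OF H' U(2) p H(2)] by blast+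
  have "sobolev_rep p U F H"
    unfolding sobolev_rep_def
    using F(2) F' H(2) H' FH weak_gradient_rep[OF UB F(1) FH(1) H(1) FH(2)] G(2) by simp
  then show ?thesis
    using that F(1) borel_rep_wgrad[OF U(1) G(2) H(1)] by blast
qed

lemma W1p_from_rep:
  assumes U: "open U" and S: "sobolev_rep p U F H" and v: "borel_rep U v F"
  shows "v \<in> W1p p U" "borel_rep U (wgrad U v) H"
proof -
  have UB: "U \<in> sets borel" using U by simp
  have H: "borel_rep U H H" using S by (intro borel_rep_self) (auto simp: sobolev_rep_def)
  have wg: "weak_gradient U v H"
    using weak_gradient_rep[OF UB v _ H] S by (auto simp: sobolev_rep_def)
  then show "borel_rep U (wgrad U v) H"
    using borel_rep_wgrad[OF U _ H] by blast
  show "v \<in> W1p p U"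
    unfolding W1p_def using wg Lp_space_rep[OF UB v] Lp_space_rep[OF UB H] S
    by (auto simp: sobolev_rep_def)
qed

lemma test_integrable:
  fixes F :: "'a::euclidean_space \<Rightarrow> real"
  assumes "integrable lborel F" "\<phi> \<in> test_functions U"
  shows "integrable lborel (\<lambda>z. F z * \<phi> z)"
    and "b \<in> Basis \<Longrightarrow> integrable lborel (\<lambda>z. F z * deriv_at \<phi> z b)"
proof -
  obtain B where B: "B > 0" "\<And>z. \<bar>\<phi> z\<bar> \<le> B"
    "\<And>z b. b \<in> Basis \<Longrightarrow> \<bar>deriv_at \<phi> z b\<bar> \<le> B"
    using test_bounded[OF assms(2)] by metis
  have *: "integrable lborel (\<lambda>z. F z * h z)" if "h \<in> Borel_fun" "\<And>z. \<bar>h z\<bar> \<le> B" for h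
  proof (rule integrable_dominated)
    show "integrable lborel (\<lambda>z. B * F z)" using assms by simp
    show "AE z in lborel. norm (F z * h z) \<le> norm (B * F z)"
      using that(2) B(1) by (intro AE_I2) (auto simp: abs_mult mult.commute[of B] intro!: mult_left_mono)
    show "(\<lambda>z. F z * h z) \<in> borel_measurable lborel"
      using that(1) assms(1) by (intro borel_measurable_times) auto
  qed
  show "integrable lborel (\<lambda>z. F z * \<phi> z)"
    using B test_borel[OF assms(2)] by (intro *)
  show "integrable lborel (\<lambda>z. F z * deriv_at \<phi> z b)" if "b \<in> Basis"
    using B(3)[OF that] test_partial_borel[OF assms(2) that] by (intro *)
qed

lemma powr_norm_diff_le:
  fixes x y :: "'b::real_normed_vector"
  assumes "p \<ge> 0"
  shows "norm (x - y) powr p \<le> 2 powr p * (norm x powr p + norm y powr p)"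
proof -
  have "norm (x - y) powr p \<le> (2 * max (norm x) (norm y)) powr p"
    using assms norm_triangle_ineq4[of x y] by (intro powr_mono2) (auto simp: max_def)
  also have "\<dots> = 2 powr p * max (norm x) (norm y) powr p"
    by (simp add: powr_mult)
  also have "max (norm x) (norm y) powr p \<le> norm x powr p + norm y powr p"
    by (auto simp: max_def)
  finally show ?thesis by simp
qed

lemma integrable_powr_diff:
  fixes F G :: "'a::euclidean_space \<Rightarrow> 'b::euclidean_space"
  assumes "F \<in> Borel_fun" "G \<in> Borel_fun" "p \<ge> 0"
    "integrable lborel (\<lambda>z. norm (F z) powr p)" "integrable lborel (\<lambda>z. norm (G z) powr p)"
  shows "integrable lborel (\<lambda>z. norm (F z - G z) powr p)"
proof (rule integrable_dominated)
  show "integrable lborel (\<lambda>z. 2 powr p * (norm (F z) powr p + norm (G z) powr p))"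
    using assms by auto
qed (use assms in \<open>auto intro!: AE_I2 powr_norm_diff_le\<close>)

lemma sobolev_rep_diff:
  assumes "sobolev_rep p U F H" "sobolev_rep p U F' H'" "p \<ge> 0"
  shows "sobolev_rep p U (\<lambda>z. F z - F' z) (\<lambda>z. H z - H' z)"
proof -
  note S = assms(1,2)[unfolded sobolev_rep_def]
  have "(LBINT z. (F z - F' z) * deriv_at \<phi> z b) =
      - (LBINT z. ((H z - H' z) \<bullet> b) * \<phi> z)" if "\<phi> \<in> test_functions U" "b \<in> Basis" for \<phi> b
  proof -
    have "integrable lborel (\<lambda>z. H z \<bullet> b)" "integrable lborel (\<lambda>z. H' z \<bullet> b)" using S by auto
    then show ?thesis
      using S that test_integrable[of _ \<phi> U]
      by (auto simp: left_diff_distrib inner_diff_left)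
  qed
  then show ?thesis
    using S assms(3) integrable_powr_diff[of F F' p] integrable_powr_diff[of H H' p]
    unfolding sobolev_rep_def by auto
qed

lemma test_functions_mono: "V \<subseteq> U \<Longrightarrow> test_functions V \<subseteq> test_functions U"
  unfolding test_functions_def by auto

lemma sobolev_rep_restrict:
  assumes S: "sobolev_rep p U F H" and V: "V \<subseteq> U" "V \<in> sets borel"
  shows "sobolev_rep p V (\<lambda>z. indicator V z * F z) (\<lambda>z. indicator V z *\<^sub>R H z)"
proof -
  note S' = S[unfolded sobolev_rep_def]
  have "(LBINT z. indicator V z * F z * deriv_at \<phi> z b) =
      - (LBINT z. ((indicator V z *\<^sub>R H z) \<bullet> b) * \<phi> z)"
    if \<phi>: "\<phi> \<in> test_functions V" and b: "b \<in> Basis" for \<phi> b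
  proof -
    have "indicator V z * F z * deriv_at \<phi> z b = F z * deriv_at \<phi> z b" for z
      using test_partial_zero[OF \<phi> b, of z] by (auto simp: indicator_def)
    moreover have "((indicator V z *\<^sub>R H z) \<bullet> b) * \<phi> z = (H z \<bullet> b) * \<phi> z" for z
      using test_zero[OF \<phi>, of z] by (auto simp: indicator_def)
    ultimately show ?thesis
      using S' \<phi> b test_functions_mono[OF V(1)] by (simp only:) blast
  qed
  moreover have "integrable lborel (\<lambda>z. \<bar>indicator V z * F z\<bar> powr p)"
  proof -
    have "(\<lambda>z. \<bar>indicator V z * F z\<bar> powr p) = (\<lambda>z. indicator V z *\<^sub>R \<bar>F z\<bar> powr p)"
      by (auto simp: indicator_def)
    then show ?thesis
      using S' V(2) by (simp only:) (intro integrable_mult_indicator, auto)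
  qed
  moreover have "integrable lborel (\<lambda>z. norm (indicator V z *\<^sub>R H z) powr p)"
  proof -
    have "(\<lambda>z. norm (indicator V z *\<^sub>R H z) powr p) = (\<lambda>z. indicator V z *\<^sub>R norm (H z) powr p)"
      by (auto simp: indicator_def)
    then show ?thesis
      using S' V(2) by (simp only:) (intro integrable_mult_indicator, auto)
  qed
  moreover have "integrable lborel (\<lambda>z. indicator V z * F z)" "integrable lborel (\<lambda>z. indicator V z *\<^sub>R H z)"
    using S' V(2) integrable_mult_indicator[of V lborel F] integrable_mult_indicator[of V lborel H] by auto
  moreover have "(\<lambda>z. indicator V z * F z) \<in> Borel_fun"
    "(\<lambda>z. indicator V z *\<^sub>R H z) \<in> Borel_fun"
    using S' V(2) by auto
  moreover have "\<forall>z. z \<notin> V \<longrightarrow> indicator V z * F z = 0 \<and> indicator V z *\<^sub>R H z = 0" by simp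
  ultimately show ?thesis
    unfolding sobolev_rep_def by (intro conjI ballI) assumption+
qed

section \<open>Integral inequalities\<close>

lemma conjugate_exponents:
  fixes p q :: real
  assumes "1 < p" "1 / p + 1 / q = 1"
  shows "1 < q" "(p - 1) * q = p" "p / q = p - 1"
proof -
  have "1 / q = (p - 1) / p" using assms by (simp add: field_simps)
  then have q: "q = p / (p - 1)"
    by (metis divide_divide_eq_right div_by_1 mult_1 divide_inverse inverse_divide)
  show "1 < q" "(p - 1) * q = p" "p / q = p - 1"
    unfolding q using assms(1) by (auto simp: field_simps)
qed

lemma integrable_mult_conjugate:
  fixes f g :: "'a \<Rightarrow> real"
  assumes [measurable]: "f \<in> borel_measurable M" "g \<in> borel_measurable M"
    and pq: "1 < p" "1 / p + 1 / q = 1"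
    and i: "integrable M (\<lambda>x. \<bar>f x\<bar> powr p)" "integrable M (\<lambda>x. \<bar>g x\<bar> powr q)"
  shows "integrable M (\<lambda>x. f x * g x)"
proof (rule integrable_dominated)
  have "1 < q" by (rule conjugate_exponents(1)[OF pq])
  show "integrable M (\<lambda>x. \<bar>f x\<bar> powr p / p + \<bar>g x\<bar> powr q / q)" using i by auto
  show "AE x in M. norm (f x * g x) \<le> norm (\<bar>f x\<bar> powr p / p + \<bar>g x\<bar> powr q / q)"
  proof (rule AE_I2)
    fix x
    have "\<bar>f x\<bar> * \<bar>g x\<bar> \<le> \<bar>f x\<bar> powr p / p + \<bar>g x\<bar> powr q / q"
      using Youngs_inequality[of p q "\<bar>f x\<bar>" "\<bar>g x\<bar>"] pq \<open>1 < q\<close> by auto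
    then show "norm (f x * g x) \<le> norm (\<bar>f x\<bar> powr p / p + \<bar>g x\<bar> powr q / q)"
      by (simp add: abs_mult)
  qed
qed auto

text \<open>Adding a small constant to both norms before normalizing makes them nonzero; the constant
  is then sent to zero.\<close>

lemma holder_inequality:
  fixes f g :: "'a \<Rightarrow> real"
  assumes [measurable]: "f \<in> borel_measurable M" "g \<in> borel_measurable M"
    and pq: "1 < p" "1 / p + 1 / q = 1"
    and i: "integrable M (\<lambda>x. \<bar>f x\<bar> powr p)" "integrable M (\<lambda>x. \<bar>g x\<bar> powr q)"
  shows "(\<integral>x. \<bar>f x * g x\<bar> \<partial>M) \<le> (\<integral>x. \<bar>f x\<bar> powr p \<partial>M) powr (1 / p) * (\<integral>x. \<bar>g x\<bar> powr q \<partial>M) powr (1 / q)"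
proof -
  have q: "1 < q" by (rule conjugate_exponents(1)[OF pq])
  define A where "A = (\<integral>x. \<bar>f x\<bar> powr p \<partial>M)"
  define B where "B = (\<integral>x. \<bar>g x\<bar> powr q \<partial>M)"
  have AB: "A \<ge> 0" "B \<ge> 0" unfolding A_def B_def by auto
  have fg: "integrable M (\<lambda>x. f x * g x)" by (rule integrable_mult_conjugate[OF _ _ pq i]) auto
  have bound: "(\<integral>x. \<bar>f x * g x\<bar> \<partial>M) \<le> (A + d) powr (1 / p) * (B + d) powr (1 / q)" if d: "d > 0" for d
  proof -
    define a where "a = (A + d) powr (1 / p)"
    define b where "b = (B + d) powr (1 / q)"
    have ab: "a > 0" "b > 0" "a powr p = A + d" "b powr q = B + d"
      using AB d pq q by (auto simp: a_def b_def powr_powr)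
    have pt: "\<bar>f x * g x\<bar> \<le> a * b * (\<bar>f x\<bar> powr p / (p * (A + d)) + \<bar>g x\<bar> powr q / (q * (B + d)))" for x
    proof -
      have "(\<bar>f x\<bar> / a) * (\<bar>g x\<bar> / b) \<le> (\<bar>f x\<bar> / a) powr p / p + (\<bar>g x\<bar> / b) powr q / q"
        using Youngs_inequality[of p q "\<bar>f x\<bar> / a" "\<bar>g x\<bar> / b"] pq q ab by auto
      also have "\<dots> = \<bar>f x\<bar> powr p / (p * (A + d)) + \<bar>g x\<bar> powr q / (q * (B + d))"
        using ab by (simp add: powr_divide mult.commute)
      finally have "a * b * ((\<bar>f x\<bar> / a) * (\<bar>g x\<bar> / b)) \<le>
          a * b * (\<bar>f x\<bar> powr p / (p * (A + d)) + \<bar>g x\<bar> powr q / (q * (B + d)))"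
        using ab by (intro mult_left_mono) auto
      then show ?thesis using ab by (simp add: abs_mult)
    qed
    have "(\<integral>x. \<bar>f x * g x\<bar> \<partial>M) \<le>
        (\<integral>x. a * b * (\<bar>f x\<bar> powr p / (p * (A + d)) + \<bar>g x\<bar> powr q / (q * (B + d))) \<partial>M)"
      using fg i pt by (intro integral_mono) auto
    also have "\<dots> = a * b * (A / (p * (A + d)) + B / (q * (B + d)))"
      using i by (simp add: A_def B_def)
    also have "\<dots> \<le> a * b * (1 / p + 1 / q)"
    proof -
      have *: "A' / (r * (A' + d)) \<le> 1 / r" if "A' \<ge> 0" "r > 0" for A' r :: real
      proof -
        have "A' / (A' + d) \<le> 1" using that d by simp
        then have "1 / r * (A' / (A' + d)) \<le> 1 / r * 1" using that by (intro mult_left_mono) auto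
        then show ?thesis by simp
      qed
      have "A / (p * (A + d)) \<le> 1 / p" "B / (q * (B + d)) \<le> 1 / q"
        using AB pq q by (auto intro!: *)
      then show ?thesis using ab by (intro mult_left_mono add_mono) auto
    qed
    finally show ?thesis using pq by (simp add: a_def b_def)
  qed
  have "((\<lambda>d. (A + d) powr (1 / p) * (B + d) powr (1 / q)) \<longlongrightarrow> (A + 0) powr (1 / p) * (B + 0) powr (1 / q)) (at_right 0)"
  proof -
    have "\<forall>\<^sub>F d in at_right 0. (0::real) < d" by (simp add: eventually_at_right_less)
    then have "\<forall>\<^sub>F d in at_right 0. 0 \<le> A + d" "\<forall>\<^sub>F d in at_right 0. 0 \<le> B + d"
      using AB by (auto elim!: eventually_mono)
    then show ?thesis
      using pq q by (intro tendsto_mult tendsto_powr' tendsto_add tendsto_const) auto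
  qed
  moreover have "\<forall>\<^sub>F d in at_right 0. (\<integral>x. \<bar>f x * g x\<bar> \<partial>M) \<le> (A + d) powr (1 / p) * (B + d) powr (1 / q)"
    using bound by (auto simp: eventually_at_filter)
  ultimately show ?thesis
    using tendsto_lowerbound[of _ _ "at_right (0::real)"] by (auto simp: A_def B_def)
qed

lemma integrable_inner_conjugate:
  fixes F G :: "'a \<Rightarrow> 'b::euclidean_space"
  assumes [measurable]: "F \<in> borel_measurable M" "G \<in> borel_measurable M"
    and pq: "1 < p" "1 / p + 1 / q = 1"
    and i: "integrable M (\<lambda>x. norm (F x) powr p)" "integrable M (\<lambda>x. norm (G x) powr q)"
  shows "integrable M (\<lambda>x. F x \<bullet> G x)"
    and "\<bar>\<integral>x. F x \<bullet> G x \<partial>M\<bar> \<le>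
      (\<integral>x. norm (F x) powr p \<partial>M) powr (1 / p) * (\<integral>x. norm (G x) powr q \<partial>M) powr (1 / q)"
proof -
  have ii: "integrable M (\<lambda>x. norm (F x) * norm (G x))"
    using i by (intro integrable_mult_conjugate[OF _ _ pq]) auto
  show I: "integrable M (\<lambda>x. F x \<bullet> G x)"
    by (rule integrable_dominated[OF ii]) (auto intro!: AE_I2 simp: Cauchy_Schwarz_ineq2)
  have "\<bar>\<integral>x. F x \<bullet> G x \<partial>M\<bar> \<le> (\<integral>x. \<bar>F x \<bullet> G x\<bar> \<partial>M)"
    by (rule integral_abs_bound)
  also have "\<dots> \<le> (\<integral>x. \<bar>norm (F x) * norm (G x)\<bar> \<partial>M)"
    using I ii by (intro integral_mono) (auto simp: Cauchy_Schwarz_ineq2)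
  also have "\<dots> \<le> (\<integral>x. norm (F x) powr p \<partial>M) powr (1 / p) * (\<integral>x. norm (G x) powr q \<partial>M) powr (1 / q)"
    using holder_inequality[OF _ _ pq, of "\<lambda>x. norm (F x)" M "\<lambda>x. norm (G x)"] i by simp
  finally show "\<bar>\<integral>x. F x \<bullet> G x \<partial>M\<bar> \<le>
      (\<integral>x. norm (F x) powr p \<partial>M) powr (1 / p) * (\<integral>x. norm (G x) powr q \<partial>M) powr (1 / q)" .
qed

text \<open>Hoelder's inequality against the indicator of \<open>A\<close>.\<close>

lemma powr_integral_le:
  fixes G :: "'a::euclidean_space \<Rightarrow> real"
  assumes [measurable]: "G \<in> Borel_fun" "A \<in> sets borel"
    and fin: "emeasure lborel A < \<infinity>" and p: "1 < p"
    and i: "integrable lborel (\<lambda>x. indicator A x * \<bar>G x\<bar> powr p)"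
  shows "integrable lborel (\<lambda>x. indicator A x * G x)"
    and "(\<integral>x. indicator A x * \<bar>G x\<bar> \<partial>lborel) powr p \<le>
      measure lborel A powr (p - 1) * (\<integral>x. indicator A x * \<bar>G x\<bar> powr p \<partial>lborel)"
proof -
  define q where "q = p / (p - 1)"
  have pq: "1 / p + 1 / q = 1" using p by (simp add: q_def field_simps)
  note q = conjugate_exponents[OF p pq]
  have e1: "\<bar>indicator A x * \<bar>G x\<bar>\<bar> powr p = indicator A x * \<bar>G x\<bar> powr p"
    and e2: "\<bar>indicator A x :: real\<bar> powr q = indicator A x" for x :: 'a
    using p q(1) by (auto simp: indicator_def)
  have iA: "integrable lborel (\<lambda>x. indicator A x :: real)" using fin by simp
  have ii: "integrable lborel (\<lambda>x. \<bar>indicator A x * \<bar>G x\<bar>\<bar> powr p)"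
    "integrable lborel (\<lambda>x. \<bar>indicator A x :: real\<bar> powr q)"
    unfolding e1 e2 using i iA by auto
  have "integrable lborel (\<lambda>x. (indicator A x * \<bar>G x\<bar>) * indicator A x)"
    by (rule integrable_mult_conjugate[OF _ _ p pq ii]) auto
  then show "integrable lborel (\<lambda>x. indicator A x * G x)"
    by (rule integrable_dominated) (auto intro!: AE_I2 simp: indicator_def)
  have eq: "\<bar>(indicator A x * \<bar>G x\<bar>) * indicator A x\<bar> = indicator A x * \<bar>G x\<bar>" for x
    by (auto simp: indicator_def)
  have "(\<integral>x. indicator A x * \<bar>G x\<bar> \<partial>lborel) \<le>
     (\<integral>x. indicator A x * \<bar>G x\<bar> powr p \<partial>lborel) powr (1 / p) * measure lborel A powr (1 / q)"
    using holder_inequality[OF _ _ p pq ii] fin unfolding e1 e2 eq by simp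
  then have "(\<integral>x. indicator A x * \<bar>G x\<bar> \<partial>lborel) powr p \<le>
     ((\<integral>x. indicator A x * \<bar>G x\<bar> powr p \<partial>lborel) powr (1 / p) * measure lborel A powr (1 / q)) powr p"
    using p by (intro powr_mono2) auto
  also have "\<dots> = (\<integral>x. indicator A x * \<bar>G x\<bar> powr p \<partial>lborel) powr (1 / p * p) * measure lborel A powr (1 / q * p)"
    by (simp only: powr_powr powr_mult)
  also have "1 / q * p = p - 1" using q(3) by simp
  finally show "(\<integral>x. indicator A x * \<bar>G x\<bar> \<partial>lborel) powr p \<le>
      measure lborel A powr (p - 1) * (\<integral>x. indicator A x * \<bar>G x\<bar> powr p \<partial>lborel)"
    using p by (simp add: mult.commute)
qed

section \<open>The p-Laplacian flux\<close>

lemma pflux_0 [simp]: "pflux p 0 = 0"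
  by (simp add: pflux_def)

lemma norm_pflux: "norm (pflux p \<xi>) = norm \<xi> powr (p - 1)"
proof (cases "\<xi> = 0")
  case False
  then have "norm \<xi> powr (p - 2) * norm \<xi> powr 1 = norm \<xi> powr (p - 2 + 1)"
    by (simp only: powr_add)
  then show ?thesis using False by (simp add: pflux_def)
qed simp

lemma pflux_inner_self: "pflux p \<xi> \<bullet> \<xi> = norm \<xi> powr p"
proof (cases "\<xi> = 0")
  case False
  then have "norm \<xi> powr (p - 2) * (norm \<xi> powr 1 * norm \<xi> powr 1) = norm \<xi> powr (p - 2 + (1 + 1))"
    by (simp only: powr_add)
  then show ?thesis using False by (simp add: pflux_def dot_square_norm power2_eq_square)
qed simp

lemma norm_pflux_powr:
  assumes "1 < p" "1 / p + 1 / q = 1"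
  shows "norm (pflux p \<xi>) powr q = norm \<xi> powr p"
  using conjugate_exponents(2)[OF assms] by (simp add: norm_pflux powr_powr)

lemma pflux_scaleR:
  assumes "t > 0"
  shows "pflux p (t *\<^sub>R \<xi>) = t powr (p - 1) *\<^sub>R pflux p \<xi>"
proof -
  have "t powr (p - 1) = t powr (p - 2) * t powr 1"
    by (simp only: powr_add[symmetric]) simp
  then show ?thesis using assms by (simp add: pflux_def powr_mult)
qed

lemma continuous_pflux:
  assumes "1 < p"
  shows "continuous_on S (pflux p :: 'b::euclidean_space \<Rightarrow> 'b)"
proof (rule continuous_at_imp_continuous_on, intro ballI)
  fix x :: 'b
  show "isCont (pflux p) x"
  proof (cases "x = 0")
    case False
    then show ?thesis unfolding pflux_def[abs_def] by (intro continuous_intros) auto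
  next
    case True
    have "((\<lambda>x::'b. norm x powr (p - 1)) \<longlongrightarrow> 0) (at 0)"
    proof -
      have "((\<lambda>x::'b. norm x powr (p - 1)) \<longlongrightarrow> norm (0::'b) powr (p - 1)) (at 0)"
        using assms by (intro tendsto_powr' tendsto_intros) auto
      then show ?thesis using assms by simp
    qed
    then have "((\<lambda>x::'b. pflux p x) \<longlongrightarrow> 0) (at 0)"
      by (subst tendsto_norm_zero_iff[symmetric]) (simp add: norm_pflux)
    then show ?thesis using True by (simp add: isCont_def)
  qed
qed

lemma borel_measurable_pflux [measurable]:
  "(pflux p :: 'b::euclidean_space \<Rightarrow> 'b) \<in> Borel_fun"
  unfolding pflux_def[abs_def] by measurable

lemma pflux_strictly_monotone:
  fixes x y :: "'b::euclidean_space"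
  assumes p: "1 < p" and xy: "x \<noteq> y"
  shows "0 < (pflux p x - pflux p y) \<bullet> (x - y)"
proof (cases "x = 0 \<or> y = 0")
  case True
  then show ?thesis
    using xy by (auto simp: pflux_inner_self)
next
  case False
  define a b where "a = norm x" and "b = norm y"
  have ab: "a > 0" "b > 0" using False by (auto simp: a_def b_def)
  have pw: "c powr p = c powr (p - 1) * c" "c powr (p - 1) = c powr (p - 2) * c" if "c > 0" for c
    using that powr_add[of c "p - 1" 1] powr_add[of c "p - 2" 1] by auto
  have "(pflux p x - pflux p y) \<bullet> (x - y) =
      a powr p + b powr p - (a powr (p - 2) + b powr (p - 2)) * (x \<bullet> y)"
    using pflux_inner_self[of p x] pflux_inner_self[of p y]
    by (simp add: inner_diff_left inner_diff_right a_def b_def pflux_def inner_commute algebra_simps)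
  also have "\<dots> = (a powr (p - 1) - b powr (p - 1)) * (a - b) +
      (a powr (p - 2) + b powr (p - 2)) * (a * b - x \<bullet> y)"
    using ab by (simp add: pw algebra_simps)
  finally have eq: "(pflux p x - pflux p y) \<bullet> (x - y) = \<dots>" .
  have cs: "a * b - x \<bullet> y \<ge> 0"
    using norm_cauchy_schwarz[of x y] by (simp add: a_def b_def)
  have pos: "a powr (p - 2) + b powr (p - 2) > 0" using ab by (simp add: add_pos_pos)
  consider "a < b" | "b < a" | "a = b" by linarith
  then show ?thesis
  proof cases
    case 1
    then have "a powr (p - 1) < b powr (p - 1)" using p ab by (intro powr_less_mono2) auto
    then have "(a powr (p - 1) - b powr (p - 1)) * (a - b) > 0" using 1 by (simp add: mult_neg_neg)
    then show ?thesis unfolding eq using cs pos by (intro add_pos_nonneg) auto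
  next
    case 2
    then have "b powr (p - 1) < a powr (p - 1)" using p ab by (intro powr_less_mono2) auto
    then have "(a powr (p - 1) - b powr (p - 1)) * (a - b) > 0" using 2 by simp
    then show ?thesis unfolding eq using cs pos by (intro add_pos_nonneg) auto
  next
    case 3
    have "0 < (x - y) \<bullet> (x - y)" using xy by simp
    also have "\<dots> = 2 * (a * b - x \<bullet> y)"
      using 3 power2_norm_eq_inner[of x] power2_norm_eq_inner[of y]
      by (simp add: inner_diff_left inner_diff_right a_def b_def inner_commute power2_eq_square)
    finally show ?thesis unfolding eq using 3 pos by simp
  qed
qed

lemma pflux_monotone:
  fixes x y :: "'b::euclidean_space"
  assumes "1 < p"
  shows "0 \<le> (pflux p x - pflux p y) \<bullet> (x - y)"
  using pflux_strictly_monotone[OF assms, of x y] by (cases "x = y") auto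

text \<open>All three terms are homogeneous of degree \<open>p\<close>, so it suffices to compare them on the unit
  sphere. Where the first term on the right fails to dominate \<open>Q\<close>, the two points differ, and by
  compactness the monotonicity product is bounded away from zero there. This replaces the usual
  case distinction between \<open>p < 2\<close> and \<open>p \<ge> 2\<close>.\<close>

lemma controlled_by_monotonicity:
  fixes Q :: "'b::euclidean_space \<Rightarrow> 'b \<Rightarrow> real"
  assumes p: "1 < p"
    and cont: "continuous_on UNIV (\<lambda>z. Q (fst z) (snd z))"
    and hom: "\<And>t x y. t > 0 \<Longrightarrow> Q (t *\<^sub>R x) (t *\<^sub>R y) = t powr p * Q x y"
    and diag: "\<And>x. Q x x = 0"
    and d: "d > 0"
  obtains C where "C \<ge> 0"
    "\<And>x y. Q x y \<le> d * (norm x powr p + norm y powr p) + C * ((pflux p x - pflux p y) \<bullet> (x - y))"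
proof -
  define N where "N z = norm (fst z) powr p + norm (snd z) powr p" for z :: "'b \<times> 'b"
  define D where "D z = (pflux p (fst z) - pflux p (snd z)) \<bullet> (fst z - snd z)" for z :: "'b \<times> 'b"
  define R where "R z = Q (fst z) (snd z)" for z :: "'b \<times> 'b"
  have cN: "continuous_on S N" for S
    unfolding N_def[abs_def] using p by (intro continuous_intros continuous_on_powr') auto
  have cf: "continuous_on S (\<lambda>z. pflux p (h z))" if "continuous_on S h" for S and h :: "'b \<times> 'b \<Rightarrow> 'b"
    using continuous_on_compose2[OF continuous_pflux[OF p, of UNIV] that] by auto
  have cD: "continuous_on S D" for S
    unfolding D_def[abs_def] by (intro continuous_intros cf)
  have cR: "continuous_on S R" for S
    using cont unfolding R_def[abs_def] by (auto intro: continuous_on_subset)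
  have homN: "N (t *\<^sub>R z) = t powr p * N z" and homR: "R (t *\<^sub>R z) = t powr p * R z"
    and homD: "D (t *\<^sub>R z) = t powr p * D z" if "t > 0" for t z
  proof -
    show "N (t *\<^sub>R z) = t powr p * N z" "R (t *\<^sub>R z) = t powr p * R z"
      using that by (auto simp: N_def R_def powr_mult hom algebra_simps)
    have "t powr p = t powr (p - 1) * t" using that powr_add[of t "p - 1" 1] by auto
    then show "D (t *\<^sub>R z) = t powr p * D z"
      using that by (simp add: D_def pflux_scaleR scaleR_diff_right[symmetric])
  qed
  have Dnn: "D z \<ge> 0" for z unfolding D_def by (rule pflux_monotone[OF p])
  let ?K = "sphere (0 :: 'b \<times> 'b) 1"
  define K' where "K' = {z \<in> ?K. d * N z \<le> R z}"
  have K': "compact K'"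
  proof -
    have "K' = ?K \<inter> {z. d * N z \<le> R z}" by (auto simp: K'_def)
    moreover have "closed {z. d * N z \<le> R z}"
      by (intro closed_Collect_le continuous_intros cN cR)
    ultimately show ?thesis by (simp add: compact_Int_closed)
  qed
  have Npos: "N z > 0" if "z \<noteq> 0" for z
    using that by (cases z) (auto simp: N_def zero_prod_def intro: add_pos_nonneg add_nonneg_pos)
  have Dpos: "D z > 0" if "z \<in> K'" for z
  proof -
    have "z \<noteq> 0" using that by (auto simp: K'_def)
    then have "R z > 0" using that Npos[of z] d by (auto simp: K'_def intro: less_le_trans[OF mult_pos_pos])
    then have "fst z \<noteq> snd z" using diag by (auto simp: R_def)
    then show ?thesis unfolding D_def by (rule pflux_strictly_monotone[OF p])
  qed
  have "\<exists>C\<ge>0. \<forall>z\<in>K'. R z \<le> C * D z"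
  proof (cases "K' = {}")
    case False
    obtain z0 where z0: "z0 \<in> K'" "\<And>z. z \<in> K' \<Longrightarrow> D z0 \<le> D z"
      using continuous_attains_inf[OF K' False cD] by blast
    obtain z1 where z1: "z1 \<in> K'" "\<And>z. z \<in> K' \<Longrightarrow> R z \<le> R z1"
      using continuous_attains_sup[OF K' False cR] by blast
    have m: "D z0 > 0" using z0 Dpos by auto
    have "R z \<le> \<bar>R z1\<bar> / D z0 * D z" if "z \<in> K'" for z
    proof -
      have "R z \<le> \<bar>R z1\<bar> / D z0 * D z0" using z1(2)[OF that] m by auto
      also have "\<dots> \<le> \<bar>R z1\<bar> / D z0 * D z" using z0(2)[OF that] m by (intro mult_left_mono) auto
      finally show ?thesis .
    qed
    then show ?thesis using m by (intro exI[of _ "\<bar>R z1\<bar> / D z0"]) auto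
  qed auto
  then obtain C where C: "C \<ge> 0" "\<And>z. z \<in> K' \<Longrightarrow> R z \<le> C * D z" by auto
  have sph: "R z \<le> d * N z + C * D z" if "z \<in> ?K" for z
  proof (cases "z \<in> K'")
    case True
    moreover have "N z \<ge> 0" by (simp add: N_def)
    ultimately show ?thesis using C(2)[of z] d by (simp add: add_increasing)
  next
    case False
    then have "R z < d * N z" using that by (auto simp: K'_def)
    then show ?thesis using C(1) Dnn[of z] by (simp add: add_increasing2 less_imp_le)
  qed
  have main: "R z \<le> d * N z + C * D z" for z
  proof (cases "z = 0")
    case True
    then show ?thesis using diag[of 0] by (simp add: R_def N_def D_def)
  next
    case False
    define w where "w = (1 / norm z) *\<^sub>R z"
    have w: "w \<in> ?K" "z = norm z *\<^sub>R w" using False by (auto simp: w_def)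
    have "R z = norm z powr p * R w" "N z = norm z powr p * N w" "D z = norm z powr p * D w"
      using False homR[of "norm z" w] homN[of "norm z" w] homD[of "norm z" w] w(2) by auto
    moreover have "norm z powr p * R w \<le> norm z powr p * (d * N w + C * D w)"
      by (intro mult_left_mono sph w) auto
    ultimately show ?thesis by (simp add: algebra_simps)
  qed
  show thesis
    using main by (intro that[OF C(1)]) (auto simp: R_def N_def D_def dest: spec[of _ "(_, _)"] )
qed

section \<open>Iterated integrals\<close>

lemma
  fixes f :: "'a::euclidean_space \<times> 'b::euclidean_space \<Rightarrow> 'c::{banach, second_countable_topology}"
  assumes "integrable lborel f"
  shows AE_integrable_slice1: "AE x in lborel. integrable lborel (\<lambda>y. f (x, y))"
    and integrable_slice1: "integrable lborel (\<lambda>x. LBINT y. f (x, y))"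
    and iterated_integral1: "(LBINT z. f z) = (LBINT x. LBINT y. f (x, y))"
    and iterated_integral2: "(LBINT z. f z) = (LBINT y. LBINT x. f (x, y))"
proof -
  have f: "integrable (lborel \<Otimes>\<^sub>M lborel) f" using assms by (simp add: lborel_prod)
  have f': "integrable (lborel \<Otimes>\<^sub>M lborel) (case_prod (\<lambda>x y. f (x, y)))" using f by simp
  show "AE x in lborel. integrable lborel (\<lambda>y. f (x, y))" by (rule lborel_pair.AE_integrable_fst'[OF f])
  show "integrable lborel (\<lambda>x. LBINT y. f (x, y))" by (rule lborel_pair.integrable_fst'[OF f])
  show "(LBINT z. f z) = (LBINT x. LBINT y. f (x, y))"
    using lborel_pair.integral_fst'[OF f] by (simp add: lborel_prod)
  show "(LBINT z. f z) = (LBINT y. LBINT x. f (x, y))"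
    using lborel_pair.integral_snd[OF f'] by (simp add: lborel_prod)
qed

lemma
  fixes f :: "'a::euclidean_space \<times> 'b::euclidean_space \<Rightarrow> ennreal"
  assumes "f \<in> Borel_fun"
  shows iterated_nn_integral1: "(\<integral>\<^sup>+z. f z \<partial>lborel) = (\<integral>\<^sup>+x. \<integral>\<^sup>+y. f (x, y) \<partial>lborel \<partial>lborel)"
    and iterated_nn_integral2: "(\<integral>\<^sup>+z. f z \<partial>lborel) = (\<integral>\<^sup>+y. \<integral>\<^sup>+x. f (x, y) \<partial>lborel \<partial>lborel)"
proof -
  have f: "f \<in> borel_measurable (lborel \<Otimes>\<^sub>M lborel)" using assms by (simp add: lborel_prod)
  show "(\<integral>\<^sup>+z. f z \<partial>lborel) = (\<integral>\<^sup>+x. \<integral>\<^sup>+y. f (x, y) \<partial>lborel \<partial>lborel)"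
    using lborel.nn_integral_fst[OF f] by (simp add: lborel_prod)
  show "(\<integral>\<^sup>+z. f z \<partial>lborel) = (\<integral>\<^sup>+y. \<integral>\<^sup>+x. f (x, y) \<partial>lborel \<partial>lborel)"
    using lborel_pair.nn_integral_snd[OF f] by (simp add: lborel_prod)
qed

lemma AE_lborel_pair:
  fixes P :: "'a::euclidean_space \<times> 'b::euclidean_space \<Rightarrow> bool"
  assumes "AE z in lborel. P z"
  shows "AE x in lborel. AE y in lborel. P (x, y)"
proof -
  have "AE z in (lborel :: 'a measure) \<Otimes>\<^sub>M (lborel :: 'b measure). P z"
    unfolding lborel_prod by (rule assms)
  from lborel_pair.AE_pair[OF this] show ?thesis .
qed

lemma integrable_nn_integral_le:
  assumes "f \<in> borel_measurable M" "\<And>x. 0 \<le> f x" "0 \<le> c" "(\<integral>\<^sup>+x. ennreal (f x) \<partial>M) \<le> ennreal c"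
  shows "integrable M f" "(LINT x|M. f x) \<le> c"
proof -
  show *: "integrable M f"
    using assms by (intro integrableI_nonneg) (auto intro: le_less_trans)
  show "(LINT x|M. f x) \<le> c"
    using assms nn_integral_eq_integral[OF *] by simp
qed

lemma integrable_tensor:
  fixes f :: "'a::euclidean_space \<Rightarrow> real" and g :: "'b::euclidean_space \<Rightarrow> real"
  assumes f: "integrable lborel f" and g: "integrable lborel g"
  shows "integrable lborel (\<lambda>z. f (fst z) * g (snd z))"
proof -
  have [measurable]: "f \<in> Borel_fun" "g \<in> Borel_fun"
    using f g by auto
  have "integrable (lborel \<Otimes>\<^sub>M lborel) (\<lambda>z. f (fst z) * g (snd z))"
  proof (rule lborel_pair.Fubini_integrable)
    show "integrable lborel (\<lambda>x. LBINT y. norm (f (fst (x, y)) * g (snd (x, y))))"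
      using f by (simp add: abs_mult)
    show "AE x in lborel. integrable lborel (\<lambda>y. f (fst (x, y)) * g (snd (x, y)))"
      using g by simp
    show "(\<lambda>z. f (fst z) * g (snd z)) \<in> borel_measurable (lborel \<Otimes>\<^sub>M lborel)" by measurable
  qed
  then show ?thesis by (simp add: lborel_prod)
qed

section \<open>Primitives and integration by parts\<close>

text \<open>Since \<open>{0..y}\<close> is empty for negative \<open>y\<close>, the primitive vanishes there, and a bound for its increments
  is also a bound for its values.\<close>

definition primitive :: "(real \<Rightarrow> real) \<Rightarrow> real \<Rightarrow> real" where
  "primitive w y = (LBINT t. indicator {0..y} t * w t)"

lemma primitive_parametric_measurable:
  fixes w :: "'a::euclidean_space \<times> real \<Rightarrow> real"
  assumes [measurable]: "w \<in> Borel_fun"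
  shows "(\<lambda>z. primitive (\<lambda>t. w (fst z, t)) (snd z)) \<in> borel_measurable (borel :: ('a \<times> real) measure)"
proof -
  have "(\<lambda>(z :: 'a \<times> real, t). (if 0 \<le> t \<and> t \<le> snd z then 1 else 0) * w (fst z, t))
      \<in> borel_measurable (borel \<Otimes>\<^sub>M lborel)"
  proof -
    have [measurable]: "w \<in> borel_measurable (borel \<Otimes>\<^sub>M borel)" by (simp add: borel_prod)
    show ?thesis unfolding borel_prod[symmetric] by measurable
  qed
  from lborel.borel_measurable_lebesgue_integral[OF this] show ?thesis
    unfolding primitive_def by (simp add: indicator_def of_bool_def)
qed

lemma primitive_measurable [measurable]:
  assumes [measurable]: "w \<in> Borel_fun"
  shows "primitive w \<in> Borel_fun"
proof -
  have "(\<lambda>(y :: real, t). (if 0 \<le> t \<and> t \<le> y then 1 else 0) * w t) \<in> borel_measurable (borel \<Otimes>\<^sub>M lborel)"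
    by measurable
  from lborel.borel_measurable_lebesgue_integral[OF this] show ?thesis
    unfolding primitive_def[abs_def] by (simp add: indicator_def of_bool_def)
qed

lemma integrable_indicator_mult:
  fixes w :: "'a::euclidean_space \<Rightarrow> real"
  assumes "integrable lborel w" "A \<in> sets borel"
  shows "integrable lborel (\<lambda>t. indicator A t * w t)"
  using integrable_mult_indicator[of A lborel w] assms by simp

lemma primitive_diff_le:
  assumes w: "integrable lborel w" and "x \<le> y"
  shows "\<bar>primitive w y - primitive w x\<bar> \<le> (LBINT t. indicator {x..y} t * \<bar>w t\<bar>)"
proof -
  have "primitive w y - primitive w x = (LBINT t. indicator {0..y} t * w t - indicator {0..x} t * w t)"
    unfolding primitive_def using integrable_indicator_mult[OF w] by simp
  also have "\<bar>\<dots>\<bar> \<le> (LBINT t. \<bar>indicator {0..y} t * w t - indicator {0..x} t * w t\<bar>)"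
    by (rule integral_abs_bound)
  also have "\<dots> \<le> (LBINT t. indicator {x..y} t * \<bar>w t\<bar>)"
  proof (rule integral_mono)
    show "integrable lborel (\<lambda>t. \<bar>indicator {0..y} t * w t - indicator {0..x} t * w t\<bar>)"
      by (intro integrable_abs Bochner_Integration.integrable_diff integrable_indicator_mult[OF w]) auto
    show "integrable lborel (\<lambda>t. indicator {x..y} t * \<bar>w t\<bar>)"
      by (rule integrable_indicator_mult[OF integrable_abs[OF w]]) simp
    show "\<bar>indicator {0..y} t * w t - indicator {0..x} t * w t\<bar> \<le> indicator {x..y} t * \<bar>w t\<bar>" for t
      using assms(2) by (auto simp: indicator_def)
  qed
  finally show ?thesis .
qed

lemma primitive_diff_le_total:
  assumes w: "integrable lborel w"
  shows "\<bar>primitive w y - primitive w x\<bar> \<le> (LBINT t. \<bar>w t\<bar>)"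
proof -
  have *: "(LBINT t. indicator {a..b} t * \<bar>w t\<bar>) \<le> (LBINT t. \<bar>w t\<bar>)" for a b
    by (rule integral_mono[OF integrable_indicator_mult[OF integrable_abs[OF w]] integrable_abs[OF w]])
       (auto simp: indicator_def)
  show ?thesis
    using primitive_diff_le[OF w, of x y] primitive_diff_le[OF w, of y x] *[of x y] *[of y x]
    by (cases "x \<le> y") (auto simp: abs_minus_commute)
qed

text \<open>What the restriction of a test function to a line parallel to an axis keeps: it is continuously
  differentiable and vanishes off an interval, so that it can be integrated by parts against
  primitives of integrable functions.\<close>

definition test_slice :: "real \<Rightarrow> (real \<Rightarrow> real) \<Rightarrow> (real \<Rightarrow> real) \<Rightarrow> bool" where
  "test_slice M \<psi> \<psi>' \<longleftrightarrow> (\<forall>t. (\<psi> has_real_derivative \<psi>' t) (at t)) \<and> continuous_on UNIV \<psi>' \<and>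
     (\<forall>t. t \<notin> {0<..<M} \<longrightarrow> \<psi> t = 0)"

lemma test_slice_derivative_zero:
  assumes "test_slice M \<psi> \<psi>'" "t < 0 \<or> M < t"
  shows "\<psi>' t = 0"
proof -
  have d: "(\<psi> has_real_derivative \<psi>' t) (at t)" and z: "\<And>t. t \<notin> {0<..<M} \<Longrightarrow> \<psi> t = 0"
    using assms unfolding test_slice_def by blast+
  define S where "S = {..<0} \<union> {M<..}"
  have "((\<lambda>t. 0) has_real_derivative 0) (at t)" by simp
  then have "(\<psi> has_real_derivative 0) (at t)"
  proof (rule has_field_derivative_transform_within_open[where S = S])
    show "open S" "t \<in> S" using assms(2) by (auto simp: S_def)
    show "0 = \<psi> x" if "x \<in> S" for x using that z[of x] by (auto simp: S_def)
  qed
  then show ?thesis using d DERIV_unique by blast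
qed

lemma test_slice_integrals:
  assumes s: "test_slice M \<psi> \<psi>'"
  shows "integrable lborel \<psi>'" "\<And>a b. a \<le> b \<Longrightarrow> (LBINT t. indicator {a..b} t * \<psi>' t) = \<psi> b - \<psi> a"
    "\<And>t. (LBINT y. indicator {t..} y * \<psi>' y) = - \<psi> t" "(LBINT y. \<psi>' y) = 0"
    "\<And>x. \<psi>' x \<noteq> 0 \<Longrightarrow> 0 \<le> x \<and> x \<le> M"
proof -
  have d: "(\<psi> has_real_derivative \<psi>' t) (at t)" and c: "continuous_on S \<psi>'"
    and z: "t \<notin> {0<..<M} \<Longrightarrow> \<psi> t = 0" for t S
    using s unfolding test_slice_def by (auto intro: continuous_on_subset)
  have c': "isCont \<psi>' t" for t using c[of UNIV] by (simp add: continuous_on_eq_continuous_at)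
  have F: "has_bochner_integral lborel (\<lambda>t. \<psi>' t * indicator {a..b} t) (\<psi> b - \<psi> a)" if "a \<le> b" for a b
    by (rule has_bochner_integral_FTC_Icc_real[OF that d c'])
  show F': "(LBINT t. indicator {a..b} t * \<psi>' t) = \<psi> b - \<psi> a" if "a \<le> b" for a b
    using has_bochner_integral_integral_eq[OF F[OF that]] by (simp add: mult.commute)
  show I0: "\<psi>' x \<noteq> 0 \<Longrightarrow> 0 \<le> x \<and> x \<le> M" for x
    using test_slice_derivative_zero[OF s, of x] by linarith
  then have eq: "\<psi>' t = \<psi>' t * indicator {0..max M 0} t" for t
    by (cases "\<psi>' t = 0") (auto simp: indicator_def max.coboundedI1)
  show "integrable lborel \<psi>'"
    using F[of 0 "max M 0"] by (subst eq[abs_def]) (auto simp: has_bochner_integral_iff)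
  show "(LBINT y. \<psi>' y) = 0"
    using has_bochner_integral_integral_eq[OF F[of 0 "max M 0"]] z[of 0] z[of "max M 0"]
    by (simp add: eq[symmetric])
  show "(LBINT y. indicator {t..} y * \<psi>' y) = - \<psi> t" for t
  proof -
    have "indicator {t..} y * \<psi>' y = indicator {t..max t M} y * \<psi>' y" for y
      using I0[of y] by (cases "\<psi>' y = 0") (auto simp: indicator_def max.coboundedI2)
    then have "(LBINT y. indicator {t..} y * \<psi>' y) = \<psi> (max t M) - \<psi> t"
      using F'[of t "max t M"] by (simp only: max.cobounded1 simp_thms)
    then show ?thesis using z[of "max t M"] by simp
  qed
qed

text \<open>Fubini's theorem on the triangle \<open>0 \<le> t \<le> y\<close>; the inner integral of \<open>\<psi>'\<close> over \<open>{t..}\<close> is \<open>- \<psi> t\<close>.\<close>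

lemma primitive_by_parts:
  assumes w: "integrable lborel w" and s: "test_slice M \<psi> \<psi>'"
  shows "(LBINT y. primitive w y * \<psi>' y) = - (LBINT t. w t * \<psi> t)"
    and "integrable lborel (\<lambda>y. primitive w y * \<psi>' y)"
proof -
  note I = test_slice_integrals[OF s]
  have [measurable]: "w \<in> Borel_fun" "\<psi>' \<in> Borel_fun" using w I(1) by auto
  define K where "K z = (if 0 \<le> snd z \<and> snd z \<le> fst z then 1 else 0) * (\<psi>' (fst z) * w (snd z))" for z :: "real \<times> real"
  have Km: "K \<in> borel_measurable (borel :: (real \<times> real) measure)"
    unfolding K_def[abs_def] borel_prod[symmetric] by measurable
  have K: "integrable lborel K"
  proof (rule integrable_dominated[OF integrable_tensor[OF I(1) w]])
    show "AE z in lborel. norm (K z) \<le> norm (\<psi>' (fst z) * w (snd z))"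
      by (intro AE_I2) (auto simp: K_def)
  qed (use Km in simp)
  have K1: "(LBINT t. K (y, t)) = primitive w y * \<psi>' y" for y
  proof -
    have "K (y, t) = (indicator {0..y} t * w t) * \<psi>' y" for t by (auto simp: K_def indicator_def)
    then show ?thesis by (simp add: primitive_def)
  qed
  have K2: "(LBINT y. K (y, t)) = - (w t * \<psi> t)" for t
  proof (cases "0 \<le> t")
    case True
    then have "K (y, t) = w t * (indicator {t..} y * \<psi>' y)" for y by (auto simp: K_def indicator_def)
    then show ?thesis using I(3)[of t] by simp
  next
    case False
    then have "K (y, t) = 0" for y by (auto simp: K_def)
    moreover have "\<psi> t = 0" using s False unfolding test_slice_def by auto
    ultimately show ?thesis by simp
  qed
  show "(LBINT y. primitive w y * \<psi>' y) = - (LBINT t. w t * \<psi> t)"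
    using iterated_integral1[OF K] iterated_integral2[OF K] unfolding K1 K2 by simp
  show "integrable lborel (\<lambda>y. primitive w y * \<psi>' y)"
    using integrable_slice1[OF K] unfolding K1 .
qed

lemma test_slice_1:
  fixes U :: "(real \<times> real) set"
  assumes \<phi>: "\<phi> \<in> test_functions U" and U: "\<And>x y. (x, y) \<in> U \<Longrightarrow> 0 < x \<and> x < M"
  shows "test_slice M (\<lambda>x. \<phi> (x, y)) (\<lambda>x. deriv_at \<phi> (x, y) (1, 0))"
  unfolding test_slice_def
proof (intro conjI allI impI)
  show "((\<lambda>x. \<phi> (x, y)) has_real_derivative deriv_at \<phi> (x, y) (1, 0)) (at x)" for x
  proof -
    have "((\<lambda>x. (x, y)) has_derivative (\<lambda>h. (h, 0))) (at x)" by (auto intro!: derivative_eq_intros)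
    from has_derivative_compose[OF this test_derivative[OF \<phi>]]
    have D: "((\<lambda>x. \<phi> (x, y)) has_derivative (\<lambda>h. deriv_at \<phi> (x, y) (h, 0))) (at x)" .
    have "linear (deriv_at \<phi> (x, y))"
      using test_derivative[OF \<phi>] has_derivative_linear by blast
    then have "deriv_at \<phi> (x, y) (h *\<^sub>R (1, 0)) = h *\<^sub>R deriv_at \<phi> (x, y) (1, 0)" for h
      by (rule linear_cmul)
    note lin = this
    have "(\<lambda>h. deriv_at \<phi> (x, y) (h, 0)) = (*) (deriv_at \<phi> (x, y) (1, 0))"
    proof
      fix h
      show "deriv_at \<phi> (x, y) (h, 0) = deriv_at \<phi> (x, y) (1, 0) * h"
      using lin[of h] by (simp only: scaleR_Pair real_scaleR_def mult_zero_right scaleR_zero_right mult_1_right mult_1_left mult_zero_left mult.commute)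
    qed
    then show ?thesis using D by (simp only: has_field_derivative_def)
  qed
  have "(1, 0) \<in> (Basis :: (real \<times> real) set)" by (simp add: Basis_prod_def)
  from test_partial_continuous[OF \<phi> this, of UNIV]
  show "continuous_on UNIV (\<lambda>x. deriv_at \<phi> (x, y) (1, 0))"
    by (rule continuous_on_compose2) (auto intro!: continuous_intros)
  show "t \<notin> {0<..<M} \<Longrightarrow> \<phi> (t, y) = 0" for t
    using test_zero[OF \<phi>, of "(t, y)"] U by force
qed

lemma test_slice_2:
  fixes U :: "(real \<times> real) set"
  assumes \<phi>: "\<phi> \<in> test_functions U" and U: "\<And>x y. (x, y) \<in> U \<Longrightarrow> 0 < y \<and> y < M"
  shows "test_slice M (\<lambda>y. \<phi> (x, y)) (\<lambda>y. deriv_at \<phi> (x, y) (0, 1))"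
  unfolding test_slice_def
proof (intro conjI allI impI)
  show "((\<lambda>y. \<phi> (x, y)) has_real_derivative deriv_at \<phi> (x, y) (0, 1)) (at y)" for y
  proof -
    have "((\<lambda>y. (x, y)) has_derivative (\<lambda>h. (0, h))) (at y)" by (auto intro!: derivative_eq_intros)
    from has_derivative_compose[OF this test_derivative[OF \<phi>]]
    have D: "((\<lambda>y. \<phi> (x, y)) has_derivative (\<lambda>h. deriv_at \<phi> (x, y) (0, h))) (at y)" .
    have "linear (deriv_at \<phi> (x, y))"
      using test_derivative[OF \<phi>] has_derivative_linear by blast
    then have "deriv_at \<phi> (x, y) (h *\<^sub>R (0, 1)) = h *\<^sub>R deriv_at \<phi> (x, y) (0, 1)" for h
      by (rule linear_cmul)
    note lin = this
    have "(\<lambda>h. deriv_at \<phi> (x, y) (0, h)) = (*) (deriv_at \<phi> (x, y) (0, 1))"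
    proof
      fix h
      show "deriv_at \<phi> (x, y) (0, h) = deriv_at \<phi> (x, y) (0, 1) * h"
      using lin[of h] by (simp only: scaleR_Pair real_scaleR_def mult_zero_right scaleR_zero_right mult_1_right mult_1_left mult_zero_left mult.commute)
    qed
    then show ?thesis using D by (simp only: has_field_derivative_def)
  qed
  have "(0, 1) \<in> (Basis :: (real \<times> real) set)" by (simp add: Basis_prod_def)
  from test_partial_continuous[OF \<phi> this, of UNIV]
  show "continuous_on UNIV (\<lambda>y. deriv_at \<phi> (x, y) (0, 1))"
    by (rule continuous_on_compose2) (auto intro!: continuous_intros)
  show "t \<notin> {0<..<M} \<Longrightarrow> \<phi> (x, t) = 0" for t
    using test_zero[OF \<phi>, of "(x, t)"] U by force
qed

lemma test_slice_real:
  assumes \<phi>: "\<phi> \<in> test_functions {0<..<M}"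
  shows "test_slice M \<phi> (\<lambda>y. deriv_at \<phi> y 1)"
  unfolding test_slice_def
proof (intro conjI allI impI)
  show "(\<phi> has_real_derivative deriv_at \<phi> y 1) (at y)" for y
    using test_derivative[OF \<phi>, of y] by (intro differentiable_real_DERIV) (auto simp: differentiable_def)
  show "continuous_on UNIV (\<lambda>y. deriv_at \<phi> y 1)"
    by (rule test_partial_continuous[OF \<phi>]) simp
  show "t \<notin> {0<..<M} \<Longrightarrow> \<phi> t = 0" for t by (rule test_zero[OF \<phi>])
qed

section \<open>Weak derivatives along lines\<close>

text \<open>The primitive starting at the left end of the support vanishes to the left of it, and also to the right
  because the integral of \<open>h\<close> is zero.\<close>

lemma antiderivative_is_test:
  fixes h :: "real \<Rightarrow> real"
  assumes C: "\<And>k. Ck k h" and cd: "c \<le> d" "{c..d} \<subseteq> {a<..<b}"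
    and sup: "\<And>t. h t \<noteq> 0 \<Longrightarrow> t \<in> {c..d}" and int: "(LBINT t. h t) = 0"
  obtains \<theta> where "\<theta> \<in> test_functions {a<..<b}" "\<And>t. deriv_at \<theta> t 1 = h t"
proof -
  have hc: "continuous_on UNIV h" using C[of 0] by simp
  then have hi: "isCont h t" for t by (simp add: continuous_on_eq_continuous_at)
  obtain F where F: "\<And>t. (F has_vector_derivative h t) (at t)"
    using einterval_antiderivative[of "-\<infinity>" "\<infinity>" h] hi by auto
  define \<theta> where "\<theta> t = F t - F c" for t
  have d: "(\<theta> has_real_derivative h t) (at t)" for t
    unfolding \<theta>_def[abs_def] has_real_derivative_iff_has_vector_derivative
    using F[of t] by (auto intro!: derivative_eq_intros)
  have "Ck k \<theta>" for k
  proof (cases k)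
    case 0
    then show ?thesis using d[THEN DERIV_isCont] by (simp add: continuous_at_imp_continuous_on)
  next
    case (Suc m)
    then show ?thesis
      using Ck_SucI[OF d[unfolded has_field_derivative_def]] C by (auto intro!: Ck_mult)
  qed
  moreover have "\<theta> t = 0" if "t \<notin> {c..d}" for t
  proof -
    have FTC: "(LBINT s. h s * indicator {u..v} s) = \<theta> v - \<theta> u" if "u \<le> v" for u v
      by (rule integral_FTC_Icc_real[OF that d hi])
    have "\<theta> c = 0" by (simp add: \<theta>_def)
    have "t < c \<or> d < t" using that by auto
    then consider "t < c" | "d < t" by blast
    then show ?thesis
    proof cases
      case 1
      have "h s * indicator {t..c} s = (h c) * indicator {c} s" for s
        using sup[of s] 1 by (auto simp: indicator_def)
      then have "(LBINT s. h s * indicator {t..c} s) = 0" by simp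
      then show ?thesis using FTC[of t c] 1 \<open>\<theta> c = 0\<close> by simp
    next
      case 2
      have "h s * indicator {c..t} s = h s" for s
        using sup[of s] 2 by (auto simp: indicator_def)
      then have "(LBINT s. h s * indicator {c..t} s) = 0" using int by (simp only:)
      then show ?thesis using FTC[of c t] 2 cd(1) \<open>\<theta> c = 0\<close> by simp
    qed
  qed
  ultimately have "\<theta> \<in> test_functions {a<..<b}"
    using cd(2) by (intro test_functionsI[of \<theta> "{c..d}"]) auto
  then show ?thesis
    using that frechet_derivative_real[OF d] by blast
qed

lemma interval_bump_test:
  assumes "a \<le> c" "d \<le> b"
  shows "interval_bump c d n \<in> test_functions {a<..<b}"
proof -
  have "interval_bump c d n = box_bump c d n" by (auto simp: box_bump_def)
  moreover have "box c d \<subseteq> {a<..<b}" using assms by auto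
  ultimately show ?thesis using box_bump_test[of c d "{a<..<b}" n] by simp
qed

lemma interval_bump_positive: "a + 1 / real (Suc n) < x \<Longrightarrow> x < b - 1 / real (Suc n) \<Longrightarrow> interval_bump a b n x > 0"
  by (auto simp: interval_bump_def exp_bump_def field_simps)

lemma ex_normalized_bump:
  fixes a b :: real
  assumes "a < b"
  obtains \<psi> c d where "\<And>k. Ck k \<psi>" "a < c" "c \<le> d" "d < b" "\<And>t. \<psi> t \<noteq> 0 \<Longrightarrow> t \<in> {c..d}"
    "integrable lborel \<psi>" "(LBINT t. \<psi> t) = (1::real)"
proof -
  obtain n where n: "1 / real (Suc n) < (b - a) / 2"
    using assms reals_Archimedean[of "(b - a) / 2"] by (auto simp: inverse_eq_divide)
  let ?c = "a + 1 / real (Suc n)" and ?d = "b - 1 / real (Suc n)"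
  let ?h = "interval_bump a b n"
  have "e < (y - x) / 2 \<Longrightarrow> x + e < y - e" for x y e :: real by (simp add: field_simps)
  from this[OF n] have cd: "?c < ?d" .
  have cont: "continuous_on S ?h" for S
    using Ck_interval_bump[of 0 a b n] by (auto intro: continuous_on_subset)
  have supp: "t \<in> {?c..?d}" if "?h t \<noteq> 0" for t using interval_bump_support[OF that] by auto
  have I: "integrable lborel ?h"
  proof -
    have "integrable lborel (\<lambda>x. indicator {?c..?d} x *\<^sub>R ?h x)"
      by (intro borel_integrable_compact cont) auto
    moreover have "indicator {?c..?d} x *\<^sub>R ?h x = ?h x" for x
      using supp[of x] by (auto simp: indicator_def)
    ultimately show ?thesis by (simp only:)
  qed
  have "(LBINT t. ?h t) \<noteq> 0"
  proof
    assume "(LBINT t. ?h t) = 0"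
    then have "AE t in lborel. ?h t = 0"
      using integral_nonneg_eq_0_iff_AE[OF I] interval_bump_bounds by simp
    then have "AE t in lborel. t \<notin> {?c<..<?d}"
      by eventually_elim (use interval_bump_positive[of a n _ b] in fastforce)
    then have "emeasure lborel {?c<..<?d} = 0"
      by (subst (asm) AE_iff_measurable[of "{?c<..<?d}"]) auto
    then show False using cd by simp
  qed
  then have nz: "(LBINT t. ?h t) \<noteq> 0" .
  let ?\<psi> = "\<lambda>t. (1 / (LBINT t. ?h t)) * ?h t"
  show ?thesis
  proof (rule that)
    show "Ck k ?\<psi>" for k by (rule Ck_mult[OF Ck_const Ck_interval_bump])
    show "a < ?c" "?d < b" by simp_all
    show "?c \<le> ?d" using cd by (rule less_imp_le)
    show "integrable lborel ?\<psi>" using I by simp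
    show "(LBINT t. ?\<psi> t) = 1" using nz by simp
    show "t \<in> {?c..?d}" if "?\<psi> t \<noteq> 0" for t using that supp[of t] by auto
  qed
qed

lemma box_bump_real_pair: "box_bump (a, c) (b, d) n (x, y) = interval_bump a b n x * interval_bump c d n (y::real)"
  for x :: real
  unfolding box_bump_def by (simp add: Basis_prod_def prod.union_disjoint[of "(\<lambda>u. (u, 0)) ` Basis"] image_def)

lemma borel_measurable_fst_snd [measurable]:
  "(fst :: 'a::euclidean_space \<times> 'b::euclidean_space \<Rightarrow> 'a) \<in> Borel_fun"
  "(snd :: 'a::euclidean_space \<times> 'b::euclidean_space \<Rightarrow> 'b) \<in> Borel_fun"
  by (auto intro!: borel_measurable_continuous_onI continuous_intros)

lemma Ck_fst: "Ck k h \<Longrightarrow> Ck k (\<lambda>z :: real \<times> real. h (fst z))"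
  using Ck_inner[of k h "(1, 0) :: real \<times> real"] by (simp add: inner_prod_def)

lemma Ck_snd: "Ck k h \<Longrightarrow> Ck k (\<lambda>z :: real \<times> real. h (snd z))"
  using Ck_inner[of k h "(0, 1) :: real \<times> real"] by (simp add: inner_prod_def)

lemma tensor_test:
  fixes \<kappa> \<psi> :: "real \<Rightarrow> real"
  assumes \<kappa>: "\<kappa> \<in> test_functions A" and \<psi>: "\<psi> \<in> test_functions B"
  shows "(\<lambda>z. \<kappa> (fst z) * \<psi> (snd z)) \<in> test_functions (A \<times> B)"
proof (rule test_functionsI)
  let ?K = "closure {t. \<kappa> t \<noteq> 0} \<times> closure {t. \<psi> t \<noteq> 0}"
  show "Ck k (\<lambda>z. \<kappa> (fst z) * \<psi> (snd z))" for k
    using \<kappa> \<psi> by (intro Ck_mult Ck_fst Ck_snd) (auto simp: test_functions_def)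
  show "compact ?K" "?K \<subseteq> A \<times> B"
    using \<kappa> \<psi> by (auto simp: test_functions_def intro!: compact_Times)
  show "z \<in> ?K" if "\<kappa> (fst z) * \<psi> (snd z) \<noteq> 0" for z
  proof -
    have "fst z \<in> {t. \<kappa> t \<noteq> 0}" "snd z \<in> {t. \<psi> t \<noteq> 0}" using that by auto
    then show ?thesis using closure_subset by (metis mem_Times_iff subsetD)
  qed
qed

lemma tensor_test_partials:
  fixes \<kappa> \<psi> :: "real \<Rightarrow> real"
  assumes \<kappa>: "\<kappa> \<in> test_functions A" and \<psi>: "\<psi> \<in> test_functions B"
  shows "deriv_at (\<lambda>z. \<kappa> (fst z) * \<psi> (snd z)) z (1, 0) =
      deriv_at \<kappa> (fst z) 1 * \<psi> (snd z)"
    and "deriv_at (\<lambda>z. \<kappa> (fst z) * \<psi> (snd z)) z (0, 1) =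
      \<kappa> (fst z) * deriv_at \<psi> (snd z) 1"
proof -
  have 1: "((\<lambda>z :: real \<times> real. \<kappa> (fst z)) has_derivative (\<lambda>h. deriv_at \<kappa> (fst z) (fst h))) (at z)"
    by (rule has_derivative_compose[OF _ test_derivative[OF \<kappa>]]) (auto intro!: derivative_eq_intros)
  have 2: "((\<lambda>z :: real \<times> real. \<psi> (snd z)) has_derivative (\<lambda>h. deriv_at \<psi> (snd z) (snd h))) (at z)"
    by (rule has_derivative_compose[OF _ test_derivative[OF \<psi>]]) (auto intro!: derivative_eq_intros)
  have 0: "deriv_at \<kappa> t 0 = 0" "deriv_at \<psi> t 0 = 0" for t
    using test_derivative[OF \<kappa>] test_derivative[OF \<psi>] has_derivative_linear linear_0 by blast+
  have e: "deriv_at (\<lambda>z. \<kappa> (fst z) * \<psi> (snd z)) z =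
      (\<lambda>h. \<kappa> (fst z) * deriv_at \<psi> (snd z) (snd h) +
        deriv_at \<kappa> (fst z) (fst h) * \<psi> (snd z))"
    by (rule frechet_derivative_at[OF has_derivative_mult[OF 1 2], symmetric])
  show "deriv_at (\<lambda>z. \<kappa> (fst z) * \<psi> (snd z)) z (1, 0) =
      deriv_at \<kappa> (fst z) 1 * \<psi> (snd z)"
    "deriv_at (\<lambda>z. \<kappa> (fst z) * \<psi> (snd z)) z (0, 1) =
      \<kappa> (fst z) * deriv_at \<psi> (snd z) 1"
    unfolding e by (simp_all add: 0)
qed

lemma integrable_mult_bounded:
  fixes F h :: "'a::euclidean_space \<Rightarrow> real"
  assumes F: "integrable lborel F" and [measurable]: "h \<in> Borel_fun" and B: "\<And>z. \<bar>h z\<bar> \<le> B"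
  shows "integrable lborel (\<lambda>z. F z * h z)"
proof (rule integrable_dominated)
  have "B \<ge> 0" using B[of undefined] by linarith
  show "integrable lborel (\<lambda>z. B * F z)" using F by simp
  show "AE z in lborel. norm (F z * h z) \<le> norm (B * F z)"
    using B \<open>B \<ge> 0\<close> by (intro AE_I2) (auto simp: abs_mult mult.commute[of B] intro!: mult_left_mono)
  show "(\<lambda>z. F z * h z) \<in> borel_measurable lborel"
    using F by (intro borel_measurable_times) auto
qed

lemma Ck_bump_bounded:
  fixes h :: "real \<Rightarrow> real"
  assumes "Ck 0 h" "\<And>t. h t \<noteq> 0 \<Longrightarrow> t \<in> {c..d}"
  obtains B where "\<And>t. \<bar>h t\<bar> \<le> B"
proof (rule compact_support_bounded[of h "{c..d}"])
  show "continuous_on UNIV h" using assms(1) by simp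
  show "h z = 0" if "z \<notin> {c..d}" for z using assms(2)[of z] that by blast
qed (use that in auto)

text \<open>A function on a rectangle whose weak derivative in the second variable vanishes depends on
  the first variable only: any test function \<open>\<psi>\<close> differs from a multiple of a fixed normalized
  bump \<open>\<psi>\<^sub>0\<close> by the derivative of a test function.\<close>

lemma constant_in_second_variable:
  fixes D :: "real \<times> real \<Rightarrow> real"
  assumes D: "integrable lborel D" and cd: "c < d"
    and ort: "\<And>\<kappa> \<psi>. \<kappa> \<in> test_functions {a<..<b} \<Longrightarrow> \<psi> \<in> test_functions {c<..<d} \<Longrightarrow>
      (LBINT z. D z * (\<kappa> (fst z) * deriv_at \<psi> (snd z) 1)) = 0"
  shows "\<exists>C\<in>Borel_fun. AE z in lborel. z \<in> {a<..<b} \<times> {c<..<d} \<longrightarrow> D z = C (fst z)"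
proof -
  let ?Q = "{a<..<b} \<times> {c<..<d}"
  obtain \<psi>0 c0 d0 where \<psi>0: "\<And>k. Ck k \<psi>0" "c < c0" "c0 \<le> d0" "d0 < d" "\<And>t. \<psi>0 t \<noteq> 0 \<Longrightarrow> t \<in> {c0..d0}"
    "integrable lborel \<psi>0" "(LBINT t. \<psi>0 t) = (1::real)"
    using ex_normalized_bump[OF cd] by blast
  obtain B0 where B0: "\<And>t. \<bar>\<psi>0 t\<bar> \<le> B0" using Ck_bump_bounded[OF \<psi>0(1,5)] by blast
  have [measurable]: "\<psi>0 \<in> Borel_fun" "D \<in> Borel_fun" using \<psi>0(6) D by auto
  have m0: "(\<lambda>z::real \<times> real. \<psi>0 (snd z)) \<in> Borel_fun"
    by measurable
  have D0: "integrable lborel (\<lambda>z. D z * \<psi>0 (snd z))"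
    by (rule integrable_mult_bounded[OF D m0]) (rule B0)
  define C where "C x = (LBINT y. D (x, y) * \<psi>0 y)" for x
  have Ci: "integrable lborel C"
    using integrable_slice1[OF D0] by (simp add: C_def[abs_def])
  then have Cm [measurable]: "C \<in> Borel_fun" by auto
  have QC: "integrable lborel (\<lambda>z. (indicator {a<..<b} (fst z) * C (fst z)) * indicator {c<..<d} (snd z))"
    using cd by (intro integrable_tensor[OF integrable_indicator_mult[OF Ci] integrable_real_indicator]) auto
  define E where "E z = D z - (indicator {a<..<b} (fst z) * C (fst z)) * indicator {c<..<d} (snd z)" for z
  have Ei: "integrable lborel E" unfolding E_def[abs_def] using D QC by simp
  then have [measurable]: "E \<in> Borel_fun" by auto
  have QB: "?Q \<in> sets borel" by (intro borel_open open_Times) auto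
  have rep: "borel_rep ?Q E (\<lambda>z. indicator ?Q z *\<^sub>R E z)"
    by (rule borel_rep_restrict[OF borel_rep_self[of E UNIV] _ QB]) auto
  have iE: "integrable lborel (\<lambda>z. indicator ?Q z *\<^sub>R E z)"
    using integrable_mult_indicator[OF _ Ei] QB by simp
  have ortE: "(LBINT z. E z * (\<kappa> (fst z) * \<psi> (snd z))) = 0"
    if \<kappa>: "\<kappa> \<in> test_functions {a<..<b}" and \<psi>: "\<And>k. Ck k \<psi>" "c < c1" "c1 \<le> d1" "d1 < d" "\<And>t. \<psi> t \<noteq> 0 \<Longrightarrow> t \<in> {c1..d1}"
      "integrable lborel \<psi>" for \<kappa> \<psi> c1 d1
  proof -
    obtain B1 where B1: "\<And>t. \<bar>\<psi> t\<bar> \<le> B1" using Ck_bump_bounded[OF \<psi>(1,5)] by blast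
    obtain B2 where B2: "\<And>t. \<bar>\<kappa> t\<bar> \<le> B2" using test_bounded[OF \<kappa>] by metis
    have [measurable]: "\<psi> \<in> Borel_fun" "\<kappa> \<in> Borel_fun"
      using \<psi>(6) test_borel[OF \<kappa>] by auto
    define m where "m = (LBINT t. \<psi> t)"
    define h where "h t = \<psi> t + (- m) * \<psi>0 t" for t
    have "\<exists>\<theta>. \<theta> \<in> test_functions {c<..<d} \<and> (\<forall>t. deriv_at \<theta> t 1 = h t)"
    proof (rule antiderivative_is_test[of h "min c0 c1" "max d0 d1" c d])
      show "Ck k h" for k unfolding h_def[abs_def] by (intro Ck_add Ck_mult Ck_const \<psi> \<psi>0)
      show "(LBINT t. h t) = 0" unfolding h_def using \<psi>(6) \<psi>0(6,7) by (simp add: m_def)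
      show "t \<in> {min c0 c1..max d0 d1}" if "h t \<noteq> 0" for t
        using that \<psi>(5)[of t] \<psi>0(5)[of t] by (cases "\<psi> t = 0") (auto simp: h_def)
    qed (use \<psi> \<psi>0 in auto)
    then obtain \<theta> where \<theta>: "\<theta> \<in> test_functions {c<..<d}" "\<And>t. deriv_at \<theta> t 1 = h t" by blast
    have mk: "(\<lambda>z::real \<times> real. \<kappa> (fst z)) \<in> Borel_fun"
      "(\<lambda>z::real \<times> real. \<psi> (snd z)) \<in> Borel_fun"
      by measurable
    have i1: "integrable lborel (\<lambda>z. D z * \<kappa> (fst z) * \<psi> (snd z))"
      by (rule integrable_mult_bounded[OF integrable_mult_bounded[OF D mk(1)] mk(2)]) (rule B2, rule B1)
    have i2: "integrable lborel (\<lambda>z. D z * \<kappa> (fst z) * \<psi>0 (snd z))"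
      by (rule integrable_mult_bounded[OF integrable_mult_bounded[OF D mk(1)] m0]) (rule B2, rule B0)
    have "(LBINT z. D z * \<kappa> (fst z) * \<psi> (snd z)) - m * (LBINT z. D z * \<kappa> (fst z) * \<psi>0 (snd z)) =
        (LBINT z. D z * \<kappa> (fst z) * \<psi> (snd z) - m * (D z * \<kappa> (fst z) * \<psi>0 (snd z)))"
      using integral_difference[OF i1 integrable_mult_right[OF i2, of m]] by simp
    also have "\<dots> = (LBINT z. D z * (\<kappa> (fst z) * h (snd z)))"
      by (rule Bochner_Integration.integral_cong) (auto simp: h_def algebra_simps)
    also have "\<dots> = 0" using ort[OF \<kappa> \<theta>(1)] by (simp add: \<theta>(2))
    finally have 1: "(LBINT z. D z * \<kappa> (fst z) * \<psi> (snd z)) = m * (LBINT z. D z * \<kappa> (fst z) * \<psi>0 (snd z))"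
      by simp
    have 2: "(LBINT z. D z * \<kappa> (fst z) * \<psi>0 (snd z)) = (LBINT x. \<kappa> x * C x)"
    proof -
      have "(LBINT y. D (x, y) * \<kappa> x * \<psi>0 y) = \<kappa> x * C x" for x
      proof -
        have "(\<lambda>y. D (x, y) * \<kappa> x * \<psi>0 y) = (\<lambda>y. \<kappa> x * (D (x, y) * \<psi>0 y))" by auto
        then show ?thesis by (simp add: C_def)
      qed
      then show ?thesis using iterated_integral1[OF i2] by simp
    qed
    have i3: "integrable lborel (\<lambda>z. (\<kappa> (fst z) * C (fst z)) * \<psi> (snd z))"
    proof (rule integrable_tensor[OF _ \<psi>(6)])
      show "integrable lborel (\<lambda>x. \<kappa> x * C x)"
        using integrable_mult_bounded[OF Ci, of \<kappa> B2] B2 by (simp add: mult.commute)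
    qed
    have 3: "(LBINT z. (\<kappa> (fst z) * C (fst z)) * \<psi> (snd z)) = m * (LBINT x. \<kappa> x * C x)"
      using iterated_integral1[OF i3] by (simp add: m_def mult.commute)
    have "E z * (\<kappa> (fst z) * \<psi> (snd z)) = D z * \<kappa> (fst z) * \<psi> (snd z) - (\<kappa> (fst z) * C (fst z)) * \<psi> (snd z)" for z
    proof -
      have "\<kappa> (fst z) = 0" if "fst z \<notin> {a<..<b}" using test_zero[OF \<kappa> that] .
      moreover have "\<psi> (snd z) = 0" if "snd z \<notin> {c<..<d}"
        using \<psi>(2,4) \<psi>(5)[of "snd z"] that by (cases "\<psi> (snd z) = 0") auto
      ultimately show ?thesis
        by (cases "fst z \<in> {a<..<b}"; cases "snd z \<in> {c<..<d}") (auto simp: E_def algebra_simps)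
    qed
    then have "(LBINT z. E z * (\<kappa> (fst z) * \<psi> (snd z))) =
        (LBINT z. D z * \<kappa> (fst z) * \<psi> (snd z)) - (LBINT z. (\<kappa> (fst z) * C (fst z)) * \<psi> (snd z))"
      using i1 i3 by simp
    then show ?thesis using 1 2 3 by simp
  qed
  have "AE z in lebesgue_on ?Q. E z = 0"
  proof (rule AE_zero_if_orthogonal_to_bumps)
    show "open ?Q" by (intro open_Times) auto
    show "locally_integrable ?Q E" by (rule locally_integrable_rep[OF QB rep iE])
    fix l u :: "real \<times> real" and n assume lu: "cbox l u \<subseteq> ?Q"
    obtain a1 c1 b1 d1 where lu': "l = (a1, c1)" "u = (b1, d1)" by (cases l; cases u) auto
    let ?\<kappa> = "interval_bump a1 b1 n" and ?\<psi> = "interval_bump c1 d1 n"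
    have bb: "box_bump l u n z = ?\<kappa> (fst z) * ?\<psi> (snd z)" for z
      using box_bump_real_pair[of a1 c1 b1 d1 n "fst z" "snd z"] by (simp add: lu')
    have rbb: "borel_rep ?Q (\<lambda>z. E z * box_bump l u n z) (\<lambda>z. indicator ?Q z *\<^sub>R E z * box_bump l u n z)"
      by (rule borel_rep_times_borel[OF rep]) (rule test_borel[OF box_bump_test[of l u UNIV]], simp)
    have "(LINT z|lebesgue_on ?Q. E z * box_bump l u n z) = (LBINT z. indicator ?Q z *\<^sub>R E z * box_bump l u n z)"
      by (rule borel_rep_integral(2)[OF QB rbb])
    also have "\<dots> = 0"
    proof (cases "a1 \<le> b1 \<and> c1 \<le> d1")
      case True
      then have mem: "(a1, c1) \<in> cbox l u" "(b1, d1) \<in> cbox l u" by (auto simp: lu' cbox_Pair_eq)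
      then have ineq: "a < a1" "b1 < b" "c < c1" "d1 < d" using lu by auto
      have \<kappa>: "?\<kappa> \<in> test_functions {a<..<b}" using ineq by (intro interval_bump_test) auto
      have \<psi>: "?\<psi> \<in> test_functions {c<..<d}" using ineq by (intro interval_bump_test) auto
      have supp: "t \<in> {c1..d1}" if "?\<psi> t \<noteq> 0" for t
      proof -
        have "0 < 1 / real (Suc n)" by simp
        then show ?thesis using interval_bump_support[OF that] unfolding atLeastAtMost_iff by linarith
      qed
      have "integrable lborel ?\<psi>"
      proof -
        have "integrable lborel (\<lambda>x. indicator {c1..d1} x *\<^sub>R ?\<psi> x)"
          using test_continuous[OF \<psi>] by (intro borel_integrable_compact) auto
        moreover have "indicator {c1..d1} x *\<^sub>R ?\<psi> x = ?\<psi> x" for x using supp[of x] by (auto simp: indicator_def)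
        ultimately show ?thesis by (simp only:)
      qed
      then have "(LBINT z. E z * (?\<kappa> (fst z) * ?\<psi> (snd z))) = 0"
        using ineq True supp by (intro ortE[OF \<kappa>, of _ c1 d1] Ck_interval_bump) auto
      moreover have "indicator ?Q z *\<^sub>R E z * box_bump l u n z = E z * (?\<kappa> (fst z) * ?\<psi> (snd z))" for z
        using test_zero[OF box_bump_test[of l u ?Q n], of z] box_subset_cbox[of l u] lu
        unfolding bb[symmetric] by (cases "z \<in> ?Q") auto
      ultimately show ?thesis by (simp only:)
    next
      case False
      have "box_bump l u n z = 0" for z
      proof (rule ccontr)
        assume "box_bump l u n z \<noteq> 0"
        then have "?\<kappa> (fst z) \<noteq> 0" "?\<psi> (snd z) \<noteq> 0" by (auto simp: bb)
        moreover have "0 < 1 / real (Suc n)" by simp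
        ultimately have "a1 \<le> b1" "c1 \<le> d1"
          using interval_bump_support[of a1 b1 n "fst z"] interval_bump_support[of c1 d1 n "snd z"] by linarith+
        then show False using False by simp
      qed
      then show ?thesis by simp
    qed
    finally show "(LINT z|lebesgue_on ?Q. E z * box_bump l u n z) = 0" .
  qed
  then have "AE z in lborel. z \<in> ?Q \<longrightarrow> E z = 0" by (rule iffD1[OF AE_lebesgue_on[OF QB]])
  then have "AE z in lborel. z \<in> ?Q \<longrightarrow> D z = C (fst z)"
    by (auto elim!: eventually_mono simp: E_def)
  then show ?thesis using Cm by blast
qed

lemma slice_borel:
  fixes F :: "'a::euclidean_space \<times> 'b::euclidean_space \<Rightarrow> 'c::euclidean_space"
  assumes "F \<in> Borel_fun"
  shows "(\<lambda>y. F (x, y)) \<in> Borel_fun"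
proof -
  have "(\<lambda>y::'b. (x, y)) \<in> Borel_fun"
    by (auto intro!: borel_measurable_continuous_onI continuous_intros)
  from measurable_compose[OF this assms] show ?thesis .
qed

lemma AE_lborel_fst:
  assumes "AE x in (lborel :: 'a::euclidean_space measure). P x"
  shows "AE z in (lborel :: ('a \<times> 'b::euclidean_space) measure). P (fst z)"
proof -
  obtain N where N: "N \<in> null_sets lborel" "{x \<in> space lborel. \<not> P x} \<subseteq> N"
    using assms by (auto simp: eventually_ae_filter)
  have "N \<times> (UNIV :: 'b set) \<in> null_sets (lborel \<Otimes>\<^sub>M lborel)"
    using lborel.times_in_null_sets1[OF N(1), of "UNIV :: 'b set"] by simp
  then have "N \<times> (UNIV :: 'b set) \<in> null_sets (lborel :: ('a \<times> 'b) measure)"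
    by (simp only: lborel_prod)
  then show ?thesis
    by (rule AE_I') (use N(2) in auto)
qed

lemma AE_lborel_ex_interval:
  fixes a b :: real
  assumes "AE x in lborel. P x" "a < b"
  shows "\<exists>x. a < x \<and> x < b \<and> P x"
proof (rule ccontr)
  assume "\<not> ?thesis"
  then have "AE x in lborel. x \<notin> {a<..<b}"
    using assms(1) by (auto elim!: eventually_mono)
  then have "emeasure lborel {a<..<b} = 0"
    by (subst (asm) AE_iff_measurable[of "{a<..<b}"]) auto
  then show False using assms(2) by simp
qed

lemma constant_if_weakly_constant:
  fixes D :: "real \<Rightarrow> real"
  assumes D: "integrable lborel D" and ab: "a < b"
    and ort: "\<And>\<psi>. \<psi> \<in> test_functions {a<..<b} \<Longrightarrow>
      (LBINT y. D y * deriv_at \<psi> y 1) = 0"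
  shows "\<exists>c. AE y in lborel. y \<in> {a<..<b} \<longrightarrow> D y = c"
proof -
  let ?I = "indicator {0<..<1} :: real \<Rightarrow> real"
  have I: "integrable lborel ?I" by simp
  define D2 where "D2 z = ?I (fst z) * D (snd z)" for z
  have D2: "integrable lborel D2"
    unfolding D2_def[abs_def] by (rule integrable_tensor[OF I D])
  have "\<exists>C\<in>Borel_fun. AE z in lborel. z \<in> {0<..<1} \<times> {a<..<b} \<longrightarrow> D2 z = C (fst z)"
  proof (rule constant_in_second_variable[OF D2 ab])
    fix \<kappa> \<psi> :: "real \<Rightarrow> real" assume \<kappa>: "\<kappa> \<in> test_functions {0<..<1}" and \<psi>: "\<psi> \<in> test_functions {a<..<b}"
    have i: "integrable lborel (\<lambda>z. (?I (fst z) * \<kappa> (fst z)) * (D (snd z) * deriv_at \<psi> (snd z) 1))"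
      using test_integrable(1)[OF I \<kappa>] test_integrable(2)[OF D \<psi>, of 1]
      by (intro integrable_tensor[of "\<lambda>x. ?I x * \<kappa> x" "\<lambda>y. D y * deriv_at \<psi> y 1"]) auto
    have "D2 z * (\<kappa> (fst z) * deriv_at \<psi> (snd z) 1) =
      (?I (fst z) * \<kappa> (fst z)) * (D (snd z) * deriv_at \<psi> (snd z) 1)" for z
      by (simp only: D2_def mult_ac)
    then have "(LBINT z. D2 z * (\<kappa> (fst z) * deriv_at \<psi> (snd z) 1)) =
      (LBINT z. (?I (fst z) * \<kappa> (fst z)) * (D (snd z) * deriv_at \<psi> (snd z) 1))"
      by (simp only:)
    then show "(LBINT z. D2 z * (\<kappa> (fst z) * deriv_at \<psi> (snd z) 1)) = 0"
      using iterated_integral1[OF i] ort[OF \<psi>] by simp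
  qed
  then obtain C where "AE z in lborel. z \<in> {0<..<1} \<times> {a<..<b} \<longrightarrow> D2 z = C (fst z)" by blast
  from AE_lborel_ex_interval[OF AE_lborel_pair[OF this], of 0 1]
  obtain x where "0 < x" "x < 1" "AE y in lborel. (x, y) \<in> {0<..<1} \<times> {a<..<b} \<longrightarrow> D2 (x, y) = C x" by auto
  then have "AE y in lborel. y \<in> {a<..<b} \<longrightarrow> D y = C x"
    by (auto elim!: eventually_mono simp: D2_def)
  then show ?thesis by blast
qed

lemma integrable_indicator_primitive:
  assumes "integrable lborel w" "A \<in> sets borel" "emeasure lborel A < \<infinity>"
  shows "integrable lborel (\<lambda>x. indicator A x * primitive w x)"
proof (rule integrable_mult_bounded)
  show "integrable lborel (indicator A :: real \<Rightarrow> real)" using assms by simp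
  show "primitive w \<in> Borel_fun" using assms(1) by simp
  have "primitive w (-1) = 0" by (simp add: primitive_def)
  then show "\<bar>primitive w x\<bar> \<le> (LBINT t. \<bar>w t\<bar>)" for x
    using primitive_diff_le_total[OF assms(1), of x "-1"] by simp
qed

text \<open>The difference between a Sobolev function and a primitive of its weak derivative has weak derivative
  zero. The continuous representative that this gives is what makes the limit solution and the
  fibre means equicontinuous later.\<close>

lemma sobolev_interval_primitive:
  assumes S: "sobolev_rep p {0<..<1} F H"
  shows "\<exists>c. AE x in lborel. x \<in> {0<..<1} \<longrightarrow> F x = c + primitive H x"
proof -
  note S' = S[unfolded sobolev_rep_def]
  have F: "integrable lborel F" and H: "integrable lborel H" using S' by auto
  define D where "D x = F x - indicator {0<..<1} x * primitive H x" for x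
  have iP: "integrable lborel (\<lambda>x. indicator {0<..<1} x * primitive H x)"
    by (rule integrable_indicator_primitive[OF H]) auto
  have "\<exists>c. AE x in lborel. x \<in> {0<..<1} \<longrightarrow> D x = c"
  proof (rule constant_if_weakly_constant)
    show "integrable lborel D" unfolding D_def[abs_def] using F iP by simp
    fix \<psi> :: "real \<Rightarrow> real" assume \<psi>: "\<psi> \<in> test_functions {0<..<1}"
    let ?\<psi>' = "\<lambda>y. deriv_at \<psi> y 1"
    note parts = primitive_by_parts[OF H test_slice_real[OF \<psi>]]
    have "(LBINT x. D x * ?\<psi>' x) = (LBINT x. F x * ?\<psi>' x - primitive H x * ?\<psi>' x)"
    proof (rule Bochner_Integration.integral_cong[OF refl])
      show "D x * ?\<psi>' x = F x * ?\<psi>' x - primitive H x * ?\<psi>' x" for x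
        using test_partial_zero[OF \<psi>, of 1 x] by (cases "x \<in> {0<..<1}") (auto simp: D_def algebra_simps)
    qed
    also have "\<dots> = (LBINT x. F x * ?\<psi>' x) - (LBINT x. primitive H x * ?\<psi>' x)"
      using test_integrable(2)[OF F \<psi>, of 1] parts(2) by simp
    also have "(LBINT x. F x * ?\<psi>' x) = - (LBINT x. H x * \<psi> x)"
      using S' \<psi> by auto
    finally show "(LBINT x. D x * ?\<psi>' x) = 0" using parts(1) by simp
  qed auto
  then obtain c where "AE x in lborel. x \<in> {0<..<1} \<longrightarrow> D x = c" by blast
  then have "AE x in lborel. x \<in> {0<..<1} \<longrightarrow> F x = c + primitive H x"
    by eventually_elim (auto simp: D_def)
  then show ?thesis by blast
qed

text \<open>The one-dimensional argument with the first variable as a parameter: tensor products are used as test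
  functions, and the integration by parts happens on almost every vertical line.\<close>

lemma sobolev_vertical_primitive:
  fixes F :: "real \<times> real \<Rightarrow> real"
  assumes S: "sobolev_rep p U F H" and h: "0 < h" and Q: "{a<..<b} \<times> {0<..<h} \<subseteq> U"
  shows "\<exists>C\<in>Borel_fun. AE z in lborel. z \<in> {a<..<b} \<times> {0<..<h} \<longrightarrow>
    F z = C (fst z) + primitive (\<lambda>t. snd (H (fst z, t))) (snd z)"
proof -
  let ?Q = "{a<..<b} \<times> {0<..<h}"
  note S' = S[unfolded sobolev_rep_def]
  have QB: "?Q \<in> sets borel" by (intro borel_open open_Times) auto
  define w where "w z = snd (H z)" for z
  define P where "P z = primitive (\<lambda>t. w (fst z, t)) (snd z)" for z
  have F: "integrable lborel F" and H: "integrable lborel H" using S' by auto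
  have w: "integrable lborel w"
    unfolding w_def[abs_def] by (rule integrable_bounded_linear[OF bounded_linear_snd H])
  then have wm [measurable]: "w \<in> Borel_fun" by auto
  have Pm [measurable]: "P \<in> Borel_fun"
    unfolding P_def[abs_def] by (rule primitive_parametric_measurable) simp
  have slice: "AE x in lborel. integrable lborel (\<lambda>t. w (x, t))" by (rule AE_integrable_slice1[OF w])
  define N where "N x = (LBINT t. \<bar>w (x, t)\<bar>)" for x
  have Ni: "integrable lborel N" unfolding N_def[abs_def] using integrable_slice1[OF integrable_abs[OF w]] .
  have iP: "integrable lborel (\<lambda>z. indicator ?Q z * P z)"
  proof (rule integrable_dominated)
    show "integrable lborel (\<lambda>z. N (fst z) * indicator {0<..<h} (snd z))"
      using h by (intro integrable_tensor[OF Ni]) simp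
    show "(\<lambda>z. indicator ?Q z * P z) \<in> borel_measurable lborel" using QB by simp
    have "AE z in lborel. integrable lborel (\<lambda>t. w (fst z, t))" by (rule AE_lborel_fst[OF slice])
    then show "AE z in lborel. norm (indicator ?Q z * P z) \<le> norm (N (fst z) * indicator {0<..<h} (snd z) :: real)"
    proof eventually_elim
      case (elim z)
      have "primitive (\<lambda>t. w (fst z, t)) (-1) = 0" by (simp add: primitive_def)
      then have "\<bar>P z\<bar> \<le> N (fst z)"
        using primitive_diff_le_total[OF elim, of "snd z" "-1"] by (simp add: P_def N_def)
      then show ?case by (cases z) (auto simp: indicator_def)
    qed
  qed
  define D where "D z = F z - indicator ?Q z * P z" for z
  have "\<exists>C\<in>Borel_fun. AE z in lborel. z \<in> ?Q \<longrightarrow> D z = C (fst z)"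
  proof (rule constant_in_second_variable)
    show Di: "integrable lborel D" unfolding D_def[abs_def] using F iP by simp
    show "0 < h" by (rule h)
    fix \<kappa> \<psi> :: "real \<Rightarrow> real" assume \<kappa>: "\<kappa> \<in> test_functions {a<..<b}" and \<psi>: "\<psi> \<in> test_functions {0<..<h}"
    let ?\<psi>' = "\<lambda>y. deriv_at \<psi> y 1"
    let ?\<phi> = "\<lambda>z. \<kappa> (fst z) * \<psi> (snd z)"
    have \<phi>Q: "?\<phi> \<in> test_functions ?Q" by (rule tensor_test[OF \<kappa> \<psi>])
    then have \<phi>: "?\<phi> \<in> test_functions U" using test_functions_mono[OF Q] by blast
    have e2: "(0, 1) \<in> (Basis :: (real \<times> real) set)" by (simp add: Basis_prod_def)
    have part: "deriv_at ?\<phi> z (0, 1) = \<kappa> (fst z) * ?\<psi>' (snd z)" for z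
      by (rule tensor_test_partials(2)[OF \<kappa> \<psi>])
    have "(LBINT z. F z * deriv_at ?\<phi> z (0, 1)) = - (LBINT z. (H z \<bullet> (0, 1)) * ?\<phi> z)"
      using S' \<phi> e2 by blast
    then have 1: "(LBINT z. F z * (\<kappa> (fst z) * ?\<psi>' (snd z))) = - (LBINT z. w z * ?\<phi> z)"
      unfolding part by (simp add: w_def inner_prod_def)
    have iF: "integrable lborel (\<lambda>z. F z * (\<kappa> (fst z) * ?\<psi>' (snd z)))"
      using test_integrable(2)[OF F \<phi> e2] unfolding part .
    have iPP: "integrable lborel (\<lambda>z. indicator ?Q z * P z * (\<kappa> (fst z) * ?\<psi>' (snd z)))"
      using test_integrable(2)[OF iP \<phi> e2] unfolding part .
    have iw: "integrable lborel (\<lambda>z. w z * ?\<phi> z)" by (rule test_integrable(1)[OF w \<phi>])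
    have "(LBINT z. indicator ?Q z * P z * (\<kappa> (fst z) * ?\<psi>' (snd z))) =
        (LBINT x. LBINT y. indicator ?Q (x, y) * P (x, y) * (\<kappa> x * ?\<psi>' y))"
      using iterated_integral1[OF iPP] by simp
    also have "\<dots> = (LBINT x. - (LBINT y. w (x, y) * (\<kappa> x * \<psi> y)))"
    proof (rule integral_cong_AE)
      show "(\<lambda>x. LBINT y. indicator ?Q (x, y) * P (x, y) * (\<kappa> x * ?\<psi>' y)) \<in> borel_measurable lborel"
        using integrable_slice1[OF iPP] by auto
      show "(\<lambda>x. - (LBINT y. w (x, y) * (\<kappa> x * \<psi> y))) \<in> borel_measurable lborel"
        using integrable_slice1[OF iw] by auto
      show "AE x in lborel. (LBINT y. indicator ?Q (x, y) * P (x, y) * (\<kappa> x * ?\<psi>' y)) =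
          - (LBINT y. w (x, y) * (\<kappa> x * \<psi> y))"
        using slice
      proof eventually_elim
        case (elim x)
        have "(LBINT y. indicator ?Q (x, y) * P (x, y) * (\<kappa> x * ?\<psi>' y)) =
            (LBINT y. \<kappa> x * (primitive (\<lambda>t. w (x, t)) y * ?\<psi>' y))"
        proof (rule Bochner_Integration.integral_cong[OF refl])
          fix y
          have "\<kappa> x = 0" if "x \<notin> {a<..<b}" by (rule test_zero[OF \<kappa> that])
          moreover have "?\<psi>' y = 0" if "y \<notin> {0<..<h}" by (rule test_partial_zero[OF \<psi> _ that]) simp
          ultimately show "indicator ?Q (x, y) * P (x, y) * (\<kappa> x * ?\<psi>' y) = \<kappa> x * (primitive (\<lambda>t. w (x, t)) y * ?\<psi>' y)"
            by (cases "x \<in> {a<..<b}"; cases "y \<in> {0<..<h}") (simp_all add: P_def)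
        qed
        also have "\<dots> = \<kappa> x * - (LBINT t. w (x, t) * \<psi> t)"
          using primitive_by_parts(1)[OF elim test_slice_real[OF \<psi>]] by simp
        also have "\<dots> = - (LBINT y. \<kappa> x * (w (x, y) * \<psi> y))" by simp
        also have "\<dots> = - (LBINT y. w (x, y) * (\<kappa> x * \<psi> y))" by (simp only: mult.left_commute)
        finally show ?case .
      qed
    qed
    also have "\<dots> = - (LBINT z. w z * ?\<phi> z)"
      using iterated_integral1[OF iw] by simp
    finally have 2: "(LBINT z. indicator ?Q z * P z * (\<kappa> (fst z) * ?\<psi>' (snd z))) = - (LBINT z. w z * ?\<phi> z)" .
    have "(LBINT z. D z * (\<kappa> (fst z) * ?\<psi>' (snd z))) =
        (LBINT z. F z * (\<kappa> (fst z) * ?\<psi>' (snd z)) - indicator ?Q z * P z * (\<kappa> (fst z) * ?\<psi>' (snd z)))"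
      by (rule Bochner_Integration.integral_cong) (auto simp: D_def left_diff_distrib)
    also have "\<dots> = 0" using integral_difference[OF iF iPP] 1 2 by simp
    finally show "(LBINT z. D z * (\<kappa> (fst z) * ?\<psi>' (snd z))) = 0" .
  qed
  then obtain C where C: "C \<in> Borel_fun" "AE z in lborel. z \<in> ?Q \<longrightarrow> D z = C (fst z)" by blast
  have "AE z in lborel. z \<in> ?Q \<longrightarrow> F z = C (fst z) + primitive (\<lambda>t. snd (H (fst z, t))) (snd z)"
    using C(2) by eventually_elim (auto simp: D_def P_def w_def)
  then show ?thesis using C(1) by blast
qed

section \<open>Domains below a graph\<close>

definition subgraph :: "(real \<Rightarrow> real) \<Rightarrow> (real \<times> real) set" where
  "subgraph \<gamma> = {(x, y). 0 < x \<and> x < 1 \<and> 0 < y \<and> y < \<gamma> x}"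

definition lower_mean :: "real \<Rightarrow> (real \<times> real \<Rightarrow> real) \<Rightarrow> real \<Rightarrow> real" where
  "lower_mean h F x = (1 / h) * (LBINT y. indicator {0<..<h} y * F (x, y))"

text \<open>Countably many rectangles standing on the bottom side exhaust the domain, all at least as
  high as the common lower strip; on each of them the function is a primitive in the vertical
  variable, up to a function of \<open>x\<close> that cancels against the mean over the strip.\<close>

lemma vertical_oscillation:
  assumes S: "sobolev_rep p (subgraph \<gamma>) F H" and op: "open (subgraph \<gamma>)"
    and h: "0 < h" "\<And>x. h \<le> \<gamma> x"
  shows "AE x in lborel. AE y in lborel. (x, y) \<in> subgraph \<gamma> \<longrightarrow>
    \<bar>F (x, y) - lower_mean h F x\<bar> \<le> (LBINT t. \<bar>snd (H (x, t))\<bar>)"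
proof -
  note S' = S[unfolded sobolev_rep_def]
  define w where "w z = snd (H z)" for z
  have F: "integrable lborel F" and H: "integrable lborel H" using S' by auto
  have w: "integrable lborel w"
    unfolding w_def[abs_def] by (rule integrable_bounded_linear[OF bounded_linear_snd H])
  have Fm: "F \<in> Borel_fun" using F by auto
  have slice: "AE x in lborel. integrable lborel (\<lambda>t. w (x, t))" by (rule AE_integrable_slice1[OF w])
  \<comment> \<open>The height \<open>h\<close> may be irrational, so it is admitted beside the rational heights.\<close>
  define R where "R = {(a, b, k). a \<in> \<rat> \<and> b \<in> \<rat> \<and> k \<in> insert h \<rat> \<and> h \<le> k \<and> {a<..<b} \<times> {0<..<k} \<subseteq> subgraph \<gamma>}"
  have "R \<subseteq> \<rat> \<times> \<rat> \<times> insert h \<rat>" by (auto simp: R_def)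
  moreover have "countable (\<rat> \<times> \<rat> \<times> insert h \<rat>)" by (intro countable_SIGMA countable_rat countable_insert)
  ultimately have "countable R" using countable_subset by blast
  have main: "AE x in lborel. x \<in> {a<..<b} \<longrightarrow> (AE y in lborel. y \<in> {0<..<k} \<longrightarrow>
      \<bar>F (x, y) - lower_mean h F x\<bar> \<le> (LBINT t. \<bar>w (x, t)\<bar>))" if abk: "(a, b, k) \<in> R" for a b k
  proof -
    have k: "0 < k" "h \<le> k" "{a<..<b} \<times> {0<..<k} \<subseteq> subgraph \<gamma>" using abk h by (auto simp: R_def)
    obtain C where C: "AE z in lborel. z \<in> {a<..<b} \<times> {0<..<k} \<longrightarrow>
        F z = C (fst z) + primitive (\<lambda>t. w (fst z, t)) (snd z)"
      using sobolev_vertical_primitive[OF S k(1,3)] unfolding w_def by blast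
    show ?thesis
      using slice AE_lborel_pair[OF C]
    proof eventually_elim
      case (elim x)
      show ?case
      proof
        assume x: "x \<in> {a<..<b}"
        let ?v = "primitive (\<lambda>t. w (x, t))" and ?N = "LBINT t. \<bar>w (x, t)\<bar>"
        have ae: "AE y in lborel. y \<in> {0<..<k} \<longrightarrow> F (x, y) = C x + ?v y"
          using elim(2) by eventually_elim (use x in auto)
        have iI: "integrable lborel (indicator {0<..<h} :: real \<Rightarrow> real)" using h(1) by simp
        have iv: "integrable lborel (\<lambda>y. indicator {0<..<h} y * ?v y)"
          using h(1) by (intro integrable_indicator_primitive[OF elim(1)]) auto
        have vm: "?v \<in> Borel_fun" using elim(1) by simp
        have "(LBINT y. indicator {0<..<h} y * F (x, y)) =
            (LBINT y. indicator {0<..<h} y * C x + indicator {0<..<h} y * ?v y)"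
        proof (rule integral_cong_AE)
          show "(\<lambda>y. indicator {0<..<h} y * F (x, y)) \<in> borel_measurable lborel"
            using slice_borel[OF Fm, of x] by simp
          show "(\<lambda>y. indicator {0<..<h} y * C x + indicator {0<..<h} y * ?v y) \<in> borel_measurable lborel"
            using vm by simp
          show "AE y in lborel. indicator {0<..<h} y * F (x, y) = indicator {0<..<h} y * C x + indicator {0<..<h} y * ?v y"
            using ae by eventually_elim (use k(2) in \<open>auto simp: indicator_def\<close>)
        qed
        also have "\<dots> = h * C x + (LBINT y. indicator {0<..<h} y * ?v y)"
          using Bochner_Integration.integral_add[OF integrable_mult_left[OF iI, of "C x"] iv] h(1) by simp
        finally have mean: "lower_mean h F x = C x + (1 / h) * (LBINT y. indicator {0<..<h} y * ?v y)"
          using h(1) by (simp add: lower_mean_def field_simps)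
        have bound: "\<bar>?v y - (1 / h) * (LBINT s. indicator {0<..<h} s * ?v s)\<bar> \<le> ?N" for y
        proof -
          have "(LBINT s. indicator {0<..<h} s * ?v y - indicator {0<..<h} s * ?v s) =
              h * ?v y - (LBINT s. indicator {0<..<h} s * ?v s)"
            using integral_difference[OF integrable_mult_left[OF iI, of "?v y"] iv] h(1) by simp
          moreover have "\<bar>LBINT s. indicator {0<..<h} s * ?v y - indicator {0<..<h} s * ?v s\<bar> \<le>
              (LBINT s. indicator {0<..<h} s * ?N)"
          proof (rule order_trans[OF integral_abs_bound], rule integral_mono)
            show "integrable lborel (\<lambda>s. \<bar>indicator {0<..<h} s * ?v y - indicator {0<..<h} s * ?v s\<bar>)"
              by (intro integrable_abs Bochner_Integration.integrable_diff integrable_mult_left[OF iI] iv)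
            show "integrable lborel (\<lambda>s. indicator {0<..<h} s * ?N)" by (rule integrable_mult_left[OF iI])
            show "\<bar>indicator {0<..<h} s * ?v y - indicator {0<..<h} s * ?v s\<bar> \<le> indicator {0<..<h} s * ?N" for s
              using primitive_diff_le_total[OF elim(1), of y s] by (auto simp: indicator_def)
          qed
          ultimately have "\<bar>h * ?v y - (LBINT s. indicator {0<..<h} s * ?v s)\<bar> \<le> h * ?N"
            using h(1) by simp
          then have "\<bar>h * ?v y - (LBINT s. indicator {0<..<h} s * ?v s)\<bar> / h \<le> ?N"
            using h(1) by (simp add: field_simps)
          moreover have "\<bar>h * ?v y - (LBINT s. indicator {0<..<h} s * ?v s)\<bar> / h =
              \<bar>?v y - (1 / h) * (LBINT s. indicator {0<..<h} s * ?v s)\<bar>"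
          proof -
            have "\<bar>h * a - b\<bar> / h = \<bar>a - (1 / h) * b\<bar>" for a b :: real
              using h(1) by (simp add: abs_div_pos diff_divide_distrib)
            then show ?thesis .
          qed
          ultimately show ?thesis by simp
        qed
        show "AE y in lborel. y \<in> {0<..<k} \<longrightarrow> \<bar>F (x, y) - lower_mean h F x\<bar> \<le> ?N"
          using ae by eventually_elim (use bound in \<open>auto simp: mean\<close>)
      qed
    qed
  qed
  have "AE x in lborel. \<forall>r\<in>R. case r of (a, b, k) \<Rightarrow> x \<in> {a<..<b} \<longrightarrow> (AE y in lborel. y \<in> {0<..<k} \<longrightarrow>
      \<bar>F (x, y) - lower_mean h F x\<bar> \<le> (LBINT t. \<bar>w (x, t)\<bar>))"
    using \<open>countable R\<close> main by (subst AE_ball_countable) auto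
  then have "AE x in lborel. AE y in lborel. (x, y) \<in> subgraph \<gamma> \<longrightarrow>
    \<bar>F (x, y) - lower_mean h F x\<bar> \<le> (LBINT t. \<bar>w (x, t)\<bar>)"
  proof eventually_elim
    case (elim x)
    define Rx where "Rx = {r \<in> R. fst r < x \<and> x < fst (snd r)}"
    have "countable Rx" using \<open>countable R\<close> by (simp add: Rx_def)
    moreover have "AE y in lborel. y \<in> {0<..<snd (snd r)} \<longrightarrow>
        \<bar>F (x, y) - lower_mean h F x\<bar> \<le> (LBINT t. \<bar>w (x, t)\<bar>)" if "r \<in> Rx" for r
      using elim that by (cases r) (auto simp: Rx_def)
    ultimately have "AE y in lborel. \<forall>r\<in>Rx. y \<in> {0<..<snd (snd r)} \<longrightarrow>
        \<bar>F (x, y) - lower_mean h F x\<bar> \<le> (LBINT t. \<bar>w (x, t)\<bar>)"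
      by (subst AE_ball_countable) auto
    then show ?case
    proof eventually_elim
      case (elim y)
      have "\<exists>r\<in>Rx. y < snd (snd r)" if xy: "(x, y) \<in> subgraph \<gamma>"
      proof (cases "y < h")
        case True
        have "{0<..<1} \<times> {0<..<h} \<subseteq> subgraph \<gamma>" using h(2) by (auto simp: subgraph_def intro: less_le_trans)
        then have "(0, 1, h) \<in> Rx" using xy by (auto simp: Rx_def R_def subgraph_def)
        then show ?thesis using True by force
      next
        case False
        obtain k where k: "k \<in> \<rat>" "y < k" "k < \<gamma> x"
          using Rats_dense_in_real[of y "\<gamma> x"] xy by (auto simp: subgraph_def)
        have "(x, k) \<in> subgraph \<gamma>" using xy k by (auto simp: subgraph_def)
        then obtain A B where AB: "open A" "open B" "x \<in> A" "k \<in> B" "A \<times> B \<subseteq> subgraph \<gamma>"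
          using open_prod_elim[OF op] by (metis mem_Times_iff fst_conv snd_conv)
        then obtain e where e: "e > 0" "ball x e \<subseteq> A" using openE by blast
        obtain a where a: "a \<in> \<rat>" "x - e < a" "a < x" using Rats_dense_in_real[of "x - e" x] e by auto
        obtain b where b: "b \<in> \<rat>" "x < b" "b < x + e" using Rats_dense_in_real[of x "x + e"] e by auto
        have "{a<..<b} \<times> {0<..<k} \<subseteq> subgraph \<gamma>"
        proof
          fix z assume "z \<in> {a<..<b} \<times> {0<..<k}"
          then obtain s t where st: "z = (s, t)" "a < s" "s < b" "0 < t" "t < k" by auto
          have "s \<in> ball x e" using st a b by (auto simp: dist_real_def)
          then have "(s, k) \<in> subgraph \<gamma>" using e AB by blast
          then show "z \<in> subgraph \<gamma>" using st by (auto simp: subgraph_def)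
        qed
        then have "(a, b, k) \<in> Rx" using a b k False by (auto simp: Rx_def R_def)
        then show ?thesis using k by force
      qed
      then show ?case using elim by (auto simp: subgraph_def)
    qed
  qed
  then show ?thesis by (simp add: w_def)
qed

text \<open>Hoelder's inequality on each fibre, whose length is at most \<open>k\<close>.\<close>

lemma slice_integral_powr:
  fixes G :: "real \<times> real \<Rightarrow> real"
  assumes G [measurable]: "G \<in> Borel_fun" and z: "\<And>x y. y \<notin> {0<..<k} \<Longrightarrow> G (x, y) = 0"
    and k: "0 < k" and p: "1 < p" and i: "integrable lborel (\<lambda>z. \<bar>G z\<bar> powr p)"
  shows "integrable lborel (\<lambda>x. \<bar>LBINT y. G (x, y)\<bar> powr p)"
    and "(LBINT x. \<bar>LBINT y. G (x, y)\<bar> powr p) \<le> k powr (p - 1) * (LBINT z. \<bar>G z\<bar> powr p)"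
proof -
  have ae: "AE x in lborel. \<bar>LBINT y. G (x, y)\<bar> powr p \<le> k powr (p - 1) * (LBINT y. \<bar>G (x, y)\<bar> powr p)"
    using AE_integrable_slice1[OF i]
  proof eventually_elim
    case (elim x)
    have Gx: "(\<lambda>y. G (x, y)) \<in> Borel_fun" by (rule slice_borel[OF G])
    have e1: "indicator {0<..<k} y * \<bar>G (x, y)\<bar> powr p = \<bar>G (x, y)\<bar> powr p"
      and e2: "indicator {0<..<k} y * \<bar>G (x, y)\<bar> = \<bar>G (x, y)\<bar>" for y
      using z[of y x] by (cases "y \<in> {0<..<k}"; simp)+
    have "(LBINT y. indicator {0<..<k} y * \<bar>G (x, y)\<bar>) powr p \<le>
        measure lborel {0<..<k} powr (p - 1) * (LBINT y. indicator {0<..<k} y * \<bar>G (x, y)\<bar> powr p)"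
      using Gx k p elim by (intro powr_integral_le(2)) (auto simp only: e1 sets.sets_into_space, auto)
    then have "(LBINT y. \<bar>G (x, y)\<bar>) powr p \<le> k powr (p - 1) * (LBINT y. \<bar>G (x, y)\<bar> powr p)"
      using k unfolding e1 e2 by simp
    moreover have "\<bar>LBINT y. G (x, y)\<bar> powr p \<le> (LBINT y. \<bar>G (x, y)\<bar>) powr p"
      using p by (intro powr_mono2 integral_abs_bound) auto
    ultimately show ?case by linarith
  qed
  have int: "integrable lborel (\<lambda>x. k powr (p - 1) * (LBINT y. \<bar>G (x, y)\<bar> powr p))"
    using integrable_slice1[OF i] by simp
  have m: "(\<lambda>x. \<bar>LBINT y. G (x, y)\<bar> powr p) \<in> borel_measurable lborel"
  proof -
    have "G \<in> borel_measurable (lborel \<Otimes>\<^sub>M lborel)" by (simp add: lborel_prod)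
    then have "(\<lambda>x. LBINT y. G (x, y)) \<in> borel_measurable lborel"
      by (intro lborel.borel_measurable_lebesgue_integral) simp
    then show ?thesis by simp
  qed
  show 1: "integrable lborel (\<lambda>x. \<bar>LBINT y. G (x, y)\<bar> powr p)"
    by (rule integrable_dominated[OF int m]) (use ae in \<open>eventually_elim, auto\<close>)
  show "(LBINT x. \<bar>LBINT y. G (x, y)\<bar> powr p) \<le> k powr (p - 1) * (LBINT z. \<bar>G z\<bar> powr p)"
    using integral_mono_AE[OF 1 int ae] iterated_integral1[OF i] by simp
qed

lemma abs_fst_snd_le: "\<bar>fst z\<bar> \<le> norm z" "\<bar>snd z\<bar> \<le> norm z" for z :: "real \<times> real"
  using norm_fst_le[of "fst z" "snd z"] norm_snd_le[of "snd z" "fst z"] by auto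

lemma subgraph_zero:
  assumes "\<And>z. z \<notin> subgraph \<gamma> \<Longrightarrow> F z = 0" "\<And>x. \<gamma> x \<le> k" "y \<notin> {0<..<k}"
  shows "F (x, y) = 0"
proof -
  have "(x, y) \<notin> subgraph \<gamma>"
    using assms(2)[of x] assms(3) by (auto simp: subgraph_def dest: less_le_trans)
  then show ?thesis by (rule assms(1))
qed

lemma lower_strip_borel:
  fixes F :: "real \<times> real \<Rightarrow> real"
  assumes [measurable]: "F \<in> Borel_fun"
  shows "(\<lambda>z. indicator {0<..<h::real} (snd z) * F z) \<in> Borel_fun"
  by measurable

lemma lower_mean_powr:
  fixes F :: "real \<times> real \<Rightarrow> real"
  assumes F [measurable]: "F \<in> Borel_fun" and h: "0 < h" and p: "1 < p"
    and i: "integrable lborel (\<lambda>z. \<bar>F z\<bar> powr p)"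
  shows "lower_mean h F \<in> Borel_fun"
    and "integrable lborel (\<lambda>x. \<bar>lower_mean h F x\<bar> powr p)"
    and "h * (LBINT x. \<bar>lower_mean h F x\<bar> powr p) \<le> (LBINT z. \<bar>F z\<bar> powr p)"
proof -
  define G where "G z = indicator {0<..<h} (snd z) * F z" for z
  have Gm: "G \<in> Borel_fun" unfolding G_def[abs_def] by (rule lower_strip_borel[OF F])
  have Gz: "y \<notin> {0<..<h} \<Longrightarrow> G (x, y) = 0" for x y by (simp add: G_def)
  have Gp: "\<bar>G z\<bar> powr p = indicator {0<..<h} (snd z) * \<bar>F z\<bar> powr p" for z
    by (auto simp: G_def indicator_def)
  have Gi: "integrable lborel (\<lambda>z. \<bar>G z\<bar> powr p)"
    by (rule integrable_dominated[OF i]) (use Gm in \<open>auto intro!: AE_I2 simp: Gp indicator_def\<close>)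
  have GF: "(LBINT z. \<bar>G z\<bar> powr p) \<le> (LBINT z. \<bar>F z\<bar> powr p)"
    by (rule integral_mono[OF Gi i]) (auto simp: Gp indicator_def)
  have eq: "lower_mean h F x = (1 / h) * (LBINT y. G (x, y))" for x
    by (simp add: lower_mean_def G_def)
  have eqp: "\<bar>lower_mean h F x\<bar> powr p = (1 / h) powr p * \<bar>LBINT y. G (x, y)\<bar> powr p" for x
  proof -
    have "\<bar>1 / h\<bar> = 1 / h" using h by simp
    then show ?thesis by (simp only: eq abs_mult powr_mult)
  qed
  note J = slice_integral_powr[OF Gm Gz h p Gi]
  show "lower_mean h F \<in> Borel_fun"
  proof -
    have "G \<in> borel_measurable (lborel \<Otimes>\<^sub>M lborel)" using Gm by (simp add: lborel_prod)
    then have "(\<lambda>x. LBINT y. G (x, y)) \<in> borel_measurable lborel"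
      by (intro lborel.borel_measurable_lebesgue_integral) simp
    then show ?thesis unfolding eq[abs_def] by simp
  qed
  show "integrable lborel (\<lambda>x. \<bar>lower_mean h F x\<bar> powr p)"
    unfolding eqp using J(1) by simp
  have "h * (LBINT x. \<bar>lower_mean h F x\<bar> powr p) =
      h * ((1 / h) powr p * (LBINT x. \<bar>LBINT y. G (x, y)\<bar> powr p))"
    unfolding eqp by simp
  also have "\<dots> \<le> h * ((1 / h) powr p * (h powr (p - 1) * (LBINT z. \<bar>G z\<bar> powr p)))"
    using h J(2) by (intro mult_left_mono) auto
  also have "\<dots> = (h powr 1 * (1 / h) powr p * h powr (p - 1)) * (LBINT z. \<bar>G z\<bar> powr p)"
    using h by simp
  also have "h powr 1 * (1 / h) powr p * h powr (p - 1) = 1"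
  proof -
    have "(1 / h) powr p = h powr (- p)" using h by (simp add: powr_minus inverse_powr divide_inverse)
    then have "h powr 1 * (1 / h) powr p * h powr (p - 1) = h powr (1 + - p + (p - 1))"
      by (simp only: powr_add)
    then show ?thesis using h by simp
  qed
  finally show "h * (LBINT x. \<bar>lower_mean h F x\<bar> powr p) \<le> (LBINT z. \<bar>F z\<bar> powr p)"
    using GF by simp
qed

text \<open>On a fibre the deviation from the mean is bounded by the integral of the vertical derivative. Its power
  costs \<open>k powr (p - 1)\<close> by Hoelder's inequality, and integrating the bound over the fibre one more factor
  \<open>k\<close>. In a thin domain this forces the function to depend on \<open>x\<close> only.\<close>

lemma vertical_oscillation_powr:
  assumes S: "sobolev_rep p (subgraph \<gamma>) F H" and op: "open (subgraph \<gamma>)" and p: "1 < p"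
    and h: "0 < h" "\<And>x. h \<le> \<gamma> x" and k: "\<And>x. \<gamma> x \<le> k"
  shows "integrable lborel (\<lambda>z. indicator (subgraph \<gamma>) z * \<bar>F z - lower_mean h F (fst z)\<bar> powr p)"
    and "(LBINT z. indicator (subgraph \<gamma>) z * \<bar>F z - lower_mean h F (fst z)\<bar> powr p) \<le>
      k powr p * (LBINT z. \<bar>snd (H z)\<bar> powr p)"
proof -
  note S' = S[unfolded sobolev_rep_def]
  have k0: "0 < k" using h k less_le_trans order_trans by (metis less_le_trans)
  have Fm [measurable]: "F \<in> Borel_fun" and Hm [measurable]: "H \<in> Borel_fun" using S' by auto
  have Um [measurable]: "subgraph \<gamma> \<in> sets borel" using op by simp
  have vm [measurable]: "lower_mean h F \<in> Borel_fun"
    using S' by (intro lower_mean_powr(1)[OF Fm h(1) p]) auto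
  define w where "w z = \<bar>snd (H z)\<bar>" for z
  have wm: "w \<in> Borel_fun" unfolding w_def[abs_def] by measurable
  have wz: "w (x, y) = 0" if "y \<notin> {0<..<k}" for x y
    by (rule subgraph_zero[where \<gamma> = \<gamma>, OF _ k that]) (use S' in \<open>auto simp: w_def\<close>)
  have wi: "integrable lborel (\<lambda>z. \<bar>w z\<bar> powr p)"
  proof (rule integrable_dominated)
    show "integrable lborel (\<lambda>z. norm (H z) powr p)" using S' by auto
    show "(\<lambda>z. \<bar>w z\<bar> powr p) \<in> borel_measurable lborel" using wm by simp
    have "\<bar>snd (H z)\<bar> powr p \<le> norm (H z) powr p" for z
      using p abs_fst_snd_le by (intro powr_mono2) auto
    then show "AE z in lborel. norm (\<bar>w z\<bar> powr p) \<le> norm (norm (H z) powr p)"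
      by (intro AE_I2) (auto simp: w_def)
  qed
  note J = slice_integral_powr[OF wm wz k0 p wi]
  let ?N = "\<lambda>x. \<bar>LBINT t. w (x, t)\<bar>"
  let ?f = "\<lambda>z. indicator (subgraph \<gamma>) z * \<bar>F z - lower_mean h F (fst z)\<bar> powr p"
  have fm: "?f \<in> Borel_fun" by measurable
  have inner: "AE x in lborel. (\<integral>\<^sup>+y. ennreal (?f (x, y)) \<partial>lborel) \<le> ennreal (k * ?N x powr p)"
    using vertical_oscillation[OF S op h]
  proof eventually_elim
    case (elim x)
    have "(\<integral>\<^sup>+y. ennreal (?f (x, y)) \<partial>lborel) \<le> (\<integral>\<^sup>+y. ennreal (?N x powr p) * indicator {0<..<k} y \<partial>lborel)"
    proof (rule nn_integral_mono_AE)
      show "AE y in lborel. ennreal (?f (x, y)) \<le> ennreal (?N x powr p) * indicator {0<..<k} y"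
        using elim
      proof eventually_elim
        case (elim y)
        show ?case
        proof (cases "(x, y) \<in> subgraph \<gamma>")
          case True
          then have "y \<in> {0<..<k}" using k[of x] by (auto simp: subgraph_def)
          moreover have "\<bar>F (x, y) - lower_mean h F x\<bar> \<le> ?N x"
            using elim True abs_ge_self[of "LBINT t. w (x, t)"] by (simp add: w_def)
          then have "\<bar>F (x, y) - lower_mean h F x\<bar> powr p \<le> ?N x powr p"
            using p by (intro powr_mono2) auto
          ultimately show ?thesis using True by (simp add: ennreal_leI)
        qed simp
      qed
    qed
    also have "\<dots> = ennreal (?N x powr p) * ennreal k" using k0 by (simp add: nn_integral_cmult_indicator)
    also have "\<dots> = ennreal (k * ?N x powr p)" using k0 by (simp add: ennreal_mult mult.commute)
    finally show ?case .
  qed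
  have "(\<integral>\<^sup>+z. ennreal (?f z) \<partial>lborel) = (\<integral>\<^sup>+x. \<integral>\<^sup>+y. ennreal (?f (x, y)) \<partial>lborel \<partial>lborel)"
    using fm by (intro iterated_nn_integral1) simp
  also have "\<dots> \<le> (\<integral>\<^sup>+x. ennreal (k * ?N x powr p) \<partial>lborel)"
    by (rule nn_integral_mono_AE[OF inner])
  also have "\<dots> = ennreal (k * (LBINT x. ?N x powr p))"
    using k0 J(1) by (subst nn_integral_eq_integral) auto
  also have "\<dots> \<le> ennreal (k powr p * (LBINT z. \<bar>snd (H z)\<bar> powr p))"
  proof (rule ennreal_leI)
    have "k * (LBINT x. ?N x powr p) \<le> k * (k powr (p - 1) * (LBINT z. \<bar>w z\<bar> powr p))"
      using k0 J(2) by (intro mult_left_mono) auto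
    also have "\<dots> = k powr (1 + (p - 1)) * (LBINT z. \<bar>w z\<bar> powr p)"
      using k0 by (simp only: powr_add) simp
    finally show "k * (LBINT x. ?N x powr p) \<le> k powr p * (LBINT z. \<bar>snd (H z)\<bar> powr p)"
      by (simp add: w_def)
  qed
  finally have le: "(\<integral>\<^sup>+z. ennreal (?f z) \<partial>lborel) \<le> ennreal (k powr p * (LBINT z. \<bar>snd (H z)\<bar> powr p))" .
  show "integrable lborel ?f"
    by (rule integrable_nn_integral_le(1)[OF _ _ _ le]) (use fm k0 in auto)
  show "(LBINT z. ?f z) \<le> k powr p * (LBINT z. \<bar>snd (H z)\<bar> powr p)"
    by (rule integrable_nn_integral_le(2)[OF _ _ _ le]) (use fm k0 in auto)
qed

text \<open>The bumps in the vertical variable increase to the indicator of the strip, so that tests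
  depending on \<open>x\<close> only become admissible in the limit.\<close>

lemma lower_mean_sobolev:
  assumes S: "sobolev_rep p (subgraph \<gamma>) F H" and p: "1 < p"
    and h: "0 < h" "\<And>x. h \<le> \<gamma> x"
  shows "sobolev_rep p {0<..<1} (lower_mean h F) (lower_mean h (\<lambda>z. fst (H z)))"
proof -
  note S' = S[unfolded sobolev_rep_def]
  have F: "integrable lborel F" and H: "integrable lborel H" and Fp: "integrable lborel (\<lambda>z. \<bar>F z\<bar> powr p)" using S' by auto
  define H1 where "H1 z = fst (H z)" for z
  have H1: "integrable lborel H1"
    unfolding H1_def[abs_def] by (rule integrable_bounded_linear[OF bounded_linear_fst H])
  then have [measurable]: "F \<in> Borel_fun" "H1 \<in> Borel_fun" using F by auto
  have H1p: "integrable lborel (\<lambda>z. \<bar>H1 z\<bar> powr p)"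
  proof (rule integrable_dominated)
    show "integrable lborel (\<lambda>z. norm (H z) powr p)" using S' by auto
    have "\<bar>H1 z\<bar> powr p \<le> norm (H z) powr p" for z
      using p abs_fst_snd_le by (intro powr_mono2) (auto simp: H1_def)
    then show "AE z in lborel. norm (\<bar>H1 z\<bar> powr p) \<le> norm (norm (H z) powr p)" by (intro AE_I2) auto
  qed simp
  note LF = lower_mean_powr[OF _ h(1) p Fp] and LH = lower_mean_powr[OF _ h(1) p H1p]
  have zero: "lower_mean h F x = 0 \<and> lower_mean h H1 x = 0" if "x \<notin> {0<..<1}" for x
  proof -
    have "(x, y) \<notin> subgraph \<gamma>" for y using that by (auto simp: subgraph_def)
    then have "F (x, y) = 0" "H1 (x, y) = 0" for y using S' by (auto simp: H1_def)
    then show ?thesis by (simp add: lower_mean_def)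
  qed
  have strip: "integrable lborel (\<lambda>z. indicator {0<..<h} (snd z) * G z)"
    and mean: "integrable lborel (lower_mean h G)" if G: "integrable lborel G" for G
  proof -
    have [measurable]: "G \<in> Borel_fun" using G by auto
    show 1: "integrable lborel (\<lambda>z. indicator {0<..<h} (snd z) * G z)"
      by (rule integrable_dominated[OF G]) (auto intro!: AE_I2 simp: indicator_def)
    show "integrable lborel (lower_mean h G)"
      unfolding lower_mean_def[abs_def] using integrable_slice1[OF 1] by simp
  qed
  let ?b = "interval_bump 0 h"
  have lim: "(\<lambda>n. LBINT z. G z * (g (fst z) * ?b n (snd z))) \<longlonglongrightarrow> h * (LBINT x. lower_mean h G x * g x)"
    if G: "integrable lborel G" and g: "g \<in> Borel_fun" "\<And>x. \<bar>g x\<bar> \<le> B" for G g B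
  proof -
    have [measurable]: "G \<in> Borel_fun" "g \<in> Borel_fun" using G g by auto
    have bm [measurable]: "?b n \<in> Borel_fun" for n
      using Ck_interval_bump[of 0 0 h n] by (auto intro: borel_measurable_continuous_onI)
    have B: "B \<ge> 0" using g(2)[of 0] by linarith
    have "(\<lambda>n. LBINT z. G z * (g (fst z) * ?b n (snd z))) \<longlonglongrightarrow>
        (LBINT z. G z * (g (fst z) * indicator {0<..<h} (snd z)))"
    proof (rule integral_dominated_convergence)
      show "integrable lborel (\<lambda>z. B * \<bar>G z\<bar>)" using G by simp
      show "AE z in lborel. (\<lambda>n. G z * (g (fst z) * ?b n (snd z))) \<longlonglongrightarrow>
          G z * (g (fst z) * indicator {0<..<h} (snd z))"
        by (intro AE_I2 tendsto_intros interval_bump_tendsto)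
      have "\<bar>g x * ?b n y\<bar> \<le> B * 1" for x y n
        unfolding abs_mult using g(2) B interval_bump_bounds[of 0 h n y] by (intro mult_mono) auto
      then show "AE z in lborel. norm (G z * (g (fst z) * ?b n (snd z))) \<le> B * \<bar>G z\<bar>" for n
        by (intro AE_I2) (simp add: abs_mult[of "G _"] mult.commute[of B] mult_left_mono)
    qed measurable
    moreover have "(LBINT z. G z * (g (fst z) * indicator {0<..<h} (snd z))) = h * (LBINT x. lower_mean h G x * g x)"
    proof -
      have "integrable lborel (\<lambda>z. (indicator {0<..<h} (snd z) * G z) * g (fst z))"
        by (rule integrable_mult_bounded[OF strip[OF G]]) (use g in auto)
      then have i: "integrable lborel (\<lambda>z. G z * (g (fst z) * indicator {0<..<h} (snd z)))"
        by (simp only: mult_ac)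
      have "(LBINT y. G (x, y) * (g x * indicator {0<..<h} y)) = h * (lower_mean h G x * g x)" for x
      proof -
        have "(LBINT y. G (x, y) * (g x * indicator {0<..<h} y)) = (LBINT y. g x * (indicator {0<..<h} y * G (x, y)))"
          by (simp only: mult_ac)
        also have "\<dots> = g x * (LBINT y. indicator {0<..<h} y * G (x, y))"
          by (rule integral_mult_right_zero)
        finally show ?thesis using h(1) by (simp add: lower_mean_def)
      qed
      then show ?thesis using iterated_integral1[OF i] by simp
    qed
    ultimately show ?thesis by (simp only:)
  qed
  have weak: "(LBINT x. lower_mean h F x * deriv_at \<psi> x b) =
      - (LBINT x. (lower_mean h H1 x \<bullet> b) * \<psi> x)" if \<psi>: "\<psi> \<in> test_functions {0<..<1}" and b: "b \<in> Basis" for \<psi> b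
  proof -
    let ?\<psi>' = "\<lambda>x. deriv_at \<psi> x 1"
    have b1: "b = 1" using b by simp
    obtain B where B: "\<And>x. \<bar>\<psi> x\<bar> \<le> B" "\<And>x. \<bar>?\<psi>' x\<bar> \<le> B" using test_bounded[OF \<psi>] by (metis Basis_real_def singletonI)
    have "{0<..<1} \<times> {0<..<h} \<subseteq> subgraph \<gamma>" using h(2) by (auto simp: subgraph_def intro: less_le_trans)
    have eqn: "(LBINT z. F z * (?\<psi>' (fst z) * ?b n (snd z))) = - (LBINT z. H1 z * (\<psi> (fst z) * ?b n (snd z)))" for n
    proof -
      have bt: "?b n \<in> test_functions {0<..<h}" by (rule interval_bump_test) auto
      have "(\<lambda>z. \<psi> (fst z) * ?b n (snd z)) \<in> test_functions (subgraph \<gamma>)"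
        using tensor_test[OF \<psi> bt] test_functions_mono[OF \<open>{0<..<1} \<times> {0<..<h} \<subseteq> subgraph \<gamma>\<close>] by blast
      moreover have "(1, 0) \<in> (Basis :: (real \<times> real) set)" by (simp add: Basis_prod_def)
      ultimately have "(LBINT z. F z * deriv_at (\<lambda>z. \<psi> (fst z) * ?b n (snd z)) z (1, 0)) =
          - (LBINT z. (H z \<bullet> (1, 0)) * (\<psi> (fst z) * ?b n (snd z)))"
        using S' by blast
      then show ?thesis unfolding tensor_test_partials(1)[OF \<psi> bt] by (simp add: H1_def inner_prod_def)
    qed
    have "?\<psi>' \<in> Borel_fun" using test_partial_borel[OF \<psi>, of 1] by simp
    from lim[OF F this B(2)] have "(\<lambda>n. - (LBINT z. H1 z * (\<psi> (fst z) * ?b n (snd z)))) \<longlonglongrightarrow>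
        h * (LBINT x. lower_mean h F x * ?\<psi>' x)"
      unfolding eqn .
    moreover have "(\<lambda>n. - (LBINT z. H1 z * (\<psi> (fst z) * ?b n (snd z)))) \<longlonglongrightarrow>
        - (h * (LBINT x. lower_mean h H1 x * \<psi> x))"
      by (rule tendsto_minus[OF lim[OF H1 test_borel[OF \<psi>] B(1)]])
    ultimately have e: "h * (LBINT x. lower_mean h F x * ?\<psi>' x) = - (h * (LBINT x. lower_mean h H1 x * \<psi> x))"
      by (rule LIMSEQ_unique)
    have "s = - t" if "h * s = - (h * t)" for s t
    proof -
      have "h * (s + t) = 0" using that by (simp add: distrib_left)
      then have "s + t = 0" using h(1) by simp
      then show ?thesis by linarith
    qed
    from this[OF e] show ?thesis by (simp add: b1)
  qed
  have "sobolev_rep p {0<..<1} (lower_mean h F) (lower_mean h H1)"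
    unfolding sobolev_rep_def using LF LH zero mean[OF F] mean[OF H1] weak by auto
  then show ?thesis by (simp add: H1_def[abs_def])
qed

section \<open>Recovery functions\<close>

text \<open>On a cell the integral of \<open>\<psi>'\<close> is a difference of values of \<open>\<psi>\<close> at two consecutive nodes, where \<open>\<psi>\<close>
  vanishes.\<close>

lemma integral_step_times_derivative:
  fixes S :: "int \<Rightarrow> real"
  assumes s: "test_slice M \<psi> \<psi>'" and l: "0 < l" and z: "\<And>i::int. \<psi> (l * (of_int i + r)) = 0"
  shows "(LBINT x. S \<lfloor>x / l - r\<rfloor> * \<psi>' x) = 0"
proof -
  note I = test_slice_integrals[OF s]
  define J where "J = {\<lfloor>0 / l - r\<rfloor>..\<lfloor>M / l - r\<rfloor>}"
  define A where "A i = {l * (of_int i + r)..<l * (of_int (i + 1) + r)}" for i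
  have mem: "x \<in> A i \<longleftrightarrow> i = \<lfloor>x / l - r\<rfloor>" for x i
  proof -
    have "x \<in> A i \<longleftrightarrow> of_int i \<le> x / l - r \<and> x / l - r < of_int i + 1"
      using l by (auto simp: A_def field_simps)
    also have "\<dots> \<longleftrightarrow> i = \<lfloor>x / l - r\<rfloor>" using floor_eq_iff[of "x / l - r" i] by auto
    finally show ?thesis .
  qed
  have 0: "(LBINT x. indicator (A i) x * \<psi>' x) = 0" for i
  proof -
    let ?a = "l * (of_int i + r)" and ?b = "l * (of_int (i + 1) + r)"
    have ab: "?a \<le> ?b" using l by simp
    have "(LBINT x. indicator (A i) x * \<psi>' x) = (LBINT x. indicator {?a..?b} x * \<psi>' x)"
    proof (rule integral_cong_AE)
      show "AE x in lborel. indicator (A i) x * \<psi>' x = indicator {?a..?b} x * \<psi>' x"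
        using AE_lborel_singleton[of ?b] by eventually_elim (auto simp: A_def indicator_def)
    qed (use I(1) in \<open>auto simp: A_def\<close>)
    also have "\<dots> = \<psi> ?b - \<psi> ?a" by (rule I(2)[OF ab])
    finally show ?thesis using z[of i] z[of "i + 1"] by simp
  qed
  have "S \<lfloor>x / l - r\<rfloor> * \<psi>' x = (\<Sum>i\<in>J. S i * (indicator (A i) x * \<psi>' x))" for x
  proof (cases "\<psi>' x = 0")
    case False
    then have "0 \<le> x" "x \<le> M" using I(5)[of x] by auto
    then have "\<lfloor>x / l - r\<rfloor> \<in> J" using l unfolding J_def by (auto intro!: floor_mono divide_right_mono)
    moreover have "(\<Sum>i\<in>J. S i * (indicator (A i) x * \<psi>' x)) = (\<Sum>i\<in>J. if i = \<lfloor>x / l - r\<rfloor> then S i * \<psi>' x else 0)"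
      by (rule sum.cong) (auto simp: indicator_def mem)
    ultimately show ?thesis by (simp add: J_def)
  qed simp
  then have "(LBINT x. S \<lfloor>x / l - r\<rfloor> * \<psi>' x) = (LBINT x. (\<Sum>i\<in>J. S i * (indicator (A i) x * \<psi>' x)))"
    by (simp only:)
  also have "\<dots> = (\<Sum>i\<in>J. S i * (LBINT x. indicator (A i) x * \<psi>' x))"
    using integrable_indicator_mult[OF I(1)] by (subst Bochner_Integration.integral_sum) (auto simp: A_def)
  finally show ?thesis by (simp add: 0)
qed

text \<open>A function of \<open>x\<close> is turned into one on a domain pinched to height \<open>h\<close> over the points
  \<open>l * (i + r)\<close>. Above the height \<open>h\<close> a ramp of width \<open>d\<close> replaces it by its value at the left pinch
  point. The jumps of that step function are harmless, since the upper part of the domain is empty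
  over the pinch points; so nearly all of the horizontal gradient in the upper part disappears.\<close>

locale pinched_domain =
  fixes p :: real and \<gamma> :: "real \<Rightarrow> real" and h k d l r c :: real and H0 :: "real \<Rightarrow> real"
  assumes p: "1 < p" and op: "open (subgraph \<gamma>)"
    and h: "0 < h" "\<And>x. h \<le> \<gamma> x" and k: "\<And>x. \<gamma> x \<le> k" and d: "0 < d" and l: "0 < l"
    and pinch: "\<And>i::int. \<gamma> (l * (of_int i + r)) = h"
    and H0: "integrable lborel H0" "integrable lborel (\<lambda>x. \<bar>H0 x\<bar> powr p)"
begin

definition base :: "real \<Rightarrow> real" where "base x = c + primitive H0 x"
definition node :: "real \<Rightarrow> real" where "node x = l * (of_int \<lfloor>x / l - r\<rfloor> + r)"
definition jump :: "real \<Rightarrow> real" where "jump x = base (node x) - base x"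
definition ramp' :: "real \<Rightarrow> real" where "ramp' y = (1 / d) * indicator {h..h + d} y"
definition ramp :: "real \<Rightarrow> real" where "ramp y = primitive ramp' y"
definition recovery :: "real \<times> real \<Rightarrow> real" where
  "recovery z = indicator (subgraph \<gamma>) z * (base (fst z) + ramp (snd z) * jump (fst z))"
definition recovery_grad :: "real \<times> real \<Rightarrow> real \<times> real" where
  "recovery_grad z = indicator (subgraph \<gamma>) z *\<^sub>R
     ((1 - ramp (snd z)) * H0 (fst z), ramp' (snd z) * jump (fst z))"

lemma hk: "h \<le> k" "0 < k" using h k[of 0] h(2)[of 0] by linarith+

lemma measurable_recovery [measurable]:
  "H0 \<in> Borel_fun" "base \<in> Borel_fun" "jump \<in> Borel_fun"
  "ramp' \<in> Borel_fun" "ramp \<in> Borel_fun" "subgraph \<gamma> \<in> sets borel"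
proof -
  show [measurable]: "H0 \<in> Borel_fun" using H0 by auto
  show b [measurable]: "base \<in> Borel_fun" unfolding base_def[abs_def] by measurable
  have "node \<in> Borel_fun" unfolding node_def[abs_def] by measurable
  then show "jump \<in> Borel_fun" unfolding jump_def[abs_def] by measurable
  show [measurable]: "ramp' \<in> Borel_fun" unfolding ramp'_def[abs_def] by measurable
  show "ramp \<in> Borel_fun" unfolding ramp_def[abs_def] by measurable
  show "subgraph \<gamma> \<in> sets borel" using op by simp
qed

lemma integrable_ramp': "integrable lborel ramp'"
  unfolding ramp'_def[abs_def] using d by simp

lemma ramp_eq: "ramp y = (1 / d) * max 0 (min y (h + d) - h)"
proof -
  have "indicator {0..y} t * ramp' t = (1 / d) * indicator {h..min y (h + d)} t" for t
    using h by (auto simp: ramp'_def indicator_def)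
  then have "ramp y = (1 / d) * measure lborel {h..min y (h + d)}"
    unfolding ramp_def primitive_def by simp
  then show ?thesis by (auto simp: max_def)
qed

lemma ramp_bounds: "0 \<le> ramp y" "ramp y \<le> 1" "y \<le> h \<Longrightarrow> ramp y = 0" "h + d \<le> y \<Longrightarrow> ramp y = 1"
  using d by (auto simp: ramp_eq field_simps min_def max_def)

lemma base_bound: "\<bar>base x\<bar> \<le> \<bar>c\<bar> + (LBINT t. \<bar>H0 t\<bar>)"
proof -
  have "primitive H0 (-1) = 0" by (simp add: primitive_def)
  then show ?thesis using primitive_diff_le_total[OF H0(1), of x "-1"] by (simp add: base_def)
qed

lemma jump_bound: "\<bar>jump x\<bar> \<le> 2 * (\<bar>c\<bar> + (LBINT t. \<bar>H0 t\<bar>))"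
  using base_bound[of x] base_bound[of "node x"] by (auto simp: jump_def)

lemma node_le: "node x \<le> x" "x - l \<le> node x"
proof -
  have *: "l * (n + r) \<le> x \<and> x - l \<le> l * (n + r)" if "n \<le> x / l - r" "x / l - r < n + 1" for n
    using that l by (simp add: field_simps)
  have "of_int \<lfloor>x / l - r\<rfloor> \<le> x / l - r" "x / l - r < of_int \<lfloor>x / l - r\<rfloor> + 1" by linarith+
  from *[OF this] show "node x \<le> x" "x - l \<le> node x" unfolding node_def by blast+
qed

lemma jump_powr_le: "\<bar>jump x\<bar> powr p \<le> l powr (p - 1) * (LBINT t. indicator {x - l..x} t * \<bar>H0 t\<bar> powr p)"
proof -
  have i: "integrable lborel (\<lambda>t. indicator {x - l..x} t * \<bar>H0 t\<bar> powr p)"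
    by (rule integrable_indicator_mult[OF H0(2)]) simp
  have "\<bar>jump x\<bar> = \<bar>primitive H0 x - primitive H0 (node x)\<bar>" by (simp add: jump_def base_def)
  also have "\<dots> \<le> (LBINT t. indicator {node x..x} t * \<bar>H0 t\<bar>)"
    by (rule primitive_diff_le[OF H0(1) node_le(1)])
  also have "\<dots> \<le> (LBINT t. indicator {x - l..x} t * \<bar>H0 t\<bar>)"
  proof (rule integral_mono)
    show "integrable lborel (\<lambda>t. indicator {node x..x} t * \<bar>H0 t\<bar>)" "integrable lborel (\<lambda>t. indicator {x - l..x} t * \<bar>H0 t\<bar>)"
      by (rule integrable_indicator_mult[OF integrable_abs[OF H0(1)]], simp)+
    show "indicator {node x..x} t * \<bar>H0 t\<bar> \<le> indicator {x - l..x} t * \<bar>H0 t\<bar>" for t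
      using node_le[of x] by (auto simp: indicator_def)
  qed
  finally have "\<bar>jump x\<bar> powr p \<le> (LBINT t. indicator {x - l..x} t * \<bar>H0 t\<bar>) powr p"
    using p by (intro powr_mono2) auto
  also have "\<dots> \<le> measure lborel {x - l..x} powr (p - 1) * (LBINT t. indicator {x - l..x} t * \<bar>H0 t\<bar> powr p)"
    using i p by (intro powr_integral_le(2)) (auto simp: emeasure_lborel_Icc_eq)
  finally show ?thesis using l by simp
qed

text \<open>Tonelli's theorem: each \<open>t\<close> contributes to the bound of \<open>jump x\<close> for \<open>x\<close> in an interval of length \<open>l\<close>
  only.\<close>

lemma jump_powr:
  shows "integrable lborel (\<lambda>x. \<bar>jump x\<bar> powr p)"
    and "(LBINT x. \<bar>jump x\<bar> powr p) \<le> l powr p * (LBINT t. \<bar>H0 t\<bar> powr p)"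
proof -
  have i: "integrable lborel (\<lambda>t. indicator {x - l..x} t * \<bar>H0 t\<bar> powr p)" for x
    by (rule integrable_indicator_mult[OF H0(2)]) simp
  define K where "K z = (if fst z - l \<le> snd z \<and> snd z \<le> fst z then 1 else 0) * \<bar>H0 (snd z)\<bar> powr p" for z :: "real \<times> real"
  have Km [measurable]: "K \<in> Borel_fun" unfolding K_def[abs_def] by measurable
  have "(\<integral>\<^sup>+x. ennreal (\<bar>jump x\<bar> powr p) \<partial>lborel) \<le> (\<integral>\<^sup>+x. ennreal (l powr (p - 1)) * (\<integral>\<^sup>+t. ennreal (K (x, t)) \<partial>lborel) \<partial>lborel)"
  proof (rule nn_integral_mono)
    fix x
    have "K (x, t) = indicator {x - l..x} t * \<bar>H0 t\<bar> powr p" for t by (auto simp: K_def indicator_def)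
    then have "(\<integral>\<^sup>+t. ennreal (K (x, t)) \<partial>lborel) = ennreal (LBINT t. indicator {x - l..x} t * \<bar>H0 t\<bar> powr p)"
      using i by (simp add: nn_integral_eq_integral)
    then show "ennreal (\<bar>jump x\<bar> powr p) \<le> ennreal (l powr (p - 1)) * (\<integral>\<^sup>+t. ennreal (K (x, t)) \<partial>lborel)"
      using jump_powr_le[of x] by (simp add: ennreal_leI flip: ennreal_mult)
  qed
  also have "\<dots> = ennreal (l powr (p - 1)) * (\<integral>\<^sup>+x. \<integral>\<^sup>+t. ennreal (K (x, t)) \<partial>lborel \<partial>lborel)"
  proof (rule nn_integral_cmult)
    have "(\<lambda>z. ennreal (K z)) \<in> borel_measurable (lborel \<Otimes>\<^sub>M lborel)" unfolding lborel_prod by simp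
    then show "(\<lambda>x. \<integral>\<^sup>+t. ennreal (K (x, t)) \<partial>lborel) \<in> borel_measurable lborel"
      by (rule lborel.borel_measurable_nn_integral_fst)
  qed
  also have "(\<integral>\<^sup>+x. \<integral>\<^sup>+t. ennreal (K (x, t)) \<partial>lborel \<partial>lborel) = (\<integral>\<^sup>+t. \<integral>\<^sup>+x. ennreal (K (x, t)) \<partial>lborel \<partial>lborel)"
    using iterated_nn_integral1[of "\<lambda>z. ennreal (K z)"] iterated_nn_integral2[of "\<lambda>z. ennreal (K z)"] by simp
  also have "\<dots> = (\<integral>\<^sup>+t. ennreal (l * \<bar>H0 t\<bar> powr p) \<partial>lborel)"
  proof (rule nn_integral_cong)
    fix t
    have "ennreal (K (x, t)) = ennreal (\<bar>H0 t\<bar> powr p) * indicator {t..t + l} x" for x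
      by (auto simp: K_def indicator_def)
    then have "(\<integral>\<^sup>+x. ennreal (K (x, t)) \<partial>lborel) = ennreal (\<bar>H0 t\<bar> powr p) * ennreal l"
      using l by (simp add: nn_integral_cmult_indicator)
    then show "(\<integral>\<^sup>+x. ennreal (K (x, t)) \<partial>lborel) = ennreal (l * \<bar>H0 t\<bar> powr p)"
      using l by (simp add: ennreal_mult mult.commute)
  qed
  also have "\<dots> = ennreal (l * (LBINT t. \<bar>H0 t\<bar> powr p))"
    using H0(2) l by (subst nn_integral_eq_integral) auto
  finally have le: "(\<integral>\<^sup>+x. ennreal (\<bar>jump x\<bar> powr p) \<partial>lborel) \<le> ennreal (l powr p * (LBINT t. \<bar>H0 t\<bar> powr p))"
  proof -
    have "l powr (p - 1) * l = l powr p" using l powr_add[of l "p - 1" 1] by simp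
    then have "l powr (p - 1) * (l * (LBINT t. \<bar>H0 t\<bar> powr p)) = l powr p * (LBINT t. \<bar>H0 t\<bar> powr p)"
      by (simp only: mult.assoc[symmetric])
    moreover assume "(\<integral>\<^sup>+x. ennreal (\<bar>jump x\<bar> powr p) \<partial>lborel) \<le> ennreal (l powr (p - 1)) * ennreal (l * (LBINT t. \<bar>H0 t\<bar> powr p))"
    moreover have "ennreal (l powr (p - 1)) * ennreal (l * (LBINT t. \<bar>H0 t\<bar> powr p)) =
        ennreal (l powr (p - 1) * (l * (LBINT t. \<bar>H0 t\<bar> powr p)))"
      using l by (intro ennreal_mult[symmetric]) auto
    ultimately show ?thesis by (simp only:)
  qed
  show "integrable lborel (\<lambda>x. \<bar>jump x\<bar> powr p)"
    by (rule integrable_nn_integral_le(1)[OF _ _ _ le]) auto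
  show "(LBINT x. \<bar>jump x\<bar> powr p) \<le> l powr p * (LBINT t. \<bar>H0 t\<bar> powr p)"
    by (rule integrable_nn_integral_le(2)[OF _ _ _ le]) auto
qed

lemma in_subgraph_box: "z \<in> subgraph \<gamma> \<Longrightarrow> fst z \<in> {0<..<1} \<and> snd z \<in> {0<..<k}"
  using k[of "fst z"] by (auto simp: subgraph_def)

lemma bounded_subgraph: "bounded (subgraph \<gamma>)"
proof (rule bounded_subset)
  show "bounded ({0<..<1::real} \<times> {0<..<k})" by (intro bounded_Times) auto
  show "subgraph \<gamma> \<subseteq> {0<..<1} \<times> {0<..<k}" using in_subgraph_box by (auto simp: mem_Times_iff)
qed

lemma recovery_measurable: "recovery \<in> Borel_fun" "recovery_grad \<in> Borel_fun"
  unfolding recovery_def[abs_def] recovery_grad_def[abs_def] by measurable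

lemma recovery_grad_powr_le:
  "norm (recovery_grad z) powr p \<le> indicator (subgraph \<gamma>) z * (2 powr p *
     (indicator {..h + d} (snd z) * \<bar>H0 (fst z)\<bar> powr p + (1 / d) powr p * (indicator {h..h + d} (snd z) * \<bar>jump (fst z)\<bar> powr p)))"
proof (cases "z \<in> subgraph \<gamma>")
  case True
  let ?a = "(1 - ramp (snd z)) * H0 (fst z)" and ?b = "ramp' (snd z) * jump (fst z)"
  have "norm (recovery_grad z) powr p = norm ((?a, 0) - (0, - ?b)) powr p"
    using True by (simp add: recovery_grad_def)
  also have "\<dots> \<le> 2 powr p * (norm (?a, 0::real) powr p + norm (0::real, - ?b) powr p)"
    using p by (intro powr_norm_diff_le) auto
  also have "\<dots> = 2 powr p * (\<bar>?a\<bar> powr p + \<bar>?b\<bar> powr p)" by simp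
  also have "\<dots> \<le> 2 powr p * (indicator {..h + d} (snd z) * \<bar>H0 (fst z)\<bar> powr p +
      (1 / d) powr p * (indicator {h..h + d} (snd z) * \<bar>jump (fst z)\<bar> powr p))"
  proof (intro mult_left_mono add_mono)
    show "\<bar>?a\<bar> powr p \<le> indicator {..h + d} (snd z) * \<bar>H0 (fst z)\<bar> powr p"
    proof (cases "snd z \<le> h + d")
      case True
      have "\<bar>1 - ramp (snd z)\<bar> * \<bar>H0 (fst z)\<bar> \<le> 1 * \<bar>H0 (fst z)\<bar>"
        using ramp_bounds(1,2)[of "snd z"] by (intro mult_right_mono) auto
      then have "\<bar>?a\<bar> powr p \<le> \<bar>H0 (fst z)\<bar> powr p"
        using p by (intro powr_mono2) (auto simp: abs_mult)
      then show ?thesis using True by simp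
    next
      case False
      then show ?thesis using ramp_bounds(4)[of "snd z"] by simp
    qed
    show "\<bar>?b\<bar> powr p \<le> (1 / d) powr p * (indicator {h..h + d} (snd z) * \<bar>jump (fst z)\<bar> powr p)"
    proof -
      have "\<bar>1 / d\<bar> = 1 / d" using d by simp
      then have "\<bar>1 / d * jump (fst z)\<bar> powr p = (1 / d) powr p * \<bar>jump (fst z)\<bar> powr p"
        by (simp only: abs_mult powr_mult)
      then show ?thesis by (auto simp: ramp'_def indicator_def)
    qed
  qed auto
  finally show ?thesis using True by simp
qed (simp add: recovery_grad_def)

lemma recovery_grad_integrable: "integrable lborel (\<lambda>z. norm (recovery_grad z) powr p)"
proof (rule integrable_dominated)
  have 1: "integrable lborel (\<lambda>z. \<bar>H0 (fst z)\<bar> powr p * indicator {0<..<k} (snd z))"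
    using hk by (intro integrable_tensor[OF H0(2)]) simp
  have 2: "integrable lborel (\<lambda>z. \<bar>jump (fst z)\<bar> powr p * indicator {0<..<k} (snd z))"
    using hk by (intro integrable_tensor[OF jump_powr(1)]) simp
  show "integrable lborel (\<lambda>z. 2 powr p * (\<bar>H0 (fst z)\<bar> powr p * indicator {0<..<k} (snd z) +
      (1 / d) powr p * (\<bar>jump (fst z)\<bar> powr p * indicator {0<..<k} (snd z))))"
    using 1 2 by (intro integrable_mult_right Bochner_Integration.integrable_add)
  show "(\<lambda>z. norm (recovery_grad z) powr p) \<in> borel_measurable lborel"
    using recovery_measurable by simp
  show "AE z in lborel. norm (norm (recovery_grad z) powr p) \<le> norm (2 powr p * (\<bar>H0 (fst z)\<bar> powr p * indicator {0<..<k} (snd z) +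
      (1 / d) powr p * (\<bar>jump (fst z)\<bar> powr p * indicator {0<..<k} (snd z))))"
  proof (rule AE_I2)
    fix z :: "real \<times> real"
    have "indicator (subgraph \<gamma>) z * (2 powr p * (indicator {..h + d} (snd z) * \<bar>H0 (fst z)\<bar> powr p +
        (1 / d) powr p * (indicator {h..h + d} (snd z) * \<bar>jump (fst z)\<bar> powr p))) \<le>
      2 powr p * (\<bar>H0 (fst z)\<bar> powr p * indicator {0<..<k} (snd z) +
        (1 / d) powr p * (\<bar>jump (fst z)\<bar> powr p * indicator {0<..<k} (snd z)))"
    proof (cases "z \<in> subgraph \<gamma>")
      case True
      then have "snd z \<in> {0<..<k}" using in_subgraph_box by blast
      then have "2 powr p * (indicator {..h + d} (snd z) * \<bar>H0 (fst z)\<bar> powr p +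
        (1 / d) powr p * (indicator {h..h + d} (snd z) * \<bar>jump (fst z)\<bar> powr p)) \<le>
        2 powr p * (\<bar>H0 (fst z)\<bar> powr p * indicator {0<..<k} (snd z) +
        (1 / d) powr p * (\<bar>jump (fst z)\<bar> powr p * indicator {0<..<k} (snd z)))"
        by (intro mult_left_mono add_mono) (auto simp: indicator_def)
      then show ?thesis using True by simp
    qed simp
    from order_trans[OF recovery_grad_powr_le[of z] this] powr_ge_zero[of "norm (recovery_grad z)" p]
    show "norm (norm (recovery_grad z) powr p) \<le> norm (2 powr p * (\<bar>H0 (fst z)\<bar> powr p * indicator {0<..<k} (snd z) +
      (1 / d) powr p * (\<bar>jump (fst z)\<bar> powr p * indicator {0<..<k} (snd z))))"
      unfolding real_norm_def by linarith
  qed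
qed

text \<open>Above the height \<open>h\<close> the gradient lives in the ramp layer, of thickness \<open>d\<close>. The horizontal part
  contributes \<open>d\<close>; the vertical part is \<open>jump / d\<close>, where the jump has size \<open>l\<close> in the mean.\<close>

lemma recovery_grad_upper:
  "(LBINT z. indicator {h<..} (snd z) * norm (recovery_grad z) powr p) \<le>
     2 powr p * (d + d powr (1 - p) * l powr p) * (LBINT t. \<bar>H0 t\<bar> powr p)"
proof -
  let ?I = "indicator {h..h + d} :: real \<Rightarrow> real"
  let ?K = "LBINT t. \<bar>H0 t\<bar> powr p"
  have iI: "integrable lborel ?I" using d by simp
  have 1: "integrable lborel (\<lambda>z. \<bar>H0 (fst z)\<bar> powr p * ?I (snd z))"
    and 2: "integrable lborel (\<lambda>z. \<bar>jump (fst z)\<bar> powr p * ?I (snd z))"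
    by (rule integrable_tensor[OF H0(2) iI], rule integrable_tensor[OF jump_powr(1) iI])
  have v1: "(LBINT z. \<bar>H0 (fst z)\<bar> powr p * ?I (snd z)) = d * ?K"
    using iterated_integral1[OF 1] d by (simp add: mult.commute)
  have v2: "(LBINT z. \<bar>jump (fst z)\<bar> powr p * ?I (snd z)) = d * (LBINT x. \<bar>jump x\<bar> powr p)"
    using iterated_integral1[OF 2] d by (simp add: mult.commute)
  have m: "(\<lambda>z::real \<times> real. indicator {h<..} (snd z) :: real) \<in> Borel_fun" by measurable
  have "(LBINT z. indicator {h<..} (snd z) * norm (recovery_grad z) powr p) \<le>
      (LBINT z. 2 powr p * (\<bar>H0 (fst z)\<bar> powr p * ?I (snd z) + (1 / d) powr p * (\<bar>jump (fst z)\<bar> powr p * ?I (snd z))))"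
  proof (rule integral_mono)
    show "integrable lborel (\<lambda>z. indicator {h<..} (snd z) * norm (recovery_grad z) powr p)"
      using integrable_mult_bounded[OF recovery_grad_integrable m, of 1] by (simp add: mult.commute indicator_def)
    show "integrable lborel (\<lambda>z. 2 powr p * (\<bar>H0 (fst z)\<bar> powr p * ?I (snd z) + (1 / d) powr p * (\<bar>jump (fst z)\<bar> powr p * ?I (snd z))))"
      using 1 2 by (intro integrable_mult_right Bochner_Integration.integrable_add)
    fix z :: "real \<times> real"
    show "indicator {h<..} (snd z) * norm (recovery_grad z) powr p \<le>
        2 powr p * (\<bar>H0 (fst z)\<bar> powr p * ?I (snd z) + (1 / d) powr p * (\<bar>jump (fst z)\<bar> powr p * ?I (snd z)))"
    proof (cases "h < snd z")
      case True
      then have "(indicator {..h + d} (snd z) :: real) = ?I (snd z)" by (auto simp: indicator_def)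
      with recovery_grad_powr_le[of z]
      have "norm (recovery_grad z) powr p \<le> indicator (subgraph \<gamma>) z * (2 powr p *
        (\<bar>H0 (fst z)\<bar> powr p * ?I (snd z) + (1 / d) powr p * (\<bar>jump (fst z)\<bar> powr p * ?I (snd z))))"
        by (simp only: mult_ac)
      also have "\<dots> \<le> 1 * (2 powr p *
        (\<bar>H0 (fst z)\<bar> powr p * ?I (snd z) + (1 / d) powr p * (\<bar>jump (fst z)\<bar> powr p * ?I (snd z))))"
        by (intro mult_right_mono) (auto simp: indicator_def)
      finally show ?thesis using True by simp
    qed simp
  qed
  also have "\<dots> = 2 powr p * (d * ?K + (1 / d) powr p * (d * (LBINT x. \<bar>jump x\<bar> powr p)))"
    using 1 2 v1 v2 by simp
  also have "\<dots> \<le> 2 powr p * (d * ?K + (1 / d) powr p * (d * (l powr p * ?K)))"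
    using jump_powr(2) d by (intro mult_left_mono add_left_mono) auto
  also have "\<dots> = 2 powr p * (d + d powr (1 - p) * l powr p) * ?K"
  proof -
    have "d powr (1 - p) = d * (1 / d) powr p"
      using d by (simp add: powr_diff powr_divide)
    then show ?thesis by (simp add: algebra_simps)
  qed
  finally show ?thesis .
qed

lemma recovery_close:
  "(LBINT z. indicator (subgraph \<gamma>) z * \<bar>recovery z - base (fst z)\<bar> powr p) \<le>
     k * l powr p * (LBINT t. \<bar>H0 t\<bar> powr p)"
proof -
  let ?I = "indicator {0<..<k} :: real \<Rightarrow> real"
  have iI: "integrable lborel ?I" using hk by simp
  have 1: "integrable lborel (\<lambda>z. \<bar>jump (fst z)\<bar> powr p * ?I (snd z))"
    by (rule integrable_tensor[OF jump_powr(1) iI])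
  have v: "(LBINT z. \<bar>jump (fst z)\<bar> powr p * ?I (snd z)) = k * (LBINT x. \<bar>jump x\<bar> powr p)"
    using iterated_integral1[OF 1] hk by (simp add: mult.commute)
  have le: "indicator (subgraph \<gamma>) z * \<bar>recovery z - base (fst z)\<bar> powr p \<le> \<bar>jump (fst z)\<bar> powr p * ?I (snd z)" for z
  proof (cases "z \<in> subgraph \<gamma>")
    case True
    have "\<bar>ramp (snd z)\<bar> * \<bar>jump (fst z)\<bar> \<le> 1 * \<bar>jump (fst z)\<bar>"
      using ramp_bounds(1,2)[of "snd z"] by (intro mult_right_mono) auto
    then have "\<bar>recovery z - base (fst z)\<bar> powr p \<le> \<bar>jump (fst z)\<bar> powr p"
      using p True by (intro powr_mono2) (auto simp: recovery_def abs_mult)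
    then show ?thesis using True in_subgraph_box[OF True] by simp
  qed simp
  have i: "integrable lborel (\<lambda>z. indicator (subgraph \<gamma>) z * \<bar>recovery z - base (fst z)\<bar> powr p)"
    by (rule integrable_dominated[OF 1])
       (use le recovery_measurable in \<open>auto intro!: AE_I2\<close>)
  have "(LBINT z. indicator (subgraph \<gamma>) z * \<bar>recovery z - base (fst z)\<bar> powr p) \<le>
      k * (LBINT x. \<bar>jump x\<bar> powr p)"
    using integral_mono[OF i 1 le] v by simp
  also have "\<dots> \<le> k * (l powr p * (LBINT t. \<bar>H0 t\<bar> powr p))"
    using jump_powr(2) hk by (intro mult_left_mono) auto
  finally show ?thesis by simp
qed

lemma recovery_lower:
  assumes "z \<in> subgraph \<gamma>" "snd z < h"
  shows "recovery z = base (fst z)" "recovery_grad z = (H0 (fst z), 0)"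
  using assms ramp_bounds(3)[of "snd z"] by (auto simp: recovery_def recovery_grad_def ramp'_def)

lemma recovery_bounded: "\<bar>recovery z\<bar> \<le> 3 * (\<bar>c\<bar> + (LBINT t. \<bar>H0 t\<bar>))"
proof -
  have "\<bar>ramp (snd z)\<bar> * \<bar>jump (fst z)\<bar> \<le> 1 * \<bar>jump (fst z)\<bar>"
    using ramp_bounds(1,2)[of "snd z"] by (intro mult_right_mono) auto
  then have "\<bar>ramp (snd z) * jump (fst z)\<bar> \<le> 2 * (\<bar>c\<bar> + (LBINT t. \<bar>H0 t\<bar>))"
    using jump_bound[of "fst z"] by (simp add: abs_mult)
  then have "\<bar>base (fst z) + ramp (snd z) * jump (fst z)\<bar> \<le> 3 * (\<bar>c\<bar> + (LBINT t. \<bar>H0 t\<bar>))"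
    using base_bound[of "fst z"]
      abs_triangle_ineq[of "base (fst z)" "ramp (snd z) * jump (fst z)"] by (simp add: algebra_simps)
  moreover have "0 \<le> (LBINT t. \<bar>H0 t\<bar>)" by simp
  ultimately show ?thesis by (auto simp: recovery_def indicator_def)
qed

text \<open>Horizontally, the recovery function combines a primitive with a step function. The step part
  disappears against the derivative of a test function, which vanishes at the pinch points for
  \<open>y > h\<close>, while the ramp vanishes for \<open>y \<le> h\<close>. Vertically, the ramp is a primitive.\<close>

lemma recovery_sobolev: "sobolev_rep p (subgraph \<gamma>) recovery recovery_grad"
proof -
  have z: "z \<notin> subgraph \<gamma> \<Longrightarrow> recovery z = 0 \<and> recovery_grad z = 0" for z
    by (simp add: recovery_def recovery_grad_def zero_prod_def)
  have IB: "integrable lborel (\<lambda>z. indicator {0<..<1::real} (fst z) * indicator {0<..<k} (snd z) :: real)"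
    using hk by (intro integrable_tensor) auto
  have i1p: "integrable lborel (\<lambda>z. \<bar>recovery z\<bar> powr p)"
  proof (rule integrable_dominated)
    show "integrable lborel (\<lambda>z. (3 * (\<bar>c\<bar> + (LBINT t. \<bar>H0 t\<bar>))) powr p * (indicator {0<..<1::real} (fst z) * indicator {0<..<k} (snd z)))"
      by (rule integrable_mult_right[OF IB])
    show "AE z in lborel. norm (\<bar>recovery z\<bar> powr p) \<le> norm ((3 * (\<bar>c\<bar> + (LBINT t. \<bar>H0 t\<bar>))) powr p * (indicator {0<..<1::real} (fst z) * indicator {0<..<k} (snd z)))"
    proof (rule AE_I2)
      fix w :: "real \<times> real"
      show "norm (\<bar>recovery w\<bar> powr p) \<le> norm ((3 * (\<bar>c\<bar> + (LBINT t. \<bar>H0 t\<bar>))) powr p * (indicator {0<..<1::real} (fst w) * indicator {0<..<k} (snd w)))"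
        using powr_mono2[OF _ _ recovery_bounded[of w], of p] p z[of w] in_subgraph_box[of w] by (cases "w \<in> subgraph \<gamma>") auto
    qed
  qed (use recovery_measurable in simp)
  have i1: "integrable lborel recovery"
    by (rule integrable_of_powr[OF recovery_measurable(1) _ bounded_subgraph _ i1p[folded real_norm_def]])
       (use p z in auto)
  have i2: "integrable lborel recovery_grad"
    by (rule integrable_of_powr[OF recovery_measurable(2) _ bounded_subgraph _ recovery_grad_integrable])
       (use p z in auto)
  have weak: "(LBINT z. recovery z * deriv_at \<phi> z b) = - (LBINT z. (recovery_grad z \<bullet> b) * \<phi> z)"
    if \<phi>: "\<phi> \<in> test_functions (subgraph \<gamma>)" and b: "b \<in> Basis" for \<phi> b
  proof -
    let ?D = "\<lambda>z. deriv_at \<phi> z b"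
    define f where "f z = (base (fst z) + ramp (snd z) * jump (fst z)) * ?D z" for z
    define g where "g z = (((1 - ramp (snd z)) * H0 (fst z), ramp' (snd z) * jump (fst z)) \<bullet> b) * \<phi> z" for z
    have f: "recovery z * ?D z = f z" and g: "(recovery_grad z \<bullet> b) * \<phi> z = g z" for z
      using test_partial_zero[OF \<phi> b, of z] test_zero[OF \<phi>, of z]
      by (cases "z \<in> subgraph \<gamma>"; simp add: recovery_def recovery_grad_def f_def g_def)+
    have fi: "integrable lborel f" using test_integrable(2)[OF i1 \<phi> b] unfolding f .
    have "integrable lborel (\<lambda>z. recovery_grad z \<bullet> b)" using i2 by simp
    from test_integrable(1)[OF this \<phi>] have gi: "integrable lborel g" unfolding g .
    have sb: "(x, y) \<in> subgraph \<gamma> \<Longrightarrow> 0 < x \<and> x < 1" "(x, y) \<in> subgraph \<gamma> \<Longrightarrow> 0 < y \<and> y < k" for x y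
      using in_subgraph_box[of "(x, y)"] by auto
    consider "b = (1, 0)" | "b = (0, 1)" using b by (auto simp: Basis_prod_def)
    then have "(LBINT z. f z) = - (LBINT z. g z)"
    proof cases
      case 1
      have "(LBINT x. f (x, y)) = - (LBINT x. g (x, y))" for y
      proof -
        let ?\<psi> = "\<lambda>x. \<phi> (x, y)" and ?\<psi>' = "\<lambda>x. deriv_at \<phi> (x, y) (1, 0)"
        have s: "test_slice 1 ?\<psi> ?\<psi>'" by (rule test_slice_1[OF \<phi> sb(1)])
        note I = test_slice_integrals[OF s] and P = primitive_by_parts[OF H0(1) s]
        let ?S = "\<lambda>i::int. base (l * (of_int i + r))"
        have step: "ramp y * (LBINT x. ?S \<lfloor>x / l - r\<rfloor> * ?\<psi>' x) = 0"
        proof (cases "y \<le> h")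
          case True
          then show ?thesis using ramp_bounds(3) by simp
        next
          case False
          have "?\<psi> (l * (of_int i + r)) = 0" for i :: int
            using False pinch[of i] by (intro test_zero[OF \<phi>]) (auto simp: subgraph_def)
          then have "(LBINT x. ?S \<lfloor>x / l - r\<rfloor> * ?\<psi>' x) = 0"
            by (rule integral_step_times_derivative[OF s l, where S = ?S])
          then show ?thesis by (simp only: mult_zero_right)
        qed
        have si: "integrable lborel (\<lambda>x. ?S \<lfloor>x / l - r\<rfloor> * ?\<psi>' x)"
        proof -
          have "(\<lambda>x. ?S \<lfloor>x / l - r\<rfloor>) = (\<lambda>x. jump x + base x)" by (simp add: jump_def node_def)
          then have "(\<lambda>x. ?S \<lfloor>x / l - r\<rfloor>) \<in> Borel_fun" by simp
          from integrable_mult_bounded[OF I(1) this, of "\<bar>c\<bar> + (LBINT t. \<bar>H0 t\<bar>)"] base_bound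
          show ?thesis by (simp add: mult.commute)
        qed
        have "f (x, y) = ((1 - ramp y) * c) * ?\<psi>' x + (1 - ramp y) * (primitive H0 x * ?\<psi>' x) + ramp y * (?S \<lfloor>x / l - r\<rfloor> * ?\<psi>' x)" for x
          unfolding f_def 1 by (simp add: jump_def node_def base_def algebra_simps)
        then have "(LBINT x. f (x, y)) = (LBINT x. ((1 - ramp y) * c) * ?\<psi>' x + (1 - ramp y) * (primitive H0 x * ?\<psi>' x) + ramp y * (?S \<lfloor>x / l - r\<rfloor> * ?\<psi>' x))"
          by (simp only:)
        also have "\<dots> = (LBINT x. ((1 - ramp y) * c) * ?\<psi>' x) + (LBINT x. (1 - ramp y) * (primitive H0 x * ?\<psi>' x)) + (LBINT x. ramp y * (?S \<lfloor>x / l - r\<rfloor> * ?\<psi>' x))"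
          using integrable_mult_right[OF I(1)] integrable_mult_right[OF P(2)] integrable_mult_right[OF si]
          by (simp only: Bochner_Integration.integral_add Bochner_Integration.integrable_add)
        also have "\<dots> = - ((1 - ramp y) * (LBINT x. H0 x * ?\<psi> x))"
          using I(4) P(1) step by simp
        also have "\<dots> = - (LBINT x. (1 - ramp y) * (H0 x * ?\<psi> x))" by simp
        also have "\<dots> = - (LBINT x. g (x, y))" unfolding g_def 1 by (simp add: mult.assoc)
        finally show ?thesis .
      qed
      then show ?thesis using iterated_integral2[OF fi] iterated_integral2[OF gi] by simp
    next
      case 2
      have "(LBINT y. f (x, y)) = - (LBINT y. g (x, y))" for x
      proof -
        let ?\<psi> = "\<lambda>y. \<phi> (x, y)" and ?\<psi>' = "\<lambda>y. deriv_at \<phi> (x, y) (0, 1)"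
        have s: "test_slice k ?\<psi> ?\<psi>'" by (rule test_slice_2[OF \<phi> sb(2)])
        note I = test_slice_integrals[OF s] and P = primitive_by_parts[OF integrable_ramp' s]
        have "f (x, y) = base x * ?\<psi>' y + jump x * (primitive ramp' y * ?\<psi>' y)" for y
          unfolding f_def 2 by (simp add: ramp_def algebra_simps)
        then have "(LBINT y. f (x, y)) = (LBINT y. base x * ?\<psi>' y + jump x * (primitive ramp' y * ?\<psi>' y))"
          by (simp only:)
        also have "\<dots> = (LBINT y. base x * ?\<psi>' y) + (LBINT y. jump x * (primitive ramp' y * ?\<psi>' y))"
          using integrable_mult_right[OF I(1)] integrable_mult_right[OF P(2)]
          by (simp only: Bochner_Integration.integral_add)
        also have "\<dots> = - (jump x * (LBINT y. ramp' y * ?\<psi> y))"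
          using I(4) P(1) by simp
        also have "\<dots> = - (LBINT y. jump x * (ramp' y * ?\<psi> y))" by simp
        also have "\<dots> = - (LBINT y. g (x, y))" unfolding g_def 2 by (simp add: mult_ac)
        finally show ?thesis .
      qed
      then show ?thesis using iterated_integral1[OF fi] iterated_integral1[OF gi] by simp
    qed
    then show ?thesis unfolding f g .
  qed
  show ?thesis
    unfolding sobolev_rep_def
    using recovery_measurable z i1p recovery_grad_integrable i1 i2 weak by simp
qed

end

section \<open>Averaging\<close>

text \<open>Replacing \<open>z i\<close> by its values at the left end points of a fine uniform subdivision costs
  little, by equicontinuity, and leaves finitely many integrals of \<open>k i\<close> over intervals. This plays
  the role of a compact embedding.\<close>

lemma integral_product_tendsto_0:
  fixes k z :: "'i \<Rightarrow> real \<Rightarrow> real"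
  assumes ki: "\<forall>\<^sub>F i in F. integrable lborel (k i) \<and> (\<forall>x. x \<notin> {0<..<1} \<longrightarrow> k i x = 0) \<and> (LBINT x. \<bar>k i x\<bar>) \<le> K"
    and kI: "\<And>a b. 0 \<le> a \<Longrightarrow> a \<le> b \<Longrightarrow> b \<le> 1 \<Longrightarrow> ((\<lambda>i. LBINT x. indicator {a..<b} x * k i x) \<longlongrightarrow> 0) F"
    and zb: "\<forall>\<^sub>F i in F. z i \<in> Borel_fun \<and> (\<forall>x\<in>{0..1}. \<bar>z i x\<bar> \<le> B)"
    and zc: "\<And>e. e > 0 \<Longrightarrow> \<exists>d>0. \<forall>\<^sub>F i in F. \<forall>x\<in>{0..1}. \<forall>y\<in>{0..1}. \<bar>x - y\<bar> < d \<longrightarrow> \<bar>z i x - z i y\<bar> < e"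
  shows "((\<lambda>i. LBINT x. k i x * z i x) \<longlongrightarrow> 0) F"
proof (rule tendstoI)
  fix e :: real assume e: "e > 0"
  define e' where "e' = e / (2 * (\<bar>K\<bar> + 1))"
  have e': "e' > 0" using e by (simp add: e'_def)
  have e'K: "e' * K \<le> e / 2"
  proof -
    have "e' * K \<le> e' * (\<bar>K\<bar> + 1)" using e' by (intro mult_left_mono) auto
    also have "\<dots> = e / 2" using e by (simp add: e'_def field_simps)
    finally show ?thesis .
  qed
  obtain d where d: "d > 0" "\<forall>\<^sub>F i in F. \<forall>x\<in>{0..1}. \<forall>y\<in>{0..1}. \<bar>x - y\<bar> < d \<longrightarrow> \<bar>z i x - z i y\<bar> < e'"
    using zc[OF e'] by blast
  obtain n where n: "1 / real (Suc n) < d"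
    using d(1) reals_Archimedean by (metis inverse_eq_divide)
  define N where "N = Suc n"
  have N: "real N > 0" "1 / real N < d" using n by (auto simp: N_def)
  define A where "A j = {real j / real N..<real (Suc j) / real N}" for j
  define S where "S i = (\<Sum>j<N. z i (real j / real N) * (LBINT x. indicator (A j) x * k i x))" for i
  have S0: "((\<lambda>i. \<Sum>j<N. B * \<bar>LBINT x. indicator (A j) x * k i x\<bar>) \<longlongrightarrow> (\<Sum>j<N. B * \<bar>0\<bar>)) F"
    unfolding A_def by (intro tendsto_sum tendsto_mult tendsto_const tendsto_rabs kI) (auto simp: N_def divide_simps)
  have "\<forall>\<^sub>F i in F. (\<Sum>j<N. B * \<bar>LBINT x. indicator (A j) x * k i x\<bar>) < e / 2"
    using order_tendstoD(2)[OF S0, of "e / 2"] e by simp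
  then show "\<forall>\<^sub>F i in F. dist (LBINT x. k i x * z i x) 0 < e"
    using ki zb d(2)
  proof eventually_elim
    case (elim i)
    then have k: "integrable lborel (k i)" "\<And>x. x \<notin> {0<..<1} \<Longrightarrow> k i x = 0" "(LBINT x. \<bar>k i x\<bar>) \<le> K"
      and zm: "z i \<in> Borel_fun" and zB: "\<And>x. x \<in> {0..1} \<Longrightarrow> \<bar>z i x\<bar> \<le> B" by auto
    have Sb: "\<bar>S i\<bar> \<le> (\<Sum>j<N. B * \<bar>LBINT x. indicator (A j) x * k i x\<bar>)"
      unfolding S_def
    proof (rule order_trans[OF sum_abs sum_mono])
      fix j assume "j \<in> {..<N}"
      then have "\<bar>z i (real j / real N)\<bar> \<le> B" using N by (intro zB) auto
      then show "\<bar>z i (real j / real N) * (LBINT x. indicator (A j) x * k i x)\<bar> \<le>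
          B * \<bar>LBINT x. indicator (A j) x * k i x\<bar>"
        by (simp add: abs_mult mult_right_mono)
    qed
    have Ai: "integrable lborel (\<lambda>x. indicator (A j) x * k i x)" for j
      by (rule integrable_indicator_mult[OF k(1)]) (simp add: A_def)
    define s where "s x = (\<Sum>j<N. z i (real j / real N) * (indicator (A j) x * k i x))" for x
    have si: "integrable lborel s" unfolding s_def[abs_def] using Ai by simp
    have Ss: "S i = (LBINT x. s x)"
      unfolding s_def S_def using Ai by (subst Bochner_Integration.integral_sum) auto
    have pt: "\<bar>k i x * z i x - s x\<bar> \<le> e' * \<bar>k i x\<bar>" for x
    proof (cases "x \<in> {0<..<1}")
      case False
      then have "k i x = 0" using k(2) by blast
      then show ?thesis by (simp add: s_def)
    next
      case True
      define m where "m = nat \<lfloor>real N * x\<rfloor>"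
      have m: "real m \<le> real N * x" "real N * x < real m + 1" using True N by (auto simp: m_def)
      have "real N * x < real N * 1" using True N by (intro mult_strict_left_mono) auto
      then have "real m < real N" using m(1) by linarith
      then have mN: "m < N" by simp
      have mem: "x \<in> A j \<longleftrightarrow> j = m" for j
      proof -
        have "x \<in> A j \<longleftrightarrow> real j \<le> real N * x \<and> real N * x < real (Suc j)"
          using N(1) by (auto simp: A_def field_simps)
        also have "\<dots> \<longleftrightarrow> j = m" using m by (auto simp: of_nat_Suc)
        finally show ?thesis .
      qed
      have "s x = (\<Sum>j<N. if j = m then z i (real j / real N) * k i x else 0)"
        unfolding s_def by (rule sum.cong) (auto simp: indicator_def mem)
      then have "s x = z i (real m / real N) * k i x" using mN by simp
      moreover have "\<bar>z i x - z i (real m / real N)\<bar> \<le> e'"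
      proof -
        have 1: "real m / real N \<le> x" using m(1) N(1) by (simp add: field_simps)
        have "x - real m / real N = (real N * x - real m) / real N" using N(1) by (simp add: diff_divide_distrib)
        also have "\<dots> < 1 / real N" using m(2) N(1) by (intro divide_strict_right_mono) auto
        finally have "x - real m / real N < 1 / real N" .
        then have "\<bar>x - real m / real N\<bar> < d" using 1 N(2) by linarith
        moreover have "real m / real N \<in> {0..1}" using mN N(1) by (auto simp: divide_le_eq)
        moreover have "x \<in> {0..1}" using True by auto
        ultimately show ?thesis using elim(4) by (meson less_imp_le)
      qed
      moreover have "\<bar>t - u\<bar> \<le> e' \<Longrightarrow> \<bar>c * t - u * c\<bar> \<le> e' * \<bar>c\<bar>" for t u c :: real
      proof -
        assume "\<bar>t - u\<bar> \<le> e'"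
        then have "\<bar>t - u\<bar> * \<bar>c\<bar> \<le> e' * \<bar>c\<bar>" by (intro mult_right_mono) auto
        moreover have "c * t - u * c = (t - u) * c" by (simp add: algebra_simps)
        ultimately show ?thesis by (simp add: abs_mult)
      qed
      ultimately show ?thesis by simp
    qed
    have kz: "integrable lborel (\<lambda>x. k i x * z i x)"
    proof (rule integrable_dominated)
      show "integrable lborel (\<lambda>x. B * \<bar>k i x\<bar>)" using k(1) by simp
      show "AE x in lborel. norm (k i x * z i x) \<le> norm (B * \<bar>k i x\<bar>)"
      proof (rule AE_I2)
        fix x
        have B: "B \<ge> 0" using zB[of 0] by auto
        show "norm (k i x * z i x) \<le> norm (B * \<bar>k i x\<bar>)"
        proof (cases "x \<in> {0<..<1}")
          case True
          then have "\<bar>z i x\<bar> * \<bar>k i x\<bar> \<le> B * \<bar>k i x\<bar>" using zB[of x] by (intro mult_right_mono) auto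
          then show ?thesis using B by (simp add: abs_mult mult.commute)
        qed (simp add: k(2))
      qed
    qed (use k(1) zm in auto)
    have "\<bar>(LBINT x. k i x * z i x) - S i\<bar> = \<bar>LBINT x. k i x * z i x - s x\<bar>"
      using kz si by (simp add: Ss)
    also have "\<dots> \<le> (LBINT x. \<bar>k i x * z i x - s x\<bar>)" by (rule integral_abs_bound)
    also have "\<dots> \<le> (LBINT x. e' * \<bar>k i x\<bar>)"
      using kz si k(1) pt by (intro integral_mono) auto
    also have "\<dots> \<le> e' * K" using k(3) e' by (simp add: mult_left_mono)
    finally have "\<bar>(LBINT x. k i x * z i x) - S i\<bar> \<le> e / 2" using e'K by linarith
    then show ?case using Sb elim(1) unfolding dist_real_def by linarith
  qed
qed

lemma periodic_int:
  fixes \<phi> :: "real \<Rightarrow> 'a"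
  assumes "\<And>x. \<phi> (x + L) = \<phi> x"
  shows "\<phi> (x + of_int k * L) = \<phi> x"
proof -
  have nat: "\<phi> (x + of_nat n * L) = \<phi> x" for n :: nat and x
  proof (induction n)
    case (Suc n)
    then show ?case using assms[of "x + of_nat n * L"] by (simp add: algebra_simps)
  qed simp
  show ?thesis
  proof (cases "k \<ge> 0")
    case True
    then show ?thesis using nat[of x "nat k"] by simp
  next
    case False
    then show ?thesis using nat[of "x + of_int k * L" "nat (- k)"] by simp
  qed
qed

text \<open>Only the two incomplete periods at the ends of an interval contribute.\<close>

lemma periodic_mean_zero_bound:
  fixes \<phi> :: "real \<Rightarrow> real"
  assumes m [measurable]: "\<phi> \<in> Borel_fun" and L: "0 < L" and per: "\<And>x. \<phi> (x + L) = \<phi> x"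
    and B: "\<And>x. \<bar>\<phi> x\<bar> \<le> M" and z: "(LBINT x. indicator {0..<L} x * \<phi> x) = 0" and ab: "a \<le> b"
  shows "\<bar>LBINT x. indicator {a..<b} x * \<phi> x\<bar> \<le> 2 * L * M"
proof -
  have M: "M \<ge> 0" using B[of 0] by linarith
  have i: "integrable lborel (\<lambda>x. indicator {u..<v} x * \<phi> x)" for u v
  proof (rule integrable_mult_bounded[OF _ m B])
    show "integrable lborel (indicator {u..<v} :: real \<Rightarrow> real)" by (cases "u \<le> v") auto
  qed
  let ?J = "\<lambda>u v. LBINT x. indicator {u..<v} x * \<phi> x"
  have split: "?J u w = ?J u v + ?J v w" if "u \<le> v" "v \<le> w" for u v w
  proof -
    have "indicator {u..<w} x * \<phi> x = indicator {u..<v} x * \<phi> x + indicator {v..<w} x * \<phi> x" for x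
      using that by (auto simp: indicator_def)
    then show ?thesis using i by (simp only: Bochner_Integration.integral_add)
  qed
  have small: "\<bar>?J u v\<bar> \<le> (v - u) * M" if "u \<le> v" for u v
  proof -
    have "\<bar>?J u v\<bar> \<le> (LBINT x. \<bar>indicator {u..<v} x * \<phi> x\<bar>)" by (rule integral_abs_bound)
    also have "\<dots> \<le> (LBINT x. indicator {u..<v} x * M)"
    proof (rule integral_mono)
      show "integrable lborel (\<lambda>x. indicator {u..<v} x * M)" using that by simp
      show "\<bar>indicator {u..<v} x * \<phi> x\<bar> \<le> indicator {u..<v} x * M" for x
        using B[of x] by (auto simp: indicator_def)
    qed (rule integrable_abs[OF i])
    finally show ?thesis using that by simp
  qed
  have cell: "?J (of_int j * L) (of_int j * L + L) = 0" for j :: int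
  proof -
    have "?J (of_int j * L) (of_int j * L + L) =
        \<bar>1\<bar> *\<^sub>R (LBINT x. indicator {of_int j * L..<of_int j * L + L} (of_int j * L + 1 * x) * \<phi> (of_int j * L + 1 * x))"
      by (rule lborel_integral_real_affine) simp
    also have "\<dots> = (LBINT x. indicator {0..<L} x * \<phi> x)"
      using periodic_int[of \<phi>, OF per, of _ j] by (auto simp: indicator_def add.commute intro!: Bochner_Integration.integral_cong)
    finally show ?thesis using z by simp
  qed
  have cells: "?J (of_int j * L) (of_int j * L + of_nat n * L) = 0" for j :: int and n :: nat
  proof (induction n)
    case (Suc n)
    have "?J (of_int j * L) (of_int j * L + of_nat (Suc n) * L) =
        ?J (of_int j * L) (of_int j * L + of_nat n * L) + ?J (of_int j * L + of_nat n * L) (of_int j * L + of_nat (Suc n) * L)"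
      using L by (intro split) auto
    moreover have "?J (of_int j * L + of_nat n * L) (of_int j * L + of_nat (Suc n) * L) = 0"
      using cell[of "j + int n"] by (simp add: algebra_simps)
    ultimately show ?case using Suc by simp
  qed simp
  define j where "j = \<lceil>a / L\<rceil>"
  define n where "n = \<lfloor>b / L\<rfloor>"
  have "of_int j - 1 < a / L" "a / L \<le> of_int j" "of_int n \<le> b / L" "b / L < of_int n + 1"
    unfolding j_def n_def by linarith+
  then have jn: "of_int j * L - L < a" "a \<le> of_int j * L" "of_int n * L \<le> b" "b < of_int n * L + L"
    using L by (simp_all add: field_simps)
  show ?thesis
  proof (cases "j \<le> n")
    case True
    then have jn': "of_int j * L \<le> of_int n * L" using L by simp
    have "?J a b = ?J a (of_int j * L) + ?J (of_int j * L) (of_int n * L) + ?J (of_int n * L) b"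
      using split[of a "of_int j * L" b] split[of "of_int j * L" "of_int n * L" b] jn jn' by linarith
    moreover have "?J (of_int j * L) (of_int n * L) = 0"
      using cells[of j "nat (n - j)"] True by (simp add: algebra_simps)
    moreover have "(of_int j * L - a) * M \<le> L * M" "(b - of_int n * L) * M \<le> L * M"
      using jn M by (intro mult_right_mono; simp)+
    ultimately show ?thesis
      using small[of a "of_int j * L"] small[of "of_int n * L" b] jn by (simp add: mult.assoc)
  next
    case False
    then have "of_int n * L + L \<le> of_int j * L" using L by (simp flip: distrib_right[of _ 1 L, simplified])
    then have "(b - a) * M \<le> (2 * L) * M" using jn M L by (intro mult_right_mono) auto
    then show ?thesis using small[OF ab] by simp
  qed
qed

lemma rapid_oscillation_bound:
  fixes \<phi> :: "real \<Rightarrow> real"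
  assumes m: "\<phi> \<in> Borel_fun" and L: "0 < L" and per: "\<And>x. \<phi> (x + L) = \<phi> x"
    and B: "\<And>x. \<bar>\<phi> x\<bar> \<le> M" and z: "(LBINT x. indicator {0..<L} x * \<phi> x) = 0" and ab: "a \<le> b" and s: "0 < s"
  shows "\<bar>LBINT x. indicator {a..<b} x * \<phi> (x / s)\<bar> \<le> s * (2 * L * M)"
proof -
  have "(LBINT x. indicator {a..<b} x * \<phi> (x / s)) =
      \<bar>s\<bar> *\<^sub>R (LBINT x. indicator {a..<b} (0 + s * x) * \<phi> ((0 + s * x) / s))"
    using s by (intro lborel_integral_real_affine) auto
  also have "\<dots> = s * (LBINT x. indicator {a / s..<b / s} x * \<phi> x)"
  proof -
    have "indicator {a..<b} (0 + s * x) * \<phi> ((0 + s * x) / s) = indicator {a / s..<b / s} x * \<phi> x" for x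
      using s by (auto simp: indicator_def field_simps)
    then have "(LBINT x. indicator {a..<b} (0 + s * x) * \<phi> ((0 + s * x) / s)) =
        (LBINT x. indicator {a / s..<b / s} x * \<phi> x)" by (simp only:)
    then show ?thesis using s by (simp only: abs_of_pos real_scaleR_def)
  qed
  finally show ?thesis
    using periodic_mean_zero_bound[OF m L per B z, of "a / s" "b / s"] ab s
    by (simp add: abs_mult divide_right_mono)
qed

lemma lower_semicontinuous_borel:
  fixes g :: "real \<Rightarrow> real"
  assumes "lower_semicontinuous g"
  shows "g \<in> Borel_fun"
proof -
  have "open {x. a < g x}" for a
    unfolding open_subopen[of "{x. a < g x}"]
  proof
    fix x assume "x \<in> {x. a < g x}"
    then have "\<forall>\<^sub>F y in nhds x. a < g y" using assms by (auto simp: lower_semicontinuous_def)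
    then show "\<exists>T. open T \<and> x \<in> T \<and> T \<subseteq> {x. a < g x}" by (auto simp: eventually_nhds)
  qed
  then show ?thesis by (subst borel_measurable_iff_greater) auto
qed

section \<open>Vertical rescaling\<close>

definition vscale :: "real \<Rightarrow> real \<times> real \<Rightarrow> real \<times> real" where
  "vscale e z = (fst z, e * snd z)"

lemma rescale_vscale: "rescale e v = (\<lambda>z. v (vscale e z))"
  by (auto simp: rescale_def vscale_def)

lemma vscale_borel [measurable]: "vscale e \<in> Borel_fun"
  unfolding vscale_def[abs_def] by measurable

lemma nn_integral_vscale:
  assumes f [measurable]: "f \<in> Borel_fun" and e: "e > 0"
  shows "(\<integral>\<^sup>+z. f (vscale e z) \<partial>lborel) = ennreal (1 / e) * (\<integral>\<^sup>+z. f z \<partial>lborel)"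
proof -
  have sl: "(\<lambda>y. f (x, y)) \<in> Borel_fun" for x
  proof -
    have "(\<lambda>y::real. (x, y)) \<in> Borel_fun"
      by (auto intro!: borel_measurable_continuous_onI continuous_intros)
    from measurable_compose[OF this f] show ?thesis .
  qed
  have eq: "(\<integral>\<^sup>+y. f (x, e * y) \<partial>lborel) = ennreal (1 / e) * (\<integral>\<^sup>+y. f (x, y) \<partial>lborel)" for x
  proof -
    have "(\<integral>\<^sup>+y. f (x, y) \<partial>lborel) = ennreal e * (\<integral>\<^sup>+y. f (x, e * y) \<partial>lborel)"
      using nn_integral_real_affine[OF sl[of x], of e 0] e by simp
    then have "ennreal (1 / e) * (\<integral>\<^sup>+y. f (x, y) \<partial>lborel) = (ennreal (1 / e) * ennreal e) * (\<integral>\<^sup>+y. f (x, e * y) \<partial>lborel)"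
      by (simp only: mult.assoc)
    also have "ennreal (1 / e) * ennreal e = 1" using e by (simp flip: ennreal_mult)
    finally show ?thesis by simp
  qed
  have fm: "(\<lambda>x. \<integral>\<^sup>+y. f (x, y) \<partial>lborel) \<in> borel_measurable lborel"
  proof -
    have "f \<in> borel_measurable (lborel \<Otimes>\<^sub>M lborel)" unfolding lborel_prod by simp
    then show ?thesis by (rule lborel.borel_measurable_nn_integral_fst)
  qed
  have m: "(\<lambda>z. f (vscale e z)) \<in> Borel_fun" by measurable
  have "(\<integral>\<^sup>+z. f (vscale e z) \<partial>lborel) = (\<integral>\<^sup>+x. ennreal (1 / e) * (\<integral>\<^sup>+y. f (x, y) \<partial>lborel) \<partial>lborel)"
    unfolding iterated_nn_integral1[OF m] by (simp add: vscale_def eq)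
  also have "\<dots> = ennreal (1 / e) * (\<integral>\<^sup>+z. f z \<partial>lborel)"
    unfolding iterated_nn_integral1[OF f] by (rule nn_integral_cmult[OF fm])
  finally show ?thesis .
qed

lemma integrable_vscale:
  fixes f :: "real \<times> real \<Rightarrow> 'b::{banach, second_countable_topology}"
  assumes f: "integrable lborel f" and e: "e > 0"
  shows "integrable lborel (\<lambda>z. f (vscale e z))"
proof -
  have m [measurable]: "f \<in> Borel_fun" using f by auto
  have "(\<integral>\<^sup>+z. ennreal (norm (f (vscale e z))) \<partial>lborel) = ennreal (1 / e) * (\<integral>\<^sup>+z. ennreal (norm (f z)) \<partial>lborel)"
    by (rule nn_integral_vscale[OF _ e]) measurable
  also have "\<dots> < \<infinity>" using f by (auto simp: integrable_iff_bounded ennreal_mult_less_top)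
  finally show ?thesis unfolding integrable_iff_bounded by simp
qed

lemma integral_vscale:
  fixes f :: "real \<times> real \<Rightarrow> real"
  assumes f: "integrable lborel f" and e: "e > 0"
  shows "(LBINT z. f (vscale e z)) = (1 / e) * (LBINT z. f z)"
proof -
  have "(LBINT y. f (x, e * y)) = (1 / e) * (LBINT y. f (x, y))" for x
    using lborel_integral_real_affine[of e "\<lambda>y. f (x, y)" 0] e by simp
  then show ?thesis
    using iterated_integral1[OF integrable_vscale[OF f e]] iterated_integral1[OF f] by (simp add: vscale_def)
qed

lemma AE_vscale:
  assumes "AE z in lborel. P z" and e: "e > 0"
  shows "AE z in lborel. P (vscale e z)"
proof -
  obtain N where N: "N \<in> null_sets lborel" "{z \<in> space lborel. \<not> P z} \<subseteq> N"
    using assms(1) by (auto simp: eventually_ae_filter)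
  have Nm [measurable]: "N \<in> sets borel" using N(1) by auto
  have "(\<integral>\<^sup>+z. indicator N (vscale e z) \<partial>lborel) = ennreal (1 / e) * (\<integral>\<^sup>+z. indicator N z \<partial>lborel)"
    by (rule nn_integral_vscale[OF _ e]) measurable
  also have "\<dots> = 0" using null_setsD1[OF N(1)] by simp
  finally have "AE z in lborel. (indicator N (vscale e z) :: ennreal) = 0"
    by (subst (asm) nn_integral_0_iff_AE) auto
  then show ?thesis
    by eventually_elim (use N(2) in \<open>auto simp: indicator_def split: if_splits\<close>)
qed

lemma borel_rep_vscale:
  fixes v F :: "real \<times> real \<Rightarrow> 'b::euclidean_space"
  assumes "borel_rep U v F" "e > 0"
  shows "borel_rep (vscale e -` U) (\<lambda>z. v (vscale e z)) (\<lambda>z. F (vscale e z))"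
proof -
  have F: "F \<in> Borel_fun" "\<And>z. z \<notin> U \<Longrightarrow> F z = 0" "AE z in lborel. z \<in> U \<longrightarrow> v z = F z"
    using assms(1) unfolding borel_rep_def by blast+
  show ?thesis
    unfolding borel_rep_def vimage_def mem_Collect_eq
    using F(2) measurable_compose[OF vscale_borel F(1)] AE_vscale[OF F(3) assms(2)] by blast
qed

lemma test_vscale:
  assumes \<phi>: "\<phi> \<in> test_functions (vscale e -` U)" and e: "e > 0"
  shows "(\<lambda>z. \<phi> (vscale (1 / e) z)) \<in> test_functions U"
    and "frechet_derivative (\<lambda>z. \<phi> (vscale (1 / e) z)) (at z) (1, 0) = deriv_at \<phi> (vscale (1 / e) z) (1, 0)"
    and "frechet_derivative (\<lambda>z. \<phi> (vscale (1 / e) z)) (at z) (0, 1) = (1 / e) * deriv_at \<phi> (vscale (1 / e) z) (0, 1)"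
proof -
  let ?A = "vscale (1 / e)"
  have lin: "bounded_linear ?A"
    unfolding vscale_def[abs_def]
    by (intro bounded_linear_Pair bounded_linear_fst bounded_linear_const_mult bounded_linear_snd)
  have inv: "vscale e (?A z) = z" "?A (vscale e z) = z" for z using e by (auto simp: vscale_def)
  have ce: "continuous_on UNIV (vscale e)"
    unfolding vscale_def[abs_def] by (intro continuous_intros)
  let ?K = "closure {z. \<phi> z \<noteq> 0}"
  have K: "compact ?K" "?K \<subseteq> vscale e -` U" using \<phi> by (auto simp: test_functions_def)
  show "(\<lambda>z. \<phi> (?A z)) \<in> test_functions U"
  proof (rule test_functionsI)
    show "Ck n (\<lambda>z. \<phi> (?A z))" for n
    proof (rule Ck_compose_diagonal[OF lin, where d = "\<lambda>b. if b = (1, 0) then 1 else 1 / e"])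
      show "b \<in> Basis \<Longrightarrow> ?A b = (if b = (1, 0) then 1 else 1 / e) *\<^sub>R b" for b
        by (auto simp: Basis_prod_def vscale_def)
      show "Ck n \<phi>" using \<phi> by (simp add: test_functions_def)
    qed
    show "compact (vscale e ` ?K)" using K(1) ce by (intro compact_continuous_image) (auto intro: continuous_on_subset)
    show "vscale e ` ?K \<subseteq> U" using K(2) by auto
    show "z \<in> vscale e ` ?K" if "\<phi> (?A z) \<noteq> 0" for z
    proof -
      have "?A z \<in> ?K" using that closure_subset[of "{z. \<phi> z \<noteq> 0}"] by blast
      then show ?thesis using inv(1)[of z] by (metis imageI)
    qed
  qed
  have D: "deriv_at (\<lambda>z. \<phi> (?A z)) z = (\<lambda>h. deriv_at \<phi> (?A z) (?A h))"
    by (rule frechet_derivative_at[OF has_derivative_compose[OF bounded_linear_imp_has_derivative[OF lin] test_derivative[OF \<phi>]], symmetric])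
  have l: "linear (deriv_at \<phi> (?A z))"
    using test_derivative[OF \<phi>] has_derivative_linear by blast
  show "deriv_at (\<lambda>z. \<phi> (?A z)) z (1, 0) = deriv_at \<phi> (?A z) (1, 0)"
    unfolding D by (simp add: vscale_def)
  have "?A (0, 1) = (1 / e) *\<^sub>R (0, 1)" by (simp add: vscale_def)
  then show "deriv_at (\<lambda>z. \<phi> (?A z)) z (0, 1) = (1 / e) * deriv_at \<phi> (?A z) (0, 1)"
    unfolding D using linear_cmul[OF l, of "1 / e" "(0, 1)"] by (simp only: real_scaleR_def)
qed

lemma sobolev_rep_vscale:
  assumes S: "sobolev_rep p U F H" and e: "e > 0"
  shows "sobolev_rep p (vscale e -` U) (\<lambda>z. F (vscale e z)) (\<lambda>z. vscale e (H (vscale e z)))"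
proof -
  note S' = S[unfolded sobolev_rep_def]
  have Fm [measurable]: "F \<in> Borel_fun" and Hm [measurable]: "H \<in> Borel_fun" using S' by auto
  have HH: "integrable lborel (\<lambda>z. H (vscale e z))" using S' integrable_vscale[OF _ e] by auto
  have lin: "bounded_linear (vscale e)"
    unfolding vscale_def[abs_def]
    by (intro bounded_linear_Pair bounded_linear_fst bounded_linear_const_mult bounded_linear_snd)
  have i1: "integrable lborel (\<lambda>z. vscale e (H (vscale e z)))"
    by (rule integrable_bounded_linear[OF lin HH])
  have Hp: "integrable lborel (\<lambda>z. norm (H z) powr p)" using S' by auto
  have i2: "integrable lborel (\<lambda>z. norm (vscale e (H (vscale e z))) powr p)" if p: "p \<ge> 0"
  proof -
    obtain B where B: "B > 0" "\<And>z. norm (vscale e z) \<le> norm z * B"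
      using bounded_linear.pos_bounded[OF lin] by blast
    show ?thesis
    proof (rule integrable_dominated)
      show "integrable lborel (\<lambda>z. B powr p * norm (H (vscale e z)) powr p)"
        using integrable_vscale[OF Hp e] by simp
      show "AE z in lborel. norm (norm (vscale e (H (vscale e z))) powr p) \<le> norm (B powr p * norm (H (vscale e z)) powr p)"
      proof (rule AE_I2)
        fix z
        have "norm (vscale e (H (vscale e z))) powr p \<le> (norm (H (vscale e z)) * B) powr p"
          using p B(2) by (intro powr_mono2) auto
        then show "norm (norm (vscale e (H (vscale e z))) powr p) \<le> norm (B powr p * norm (H (vscale e z)) powr p)"
          using B(1) by (simp add: powr_mult mult.commute)
      qed
    qed simp
  qed
  have i2': "integrable lborel (\<lambda>z. norm (vscale e (H (vscale e z))) powr p)" if p: "p < 0"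
  proof -
    obtain B where B: "B > 0" "\<And>z. norm (vscale (1 / e) z) \<le> norm z * B"
    proof -
      have "bounded_linear (vscale (1 / e))"
        unfolding vscale_def[abs_def]
        by (intro bounded_linear_Pair bounded_linear_fst bounded_linear_const_mult bounded_linear_snd)
      then show thesis using bounded_linear.pos_bounded that by blast
    qed
    show ?thesis
    proof (rule integrable_dominated)
      show "integrable lborel (\<lambda>z. B powr (- p) * norm (H (vscale e z)) powr p)"
        using integrable_vscale[OF Hp e] by simp
      show "AE z in lborel. norm (norm (vscale e (H (vscale e z))) powr p) \<le> norm (B powr (- p) * norm (H (vscale e z)) powr p)"
      proof (rule AE_I2)
        fix z
        let ?h = "H (vscale e z)"
        show "norm (norm (vscale e ?h) powr p) \<le> norm (B powr (- p) * norm ?h powr p)"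
        proof (cases "?h = 0")
          case False
          have "norm ?h \<le> norm (vscale e ?h) * B" using B(2)[of "vscale e ?h"] e by (simp add: vscale_def)
          moreover have "norm ?h > 0" using False by simp
          ultimately have "(norm (vscale e ?h) * B) powr p \<le> norm ?h powr p"
            using p by (intro powr_mono2') auto
          then have "B powr (- p) * ((norm (vscale e ?h) * B) powr p) \<le> B powr (- p) * norm ?h powr p"
            by (intro mult_left_mono) auto
          moreover have "B powr (- p) * ((norm (vscale e ?h) * B) powr p) = norm (vscale e ?h) powr p"
            using B(1) by (simp add: powr_mult powr_minus)
          ultimately show ?thesis by simp
        qed (simp add: vscale_def)
      qed
    qed simp
  qed
  have weak: "(LBINT z. F (vscale e z) * deriv_at \<phi> z b) =
      - (LBINT z. (vscale e (H (vscale e z)) \<bullet> b) * \<phi> z)"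
    if \<phi>: "\<phi> \<in> test_functions (vscale e -` U)" and b: "b \<in> Basis" for \<phi> b
  proof -
    let ?\<psi> = "\<lambda>z. \<phi> (vscale (1 / e) z)"
    note T = test_vscale[OF \<phi> e]
    have inv: "vscale (1 / e) (vscale e z) = z" for z using e by (auto simp: vscale_def)
    have F: "integrable lborel F" and Hb: "integrable lborel (\<lambda>z. H z \<bullet> b)" using S' by auto
    define s where "s = (if b = (1, 0) then 1 else e)"
    have b': "b = (1, 0) \<or> b = (0, 1)" using b by (auto simp: Basis_prod_def)
    have D: "deriv_at \<phi> z b = s * deriv_at ?\<psi> (vscale e z) b" for z
      using b' e T(2,3)[of "vscale e z"] by (auto simp: inv s_def)
    have Hs: "vscale e h \<bullet> b = s * (h \<bullet> b)" for h
      using b' by (auto simp: vscale_def s_def inner_prod_def)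
    have "(LBINT z. F (vscale e z) * deriv_at \<phi> z b) =
        s * (LBINT z. F (vscale e z) * deriv_at ?\<psi> (vscale e z) b)"
      unfolding D by (simp add: mult.left_commute)
    also have "\<dots> = s * ((1 / e) * (LBINT z. F z * deriv_at ?\<psi> z b))"
      using integral_vscale[OF test_integrable(2)[OF F T(1) b] e] by simp
    also have "(LBINT z. F z * deriv_at ?\<psi> z b) = - (LBINT z. (H z \<bullet> b) * ?\<psi> z)"
      using S' T(1) b by blast
    also have "s * ((1 / e) * - (LBINT z. (H z \<bullet> b) * ?\<psi> z)) = - (s * ((1 / e) * (LBINT z. (H z \<bullet> b) * ?\<psi> z)))" by simp
    also have "(1 / e) * (LBINT z. (H z \<bullet> b) * ?\<psi> z) = (LBINT z. (H (vscale e z) \<bullet> b) * \<phi> z)"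
      using integral_vscale[OF test_integrable(1)[OF Hb T(1)] e] by (simp add: inv)
    also have "s * (LBINT z. (H (vscale e z) \<bullet> b) * \<phi> z) = (LBINT z. (vscale e (H (vscale e z)) \<bullet> b) * \<phi> z)"
      unfolding Hs by (simp add: mult.assoc)
    finally show ?thesis .
  qed
  have "integrable lborel (\<lambda>z. norm (vscale e (H (vscale e z))) powr p)"
    using i2 i2' by (cases "p \<ge> 0") auto
  moreover have "(\<lambda>z. F (vscale e z)) \<in> Borel_fun"
    "(\<lambda>z. vscale e (H (vscale e z))) \<in> Borel_fun" by measurable
  moreover have "integrable lborel (\<lambda>z. F (vscale e z))" "integrable lborel (\<lambda>z. \<bar>F (vscale e z)\<bar> powr p)"
    using S' integrable_vscale[OF _ e, of F] integrable_vscale[OF _ e, of "\<lambda>z. \<bar>F z\<bar> powr p"] by auto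
  moreover have "\<forall>z. z \<notin> vscale e -` U \<longrightarrow> F (vscale e z) = 0 \<and> vscale e (H (vscale e z)) = 0"
    using S' by (auto simp: vscale_def zero_prod_def)
  ultimately show ?thesis
    unfolding sobolev_rep_def using i1 weak by (intro conjI ballI) assumption+
qed

section \<open>Unfolding\<close>

text \<open>The point at which an unfolded function is evaluated, with the cell index written as a floor.\<close>

definition unfold_point :: "real \<Rightarrow> real \<Rightarrow> real \<Rightarrow> real \<times> real \<times> real \<Rightarrow> real \<times> real" where
  "unfold_point L a e w = (a * of_int \<lfloor>fst w / (a * L)\<rfloor> * L + a * fst (snd w), e * snd (snd w))"

lemma unfold_point_borel [measurable]: "unfold_point L a e \<in> Borel_fun"
  unfolding unfold_point_def[abs_def] by measurable

text \<open>Two points lie in the same cell when their cell indices agree. Exchanging the roles of the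
  point \<open>x\<close> and of the unfolded point \<open>s\<close> by Tonelli's theorem thus counts every \<open>s\<close> with the length
  of one cell.\<close>

lemma nn_integral_unfold_le:
  fixes f :: "real \<times> real \<Rightarrow> ennreal"
  assumes f [measurable]: "f \<in> Borel_fun" and L: "0 < L" and a: "0 < a" and e: "0 < e"
  shows "(\<integral>\<^sup>+w. indicator {0<..<L} (fst (snd w)) * f (unfold_point L a e w) \<partial>lborel) \<le>
    ennreal (L / e) * (\<integral>\<^sup>+z. f z \<partial>lborel)"
proof -
  let ?l = "a * L"
  have l: "?l > 0" using a L by simp
  define \<Phi> where "\<Phi> s = (\<integral>\<^sup>+t. f (s, t) \<partial>lborel)" for s
  have \<Phi>m [measurable]: "\<Phi> \<in> Borel_fun"
  proof -
    have "f \<in> borel_measurable (lborel \<Otimes>\<^sub>M lborel)" unfolding lborel_prod by simp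
    from lborel.borel_measurable_nn_integral_fst[OF this] show ?thesis by (simp add: \<Phi>_def[abs_def])
  qed
  have sl: "(\<lambda>y. f (x, y)) \<in> Borel_fun" for x
  proof -
    have "(\<lambda>y::real. (x, y)) \<in> Borel_fun"
      by (auto intro!: borel_measurable_continuous_onI continuous_intros)
    from measurable_compose[OF this f] show ?thesis .
  qed
  have inv: "ennreal (1 / c) * (ennreal c * X) = X" if "c > 0" for c and X :: ennreal
  proof -
    have "ennreal (1 / c) * ennreal c = 1" using that by (simp flip: ennreal_mult)
    then show ?thesis by (simp flip: mult.assoc)
  qed
  have in1: "(\<integral>\<^sup>+t. f (s, e * t) \<partial>lborel) = ennreal (1 / e) * \<Phi> s" for s
    using nn_integral_real_affine[OF sl[of s], of e 0] e inv[OF e, of "\<integral>\<^sup>+t. f (s, e * t) \<partial>lborel"] by (simp add: \<Phi>_def)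
  define g where "g w = indicator {0<..<L} (fst (snd w)) * f (unfold_point L a e w)" for w :: "real \<times> real \<times> real"
  have gm [measurable]: "g \<in> Borel_fun" unfolding g_def[abs_def] by measurable
  define same where "same x s = (if real_of_int \<lfloor>x / ?l\<rfloor> = real_of_int \<lfloor>s / ?l\<rfloor> then 1 else 0 :: ennreal)" for x s
  have same_pair: "(\<lambda>z. same (fst z) (snd z)) \<in> borel_measurable (borel :: (real \<times> real) measure)"
    unfolding same_def by measurable
  have same1: "(\<lambda>s. same x s) \<in> Borel_fun" and same2: "(\<lambda>x. same x s) \<in> Borel_fun" for x s
    unfolding same_def by measurable
  have inner: "(\<integral>\<^sup>+v. g (x, v) \<partial>lborel) \<le> ennreal (1 / e) * (ennreal (1 / a) * (\<integral>\<^sup>+s. same x s * \<Phi> s \<partial>lborel))" for x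
  proof -
    let ?k = "a * of_int \<lfloor>x / ?l\<rfloor> * L"
    have gx: "(\<lambda>v. g (x, v)) \<in> Borel_fun"
    proof -
      have "(\<lambda>v::real \<times> real. (x, v)) \<in> Borel_fun"
        by (auto intro!: borel_measurable_continuous_onI continuous_intros)
      from measurable_compose[OF this gm] show ?thesis .
    qed
    have "(\<integral>\<^sup>+v. g (x, v) \<partial>lborel) = (\<integral>\<^sup>+y1. \<integral>\<^sup>+y2. indicator {0<..<L} y1 * f (?k + a * y1, e * y2) \<partial>lborel \<partial>lborel)"
      unfolding iterated_nn_integral1[OF gx] by (simp add: g_def unfold_point_def)
    also have "\<dots> = (\<integral>\<^sup>+y1. ennreal (1 / e) * (indicator {0<..<L} y1 * \<Phi> (?k + a * y1)) \<partial>lborel)"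
    proof (rule nn_integral_cong)
      fix y1
      have "(\<integral>\<^sup>+y2. indicator {0<..<L} y1 * f (?k + a * y1, e * y2) \<partial>lborel) =
          indicator {0<..<L} y1 * (ennreal (1 / e) * \<Phi> (?k + a * y1))"
        unfolding in1[symmetric]
      proof (rule nn_integral_cmult)
        have "(\<lambda>y. f (?k + a * y1, e * y)) \<in> Borel_fun"
          by (rule measurable_compose[OF _ sl]) simp
        then show "(\<lambda>y2. f (?k + a * y1, e * y2)) \<in> borel_measurable lborel" by simp
      qed
      then show "(\<integral>\<^sup>+y2. indicator {0<..<L} y1 * f (?k + a * y1, e * y2) \<partial>lborel) =
          ennreal (1 / e) * (indicator {0<..<L} y1 * \<Phi> (?k + a * y1))" by (simp only: mult.left_commute)
    qed
    also have "\<dots> = ennreal (1 / e) * (\<integral>\<^sup>+y1. indicator {0<..<L} y1 * \<Phi> (?k + a * y1) \<partial>lborel)"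
      by (rule nn_integral_cmult) measurable
    finally have eq1: "(\<integral>\<^sup>+v. g (x, v) \<partial>lborel) = ennreal (1 / e) * (\<integral>\<^sup>+y1. indicator {0<..<L} y1 * \<Phi> (?k + a * y1) \<partial>lborel)" .
    have "(\<integral>\<^sup>+y1. indicator {0<..<L} y1 * \<Phi> (?k + a * y1) \<partial>lborel) \<le> (\<integral>\<^sup>+y1. same x (?k + a * y1) * \<Phi> (?k + a * y1) \<partial>lborel)"
    proof (intro nn_integral_mono mult_right_mono)
      fix y1
      have "\<lfloor>(?k + a * y1) / ?l\<rfloor> = \<lfloor>x / ?l\<rfloor>" if y1: "0 < y1" "y1 < L"
      proof -
        have "(?k + a * y1) / ?l = of_int \<lfloor>x / ?l\<rfloor> + y1 / L"
          using a L by (simp add: add_divide_distrib)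
        moreover have "\<lfloor>of_int \<lfloor>x / ?l\<rfloor> + y1 / L\<rfloor> = \<lfloor>x / ?l\<rfloor>"
          using y1 L by (intro floor_unique) auto
        ultimately show ?thesis by (simp only:)
      qed
      then show "indicator {0<..<L} y1 \<le> same x (?k + a * y1)" by (auto simp: same_def indicator_def)
    qed simp
    also have "(\<integral>\<^sup>+y1. same x (?k + a * y1) * \<Phi> (?k + a * y1) \<partial>lborel) = ennreal (1 / a) * (\<integral>\<^sup>+s. same x s * \<Phi> s \<partial>lborel)"
    proof -
      have m: "(\<lambda>s. same x s * \<Phi> s) \<in> Borel_fun"
        by (rule borel_measurable_times_ennreal[OF same1 \<Phi>m])
      have a0: "a \<noteq> 0" using a by simp
      have "(\<integral>\<^sup>+s. same x s * \<Phi> s \<partial>lborel) = ennreal \<bar>a\<bar> * (\<integral>\<^sup>+y1. same x (?k + a * y1) * \<Phi> (?k + a * y1) \<partial>lborel)"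
        by (rule nn_integral_real_affine[OF m a0])
      then show ?thesis unfolding abs_of_pos[OF a] by (simp only: inv[OF a])
    qed
    finally have "(\<integral>\<^sup>+y1. indicator {0<..<L} y1 * \<Phi> (?k + a * y1) \<partial>lborel) \<le> ennreal (1 / a) * (\<integral>\<^sup>+s. same x s * \<Phi> s \<partial>lborel)" .
    then show ?thesis unfolding eq1 by (rule mult_left_mono) simp
  qed
  define K where "K z = same (fst z) (snd z) * \<Phi> (snd z)" for z :: "real \<times> real"
  have Km: "K \<in> Borel_fun" unfolding K_def[abs_def] by (intro borel_measurable_times_ennreal same_pair) measurable
  have K1m: "(\<lambda>x. \<integral>\<^sup>+s. K (x, s) \<partial>lborel) \<in> borel_measurable lborel"
  proof -
    have "K \<in> borel_measurable (lborel \<Otimes>\<^sub>M lborel)" unfolding lborel_prod using Km by simp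
    then show ?thesis by (rule lborel.borel_measurable_nn_integral_fst)
  qed
  have len: "(\<integral>\<^sup>+x. same x s \<partial>lborel) = ennreal ?l" for s
  proof -
    let ?n = "of_int \<lfloor>s / ?l\<rfloor> :: real"
    have "same x s = indicator {?l * ?n..<?l * (?n + 1)} x" for x
    proof -
      have "\<lfloor>x / ?l\<rfloor> = \<lfloor>s / ?l\<rfloor> \<longleftrightarrow> ?n \<le> x / ?l \<and> x / ?l < ?n + 1" using floor_eq_iff[of "x / ?l" "\<lfloor>s / ?l\<rfloor>"] by blast
      also have "\<dots> \<longleftrightarrow> x \<in> {?l * ?n..<?l * (?n + 1)}"
        using l by (simp add: pos_le_divide_eq pos_divide_less_eq mult.commute)
      finally show ?thesis by (simp add: same_def indicator_def)
    qed
    then show ?thesis using l by (simp add: algebra_simps)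
  qed
  have "(\<integral>\<^sup>+w. g w \<partial>lborel) = (\<integral>\<^sup>+x. \<integral>\<^sup>+v. g (x, v) \<partial>lborel \<partial>lborel)" by (rule iterated_nn_integral1[OF gm])
  also have "\<dots> \<le> (\<integral>\<^sup>+x. ennreal (1 / e) * (ennreal (1 / a) * (\<integral>\<^sup>+s. K (x, s) \<partial>lborel)) \<partial>lborel)"
    using inner by (intro nn_integral_mono) (simp add: K_def)
  also have "\<dots> = ennreal (1 / e) * (ennreal (1 / a) * (\<integral>\<^sup>+x. \<integral>\<^sup>+s. K (x, s) \<partial>lborel \<partial>lborel))"
    using K1m by (simp add: nn_integral_cmult)
  also have "(\<integral>\<^sup>+x. \<integral>\<^sup>+s. K (x, s) \<partial>lborel \<partial>lborel) = (\<integral>\<^sup>+s. \<integral>\<^sup>+x. K (x, s) \<partial>lborel \<partial>lborel)"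
    using iterated_nn_integral1[OF Km] iterated_nn_integral2[OF Km] by simp
  also have "\<dots> = (\<integral>\<^sup>+s. ennreal ?l * \<Phi> s \<partial>lborel)"
  proof (rule nn_integral_cong)
    fix s
    have "(\<lambda>x. same x s) \<in> borel_measurable lborel" using same2 by simp
    then have "(\<integral>\<^sup>+x. same x s * \<Phi> s \<partial>lborel) = (\<integral>\<^sup>+x. same x s \<partial>lborel) * \<Phi> s"
      by (rule nn_integral_multc)
    then show "(\<integral>\<^sup>+x. K (x, s) \<partial>lborel) = ennreal ?l * \<Phi> s" by (simp add: K_def len)
  qed
  also have "\<dots> = ennreal ?l * (\<integral>\<^sup>+z. f z \<partial>lborel)"
    unfolding iterated_nn_integral1[OF f] \<Phi>_def[symmetric] by (rule nn_integral_cmult) simp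
  also have "ennreal (1 / e) * (ennreal (1 / a) * (ennreal ?l * (\<integral>\<^sup>+z. f z \<partial>lborel))) =
      (ennreal (1 / e) * (ennreal (1 / a) * ennreal ?l)) * (\<integral>\<^sup>+z. f z \<partial>lborel)"
    by (simp only: mult.assoc)
  also have "ennreal (1 / e) * (ennreal (1 / a) * ennreal ?l) = ennreal (L / e)"
    using a e L by (simp flip: ennreal_mult)
  finally show ?thesis by (simp add: g_def)
qed

lemma cell_index_floor:
  assumes "0 < L"
  shows "cell_index L x = \<lfloor>x / L\<rfloor>"
  unfolding cell_index_def
proof (rule the_equality)
  have eq: "x - of_int k * L \<in> {0..<L} \<longleftrightarrow> of_int k \<le> x / L \<and> x / L < of_int k + 1" for k
    using assms by (auto simp: field_simps)
  show "x - of_int \<lfloor>x / L\<rfloor> * L \<in> {0..<L}" unfolding eq by linarith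
  show "k = \<lfloor>x / L\<rfloor>" if "x - of_int k * L \<in> {0..<L}" for k
    using that unfolding eq using floor_eq_iff[of "x / L" k] by auto
qed

text \<open>The full cells fill an interval from \<open>0\<close> to a multiple of the cell length that is at most \<open>1\<close>, so the
  whole cell of each of their points lies in \<open>{0..1}\<close>.\<close>

lemma full_cells_cell:
  assumes L: "0 < L" and e: "0 < e" and x: "x \<in> full_cells L \<alpha> e"
  defines "a \<equiv> e powr \<alpha>"
  shows "0 \<le> \<lfloor>x / (a * L)\<rfloor>" "a * L * (of_int \<lfloor>x / (a * L)\<rfloor> + 1) \<le> 1"
proof -
  have a: "a > 0" using e by (simp add: a_def)
  let ?l = "a * L"
  have l: "?l > 0" using a L by simp
  define N where "N = last_cell L \<alpha> e"
  have N: "N = \<lfloor>1 / ?l\<rfloor> - 1"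
    unfolding N_def last_cell_def a_def[symmetric]
  proof (rule Greatest_equality)
    have iff: "?l * (of_int k + 1) \<le> 1 \<longleftrightarrow> of_int k + 1 \<le> 1 / ?l" for k :: int
      using l by (simp add: pos_le_divide_eq mult.commute)
    show "?l * (of_int (\<lfloor>1 / ?l\<rfloor> - 1) + 1) \<le> 1" unfolding iff by simp
    show "k \<le> \<lfloor>1 / ?l\<rfloor> - 1" if "?l * (of_int k + 1) \<le> 1" for k :: int
      using that unfolding iff by linarith
  qed
  have sub: "(\<Union>k\<in>{0..N}. {of_int k * L * a..(of_int k + 1) * L * a}) \<subseteq> {0..(of_int N + 1) * ?l}"
  proof
    fix y assume "y \<in> (\<Union>k\<in>{0..N}. {of_int k * L * a..(of_int k + 1) * L * a})"
    then obtain k where k: "0 \<le> k" "k \<le> N" "of_int k * L * a \<le> y" "y \<le> (of_int k + 1) * L * a" by auto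
    have "0 \<le> of_int k * (L * a)" using k(1) L a by simp
    moreover have "(of_int k + 1) * (L * a) \<le> (of_int N + 1) * (L * a)" using k(2) L a by (intro mult_right_mono) auto
    ultimately show "y \<in> {0..(of_int N + 1) * ?l}" using k by (simp add: mult_ac)
  qed
  have "x \<in> interior {0..(of_int N + 1) * ?l}"
    using x interior_mono[OF sub] by (auto simp: full_cells_def N_def a_def)
  then have x': "0 < x" "x < (of_int N + 1) * ?l" by (auto simp: interior_atLeastAtMost_real)
  show "0 \<le> \<lfloor>x / ?l\<rfloor>" using x'(1) l by simp
  have "x / ?l < of_int N + 1" using x'(2) l by (simp add: pos_divide_less_eq)
  then have "\<lfloor>x / ?l\<rfloor> < N + 1" unfolding floor_less_iff by simp
  then have "\<lfloor>x / ?l\<rfloor> + 1 \<le> N + 1" by simp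
  then have "of_int (\<lfloor>x / ?l\<rfloor> + 1) \<le> (of_int (N + 1) :: real)" unfolding of_int_le_iff .
  then have "of_int \<lfloor>x / ?l\<rfloor> + 1 \<le> (of_int (N + 1) :: real)" by simp
  also have "\<dots> \<le> 1 / ?l" unfolding N by simp
  finally show "?l * (of_int \<lfloor>x / ?l\<rfloor> + 1) \<le> 1" using l by (simp add: pos_le_divide_eq mult.commute)
qed

section \<open>Pairings and scaled norms\<close>

definition Lpb :: "real \<Rightarrow> ('a::euclidean_space \<Rightarrow> 'b::euclidean_space) \<Rightarrow> bool" where
  "Lpb p F \<longleftrightarrow> F \<in> Borel_fun \<and> integrable lborel (\<lambda>z. norm (F z) powr p)"

lemma Lpb_diff: "0 \<le> p \<Longrightarrow> Lpb p F \<Longrightarrow> Lpb p G \<Longrightarrow> Lpb p (\<lambda>z. F z - G z)"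
  unfolding Lpb_def using integrable_powr_diff[of F G p] by auto

lemma Lpb_pflux:
  assumes "1 < p" "1 / p + 1 / q = 1" "Lpb p F"
  shows "Lpb q (\<lambda>z. pflux p (F z))"
  using assms(3) unfolding Lpb_def norm_pflux_powr[OF assms(1,2)] by auto

lemma Lpb_dominated:
  assumes "Lpb p F" "G \<in> Borel_fun" "\<And>z. norm (G z) \<le> norm (F z)" "0 \<le> p"
  shows "Lpb p G" "(LBINT z. norm (G z) powr p) \<le> (LBINT z. norm (F z) powr p)"
proof -
  have le: "norm (G z) powr p \<le> norm (F z) powr p" for z
    using assms(3,4) by (intro powr_mono2) auto
  have F: "integrable lborel (\<lambda>z. norm (F z) powr p)" using assms(1) by (simp add: Lpb_def)
  have G: "integrable lborel (\<lambda>z. norm (G z) powr p)"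
    by (rule integrable_dominated[OF F]) (use assms(2) le in auto)
  then show "Lpb p G" using assms(2) by (simp add: Lpb_def)
  show "(LBINT z. norm (G z) powr p) \<le> (LBINT z. norm (F z) powr p)"
    by (rule integral_mono[OF G F le])
qed

lemma pairing_integrable:
  assumes "1 < p" "1 / p + 1 / q = 1" "Lpb q F" "Lpb p G"
  shows "integrable lborel (\<lambda>z. F z \<bullet> G z)"
proof -
  have "integrable lborel (\<lambda>z. G z \<bullet> F z)"
    using assms(3,4) unfolding Lpb_def by (intro integrable_inner_conjugate(1)[OF _ _ assms(1,2)]) auto
  then show ?thesis by (simp add: inner_commute)
qed

text \<open>Since \<open>1 / p + 1 / q = 1\<close>, a common scaling factor of both \<open>p\<close>-th and \<open>q\<close>-th powers comes out linearly;
  with the measure of the thin domain as factor, this is Hoelder's inequality for the rescaled norms.\<close>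

lemma pairing_le:
  assumes pq: "1 < p" "1 / p + 1 / q = 1" and F: "Lpb q F" and G: "Lpb p G" and e: "e > 0"
    and A: "(LBINT z. norm (F z) powr q) \<le> e * A" and B: "(LBINT z. norm (G z) powr p) \<le> e * B"
  shows "\<bar>LBINT z. F z \<bullet> G z\<bar> \<le> e * (A powr (1 / q) * B powr (1 / p))"
proof -
  have q: "1 < q" by (rule conjugate_exponents(1)[OF pq])
  have "0 \<le> e * A" "0 \<le> e * B"
    by (rule order_trans[OF _ A], simp, rule order_trans[OF _ B], simp)
  then have AB: "0 \<le> A" "0 \<le> B" using e by (auto simp: zero_le_mult_iff)
  have "\<bar>LBINT z. F z \<bullet> G z\<bar> = \<bar>LBINT z. G z \<bullet> F z\<bar>" by (simp add: inner_commute)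
  also have "\<dots> \<le> (LBINT z. norm (G z) powr p) powr (1 / p) * (LBINT z. norm (F z) powr q) powr (1 / q)"
    using F G unfolding Lpb_def by (intro integrable_inner_conjugate(2)[OF _ _ pq]) auto
  also have "\<dots> \<le> (e * B) powr (1 / p) * (e * A) powr (1 / q)"
    using A B pq q by (intro mult_mono powr_mono2) auto
  also have "\<dots> = (e powr (1 / p) * e powr (1 / q)) * (A powr (1 / q) * B powr (1 / p))"
    by (simp add: powr_mult)
  also have "e powr (1 / p) * e powr (1 / q) = e"
    using e pq by (simp flip: powr_add)
  finally show ?thesis .
qed

lemma tendsto_0_interpolate:
  fixes A E :: "'i \<Rightarrow> real"
  assumes nn: "\<And>i. 0 \<le> A i" and E: "(E \<longlongrightarrow> 0) F"
    and le: "\<And>d. d > 0 \<Longrightarrow> \<exists>C\<ge>0. \<forall>\<^sub>F i in F. A i \<le> d * M + C * E i"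
  shows "(A \<longlongrightarrow> 0) F"
proof (rule tendstoI)
  fix e :: real assume e: "e > 0"
  define d where "d = e / (2 * (\<bar>M\<bar> + 1))"
  have d: "d > 0" using e by (simp add: d_def)
  have "d * M \<le> d * (\<bar>M\<bar> + 1)" using d by (intro mult_left_mono) auto
  also have "\<dots> = e / 2" using e by (simp add: d_def field_simps)
  finally have dM: "d * M \<le> e / 2" .
  obtain C where C: "C \<ge> 0" "\<forall>\<^sub>F i in F. A i \<le> d * M + C * E i" using le[OF d] by blast
  have "((\<lambda>i. C * E i) \<longlongrightarrow> C * 0) F" by (intro tendsto_mult tendsto_const E)
  then have "\<forall>\<^sub>F i in F. C * E i < e / 2" using order_tendstoD(2)[of _ "C * 0" F "e / 2"] e by simp
  then show "\<forall>\<^sub>F i in F. dist (A i) 0 < e"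
    using C(2) by eventually_elim (use nn dM in \<open>auto simp: dist_real_def\<close>)
qed

lemma sobolev_rep_cong_AE:
  assumes S: "sobolev_rep p U F H" and F': "F' \<in> Borel_fun" "\<And>z. z \<notin> U \<Longrightarrow> F' z = 0"
    and ae: "AE z in lborel. F' z = F z"
  shows "sobolev_rep p U F' H"
proof -
  note S' = S[unfolded sobolev_rep_def]
  have Fm: "F \<in> Borel_fun" using S' by auto
  have "integrable lborel F'" "integrable lborel (\<lambda>z. \<bar>F' z\<bar> powr p)"
  proof -
    show "integrable lborel F'"
      using S' ae F'(1) by (subst integrable_cong_AE[of _ _ F]) auto
    show "integrable lborel (\<lambda>z. \<bar>F' z\<bar> powr p)"
      using S' ae F'(1) Fm by (subst integrable_cong_AE[of _ _ "\<lambda>z. \<bar>F z\<bar> powr p"]) (auto elim!: eventually_mono)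
  qed
  moreover have "(LBINT z. F' z * deriv_at \<phi> z b) = (LBINT z. F z * deriv_at \<phi> z b)"
    if "\<phi> \<in> test_functions U" "b \<in> Basis" for \<phi> b
    using F'(1) Fm test_partial_borel[OF that] ae by (intro integral_cong_AE) (auto elim!: eventually_mono)
  ultimately show ?thesis using S' F' unfolding sobolev_rep_def by auto
qed

lemma primitive_holder:
  assumes w: "integrable lborel w" "integrable lborel (\<lambda>t. \<bar>w t\<bar> powr p)" and p: "1 < p"
    and A: "(LBINT t. \<bar>w t\<bar> powr p) \<le> A"
  shows "\<bar>primitive w y - primitive w x\<bar> powr p \<le> \<bar>y - x\<bar> powr (p - 1) * A"
proof -
  have *: "\<bar>primitive w y - primitive w x\<bar> powr p \<le> (y - x) powr (p - 1) * A" if "x \<le> y" for x y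
  proof -
    have i: "integrable lborel (\<lambda>t. indicator {x..y} t * \<bar>w t\<bar> powr p)"
      by (rule integrable_indicator_mult[OF w(2)]) simp
    have wm: "w \<in> Borel_fun" using w(1) by auto
    have "\<bar>primitive w y - primitive w x\<bar> powr p \<le> (LBINT t. indicator {x..y} t * \<bar>w t\<bar>) powr p"
      using primitive_diff_le[OF w(1) that] p by (intro powr_mono2) auto
    also have "\<dots> \<le> measure lborel {x..y} powr (p - 1) * (LBINT t. indicator {x..y} t * \<bar>w t\<bar> powr p)"
      using wm i p by (intro powr_integral_le(2)) (auto simp: emeasure_lborel_Icc_eq)
    also have "\<dots> \<le> measure lborel {x..y} powr (p - 1) * (LBINT t. \<bar>w t\<bar> powr p)"
      by (intro mult_left_mono integral_mono[OF i w(2)]) (auto simp: indicator_def)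
    also have "\<dots> \<le> measure lborel {x..y} powr (p - 1) * A"
      by (intro mult_left_mono A) auto
    finally show ?thesis using that by simp
  qed
  show ?thesis
    using *[of x y] *[of y x] by (cases "x \<le> y") (auto simp: abs_minus_commute)
qed

lemma powr_integral_unit:
  fixes w :: "real \<Rightarrow> real"
  assumes w: "w \<in> Borel_fun" "\<And>x. x \<notin> {0<..<1} \<Longrightarrow> w x = 0" "integrable lborel (\<lambda>t. \<bar>w t\<bar> powr p)" and p: "1 < p"
  shows "integrable lborel w" "(LBINT t. \<bar>w t\<bar>) powr p \<le> (LBINT t. \<bar>w t\<bar> powr p)"
proof -
  have e: "indicator {0<..<1} t * w t = w t" "indicator {0<..<1} t * \<bar>w t\<bar> = \<bar>w t\<bar>"
    "indicator {0<..<1} t * \<bar>w t\<bar> powr p = \<bar>w t\<bar> powr p" for t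
    using w(2)[of t] by (cases "t \<in> {0<..<1}"; simp)+
  have i: "integrable lborel (\<lambda>t. indicator {0<..<1} t * \<bar>w t\<bar> powr p)" unfolding e by (rule w(3))
  have fin: "emeasure lborel {0<..<1::real} < \<infinity>" by simp
  have S: "{0<..<1::real} \<in> sets borel" by simp
  note P = powr_integral_le[OF w(1) S fin p i]
  show "integrable lborel w" using P(1) unfolding e .
  show "(LBINT t. \<bar>w t\<bar>) powr p \<le> (LBINT t. \<bar>w t\<bar> powr p)" using P(2) unfolding e by simp
qed

lemma open_subgraph:
  assumes "lower_semicontinuous \<gamma>"
  shows "open (subgraph \<gamma>)"
  unfolding open_prod_def
proof
  fix z assume "z \<in> subgraph \<gamma>"
  then obtain x y where z: "z = (x, y)" "0 < x" "x < 1" "0 < y" "y < \<gamma> x" by (auto simp: subgraph_def)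
  obtain a where a: "y < a" "a < \<gamma> x" using z dense by blast
  have "\<forall>\<^sub>F t in nhds x. a < \<gamma> t" using assms a(2) by (auto simp: lower_semicontinuous_def)
  then obtain T where T: "open T" "x \<in> T" "\<And>t. t \<in> T \<Longrightarrow> a < \<gamma> t" by (auto simp: eventually_nhds)
  show "\<exists>A B. open A \<and> open B \<and> z \<in> A \<times> B \<and> A \<times> B \<subseteq> subgraph \<gamma>"
  proof (intro exI conjI)
    show "open (T \<inter> {0<..<1})" "open {0<..<a}" using T by auto
    show "z \<in> (T \<inter> {0<..<1}) \<times> {0<..<a}" using z T a by auto
    show "(T \<inter> {0<..<1}) \<times> {0<..<a} \<subseteq> subgraph \<gamma>"
      using T(3) by (force simp: subgraph_def)
  qed
qed

lemma lower_semicontinuous_scaled: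
  fixes g :: "real \<Rightarrow> real"
  assumes "lower_semicontinuous g" "e > 0"
  shows "lower_semicontinuous (\<lambda>x. e * g (x / s))"
  unfolding lower_semicontinuous_def
proof (intro allI impI)
  fix x a assume a: "a < e * g (x / s)"
  then have "a / e < g (x / s)" using assms(2) by (simp add: field_simps)
  then have 1: "\<forall>\<^sub>F y in nhds (x / s). a / e < g y" using assms(1) by (auto simp: lower_semicontinuous_def)
  have "((\<lambda>y. y * inverse s) \<longlongrightarrow> x * inverse s) (nhds x)" by (intro tendsto_intros filterlim_ident)
  then have "filterlim (\<lambda>y. y / s) (nhds (x / s)) (nhds x)" by (simp add: divide_inverse)
  from eventually_compose_filterlim[OF 1 this] show "\<forall>\<^sub>F y in nhds x. a < e * g (y / s)"
    using assms(2) by (auto simp: field_simps elim!: eventually_mono)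
qed

lemma pflux_pair: "pflux p (d, 0::real) = (pflux p d, 0)" for d :: real
  by (simp add: pflux_def)

section \<open>The thin domain problem\<close>

lemma AE_snd_neq: "AE z in (lborel :: (real \<times> real) measure). snd z \<noteq> h"
proof -
  have "(UNIV :: real set) \<times> {h} \<in> null_sets (lborel \<Otimes>\<^sub>M lborel)"
    by (intro lborel.times_in_null_sets2) auto
  then have "(UNIV :: real set) \<times> {h} \<in> null_sets (lborel :: (real \<times> real) measure)"
    by (simp only: lborel_prod)
  then show ?thesis by (rule AE_I') auto
qed

text \<open>The problem in terms of Borel representatives: \<open>u e\<close> solves the equation in the thin domain and has
  gradient \<open>G e\<close>, while \<open>c0 + primitive D\<close> solves the limit equation and has derivative \<open>D\<close>. The point
  \<open>y0\<close> is one where \<open>g\<close> attains its minimum, and weak convergence of the fibre averages of the load is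
  only tested with indicators of intervals.\<close>

locale thin_limit =
  fixes g :: "real \<Rightarrow> real" and L g0 g1 y0 \<alpha> p q c c0 gbar :: real
    and f u :: "real \<Rightarrow> real \<times> real \<Rightarrow> real" and G :: "real \<Rightarrow> real \<times> real \<Rightarrow> real \<times> real"
    and fhat D :: "real \<Rightarrow> real"
  assumes lsc: "lower_semicontinuous g" and L: "0 < L" and per: "\<And>x. g (x + L) = g x"
    and g0: "0 < g0" "\<And>x. g0 \<le> g x" "g y0 = g0" and g1: "\<And>x. g x \<le> g1"
    and \<alpha>: "1 < \<alpha>" and pq: "1 < p" "1 / p + 1 / q = 1" and c: "0 \<le> c"
    and gbar: "gbar = (1 / L) * (LBINT s. indicator {0..<L} s * g s)"
    and S: "\<And>e. 0 < e \<Longrightarrow> sobolev_rep p (subgraph (\<lambda>x. e * g (x / e powr \<alpha>))) (u e) (G e)"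
    and f: "\<And>e. 0 < e \<Longrightarrow> Lpb q (f e)"
      "\<And>e z. 0 < e \<Longrightarrow> z \<notin> subgraph (\<lambda>x. e * g (x / e powr \<alpha>)) \<Longrightarrow> f e z = 0"
      "\<And>e. 0 < e \<Longrightarrow> (LBINT z. norm (f e z) powr q) \<le> e * c powr q"
    and eq: "\<And>e \<phi> \<Phi>. 0 < e \<Longrightarrow> sobolev_rep p (subgraph (\<lambda>x. e * g (x / e powr \<alpha>))) \<phi> \<Phi> \<Longrightarrow>
      (LBINT z. pflux p (G e z) \<bullet> \<Phi> z + pflux p (u e z) * \<phi> z) = (LBINT z. f e z * \<phi> z)"
    and fhat: "Lpb q fhat" "\<And>x. x \<notin> {0<..<1} \<Longrightarrow> fhat x = 0"
    and weak: "\<And>a b. 0 \<le> a \<Longrightarrow> a \<le> b \<Longrightarrow> b \<le> 1 \<Longrightarrow>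
      ((\<lambda>e. LBINT x. indicator {a..<b} x * ((1 / e) * (LBINT y. f e (x, y)))) \<longlongrightarrow>
        (LBINT x. indicator {a..<b} x * fhat x)) (at_right 0)"
    and S0: "sobolev_rep p {0<..<1} (\<lambda>x. indicator {0<..<1} x * (c0 + primitive D x)) D"
    and eq0: "\<And>\<phi> \<Phi>. sobolev_rep p {0<..<1} \<phi> \<Phi> \<Longrightarrow>
      (LBINT x. g0 / gbar * pflux p (D x) * \<Phi> x + pflux p (indicator {0<..<1} x * (c0 + primitive D x)) * \<phi> x) =
      (LBINT x. fhat x / gbar * \<phi> x)"
begin

text \<open>The pair \<open>W\<close>, \<open>Gw\<close> is the recovery function of the limit solution \<open>V\<close> with its gradient, pinched over
  the minimum points of \<open>g\<close>. Both the ramp and the cells have the small scale \<open>e powr \<alpha>\<close>. The function \<open>v\<close>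
  is the mean of \<open>u\<close> over the lower fibres, with derivative \<open>v'\<close>; \<open>Vu\<close> and \<open>vu\<close> regard \<open>V\<close> and \<open>v\<close> as functions
  on the thin domain.\<close>

definition U :: "real \<Rightarrow> (real \<times> real) set" where "U e = subgraph (\<lambda>x. e * g (x / e powr \<alpha>))"
definition V :: "real \<Rightarrow> real" where "V x = indicator {0<..<1} x * (c0 + primitive D x)"
definition K0 :: real where "K0 = (LBINT x. \<bar>D x\<bar> powr p)"
definition W :: "real \<Rightarrow> real \<times> real \<Rightarrow> real" where
  "W e = pinched_domain.recovery (\<lambda>x. e * g (x / e powr \<alpha>)) (e * g0) (e powr \<alpha>) (e powr \<alpha> * L) (y0 / L) c0 D"
definition Gw :: "real \<Rightarrow> real \<times> real \<Rightarrow> real \<times> real" where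
  "Gw e = pinched_domain.recovery_grad (\<lambda>x. e * g (x / e powr \<alpha>)) (e * g0) (e powr \<alpha>) (e powr \<alpha> * L) (y0 / L) c0 D"
definition v :: "real \<Rightarrow> real \<Rightarrow> real" where "v e = lower_mean (e * g0) (u e)"
definition v' :: "real \<Rightarrow> real \<Rightarrow> real" where "v' e = lower_mean (e * g0) (\<lambda>z. fst (G e z))"
definition Vu :: "real \<Rightarrow> real \<times> real \<Rightarrow> real" where "Vu e z = indicator (U e) z * V (fst z)"
definition vu :: "real \<Rightarrow> real \<times> real \<Rightarrow> real" where "vu e z = indicator (U e) z * v e (fst z)"
definition fib :: "real \<Rightarrow> real \<Rightarrow> real" where "fib e x = (1 / e) * (LBINT y. f e (x, y))"

lemmas S_U = S[folded U_def] and f_U = f(2)[folded U_def] and eq_U = eq[folded U_def]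
  and S0_V = S0[folded V_def] and eq0_V = eq0[folded V_def]

lemma q: "1 < q" by (rule conjugate_exponents(1)[OF pq])

lemma g1_pos: "0 < g1" using g0(1) g0(2)[of 0] g1[of 0] by linarith

lemma g_borel [measurable]: "g \<in> Borel_fun" by (rule lower_semicontinuous_borel[OF lsc])

lemma D_props: "integrable lborel D" "integrable lborel (\<lambda>x. \<bar>D x\<bar> powr p)" "\<And>x. x \<notin> {0<..<1} \<Longrightarrow> D x = 0"
  using S0 by (auto simp: sobolev_rep_def)

lemma D_borel [measurable]: "D \<in> Borel_fun" using D_props(1) by auto

lemma K0_nonneg: "0 \<le> K0" by (simp add: K0_def)

lemma gamma_bounds:
  assumes "0 < e"
  shows "0 < e * g0" "e * g0 \<le> e * g (x / e powr \<alpha>)" "e * g (x / e powr \<alpha>) \<le> e * g1"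
  using assms g0 g1 by (auto intro: mult_left_mono)

lemma open_U: "0 < e \<Longrightarrow> open (U e)"
  unfolding U_def by (intro open_subgraph lower_semicontinuous_scaled lsc)

lemma U_borel [measurable]: "0 < e \<Longrightarrow> U e \<in> sets borel"
  using open_U by auto

lemma U_box: "(x, y) \<in> U e \<Longrightarrow> 0 < e \<Longrightarrow> 0 < x \<and> x < 1 \<and> 0 < y \<and> y < e * g1"
  using less_le_trans[OF _ gamma_bounds(3)[of e x], of y] by (auto simp: U_def subgraph_def)

lemma pinched:
  assumes e: "0 < e"
  shows "pinched_domain p (\<lambda>x. e * g (x / e powr \<alpha>)) (e * g0) (e * g1) (e powr \<alpha>) (e powr \<alpha> * L) (y0 / L) D"
proof
  show "1 < p" by (rule pq(1))
  show "open (subgraph (\<lambda>x. e * g (x / e powr \<alpha>)))" using open_U[OF e] by (simp add: U_def)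
  show "0 < e * g0" "\<And>x. e * g0 \<le> e * g (x / e powr \<alpha>)" "\<And>x. e * g (x / e powr \<alpha>) \<le> e * g1"
    using gamma_bounds[OF e] by auto
  show "0 < e powr \<alpha>" "0 < e powr \<alpha> * L" using e L by auto
  show "e * g (e powr \<alpha> * L * (real_of_int i + y0 / L) / e powr \<alpha>) = e * g0" for i
  proof -
    have "e powr \<alpha> * L * (real_of_int i + y0 / L) / e powr \<alpha> = y0 + of_int i * L"
      using e L by (simp add: field_simps)
    then show ?thesis using periodic_int[of g, OF per, of y0 i] g0(3) by simp
  qed
  show "integrable lborel D" "integrable lborel (\<lambda>x. \<bar>D x\<bar> powr p)" by (rule D_props)+
qed

lemma V_eq: "V x = indicator {0<..<1} x * pinched_domain.base c0 D x"
  unfolding V_def by (subst pinched_domain.base_def[OF pinched[of 1]]) simp_all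

lemma Lpb_u: "0 < e \<Longrightarrow> Lpb p (u e)" and Lpb_G: "0 < e \<Longrightarrow> Lpb p (G e)"
  using S[of e] by (auto simp: Lpb_def sobolev_rep_def)

lemma W_sobolev: "0 < e \<Longrightarrow> sobolev_rep p (U e) (W e) (Gw e)"
  unfolding U_def W_def Gw_def by (rule pinched_domain.recovery_sobolev[OF pinched])

lemma Lpb_W: "0 < e \<Longrightarrow> Lpb p (W e)" and Lpb_Gw: "0 < e \<Longrightarrow> Lpb p (Gw e)"
  using W_sobolev[of e] by (auto simp: Lpb_def sobolev_rep_def)

lemma zero_off_U:
  assumes "0 < e" "z \<notin> U e"
  shows "u e z = 0" "G e z = 0" "W e z = 0" "Gw e z = 0" "Vu e z = 0" "vu e z = 0" "f e z = 0"
proof -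
  have "\<forall>z. z \<notin> U e \<longrightarrow> u e z = 0 \<and> G e z = 0" "\<forall>z. z \<notin> U e \<longrightarrow> W e z = 0 \<and> Gw e z = 0"
    using S_U[OF assms(1)] W_sobolev[OF assms(1)] unfolding sobolev_rep_def by blast+
  then show "u e z = 0" "G e z = 0" "W e z = 0" "Gw e z = 0" using assms(2) by blast+
  show "Vu e z = 0" "vu e z = 0" using assms(2) by (simp_all add: Vu_def vu_def)
  show "f e z = 0" by (rule f_U[OF assms])
qed

lemma Vu_W: "0 < e \<Longrightarrow> \<bar>W e z - Vu e z\<bar> powr p =
    indicator (U e) z * \<bar>W e z - pinched_domain.base c0 D (fst z)\<bar> powr p"
proof (cases "z \<in> U e")
  case True
  assume "0 < e"
  then have "fst z \<in> {0<..<1}" using U_box[of "fst z" "snd z" e] True by auto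
  then show ?thesis using True by (simp add: Vu_def V_eq)
next
  case False
  assume "0 < e"
  then show ?thesis using False zero_off_U[of e z] by simp
qed

text \<open>Up to the factor \<open>e\<close>, these bound \<open>p\<close>-th powers: \<open>B1\<close> of the distance between \<open>W\<close> and \<open>V\<close>, \<open>B2\<close> of the
  gradient of \<open>W\<close> in the upper part, \<open>B3\<close> of the distance between \<open>u\<close> and \<open>v\<close>, and \<open>B4\<close> of \<open>V\<close>. The first
  three tend to zero, \<open>B2\<close> thanks to \<open>\<alpha> > 1\<close>.\<close>

definition B1 :: "real \<Rightarrow> real" where "B1 e = g1 * (e powr \<alpha> * L) powr p * K0"
definition B2 :: "real \<Rightarrow> real" where "B2 e = 2 powr p * (1 + L powr p) * K0 * e powr (\<alpha> - 1)"
definition B3 :: "real \<Rightarrow> real" where "B3 e = (e * g1) powr p * c powr q"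
definition B4 :: real where "B4 = (\<bar>c0\<bar> + (LBINT t. \<bar>D t\<bar>)) powr p * g1"

lemma W_close:
  assumes e: "0 < e"
  shows "(LBINT z. norm (W e z - Vu e z) powr p) \<le> e * B1 e"
  using pinched_domain.recovery_close[OF pinched[OF e], where c = c0] Vu_W[OF e]
  unfolding W_def[symmetric] U_def[symmetric] K0_def[symmetric] B1_def by (simp add: mult.assoc)

lemma Gw_upper:
  assumes e: "0 < e"
  shows "(LBINT z. indicator {e * g0<..} (snd z) * norm (Gw e z) powr p) \<le> e * B2 e"
proof -
  have "(e powr \<alpha>) powr (1 - p) * (e powr \<alpha> * L) powr p = ((e powr \<alpha>) powr (1 - p) * (e powr \<alpha>) powr p) * L powr p"
    by (simp add: powr_mult)
  also have "(e powr \<alpha>) powr (1 - p) * (e powr \<alpha>) powr p = e powr \<alpha>"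
    using e by (simp flip: powr_add)
  finally have 1: "(e powr \<alpha>) powr (1 - p) * (e powr \<alpha> * L) powr p = e powr \<alpha> * L powr p" .
  have 2: "e powr \<alpha> = e * e powr (\<alpha> - 1)" using e powr_add[of e 1 "\<alpha> - 1"] by simp
  have "2 powr p * (e powr \<alpha> + (e powr \<alpha>) powr (1 - p) * (e powr \<alpha> * L) powr p) * K0 = e * B2 e"
    unfolding 1 B2_def by (simp add: 2 algebra_simps)
  then show ?thesis
    using pinched_domain.recovery_grad_upper[OF pinched[OF e], where c = c0]
    unfolding Gw_def[symmetric] K0_def[symmetric] by simp
qed

lemma Gw_lower:
  assumes e: "0 < e" and z: "z \<in> U e" "snd z < e * g0"
  shows "W e z = V (fst z)" "Gw e z = (D (fst z), 0)"
proof -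
  have "fst z \<in> {0<..<1}" using U_box[of "fst z" "snd z" e] z e by auto
  then show "W e z = V (fst z)" "Gw e z = (D (fst z), 0)"
    using pinched_domain.recovery_lower[OF pinched[OF e] z[unfolded U_def], where c = c0]
    unfolding W_def[symmetric] Gw_def[symmetric] by (simp_all add: V_eq)
qed

lemma V_bound: "\<bar>V x\<bar> \<le> \<bar>c0\<bar> + (LBINT t. \<bar>D t\<bar>)"
proof -
  have "primitive D (-1) = 0" by (simp add: primitive_def)
  then have "\<bar>c0 + primitive D x\<bar> \<le> \<bar>c0\<bar> + (LBINT t. \<bar>D t\<bar>)"
    using primitive_diff_le_total[OF D_props(1), of x "-1"] by simp
  then show ?thesis by (auto simp: V_def indicator_def)
qed

lemma V_borel [measurable]: "V \<in> Borel_fun"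
  unfolding V_def[abs_def] by measurable

lemma Vu_bound:
  assumes e: "0 < e"
  shows "Lpb p (Vu e)" "(LBINT z. norm (Vu e z) powr p) \<le> e * B4"
proof -
  let ?M = "\<bar>c0\<bar> + (LBINT t. \<bar>D t\<bar>)"
  have M: "?M \<ge> 0" by (intro add_nonneg_nonneg) auto
  define T where "T z = ?M * (indicator {0<..<1} (fst z) * indicator {0<..<e * g1} (snd z))" for z :: "real \<times> real"
  have ti: "integrable lborel (\<lambda>z::real \<times> real. indicator {0<..<1::real} (fst z) * indicator {0<..<e * g1} (snd z) :: real)"
    using e g1_pos by (intro integrable_tensor) auto
  have Tp: "norm (T z) powr p = ?M powr p * (indicator {0<..<1} (fst z) * indicator {0<..<e * g1} (snd z))" for z
    using M by (auto simp: T_def indicator_def)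
  have LT: "Lpb p T"
    unfolding Lpb_def Tp using ti by (auto simp: T_def[abs_def])
  have "(LBINT z. norm (T z) powr p) = ?M powr p * (e * g1)"
    unfolding Tp using iterated_integral1[OF ti] e g1_pos by simp
  moreover have "Vu e \<in> Borel_fun" unfolding Vu_def[abs_def] using e by measurable
  moreover have "norm (Vu e z) \<le> norm (T z)" for z
  proof (cases "z \<in> U e")
    case True
    then show ?thesis using U_box[of "fst z" "snd z" e] e V_bound[of "fst z"] M by (simp add: Vu_def T_def)
  qed (simp add: Vu_def)
  ultimately show "Lpb p (Vu e)" "(LBINT z. norm (Vu e z) powr p) \<le> e * B4"
    using Lpb_dominated[OF LT, of "Vu e"] pq(1) by (auto simp: B4_def mult_ac)
qed

text \<open>Testing with \<open>u e\<close> itself bounds the rescaled energy \<open>X\<close> by \<open>c * X powr (1 / p)\<close>.\<close>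

lemma energy_bound:
  assumes e: "0 < e"
  shows "(LBINT z. norm (G e z) powr p) + (LBINT z. norm (u e z) powr p) \<le> e * c powr q"
proof -
  define X where "X = ((LBINT z. norm (G e z) powr p) + (LBINT z. norm (u e z) powr p)) / e"
  have X0: "0 \<le> X" using e by (simp add: X_def)
  have sum: "(LBINT z. norm (G e z) powr p) + (LBINT z. norm (u e z) powr p) = e * X"
    using e by (simp add: X_def)
  have int: "integrable lborel (\<lambda>z. norm (G e z) powr p)" "integrable lborel (\<lambda>z. norm (u e z) powr p)"
    using Lpb_u[OF e] Lpb_G[OF e] by (auto simp: Lpb_def)
  have pu: "pflux p (u e z) * u e z = norm (u e z) powr p" for z using pflux_inner_self[of p "u e z"] by simp
  have "e * X = (LBINT z. norm (G e z) powr p + norm (u e z) powr p)"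
    unfolding Bochner_Integration.integral_add[OF int] by (rule sum[symmetric])
  also have "\<dots> = (LBINT z. pflux p (G e z) \<bullet> G e z + pflux p (u e z) * u e z)"
    by (simp only: pu pflux_inner_self)
  also have "\<dots> = (LBINT z. f e z \<bullet> u e z)"
    using eq_U[OF e S_U[OF e]] by simp
  also have "\<dots> \<le> e * ((c powr q) powr (1 / q) * X powr (1 / p))"
  proof (rule order_trans[OF abs_ge_self pairing_le[OF pq f(1)[OF e] Lpb_u[OF e] e f(3)[OF e]]])
    have "0 \<le> (LBINT z. norm (G e z) powr p)" by simp
    then show "(LBINT z. norm (u e z) powr p) \<le> e * X" using sum by linarith
  qed
  finally have "X \<le> c * X powr (1 / p)"
    using e q c by (simp add: powr_powr)
  have "X \<le> c powr q"
  proof (cases "X = 0")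
    case False
    then have X: "X > 0" using X0 by simp
    have "X = X powr (1 / p) * X powr (1 / q)" using X pq(2) by (simp flip: powr_add)
    with \<open>X \<le> c * X powr (1 / p)\<close> have "X powr (1 / p) * X powr (1 / q) \<le> X powr (1 / p) * c"
      by (metis mult.commute)
    then have "X powr (1 / q) \<le> c" using X by simp
    then have "(X powr (1 / q)) powr q \<le> c powr q" using q by (intro powr_mono2) auto
    then show ?thesis using X q by (simp add: powr_powr)
  qed simp
  then show ?thesis unfolding sum using e by simp
qed

lemma
  assumes e: "0 < e"
  shows G_bound: "(LBINT z. norm (G e z) powr p) \<le> e * c powr q"
    and u_bound: "(LBINT z. norm (u e z) powr p) \<le> e * c powr q"
proof -
  have "0 \<le> (LBINT z. norm (G e z) powr p)" "0 \<le> (LBINT z. norm (u e z) powr p)" by simp_all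
  then show "(LBINT z. norm (G e z) powr p) \<le> e * c powr q"
    "(LBINT z. norm (u e z) powr p) \<le> e * c powr q"
    using energy_bound[OF e] by linarith+
qed

lemma G_component:
  assumes e: "0 < e"
  shows "Lpb p (\<lambda>z. fst (G e z))" "(LBINT z. norm (fst (G e z)) powr p) \<le> e * c powr q"
    "(LBINT z. norm (snd (G e z)) powr p) \<le> e * c powr q"
proof -
  have m [measurable]: "G e \<in> Borel_fun" using Lpb_G[OF e] by (simp add: Lpb_def)
  show "Lpb p (\<lambda>z. fst (G e z))" "(LBINT z. norm (fst (G e z)) powr p) \<le> e * c powr q"
    using Lpb_dominated[OF Lpb_G[OF e], of "\<lambda>z. fst (G e z)"] G_bound[OF e] abs_fst_snd_le(1) pq(1) by fastforce+
  show "(LBINT z. norm (snd (G e z)) powr p) \<le> e * c powr q"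
    using Lpb_dominated(2)[OF Lpb_G[OF e], of "\<lambda>z. snd (G e z)"] G_bound[OF e] abs_fst_snd_le(2) pq(1) by fastforce
qed

lemma v_sobolev: "0 < e \<Longrightarrow> sobolev_rep p {0<..<1} (v e) (v' e)"
  unfolding v_def v'_def
  by (rule lower_mean_sobolev[OF S pq(1)]) (use gamma_bounds in auto)

lemma v_bounds:
  assumes e: "0 < e"
  shows "(LBINT x. \<bar>v e x\<bar> powr p) \<le> c powr q / g0" "(LBINT x. \<bar>v' e x\<bar> powr p) \<le> c powr q / g0"
proof -
  have um: "u e \<in> Borel_fun" "integrable lborel (\<lambda>z. \<bar>u e z\<bar> powr p)"
    using Lpb_u[OF e] by (auto simp: Lpb_def)
  have gm: "(\<lambda>z. fst (G e z)) \<in> Borel_fun" "integrable lborel (\<lambda>z. \<bar>fst (G e z)\<bar> powr p)"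
    using G_component(1)[OF e] by (auto simp: Lpb_def)
  have *: "t \<le> c powr q / g0" if "e * g0 * t \<le> X" "X \<le> e * c powr q" for t X
  proof -
    have "e * (g0 * t) \<le> e * c powr q" using that by (simp add: mult.assoc)
    then show ?thesis using e g0(1) by (simp add: field_simps)
  qed
  show "(LBINT x. \<bar>v e x\<bar> powr p) \<le> c powr q / g0"
    using *[OF lower_mean_powr(3)[OF um(1) gamma_bounds(1)[OF e] pq(1) um(2)]] u_bound[OF e] by (simp add: v_def)
  show "(LBINT x. \<bar>v' e x\<bar> powr p) \<le> c powr q / g0"
    using *[OF lower_mean_powr(3)[OF gm(1) gamma_bounds(1)[OF e] pq(1) gm(2)]] G_component(2)[OF e] by (simp add: v'_def)
qed

lemma vu_close:
  assumes e: "0 < e"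
  shows "Lpb p (\<lambda>z. u e z - vu e z)" "(LBINT z. norm (u e z - vu e z) powr p) \<le> e * B3 e"
proof -
  have eq: "norm (u e z - vu e z) powr p = indicator (U e) z * \<bar>u e z - lower_mean (e * g0) (u e) (fst z)\<bar> powr p" for z
    using zero_off_U[OF e, of z] by (cases "z \<in> U e") (auto simp: vu_def v_def)
  note O = vertical_oscillation_powr[OF S[OF e] open_U[OF e, unfolded U_def] pq(1) gamma_bounds[OF e], folded U_def, folded eq]
  have "vu e \<in> Borel_fun"
    unfolding vu_def[abs_def] using v_sobolev[OF e] e by (auto simp: sobolev_rep_def)
  then show "Lpb p (\<lambda>z. u e z - vu e z)"
    using O(1) Lpb_u[OF e] by (auto simp: Lpb_def)
  have "(e * g1) powr p * (LBINT z. \<bar>snd (G e z)\<bar> powr p) \<le> (e * g1) powr p * (e * c powr q)"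
    using G_component(3)[OF e] by (intro mult_left_mono) auto
  then show "(LBINT z. norm (u e z - vu e z) powr p) \<le> e * B3 e"
    using O(2) by (simp add: B3_def mult_ac)
qed

lemma Lpb_vu: "0 < e \<Longrightarrow> Lpb p (vu e)"
  using Lpb_diff[OF _ Lpb_u vu_close(1), of e e] pq(1) by simp

lemma Gw_bound:
  assumes e: "0 < e"
  shows "(LBINT z. norm (Gw e z) powr p) \<le> e * (g0 * K0 + B2 e)"
proof -
  let ?h = "e * g0"
  have hp: "0 < ?h" by (rule gamma_bounds(1)[OF e])
  have iG: "integrable lborel (\<lambda>z. norm (Gw e z) powr p)" using Lpb_Gw[OF e] by (simp add: Lpb_def)
  have m: "(\<lambda>z::real \<times> real. indicator {?h<..} (snd z) :: real) \<in> Borel_fun" by measurable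
  have iU: "integrable lborel (\<lambda>z. indicator {?h<..} (snd z) * norm (Gw e z) powr p)"
    using integrable_mult_bounded[OF iG m, of 1] by (simp add: mult.commute indicator_def)
  have iL: "integrable lborel (\<lambda>z. \<bar>D (fst z)\<bar> powr p * indicator {0<..?h} (snd z))"
    using hp by (intro integrable_tensor[OF D_props(2)]) simp
  have vL: "(LBINT z. \<bar>D (fst z)\<bar> powr p * indicator {0<..?h} (snd z)) = ?h * K0"
    using iterated_integral1[OF iL] hp by (simp add: K0_def mult.commute)
  note ne = AE_snd_neq[of ?h]
  have "(LBINT z. norm (Gw e z) powr p) \<le>
      (LBINT z. \<bar>D (fst z)\<bar> powr p * indicator {0<..?h} (snd z) + indicator {?h<..} (snd z) * norm (Gw e z) powr p)"
  proof (rule integral_mono_AE[OF iG Bochner_Integration.integrable_add[OF iL iU]])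
    show "AE z in lborel. norm (Gw e z) powr p \<le>
        \<bar>D (fst z)\<bar> powr p * indicator {0<..?h} (snd z) + indicator {?h<..} (snd z) * norm (Gw e z) powr p"
      using ne
    proof eventually_elim
      case (elim z)
      show ?case
      proof (cases "z \<in> U e")
        case True
        then have "0 < snd z" using U_box[of "fst z" "snd z" e] e by auto
        then show ?thesis using elim Gw_lower(2)[OF e True] by (cases "snd z < ?h") auto
      qed (use zero_off_U[OF e, of z] in simp)
    qed
  qed
  also have "\<dots> = ?h * K0 + (LBINT z. indicator {?h<..} (snd z) * norm (Gw e z) powr p)"
    using iL iU vL by simp
  finally show ?thesis using Gw_upper[OF e] by (simp add: algebra_simps)
qed

end

section \<open>The energy excess\<close>

context thin_limit
begin

text \<open>Both integrands are nonnegative because the flux is monotone. The gradient is compared with that of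
  the recovery function, the value with the limit solution itself.\<close>

definition excess :: "real \<Rightarrow> real" where
  "excess e = (LBINT z. (pflux p (G e z) - pflux p (Gw e z)) \<bullet> (G e z - Gw e z)) +
     (LBINT z. (pflux p (u e z) - pflux p (Vu e z)) * (u e z - Vu e z))"

lemma Lpb_flux:
  assumes "0 < e"
  shows "Lpb q (\<lambda>z. pflux p (G e z))" "Lpb q (\<lambda>z. pflux p (Gw e z))"
    "Lpb q (\<lambda>z. pflux p (u e z))" "Lpb q (\<lambda>z. pflux p (Vu e z))"
  using Lpb_pflux[OF pq] Lpb_G[OF assms] Lpb_Gw[OF assms] Lpb_u[OF assms] Vu_bound(1)[OF assms] by blast+

lemma pairing_integrable_real:
  fixes F H :: "real \<times> real \<Rightarrow> real"
  assumes "Lpb q F" "Lpb p H"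
  shows "integrable lborel (\<lambda>z. F z * H z)"
  using pairing_integrable[OF pq assms] by simp

text \<open>The equation tested with \<open>u e\<close> and with \<open>W e\<close> eliminates the flux of the unknown gradient. The fibre
  mean \<open>vu\<close> is inserted between \<open>u\<close> and \<open>V\<close>, since it is the function that the limit equation can be
  tested with.\<close>

lemma excess_expansion:
  assumes e: "0 < e"
  shows "excess e =
     (LBINT z. f e z * (u e z - vu e z)) + (LBINT z. f e z * (vu e z - Vu e z)) +
     (LBINT z. f e z * (Vu e z - W e z)) + (LBINT z. pflux p (u e z) * (W e z - Vu e z)) -
     (LBINT z. pflux p (Vu e z) * (u e z - vu e z)) - (LBINT z. pflux p (Vu e z) * (vu e z - Vu e z)) -
     (LBINT z. pflux p (Gw e z) \<bullet> (G e z - Gw e z))"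
proof -
  note Lq = Lpb_flux[OF e] and Lp = Lpb_G[OF e] Lpb_Gw[OF e]
  note Lf = f(1)[OF e] and Lr = Lpb_u[OF e] Vu_bound(1)[OF e] Lpb_W[OF e] Lpb_vu[OF e]
  note I1 = pairing_integrable[OF pq Lq(1) Lp(1)] pairing_integrable[OF pq Lq(1) Lp(2)]
    pairing_integrable[OF pq Lq(2) Lp(1)] pairing_integrable[OF pq Lq(2) Lp(2)]
  note I2 = pairing_integrable_real[OF Lq(3) Lr(1)] pairing_integrable_real[OF Lq(3) Lr(2)] pairing_integrable_real[OF Lq(3) Lr(3)]
    pairing_integrable_real[OF Lq(4) Lr(1)] pairing_integrable_real[OF Lq(4) Lr(2)] pairing_integrable_real[OF Lq(4) Lr(4)]
    pairing_integrable_real[OF Lf Lr(1)] pairing_integrable_real[OF Lf Lr(2)] pairing_integrable_real[OF Lf Lr(3)] pairing_integrable_real[OF Lf Lr(4)]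
  have t1: "(LBINT z. pflux p (G e z) \<bullet> G e z) + (LBINT z. pflux p (u e z) * u e z) = (LBINT z. f e z * u e z)"
    using eq_U[OF e S_U[OF e]] Bochner_Integration.integral_add[OF I1(1) I2(1)] by simp
  have t2: "(LBINT z. pflux p (G e z) \<bullet> Gw e z) + (LBINT z. pflux p (u e z) * W e z) = (LBINT z. f e z * W e z)"
    using eq_U[OF e W_sobolev[OF e]] Bochner_Integration.integral_add[OF I1(2) I2(3)] by simp
  have d: "(LBINT z. F z * (A z - B z)) = (LBINT z. F z * A z) - (LBINT z. F z * B z)"
    if "integrable lborel (\<lambda>z. F z * A z)" "integrable lborel (\<lambda>z. F z * B z)" for F A B :: "real \<times> real \<Rightarrow> real"
    using integral_difference[OF that] by (simp add: right_diff_distrib)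
  have di: "(LBINT z. F z \<bullet> (A z - B z)) = (LBINT z. F z \<bullet> A z) - (LBINT z. F z \<bullet> B z)"
    if "integrable lborel (\<lambda>z. F z \<bullet> A z)" "integrable lborel (\<lambda>z. F z \<bullet> B z)" for F A B :: "real \<times> real \<Rightarrow> real \<times> real"
    using integral_difference[OF that] by (simp add: inner_diff_right)
  have dd: "integrable lborel (\<lambda>z. F z \<bullet> (A z - B z))"
    if "integrable lborel (\<lambda>z. F z \<bullet> A z)" "integrable lborel (\<lambda>z. F z \<bullet> B z)" for F A B :: "real \<times> real \<Rightarrow> real \<times> real"
    using Bochner_Integration.integrable_diff[OF that] by (simp add: inner_diff_right)
  have ddr: "integrable lborel (\<lambda>z. F z * (A z - B z))"
    if "integrable lborel (\<lambda>z. F z * A z)" "integrable lborel (\<lambda>z. F z * B z)" for F A B :: "real \<times> real \<Rightarrow> real"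
    using Bochner_Integration.integrable_diff[OF that] by (simp add: right_diff_distrib)
  have e1: "(LBINT z. (pflux p (G e z) - pflux p (Gw e z)) \<bullet> (G e z - Gw e z)) =
      (LBINT z. pflux p (G e z) \<bullet> G e z) - (LBINT z. pflux p (G e z) \<bullet> Gw e z) -
      (LBINT z. pflux p (Gw e z) \<bullet> (G e z - Gw e z))"
    using integral_difference[OF dd[OF I1(1,2)] dd[OF I1(3,4)]] di[OF I1(1,2)]
    by (simp only: inner_diff_left)
  have e2: "(LBINT z. (pflux p (u e z) - pflux p (Vu e z)) * (u e z - Vu e z)) =
      (LBINT z. pflux p (u e z) * u e z) - (LBINT z. pflux p (u e z) * Vu e z) -
      (LBINT z. pflux p (Vu e z) * (u e z - Vu e z))"
    using integral_difference[OF ddr[OF I2(1,2)] ddr[OF I2(4,5)]] d[OF I2(1,2)]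
    by (simp only: left_diff_distrib)
  show ?thesis
    unfolding excess_def e1 e2 d[OF I2(7,10)] d[OF I2(10,8)] d[OF I2(8,9)] d[OF I2(3,2)] d[OF I2(4,6)] d[OF I2(6,5)] d[OF I2(4,5)]
    using t1 t2 by linarith
qed

lemma v_zero: "0 < e \<Longrightarrow> x \<notin> {0<..<1} \<Longrightarrow> v e x = 0" and v'_zero: "0 < e \<Longrightarrow> x \<notin> {0<..<1} \<Longrightarrow> v' e x = 0"
proof -
  assume e: "0 < e" and x: "x \<notin> {0<..<1}"
  have "\<forall>z. z \<notin> {0<..<1} \<longrightarrow> v e z = 0 \<and> v' e z = 0"
    using v_sobolev[OF e] unfolding sobolev_rep_def by blast
  then show "v e x = 0" "v' e x = 0" using x by blast+
qed

lemma V_zero: "x \<notin> {0<..<1} \<Longrightarrow> V x = 0" by (simp add: V_def)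

lemma load_term:
  assumes e: "0 < e"
  shows "(LBINT z. f e z * (vu e z - Vu e z)) = e * (LBINT x. fib e x * (v e x - V x))"
proof -
  have i: "integrable lborel (\<lambda>z. f e z * (vu e z - Vu e z))"
    by (rule pairing_integrable_real[OF f(1)[OF e] Lpb_diff[OF _ Lpb_vu[OF e] Vu_bound(1)[OF e]]]) (use pq in simp)
  have "(LBINT y. f e (x, y) * (vu e (x, y) - Vu e (x, y))) = e * (fib e x * (v e x - V x))" for x
  proof -
    have "f e (x, y) * (vu e (x, y) - Vu e (x, y)) = f e (x, y) * (v e x - V x)" for y
      using zero_off_U(7)[OF e, of "(x, y)"] by (cases "(x, y) \<in> U e") (auto simp: vu_def Vu_def)
    then have "(LBINT y. f e (x, y) * (vu e (x, y) - Vu e (x, y))) = (LBINT y. f e (x, y) * (v e x - V x))"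
      by (simp only:)
    also have "\<dots> = (LBINT y. f e (x, y)) * (v e x - V x)" by (rule integral_mult_left_zero)
    finally show ?thesis using e by (simp add: fib_def)
  qed
  then show ?thesis unfolding iterated_integral1[OF i] by simp
qed

lemma zero_order_term:
  assumes e: "0 < e"
  shows "(LBINT z. pflux p (Vu e z) * (vu e z - Vu e z)) =
    e * (LBINT x. g (x / e powr \<alpha>) * (pflux p (V x) * (v e x - V x)))"
proof -
  have i: "integrable lborel (\<lambda>z. pflux p (Vu e z) * (vu e z - Vu e z))"
    by (rule pairing_integrable_real[OF Lpb_flux(4)[OF e] Lpb_diff[OF _ Lpb_vu[OF e] Vu_bound(1)[OF e]]]) (use pq in simp)
  have "(LBINT y. pflux p (Vu e (x, y)) * (vu e (x, y) - Vu e (x, y))) =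
      e * (g (x / e powr \<alpha>) * (pflux p (V x) * (v e x - V x)))" for x
  proof (cases "x \<in> {0<..<1}")
    case True
    have "pflux p (Vu e (x, y)) * (vu e (x, y) - Vu e (x, y)) =
        indicator {0<..<e * g (x / e powr \<alpha>)} y * (pflux p (V x) * (v e x - V x))" for y
      using True by (auto simp: Vu_def vu_def U_def subgraph_def indicator_def)
    moreover have "0 \<le> e * g (x / e powr \<alpha>)" using gamma_bounds(1)[OF e] gamma_bounds(2)[OF e, of x] by linarith
    ultimately show ?thesis by (simp add: mult.assoc)
  next
    case False
    then have "(x, y) \<notin> U e" for y using U_box[of x y e] e by auto
    then show ?thesis using False V_zero[OF False] v_zero[OF e False] by (simp add: Vu_def)
  qed
  then show ?thesis unfolding iterated_integral1[OF i] by simp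
qed

definition up_term :: "real \<Rightarrow> real" where
  "up_term e = (LBINT z. (indicator {e * g0<..} (snd z) *\<^sub>R pflux p (Gw e z)) \<bullet> (G e z - Gw e z))"

lemma Lpb_upper_flux:
  assumes e: "0 < e"
  shows "Lpb q (\<lambda>z. indicator {e * g0<..} (snd z) *\<^sub>R pflux p (Gw e z))"
    "(LBINT z. norm (indicator {e * g0<..} (snd z) *\<^sub>R pflux p (Gw e z)) powr q) \<le> e * B2 e"
proof -
  have [measurable]: "Gw e \<in> Borel_fun" using Lpb_Gw[OF e] by (simp add: Lpb_def)
  have m: "(\<lambda>z. indicator {e * g0<..} (snd z) *\<^sub>R pflux p (Gw e z)) \<in> Borel_fun" by measurable
  show "Lpb q (\<lambda>z. indicator {e * g0<..} (snd z) *\<^sub>R pflux p (Gw e z))"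
    by (rule Lpb_dominated(1)[OF Lpb_flux(2)[OF e] m]) (use q in \<open>auto simp: indicator_def\<close>)
  have "norm (indicator {e * g0<..} (snd z) *\<^sub>R pflux p (Gw e z)) powr q = indicator {e * g0<..} (snd z) * norm (Gw e z) powr p" for z
    using norm_pflux_powr[OF pq, of "Gw e z"] by (auto simp: indicator_def)
  then show "(LBINT z. norm (indicator {e * g0<..} (snd z) *\<^sub>R pflux p (Gw e z)) powr q) \<le> e * B2 e"
    using Gw_upper[OF e] by (simp only:)
qed

text \<open>Below the height \<open>e * g0\<close> the gradient of the recovery function is \<open>(D, 0)\<close>, so there only the mean of the
  horizontal derivative over the fibre enters.\<close>

lemma flux_term:
  assumes e: "0 < e"
  shows "(LBINT z. pflux p (Gw e z) \<bullet> (G e z - Gw e z)) =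
    up_term e + e * (g0 * (LBINT x. pflux p (D x) * (v' e x - D x)))"
proof -
  let ?h = "e * g0"
  have h: "0 < ?h" by (rule gamma_bounds(1)[OF e])
  note LD = Lpb_diff[OF _ Lpb_G[OF e] Lpb_Gw[OF e]]
  have LD': "Lpb p (\<lambda>z. G e z - Gw e z)" by (rule LD) (use pq in simp)
  have iU: "integrable lborel (\<lambda>z. (indicator {?h<..} (snd z) *\<^sub>R pflux p (Gw e z)) \<bullet> (G e z - Gw e z))"
    by (rule pairing_integrable[OF pq Lpb_upper_flux(1)[OF e] LD'])
  define A where "A z = indicator {0<..<?h} (snd z) * pflux p (D (fst z))" for z :: "real \<times> real"
  have LA: "Lpb q A"
  proof -
    have "Lpb p D" using D_props(2) by (simp add: Lpb_def)
    then have "integrable lborel (\<lambda>x. norm (pflux p (D x)) powr q)"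
      using Lpb_pflux[OF pq, of D] unfolding Lpb_def by blast
    from integrable_tensor[OF this, of "indicator {0<..<?h}"] h
    have "integrable lborel (\<lambda>z. norm (pflux p (D (fst z))) powr q * indicator {0<..<?h} (snd z))" by simp
    moreover have "norm (A z) powr q = norm (pflux p (D (fst z))) powr q * indicator {0<..<?h} (snd z)" for z
      by (auto simp: A_def indicator_def)
    moreover have "A \<in> Borel_fun" unfolding A_def[abs_def] by measurable
    ultimately show ?thesis by (simp add: Lpb_def)
  qed
  have i1: "integrable lborel (\<lambda>z. A z * fst (G e z))"
    by (rule pairing_integrable_real[OF LA G_component(1)[OF e]])
  have i2: "integrable lborel (\<lambda>z. (pflux p (D (fst z)) * D (fst z)) * indicator {0<..<?h} (snd z))"
  proof (rule integrable_tensor)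
    have "pflux p (D x) * D x = \<bar>D x\<bar> powr p" for x using pflux_inner_self[of p "D x"] by simp
    then show "integrable lborel (\<lambda>x. pflux p (D x) * D x)" using D_props(2) by simp
  qed (use h in simp)
  have l1: "(LBINT z. A z * fst (G e z)) = ?h * (LBINT x. pflux p (D x) * v' e x)"
  proof -
    have "(LBINT y. A (x, y) * fst (G e (x, y))) = ?h * (pflux p (D x) * v' e x)" for x
    proof -
      have "(LBINT y. A (x, y) * fst (G e (x, y))) = (LBINT y. pflux p (D x) * (indicator {0<..<?h} y * fst (G e (x, y))))"
        by (simp only: A_def mult_ac fst_conv snd_conv)
      also have "\<dots> = pflux p (D x) * (LBINT y. indicator {0<..<?h} y * fst (G e (x, y)))"
        by (rule integral_mult_right_zero)
      finally show ?thesis using h by (simp add: v'_def lower_mean_def)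
    qed
    then show ?thesis unfolding iterated_integral1[OF i1] by simp
  qed
  have l2: "(LBINT z. (pflux p (D (fst z)) * D (fst z)) * indicator {0<..<?h} (snd z)) = ?h * (LBINT x. pflux p (D x) * D x)"
    unfolding iterated_integral1[OF i2] using h by (simp add: mult.commute)
  have "(LBINT z. pflux p (Gw e z) \<bullet> (G e z - Gw e z)) =
      (LBINT z. (indicator {?h<..} (snd z) *\<^sub>R pflux p (Gw e z)) \<bullet> (G e z - Gw e z) +
        (A z * fst (G e z) - (pflux p (D (fst z)) * D (fst z)) * indicator {0<..<?h} (snd z)))"
  proof (rule integral_cong_AE)
    show "(\<lambda>z. pflux p (Gw e z) \<bullet> (G e z - Gw e z)) \<in> borel_measurable lborel"
      using pairing_integrable[OF pq Lpb_flux(2)[OF e] LD'] by auto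
    show "(\<lambda>z. (indicator {?h<..} (snd z) *\<^sub>R pflux p (Gw e z)) \<bullet> (G e z - Gw e z) +
        (A z * fst (G e z) - (pflux p (D (fst z)) * D (fst z)) * indicator {0<..<?h} (snd z))) \<in> borel_measurable lborel"
      using iU i1 i2 by auto
    show "AE z in lborel. pflux p (Gw e z) \<bullet> (G e z - Gw e z) =
        (indicator {?h<..} (snd z) *\<^sub>R pflux p (Gw e z)) \<bullet> (G e z - Gw e z) +
        (A z * fst (G e z) - (pflux p (D (fst z)) * D (fst z)) * indicator {0<..<?h} (snd z))"
      using AE_snd_neq[of ?h]
    proof eventually_elim
      case (elim z)
      show ?case
      proof (cases "z \<in> U e")
        case True
        then have pos: "0 < snd z" using U_box[of "fst z" "snd z" e] e by auto
        show ?thesis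
        proof (cases "snd z < ?h")
          case True
          then show ?thesis using pos Gw_lower(2)[OF e \<open>z \<in> U e\<close> True]
            by (simp add: A_def pflux_pair inner_prod_def algebra_simps)
        next
          case False
          then have "?h < snd z" using elim by linarith
          then show ?thesis by (simp add: A_def)
        qed
      next
        case False
        have "D (fst z) = 0 \<or> snd z \<notin> {0<..<?h}"
        proof (rule ccontr)
          assume "\<not> ?thesis"
          then have 1: "D (fst z) \<noteq> 0" "0 < snd z" "snd z < ?h" by auto
          then have "fst z \<in> {0<..<1}" using D_props(3) by blast
          moreover have "snd z < e * g (fst z / e powr \<alpha>)" using 1(3) gamma_bounds(2)[OF e, of "fst z"] by linarith
          ultimately have "z \<in> U e" using 1(2) by (cases z) (auto simp: U_def subgraph_def)
          then show False using False by simp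
        qed
        then show ?thesis using zero_off_U[OF e False] by (auto simp: A_def)
      qed
    qed
  qed
  also have "\<dots> = up_term e + (?h * (LBINT x. pflux p (D x) * v' e x) - ?h * (LBINT x. pflux p (D x) * D x))"
    using iU i1 i2 by (simp add: up_term_def l1 l2)
  also have "\<dots> = up_term e + e * (g0 * ((LBINT x. pflux p (D x) * v' e x) - (LBINT x. pflux p (D x) * D x)))"
    by (simp add: algebra_simps)
  also have "(LBINT x. pflux p (D x) * v' e x) - (LBINT x. pflux p (D x) * D x) =
      (LBINT x. pflux p (D x) * (v' e x - D x))"
  proof -
    have LDD: "Lpb p D" using D_props(2) by (simp add: Lpb_def)
    have Lv': "Lpb p (v' e)" using v_sobolev[OF e] by (auto simp: Lpb_def sobolev_rep_def)
    have "integrable lborel (\<lambda>x. pflux p (D x) * v' e x)" "integrable lborel (\<lambda>x. pflux p (D x) * D x)"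
      using pairing_integrable[OF pq Lpb_pflux[OF pq LDD] Lv'] pairing_integrable[OF pq Lpb_pflux[OF pq LDD] LDD] by auto
    then show ?thesis by (simp add: right_diff_distrib)
  qed
  finally show ?thesis .
qed

lemma integrable_period: "integrable lborel (\<lambda>s. indicator {0..<L} s * g s)"
proof (rule integrable_mult_bounded)
  show "integrable lborel (indicator {0..<L} :: real \<Rightarrow> real)" using L by simp
  show "\<bar>g s\<bar> \<le> g1" for s using g0(1) g0(2)[of s] g1[of s] by linarith
qed simp

lemma gbar_pos: "0 < gbar"
proof -
  have "(LBINT s. indicator {0..<L} s * g0) \<le> (LBINT s. indicator {0..<L} s * g s)"
  proof (rule integral_mono[OF _ integrable_period])
    show "integrable lborel (\<lambda>s. indicator {0..<L} s * g0)" using L by simp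
    show "indicator {0..<L} s * g0 \<le> indicator {0..<L} s * g s" for s
      using g0(2)[of s] by (auto simp: indicator_def)
  qed
  moreover have "(LBINT s. indicator {0..<L} s * g0) = L * g0" using L by simp
  moreover have "0 < L * g0" using L g0 by simp
  ultimately have "0 < (LBINT s. indicator {0..<L} s * g s)" by linarith
  then show ?thesis unfolding gbar using L by simp
qed

lemma Lpb_line:
  shows "Lpb p D" "Lpb p V" "0 < e \<Longrightarrow> Lpb p (v e)" "0 < e \<Longrightarrow> Lpb p (v' e)"
  using S0_V v_sobolev[of e] by (auto simp: Lpb_def sobolev_rep_def)

text \<open>The limit equation tested with \<open>v e\<close> and with \<open>V\<close>, multiplied by the mean value of \<open>g\<close>.\<close>

lemma limit_equation:
  assumes e: "0 < e"
  shows "g0 * (LBINT x. pflux p (D x) * (v' e x - D x)) + gbar * (LBINT x. pflux p (V x) * (v e x - V x)) =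
    (LBINT x. fhat x * (v e x - V x))"
proof -
  have pr: "integrable lborel (\<lambda>x. F x * H x)" if "Lpb q F" "Lpb p H" for F H :: "real \<Rightarrow> real"
    using pairing_integrable[OF pq that] by simp
  note fl = Lpb_pflux[OF pq Lpb_line(1)] Lpb_pflux[OF pq Lpb_line(2)]
  have T: "g0 * (LBINT x. pflux p (D x) * \<Phi> x) + gbar * (LBINT x. pflux p (V x) * \<phi> x) = (LBINT x. fhat x * \<phi> x)"
    if "sobolev_rep p {0<..<1} \<phi> \<Phi>" for \<phi> \<Phi>
  proof -
    have L1: "Lpb p \<Phi>" "Lpb p \<phi>" using that by (auto simp: Lpb_def sobolev_rep_def)
    have "(LBINT x. g0 / gbar * pflux p (D x) * \<Phi> x + pflux p (V x) * \<phi> x) =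
        (g0 / gbar) * (LBINT x. pflux p (D x) * \<Phi> x) + (LBINT x. pflux p (V x) * \<phi> x)"
      using pr[OF fl(1) L1(1)] pr[OF fl(2) L1(2)] by (simp add: mult.assoc)
    moreover have "(LBINT x. fhat x / gbar * \<phi> x) = (1 / gbar) * (LBINT x. fhat x * \<phi> x)"
      by simp
    ultimately have "(g0 / gbar) * (LBINT x. pflux p (D x) * \<Phi> x) + (LBINT x. pflux p (V x) * \<phi> x) =
        (1 / gbar) * (LBINT x. fhat x * \<phi> x)" using eq0_V[OF that] by simp
    then have "gbar * ((g0 / gbar) * (LBINT x. pflux p (D x) * \<Phi> x) + (LBINT x. pflux p (V x) * \<phi> x)) =
        gbar * ((1 / gbar) * (LBINT x. fhat x * \<phi> x))" by simp
    then show ?thesis using gbar_pos by (simp add: distrib_left)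
  qed
  have d: "(LBINT x. F x * (A x - B x)) = (LBINT x. F x * A x) - (LBINT x. F x * B x)"
    if "Lpb q F" "Lpb p A" "Lpb p B" for F A B :: "real \<Rightarrow> real"
    using integral_difference[OF pr[OF that(1,2)] pr[OF that(1,3)]] by (simp add: right_diff_distrib)
  show ?thesis
    unfolding d[OF fl(1) Lpb_line(4)[OF e] Lpb_line(1)] d[OF fl(2) Lpb_line(3)[OF e] Lpb_line(2)]
      d[OF fhat(1) Lpb_line(3)[OF e] Lpb_line(2)]
    using T[OF v_sobolev[OF e]] T[OF S0_V] by (simp add: right_diff_distrib)
qed

text \<open>Divided by \<open>e\<close>, the terms of the expansion that are small in norm add up to at most this much, by
  Hoelder's inequality.\<close>

definition rho :: "real \<Rightarrow> real" where
  "rho e = c * B3 e powr (1 / p) + c * B1 e powr (1 / p) + c * B1 e powr (1 / p) +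
     B4 powr (1 / q) * B3 e powr (1 / p) + B2 e powr (1 / q) * (2 powr p * (c powr q + (g0 * K0 + B2 e))) powr (1 / p)"

lemma GGw_bound:
  assumes e: "0 < e"
  shows "Lpb p (\<lambda>z. G e z - Gw e z)"
    "(LBINT z. norm (G e z - Gw e z) powr p) \<le> e * (2 powr p * (c powr q + (g0 * K0 + B2 e)))"
proof -
  have p0: "0 \<le> p" using pq by simp
  show Ld: "Lpb p (\<lambda>z. G e z - Gw e z)" by (rule Lpb_diff[OF p0 Lpb_G[OF e] Lpb_Gw[OF e]])
  have i: "integrable lborel (\<lambda>z. norm (G e z) powr p)" "integrable lborel (\<lambda>z. norm (Gw e z) powr p)"
    "integrable lborel (\<lambda>z. norm (G e z - Gw e z) powr p)"
    using Lpb_G[OF e] Lpb_Gw[OF e] Ld by (auto simp: Lpb_def)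
  have "(LBINT z. norm (G e z - Gw e z) powr p) \<le> (LBINT z. 2 powr p * (norm (G e z) powr p + norm (Gw e z) powr p))"
    using i p0 by (intro integral_mono powr_norm_diff_le) auto
  also have "\<dots> = 2 powr p * ((LBINT z. norm (G e z) powr p) + (LBINT z. norm (Gw e z) powr p))"
    using i by simp
  also have "\<dots> \<le> 2 powr p * (e * c powr q + e * (g0 * K0 + B2 e))"
    using G_bound[OF e] Gw_bound[OF e] by (intro mult_left_mono add_mono) auto
  finally show "(LBINT z. norm (G e z - Gw e z) powr p) \<le> e * (2 powr p * (c powr q + (g0 * K0 + B2 e)))"
    by (simp add: algebra_simps)
qed

definition load_error :: "real \<Rightarrow> real" where
  "load_error e = (LBINT x. (fib e x - fhat x) * (v e x - V x))"
definition oscillation_error :: "real \<Rightarrow> real" where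
  "oscillation_error e = (LBINT x. (indicator {0<..<1} x * (g (x / e powr \<alpha>) - gbar)) * (pflux p (V x) * (v e x - V x)))"

lemma Lpb_fib:
  assumes e: "0 < e"
  shows "Lpb q (fib e)"
proof -
  have fz: "y \<notin> {0<..<e * g1} \<Longrightarrow> f e (x, y) = 0" for x y
    using U_box[of x y e] e f_U[OF e, of "(x, y)"] by auto
  have fm: "f e \<in> Borel_fun" and fi: "integrable lborel (\<lambda>z. \<bar>f e z\<bar> powr q)"
    using f(1)[OF e] by (auto simp: Lpb_def)
  have k: "0 < e * g1" using e g1_pos by simp
  have "f e \<in> borel_measurable (lborel \<Otimes>\<^sub>M lborel)" unfolding lborel_prod using fm by simp
  then have m: "(\<lambda>x. LBINT y. f e (x, y)) \<in> borel_measurable lborel"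
    by (intro lborel.borel_measurable_lebesgue_integral) simp
  have "norm (fib e x) powr q = \<bar>1 / e\<bar> powr q * \<bar>LBINT y. f e (x, y)\<bar> powr q" for x
    by (simp only: fib_def real_norm_def abs_mult powr_mult)
  then show ?thesis
    unfolding Lpb_def using slice_integral_powr(1)[OF fm fz k q fi] m by (auto simp: fib_def[abs_def])
qed

text \<open>The limit equation turns the lower flux term into a load term and a zero order term. They combine
  with those of the thin equation into one integral against \<open>fib e - fhat\<close> and one against the
  oscillation of \<open>g\<close> about its mean; both factors converge to zero weakly.\<close>

lemma excess_le:
  assumes e: "0 < e"
  shows "excess e / e \<le> rho e + load_error e - oscillation_error e"
proof -
  have WV: "Lpb p (\<lambda>z. W e z - Vu e z)" "Lpb p (\<lambda>z. Vu e z - W e z)"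
    using Lpb_diff[OF _ Lpb_W[OF e] Vu_bound(1)[OF e]] Lpb_diff[OF _ Vu_bound(1)[OF e] Lpb_W[OF e]] pq(1) by auto
  have VW: "(LBINT z. norm (Vu e z - W e z) powr p) \<le> e * B1 e"
    using W_close[OF e] by (simp only: norm_minus_commute[of "Vu e _"])
  have uq: "(LBINT z. norm (pflux p (u e z)) powr q) \<le> e * c powr q"
    using u_bound[OF e] unfolding norm_pflux_powr[OF pq] .
  have Vq: "(LBINT z. norm (pflux p (Vu e z)) powr q) \<le> e * B4"
    using Vu_bound(2)[OF e] unfolding norm_pflux_powr[OF pq] .
  have cq: "(c powr q) powr (1 / q) = c" using c q by (simp add: powr_powr)
  have r1: "\<bar>LBINT z. f e z * (u e z - vu e z)\<bar> \<le> e * (c * B3 e powr (1 / p))"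
    using pairing_le[OF pq f(1)[OF e] vu_close(1)[OF e] e f(3)[OF e] vu_close(2)[OF e]] by (simp add: cq)
  have r2: "\<bar>LBINT z. f e z * (Vu e z - W e z)\<bar> \<le> e * (c * B1 e powr (1 / p))"
    using pairing_le[OF pq f(1)[OF e] WV(2) e f(3)[OF e] VW] by (simp add: cq)
  have r3: "\<bar>LBINT z. pflux p (u e z) * (W e z - Vu e z)\<bar> \<le> e * (c * B1 e powr (1 / p))"
    using pairing_le[OF pq Lpb_flux(3)[OF e] WV(1) e uq W_close[OF e]] by (simp add: cq)
  have r4: "\<bar>LBINT z. pflux p (Vu e z) * (u e z - vu e z)\<bar> \<le> e * (B4 powr (1 / q) * B3 e powr (1 / p))"
    using pairing_le[OF pq Lpb_flux(4)[OF e] vu_close(1)[OF e] e Vq vu_close(2)[OF e]] by simp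
  have r5: "\<bar>up_term e\<bar> \<le> e * (B2 e powr (1 / q) * (2 powr p * (c powr q + (g0 * K0 + B2 e))) powr (1 / p))"
    unfolding up_term_def by (rule pairing_le[OF pq Lpb_upper_flux(1)[OF e] GGw_bound(1)[OF e] e Lpb_upper_flux(2)[OF e] GGw_bound(2)[OF e]])
  have bd: "integrable lborel (\<lambda>x. F x * H x)" if "Lpb q F" "Lpb p H" for F H :: "real \<Rightarrow> real"
    using pairing_integrable[OF pq that] by simp
  have Lvv: "Lpb p (\<lambda>x. v e x - V x)" by (rule Lpb_diff[OF _ Lpb_line(3)[OF e] Lpb_line(2)]) (use pq in simp)
  have i1: "integrable lborel (\<lambda>x. pflux p (V x) * (v e x - V x))" by (rule bd[OF Lpb_pflux[OF pq Lpb_line(2)] Lvv])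
  have i2: "integrable lborel (\<lambda>x. g (x / e powr \<alpha>) * (pflux p (V x) * (v e x - V x)))"
  proof -
    have "\<bar>g x\<bar> \<le> g1" for x using g0(1) g0(2)[of x] g1[of x] by linarith
    then have "integrable lborel (\<lambda>x. (pflux p (V x) * (v e x - V x)) * g (x / e powr \<alpha>))"
      by (intro integrable_mult_bounded[OF i1]) auto
    then show ?thesis by (simp only: mult.commute)
  qed
  have s2: "oscillation_error e =
      (LBINT x. g (x / e powr \<alpha>) * (pflux p (V x) * (v e x - V x))) - gbar * (LBINT x. pflux p (V x) * (v e x - V x))"
  proof -
    have "(indicator {0<..<1} x * (g (x / e powr \<alpha>) - gbar)) * (pflux p (V x) * (v e x - V x)) =
        g (x / e powr \<alpha>) * (pflux p (V x) * (v e x - V x)) - gbar * (pflux p (V x) * (v e x - V x))" for x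
      using V_zero[of x] by (cases "x \<in> {0<..<1}") (auto simp: algebra_simps)
    then have "oscillation_error e =
        (LBINT x. g (x / e powr \<alpha>) * (pflux p (V x) * (v e x - V x)) - gbar * (pflux p (V x) * (v e x - V x)))"
      unfolding oscillation_error_def by (simp only:)
    then show ?thesis using integral_difference[OF i2 integrable_mult_right[OF i1, of gbar]] by simp
  qed
  note Lfib = Lpb_fib[OF e]
  have s1: "load_error e =
      (LBINT x. fib e x * (v e x - V x)) - (LBINT x. fhat x * (v e x - V x))"
    using integral_difference[OF bd[OF Lfib Lvv] bd[OF fhat(1) Lvv]]
    unfolding load_error_def by (simp only: left_diff_distrib)
  have "excess e \<le> e * (rho e + load_error e - oscillation_error e)"
  proof -
    define a1 where "a1 = (LBINT x. fib e x * (v e x - V x))"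
    define a2 where "a2 = (LBINT x. g (x / e powr \<alpha>) * (pflux p (V x) * (v e x - V x)))"
    define a3 where "a3 = (LBINT x. pflux p (D x) * (v' e x - D x))"
    define a4 where "a4 = (LBINT x. fhat x * (v e x - V x))"
    define a5 where "a5 = (LBINT x. pflux p (V x) * (v e x - V x))"
    have le: "g0 * a3 + gbar * a5 = a4" using limit_equation[OF e] by (simp only: a3_def a4_def a5_def)
    have "e * (a1 - a2 - g0 * a3) = e * ((a1 - a4) - (a2 - gbar * a5))" unfolding le[symmetric] by (simp add: algebra_simps)
    moreover have "excess e \<le> e * rho e + (e * a1 - e * a2 - e * (g0 * a3))"
      unfolding excess_expansion[OF e] load_term[OF e] zero_order_term[OF e] flux_term[OF e] rho_def distrib_left
      using r1 r2 r3 r4 r5 unfolding a1_def[symmetric] a2_def[symmetric] a3_def[symmetric] distrib_left by linarith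
    ultimately show ?thesis
      unfolding s1 s2 a1_def[symmetric] a2_def[symmetric] a4_def[symmetric] a5_def[symmetric]
      by (simp add: algebra_simps)
  qed
  then show ?thesis using e by (simp add: pos_divide_le_eq mult.commute)
qed

lemma Lfib_bound:
  assumes e: "0 < e"
  shows "integrable lborel (fib e)" "(LBINT x. \<bar>fib e x\<bar>) powr q \<le> g1 powr (q - 1) * c powr q"
    "x \<notin> {0<..<1} \<Longrightarrow> fib e x = 0"
proof -
  have fz: "y \<notin> {0<..<e * g1} \<Longrightarrow> f e (x, y) = 0" for x y
    using U_box[of x y e] e f_U[OF e, of "(x, y)"] by auto
  have fm: "f e \<in> Borel_fun" and fi: "integrable lborel (\<lambda>z. \<bar>f e z\<bar> powr q)"
    using f(1)[OF e] by (auto simp: Lpb_def)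
  have k: "0 < e * g1" using e g1_pos by simp
  have m: "fib e \<in> Borel_fun" and i: "integrable lborel (\<lambda>x. \<bar>fib e x\<bar> powr q)"
    using Lpb_fib[OF e] by (auto simp: Lpb_def)
  show z: "fib e x = 0" if "x \<notin> {0<..<1}" for x
  proof -
    have "f e (x, y) = 0" for y using U_box[of x y e] e f_U[OF e, of "(x, y)"] that by auto
    then show ?thesis by (simp add: fib_def)
  qed
  have eq: "\<bar>fib e x\<bar> powr q = \<bar>1 / e\<bar> powr q * \<bar>LBINT y. f e (x, y)\<bar> powr q" for x
    by (simp only: fib_def abs_mult powr_mult)
  note J = slice_integral_powr[OF fm fz k q fi]
  note P = powr_integral_unit[OF m z i q]
  show "integrable lborel (fib e)" by (rule P(1))
  have "(LBINT x. \<bar>fib e x\<bar> powr q) = \<bar>1 / e\<bar> powr q * (LBINT x. \<bar>LBINT y. f e (x, y)\<bar> powr q)"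
    unfolding eq by simp
  also have "\<dots> \<le> \<bar>1 / e\<bar> powr q * ((e * g1) powr (q - 1) * (e * c powr q))"
    using J(2) f(3)[OF e] by (intro mult_left_mono) (auto intro: order_trans[OF _ mult_left_mono])
  also have "\<dots> = (\<bar>1 / e\<bar> powr q * e powr (q - 1) * e) * (g1 powr (q - 1) * c powr q)"
    by (simp add: powr_mult)
  also have "\<bar>1 / e\<bar> powr q * e powr (q - 1) * e = 1"
    using e by (simp add: powr_divide powr_diff)
  finally show "(LBINT x. \<bar>fib e x\<bar>) powr q \<le> g1 powr (q - 1) * c powr q" using P(2) by simp
qed

end

section \<open>Vanishing of the excess and strong convergence\<close>

lemma powr_at_right_0: "0 < a \<Longrightarrow> ((\<lambda>e::real. e powr a) \<longlongrightarrow> 0) (at_right 0)"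
  by real_asymp

lemma scaled_powr_tendsto_0:
  fixes B :: "real \<Rightarrow> real"
  assumes "(B \<longlongrightarrow> 0) (at_right 0)" "\<And>e. 0 < e \<Longrightarrow> 0 \<le> B e" "0 < a"
  shows "((\<lambda>e. B e powr a) \<longlongrightarrow> 0) (at_right 0)"
proof -
  have "\<forall>\<^sub>F e in at_right 0. 0 \<le> B e" using assms(2) by (auto simp: eventually_at_filter)
  then have "((\<lambda>e. B e powr a) \<longlongrightarrow> 0 powr a) (at_right 0)"
    using assms(1,3) by (intro tendsto_powr' tendsto_const) auto
  then show ?thesis using assms(3) by simp
qed

lemma eventually_at_right_0: "(\<And>e::real. 0 < e \<Longrightarrow> P e) \<Longrightarrow> \<forall>\<^sub>F e in at_right 0. P e"
  by (auto simp: eventually_at_filter)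

text \<open>A bound for the \<open>p\<close>-th powers of the derivatives makes the primitives uniformly Hoelder continuous with
  exponent \<open>1 - 1 / p\<close>.\<close>

lemma primitive_modulus:
  assumes p: "1 < p" and e: "0 < e"
  shows "\<exists>d>0. \<forall>w. integrable lborel w \<longrightarrow> integrable lborel (\<lambda>t. \<bar>w t\<bar> powr p) \<longrightarrow>
    (LBINT t. \<bar>w t\<bar> powr p) \<le> A \<longrightarrow> (\<forall>x y. \<bar>x - y\<bar> < d \<longrightarrow> \<bar>primitive w x - primitive w y\<bar> < e)"
proof -
  have "((\<lambda>d. d powr (p - 1) * \<bar>A\<bar>) \<longlongrightarrow> 0 * \<bar>A\<bar>) (at_right (0::real))"
    using p by (intro tendsto_mult tendsto_const powr_at_right_0) auto
  then have "\<forall>\<^sub>F d in at_right (0::real). d powr (p - 1) * \<bar>A\<bar> < e powr p"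
    using e order_tendstoD(2)[of "\<lambda>d::real. d powr (p - 1) * \<bar>A\<bar>" "0 * \<bar>A\<bar>" "at_right 0" "e powr p"] by simp
  then obtain b where b: "b > 0" "\<And>d. 0 < d \<Longrightarrow> d < b \<Longrightarrow> d powr (p - 1) * \<bar>A\<bar> < e powr p"
    unfolding eventually_at_right_field by auto
  show ?thesis
  proof (intro exI[of _ "b / 2"] conjI allI impI)
    show "0 < b / 2" using b by simp
    fix w :: "real \<Rightarrow> real" and x y assume w: "integrable lborel w" "integrable lborel (\<lambda>t. \<bar>w t\<bar> powr p)"
      "(LBINT t. \<bar>w t\<bar> powr p) \<le> A" and xy: "\<bar>x - y\<bar> < b / 2"
    have "\<bar>primitive w x - primitive w y\<bar> powr p \<le> \<bar>x - y\<bar> powr (p - 1) * A"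
      by (rule primitive_holder[OF w(1,2) p w(3)])
    also have "\<dots> \<le> (b / 2) powr (p - 1) * \<bar>A\<bar>"
      using xy p by (intro mult_mono' powr_mono2) (auto intro: order_trans[OF integral_nonneg_AE w(3)])
    also have "\<dots> < e powr p" using b by auto
    finally show "\<bar>primitive w x - primitive w y\<bar> < e"
      using p e by (smt (verit) powr_mono2)
  qed
qed

text \<open>The monotonicity product controls \<open>Q\<close> up to an arbitrarily small multiple of the energies, which stay
  bounded after division by \<open>e\<close>.\<close>

lemma scaled_convergence:
  fixes F1 F2 :: "real \<Rightarrow> 'a::euclidean_space \<Rightarrow> 'b::euclidean_space" and Q :: "'b \<Rightarrow> 'b \<Rightarrow> real"
  assumes pq: "1 < p" "1 / p + 1 / q = 1"
    and Q: "continuous_on UNIV (\<lambda>z. Q (fst z) (snd z))"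
      "\<And>t x y. t > 0 \<Longrightarrow> Q (t *\<^sub>R x) (t *\<^sub>R y) = t powr p * Q x y" "\<And>x. Q x x = 0" "\<And>x y. 0 \<le> Q x y"
    and L: "\<And>e. 0 < e \<Longrightarrow> Lpb p (F1 e)" "\<And>e. 0 < e \<Longrightarrow> Lpb p (F2 e)"
    and iQ: "\<And>e. 0 < e \<Longrightarrow> integrable lborel (\<lambda>z. Q (F1 e z) (F2 e z))"
    and M: "\<And>e. 0 < e \<Longrightarrow> e < 1 \<Longrightarrow> (LBINT z. norm (F1 e z) powr p) + (LBINT z. norm (F2 e z) powr p) \<le> e * M"
    and E: "\<And>e. 0 < e \<Longrightarrow> (LBINT z. (pflux p (F1 e z) - pflux p (F2 e z)) \<bullet> (F1 e z - F2 e z)) \<le> e * E e"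
      "(E \<longlongrightarrow> 0) (at_right 0)"
  shows "((\<lambda>e. (LBINT z. Q (F1 e z) (F2 e z)) / e) \<longlongrightarrow> 0) (at_right 0)"
proof -
  define A where "A e = (if 0 < e then (LBINT z. Q (F1 e z) (F2 e z)) / e else 0)" for e
  have "(A \<longlongrightarrow> 0) (at_right 0)"
  proof (rule tendsto_0_interpolate[OF _ E(2)])
    show "0 \<le> A e" for e using Q(4) by (simp add: A_def)
    fix d :: real assume d: "d > 0"
    obtain C where C: "C \<ge> 0"
      "\<And>x y. Q x y \<le> d * (norm x powr p + norm y powr p) + C * ((pflux p x - pflux p y) \<bullet> (x - y))"
      using controlled_by_monotonicity[OF pq(1) Q(1-3) d] by blast
    have "A e \<le> d * M + C * E e" if e: "0 < e" "e < 1" for e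
    proof -
      have p0: "0 \<le> p" using pq by simp
      have i: "integrable lborel (\<lambda>z. norm (F1 e z) powr p)" "integrable lborel (\<lambda>z. norm (F2 e z) powr p)"
        using L e by (auto simp: Lpb_def)
      note fl = Lpb_pflux[OF pq L(1)[OF e(1)]] Lpb_pflux[OF pq L(2)[OF e(1)]]
      have q0: "0 \<le> q" using conjugate_exponents(1)[OF pq] by simp
      have im: "integrable lborel (\<lambda>z. (pflux p (F1 e z) - pflux p (F2 e z)) \<bullet> (F1 e z - F2 e z))"
        by (rule pairing_integrable[OF pq Lpb_diff[OF q0 fl] Lpb_diff[OF p0 L(1)[OF e(1)] L(2)[OF e(1)]]])
      have "(LBINT z. Q (F1 e z) (F2 e z)) \<le> (LBINT z. d * (norm (F1 e z) powr p + norm (F2 e z) powr p) +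
          C * ((pflux p (F1 e z) - pflux p (F2 e z)) \<bullet> (F1 e z - F2 e z)))"
        using iQ[OF e(1)] i im C(2) by (intro integral_mono) auto
      also have "\<dots> = d * ((LBINT z. norm (F1 e z) powr p) + (LBINT z. norm (F2 e z) powr p)) +
          C * (LBINT z. (pflux p (F1 e z) - pflux p (F2 e z)) \<bullet> (F1 e z - F2 e z))"
        using i im by simp
      also have "\<dots> \<le> d * (e * M) + C * (e * E e)"
        using d C(1) M[OF e] E(1)[OF e(1)] by (intro add_mono mult_left_mono) auto
      also have "\<dots> = (d * M + C * E e) * e" by (simp add: algebra_simps)
      finally show ?thesis using e by (simp add: A_def pos_divide_le_eq)
    qed
    then have "\<forall>\<^sub>F e in at_right 0. A e \<le> d * M + C * E e"
      unfolding eventually_at_right_field by (intro exI[of _ 1]) auto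
    then show "\<exists>C\<ge>0. \<forall>\<^sub>F e in at_right 0. A e \<le> d * M + C * E e" using C(1) by blast
  qed
  then show ?thesis
    by (rule Lim_transform_eventually) (auto simp: A_def eventually_at_filter)
qed

context thin_limit
begin

lemma B_tendsto: "(B1 \<longlongrightarrow> 0) (at_right 0)" "(B2 \<longlongrightarrow> 0) (at_right 0)" "(B3 \<longlongrightarrow> 0) (at_right 0)"
proof -
  have "((\<lambda>e. g1 * (L powr p * K0) * e powr (\<alpha> * p)) \<longlongrightarrow> g1 * (L powr p * K0) * 0) (at_right 0)"
    using \<alpha> pq by (intro tendsto_mult tendsto_const powr_at_right_0) auto
  then show "(B1 \<longlongrightarrow> 0) (at_right 0)"
    by (simp add: B1_def[abs_def] powr_mult powr_powr mult_ac)
  have "((\<lambda>e. 2 powr p * (1 + L powr p) * K0 * e powr (\<alpha> - 1)) \<longlongrightarrow> 2 powr p * (1 + L powr p) * K0 * 0) (at_right 0)"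
    using \<alpha> by (intro tendsto_mult tendsto_const powr_at_right_0) auto
  then show "(B2 \<longlongrightarrow> 0) (at_right 0)" by (simp add: B2_def[abs_def])
  have "((\<lambda>e. g1 powr p * c powr q * e powr p) \<longlongrightarrow> g1 powr p * c powr q * 0) (at_right 0)"
    using pq by (intro tendsto_mult tendsto_const powr_at_right_0) auto
  then show "(B3 \<longlongrightarrow> 0) (at_right 0)" by (simp add: B3_def[abs_def] powr_mult mult_ac)
qed

lemma B_nonneg: "0 \<le> B1 e" "0 \<le> B2 e" "0 \<le> B3 e"
  using g1_pos K0_nonneg by (auto simp: B1_def B2_def B3_def)

lemma rho_tendsto: "(rho \<longlongrightarrow> 0) (at_right 0)"
proof -
  have pp: "0 < 1 / p" "0 < 1 / q" using pq q by auto
  note b1 = scaled_powr_tendsto_0[OF B_tendsto(1) B_nonneg(1) pp(1)]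
  note b2 = scaled_powr_tendsto_0[OF B_tendsto(2) B_nonneg(2) pp(2)]
  note b3 = scaled_powr_tendsto_0[OF B_tendsto(3) B_nonneg(3) pp(1)]
  have "((\<lambda>e. 2 powr p * (c powr q + (g0 * K0 + B2 e))) \<longlongrightarrow> 2 powr p * (c powr q + (g0 * K0 + 0))) (at_right 0)"
    by (intro tendsto_intros B_tendsto)
  then have b4: "((\<lambda>e. (2 powr p * (c powr q + (g0 * K0 + B2 e))) powr (1 / p)) \<longlongrightarrow>
      (2 powr p * (c powr q + (g0 * K0 + 0))) powr (1 / p)) (at_right 0)"
    using pp g0(1) K0_nonneg B_nonneg by (intro tendsto_powr' tendsto_const) auto
  have "(rho \<longlongrightarrow> c * 0 + c * 0 + c * 0 + B4 powr (1 / q) * 0 + 0 * (2 powr p * (c powr q + (g0 * K0 + 0))) powr (1 / p)) (at_right 0)"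
    unfolding rho_def[abs_def] by (intro tendsto_intros b1 b2 b3 b4)
  then show ?thesis by simp
qed

lemma ex_mean_primitive: "\<exists>cv. \<forall>e>0. AE x in lborel. x \<in> {0<..<1} \<longrightarrow> v e x = cv e + primitive (v' e) x"
proof -
  have "\<forall>e. \<exists>k. e > 0 \<longrightarrow> (AE x in lborel. x \<in> {0<..<1} \<longrightarrow> v e x = k + primitive (v' e) x)"
    using sobolev_interval_primitive[OF v_sobolev] by blast
  then show ?thesis by metis
qed

definition cv :: "real \<Rightarrow> real" where
  "cv = (SOME cv. \<forall>e>0. AE x in lborel. x \<in> {0<..<1} \<longrightarrow> v e x = cv e + primitive (v' e) x)"

lemma cv: "e > 0 \<Longrightarrow> AE x in lborel. x \<in> {0<..<1} \<longrightarrow> v e x = cv e + primitive (v' e) x"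
  using someI_ex[OF ex_mean_primitive] unfolding cv_def by blast

text \<open>The continuous representative of \<open>v e - V\<close>.\<close>

definition diffc :: "real \<Rightarrow> real \<Rightarrow> real" where
  "diffc e x = (cv e + primitive (v' e) x) - (c0 + primitive D x)"

lemma v'_props:
  assumes "0 < e"
  shows "integrable lborel (v' e)" "integrable lborel (\<lambda>x. \<bar>v' e x\<bar> powr p)" "v e \<in> Borel_fun"
    "integrable lborel (v e)" "integrable lborel (\<lambda>x. \<bar>v e x\<bar> powr p)"
  using v_sobolev[OF assms] by (auto simp: sobolev_rep_def)

lemma diffc_borel: "0 < e \<Longrightarrow> diffc e \<in> Borel_fun"
proof -
  assume "0 < e"
  then have [measurable]: "v' e \<in> Borel_fun" using v'_props(1) by auto
  show ?thesis unfolding diffc_def[abs_def] by measurable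
qed

lemma diffc_AE: "0 < e \<Longrightarrow> AE x in lborel. x \<in> {0<..<1} \<longrightarrow> v e x - V x = diffc e x"
  using cv[of e] by (auto elim!: eventually_mono simp: diffc_def V_def)

lemma integral_diffc:
  assumes e: "0 < e" and k: "k \<in> Borel_fun" "\<And>x. x \<notin> {0<..<1} \<Longrightarrow> k x = 0"
  shows "(LBINT x. k x * (v e x - V x)) = (LBINT x. k x * diffc e x)"
proof (rule integral_cong_AE)
  show "(\<lambda>x. k x * (v e x - V x)) \<in> borel_measurable lborel" using k(1) v'_props(3)[OF e] by simp
  show "(\<lambda>x. k x * diffc e x) \<in> borel_measurable lborel" using k(1) diffc_borel[OF e] by simp
  show "AE x in lborel. k x * (v e x - V x) = k x * diffc e x"
    using diffc_AE[OF e] by eventually_elim (use k(2) in \<open>metis mult_zero_left\<close>)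
qed

definition Bv :: real where "Bv = 2 * (c powr q / g0) powr (1 / p) + (\<bar>c0\<bar> + (LBINT t. \<bar>D t\<bar>))"

lemma root_bound: "0 \<le> t \<Longrightarrow> t powr p \<le> M \<Longrightarrow> t \<le> M powr (1 / p)"
proof -
  assume t: "0 \<le> t" "t powr p \<le> M"
  have "(t powr p) powr (1 / p) \<le> M powr (1 / p)" using t pq by (intro powr_mono2) auto
  then show ?thesis using t pq by (simp add: powr_powr)
qed

text \<open>The value of \<open>cv e + primitive (v' e)\<close> at a point differs from every other value by at most the integral
  of \<open>\<bar>v' e\<bar>\<close>; averaging over the unit interval compares it with the integral of \<open>\<bar>v e\<bar>\<close>.\<close>

lemma diffc_bound:
  assumes e: "0 < e"
  shows "\<bar>diffc e x\<bar> \<le> Bv"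
proof -
  let ?M = "(c powr q / g0) powr (1 / p)"
  note P = v'_props[OF e]
  have n1: "(LBINT t. \<bar>v e t\<bar>) \<le> ?M"
    using powr_integral_unit(2)[OF P(3) v_zero[OF e] P(5) pq(1)] v_bounds(1)[OF e] by (intro root_bound) auto
  have n2: "(LBINT t. \<bar>v' e t\<bar>) \<le> ?M"
  proof (rule root_bound)
    have "v' e \<in> Borel_fun" using P(1) by auto
    from powr_integral_unit(2)[OF this v'_zero[OF e] P(2) pq(1)] v_bounds(2)[OF e]
    show "(LBINT t. \<bar>v' e t\<bar>) powr p \<le> c powr q / g0" by linarith
  qed simp
  let ?N = "LBINT t. \<bar>v' e t\<bar>"
  let ?k = "cv e + primitive (v' e) x"
  have "(LBINT t. indicator {0<..<1::real} t * \<bar>?k\<bar>) \<le> (LBINT t. \<bar>v e t\<bar> + indicator {0<..<1} t * ?N)"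
  proof (rule integral_mono_AE)
    show "integrable lborel (\<lambda>t. indicator {0<..<1::real} t * \<bar>?k\<bar>)" by simp
    show "integrable lborel (\<lambda>t. \<bar>v e t\<bar> + indicator {0<..<1} t * ?N)" using P(4) by simp
    show "AE t in lborel. indicator {0<..<1} t * \<bar>?k\<bar> \<le> \<bar>v e t\<bar> + indicator {0<..<1} t * ?N"
      using cv[OF e]
    proof eventually_elim
      case (elim t)
      then show ?case
        using primitive_diff_le_total[OF P(1), of x t] by (cases "t \<in> {0<..<1}") auto
    qed
  qed
  then have "\<bar>?k\<bar> \<le> (LBINT t. \<bar>v e t\<bar>) + ?N" using P(4) by simp
  moreover have "\<bar>c0 + primitive D x\<bar> \<le> \<bar>c0\<bar> + (LBINT t. \<bar>D t\<bar>)"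
  proof -
    have "primitive D (-1) = 0" by (simp add: primitive_def)
    then show ?thesis using primitive_diff_le_total[OF D_props(1), of x "-1"] by simp
  qed
  ultimately show ?thesis using n1 n2 unfolding diffc_def Bv_def by linarith
qed

lemma diffc_equicontinuous:
  assumes r: "0 < r"
  shows "\<exists>d>0. \<forall>e>0. \<forall>x y. \<bar>x - y\<bar> < d \<longrightarrow> \<bar>diffc e x - diffc e y\<bar> < r"
proof -
  define A where "A = c powr q / g0 + K0"
  have A: "c powr q / g0 \<le> A" "K0 \<le> A" using K0_nonneg g0(1) by (auto simp: A_def)
  obtain d where d: "d > 0" "\<And>w x y. integrable lborel w \<Longrightarrow> integrable lborel (\<lambda>t. \<bar>w t\<bar> powr p) \<Longrightarrow>
    (LBINT t. \<bar>w t\<bar> powr p) \<le> A \<Longrightarrow> \<bar>x - y\<bar> < d \<Longrightarrow> \<bar>primitive w x - primitive w y\<bar> < r / 2"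
    using primitive_modulus[OF pq(1), of "r / 2" A] r by auto
  have "\<bar>diffc e x - diffc e y\<bar> < r" if e: "e > 0" and xy: "\<bar>x - y\<bar> < d" for e x y
  proof -
    have "\<bar>primitive (v' e) x - primitive (v' e) y\<bar> < r / 2"
      using v_bounds(2)[OF e] A(1) by (intro d(2)[OF v'_props(1,2)[OF e] _ xy]) linarith
    moreover have "\<bar>primitive D x - primitive D y\<bar> < r / 2"
      using A(2) by (intro d(2)[OF D_props(1,2) _ xy]) (simp add: K0_def)
    ultimately show ?thesis unfolding diffc_def by linarith
  qed
  then show ?thesis using d(1) by blast
qed

text \<open>Weak convergence of the fibre averages of the load against the equicontinuous family \<open>diffc\<close>.\<close>

lemma load_limit: "(load_error \<longlongrightarrow> 0) (at_right 0)"
proof -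
  have fh: "fhat \<in> Borel_fun" "integrable lborel (\<lambda>x. \<bar>fhat x\<bar> powr q)" using fhat(1) by (auto simp: Lpb_def)
  note fhi = powr_integral_unit(1)[OF fh(1) fhat(2) fh(2) q]
  define K where "K = (g1 powr (q - 1) * c powr q) powr (1 / q) + (LBINT x. \<bar>fhat x\<bar>)"
  have "((\<lambda>e. LBINT x. (fib e x - fhat x) * diffc e x) \<longlongrightarrow> 0) (at_right 0)"
  proof (rule integral_product_tendsto_0[where K = K and B = Bv])
    show "\<forall>\<^sub>F e in at_right 0. integrable lborel (\<lambda>x. fib e x - fhat x) \<and> (\<forall>x. x \<notin> {0<..<1} \<longrightarrow> fib e x - fhat x = 0) \<and>
        (LBINT x. \<bar>fib e x - fhat x\<bar>) \<le> K"
    proof (rule eventually_at_right_0)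
      fix e :: real assume e: "0 < e"
      note F = Lfib_bound[OF e]
      have "((LBINT x. \<bar>fib e x\<bar>) powr q) powr (1 / q) \<le> (g1 powr (q - 1) * c powr q) powr (1 / q)"
        using F(2) q by (intro powr_mono2) auto
      then have b: "(LBINT x. \<bar>fib e x\<bar>) \<le> (g1 powr (q - 1) * c powr q) powr (1 / q)" using q by (simp add: powr_powr)
      have "(LBINT x. \<bar>fib e x - fhat x\<bar>) \<le> (LBINT x. \<bar>fib e x\<bar> + \<bar>fhat x\<bar>)"
        using F(1) fhi by (intro integral_mono) auto
      also have "\<dots> = (LBINT x. \<bar>fib e x\<bar>) + (LBINT x. \<bar>fhat x\<bar>)" using F(1) fhi by simp
      finally have "(LBINT x. \<bar>fib e x - fhat x\<bar>) \<le> K" using b by (simp add: K_def)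
      then show "integrable lborel (\<lambda>x. fib e x - fhat x) \<and> (\<forall>x. x \<notin> {0<..<1} \<longrightarrow> fib e x - fhat x = 0) \<and>
        (LBINT x. \<bar>fib e x - fhat x\<bar>) \<le> K"
        using F(1,3) fhi fhat(2) by auto
    qed
    show "((\<lambda>e. LBINT x. indicator {a..<b} x * (fib e x - fhat x)) \<longlongrightarrow> 0) (at_right 0)"
      if ab: "0 \<le> a" "a \<le> b" "b \<le> 1" for a b
    proof -
      have "((\<lambda>e. (LBINT x. indicator {a..<b} x * fib e x) - (LBINT x. indicator {a..<b} x * fhat x)) \<longlongrightarrow> 0) (at_right 0)"
        using weak[OF ab] unfolding fib_def[symmetric] by (rule LIM_zero)
      moreover have "\<forall>\<^sub>F e in at_right 0. (LBINT x. indicator {a..<b} x * fib e x) - (LBINT x. indicator {a..<b} x * fhat x) =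
          (LBINT x. indicator {a..<b} x * (fib e x - fhat x))"
      proof (rule eventually_at_right_0)
        fix e :: real assume e: "0 < e"
        have "integrable lborel (\<lambda>x. indicator {a..<b} x * fib e x)" "integrable lborel (\<lambda>x. indicator {a..<b} x * fhat x)"
          using integrable_indicator_mult[OF Lfib_bound(1)[OF e], of "{a..<b}"] integrable_indicator_mult[OF fhi, of "{a..<b}"]
          by simp_all
        from integral_difference[OF this]
        show "(LBINT x. indicator {a..<b} x * fib e x) - (LBINT x. indicator {a..<b} x * fhat x) =
          (LBINT x. indicator {a..<b} x * (fib e x - fhat x))" by (simp only: right_diff_distrib)
      qed
      ultimately show ?thesis by (rule Lim_transform_eventually)
    qed
    show "\<forall>\<^sub>F e in at_right 0. diffc e \<in> Borel_fun \<and> (\<forall>x\<in>{0..1}. \<bar>diffc e x\<bar> \<le> Bv)"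
      using diffc_borel diffc_bound by (intro eventually_at_right_0) auto
    show "\<exists>d>0. \<forall>\<^sub>F e in at_right 0. \<forall>x\<in>{0..1}. \<forall>y\<in>{0..1}. \<bar>x - y\<bar> < d \<longrightarrow> \<bar>diffc e x - diffc e y\<bar> < r" if r: "0 < r" for r
    proof -
      obtain d where "d > 0" "\<And>e x y. e > 0 \<Longrightarrow> \<bar>x - y\<bar> < d \<Longrightarrow> \<bar>diffc e x - diffc e y\<bar> < r"
        using diffc_equicontinuous[OF r] by auto
      then show ?thesis by (intro exI[of _ d] conjI eventually_at_right_0) auto
    qed
  qed
  moreover have "\<forall>\<^sub>F e in at_right 0. (LBINT x. (fib e x - fhat x) * diffc e x) = (LBINT x. (fib e x - fhat x) * (v e x - V x))"
  proof (rule eventually_at_right_0)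
    fix e :: real assume e: "0 < e"
    have "(\<lambda>x. fib e x - fhat x) \<in> Borel_fun" using Lfib_bound(1)[OF e] fh(1) by auto
    from integral_diffc[OF e this] show "(LBINT x. (fib e x - fhat x) * diffc e x) = (LBINT x. (fib e x - fhat x) * (v e x - V x))"
      using Lfib_bound(3)[OF e] fhat(2) by simp
  qed
  ultimately show ?thesis unfolding load_error_def[abs_def] by (rule Lim_transform_eventually)
qed

lemma V_flux_uniform:
  "uniformly_continuous_on {0..1} (\<lambda>x. pflux p (c0 + primitive D x))"
proof (rule compact_uniformly_continuous)
  have "continuous_on {0..1} (\<lambda>x. c0 + primitive D x)"
    unfolding continuous_on_iff
  proof (intro ballI allI impI)
    fix x r :: real assume "0 < r"
    from primitive_modulus[OF pq(1) this, of K0] D_props(1,2)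
    obtain d where "d > 0" "\<And>x y. \<bar>x - y\<bar> < d \<Longrightarrow> \<bar>primitive D x - primitive D y\<bar> < r"
      unfolding K0_def by blast
    then show "\<exists>d>0. \<forall>x'\<in>{0..1}. dist x' x < d \<longrightarrow> dist (c0 + primitive D x') (c0 + primitive D x) < r"
      by (intro exI[of _ d]) (auto simp: dist_real_def)
  qed
  from continuous_on_compose2[OF continuous_pflux[OF pq(1), of UNIV] this]
  show "continuous_on {0..1} (\<lambda>x. pflux p (c0 + primitive D x))" by simp
qed simp

text \<open>The oscillation of \<open>g (x / e powr \<alpha>)\<close> about its mean has integrals of order \<open>e powr \<alpha>\<close> over intervals,
  and the product of the flux of \<open>V\<close> with \<open>diffc\<close> is equicontinuous.\<close>

lemma oscillation_limit: "(oscillation_error \<longlongrightarrow> 0) (at_right 0)"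
proof -
  define k where "k e x = indicator {0<..<1} x * (g (x / e powr \<alpha>) - gbar)" for e x
  define w where "w x = pflux p (c0 + primitive D x)" for x
  have wm [measurable]: "w \<in> Borel_fun" unfolding w_def[abs_def] by measurable
  have km: "k e \<in> Borel_fun" for e unfolding k_def[abs_def] by measurable
  have gb: "\<bar>g x - gbar\<bar> \<le> g1 + gbar" for x using g0(1) g0(2)[of x] g1[of x] gbar_pos by linarith
  define Bw where "Bw = (\<bar>c0\<bar> + (LBINT t. \<bar>D t\<bar>)) powr (p - 1)"
  have wB: "\<bar>w x\<bar> \<le> Bw" for x
  proof -
    have "primitive D (-1) = 0" by (simp add: primitive_def)
    then have "\<bar>c0 + primitive D x\<bar> \<le> \<bar>c0\<bar> + (LBINT t. \<bar>D t\<bar>)"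
      using primitive_diff_le_total[OF D_props(1), of x "-1"] by simp
    then have "norm (w x) \<le> Bw" unfolding w_def norm_pflux Bw_def using pq by (intro powr_mono2) auto
    then show ?thesis by simp
  qed
  have Bw0: "0 \<le> Bw" by (simp add: Bw_def)
  have "\<bar>diffc 1 0\<bar> \<le> Bv" by (rule diffc_bound) simp
  then have Bv0: "0 \<le> Bv" by linarith
  have ki: "integrable lborel (k e)" for e
  proof (unfold k_def[abs_def], rule integrable_mult_bounded)
    show "integrable lborel (indicator {0<..<1} :: real \<Rightarrow> real)" by simp
    show "\<bar>g (x / e powr \<alpha>) - gbar\<bar> \<le> g1 + gbar" for x by (rule gb)
  qed measurable
  have "((\<lambda>e. LBINT x. k e x * (w x * diffc e x)) \<longlongrightarrow> 0) (at_right 0)"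
  proof (rule integral_product_tendsto_0[where K = "g1 + gbar" and B = "Bw * Bv"])
    have "(LBINT x. \<bar>k e x\<bar>) \<le> g1 + gbar" for e
    proof -
      have "(LBINT x. \<bar>k e x\<bar>) \<le> (LBINT x. indicator {0<..<1::real} x * (g1 + gbar))"
      proof (rule integral_mono[OF integrable_abs[OF ki]])
        show "\<bar>k e x\<bar> \<le> indicator {0<..<1} x * (g1 + gbar)" for x using gb by (auto simp: k_def indicator_def)
      qed simp
      then show ?thesis by simp
    qed
    then show "\<forall>\<^sub>F e in at_right 0. integrable lborel (k e) \<and> (\<forall>x. x \<notin> {0<..<1} \<longrightarrow> k e x = 0) \<and> (LBINT x. \<bar>k e x\<bar>) \<le> g1 + gbar"
      using ki by (intro eventually_at_right_0) (auto simp: k_def)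
    show "((\<lambda>e. LBINT x. indicator {a..<b} x * k e x) \<longlongrightarrow> 0) (at_right 0)"
      if ab: "0 \<le> a" "a \<le> b" "b \<le> 1" for a b
    proof (rule Lim_null_comparison)
      have mean: "(LBINT x. indicator {0..<L} x * (g x - gbar)) = 0"
      proof -
        have ci: "integrable lborel (\<lambda>s. indicator {0..<L} s * gbar)" using L by simp
        have "(LBINT x. indicator {0..<L} x * (g x - gbar)) = (LBINT x. indicator {0..<L} x * g x) - (LBINT x. indicator {0..<L} x * gbar)"
          using integral_difference[OF integrable_period ci] by (simp only: right_diff_distrib)
        then show ?thesis using L by (simp add: gbar)
      qed
      show "\<forall>\<^sub>F e in at_right 0. norm (LBINT x. indicator {a..<b} x * k e x) \<le> e powr \<alpha> * (2 * L * (g1 + gbar))"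
      proof (rule eventually_at_right_0)
        fix e :: real assume e: "0 < e"
        have "(LBINT x. indicator {a..<b} x * k e x) = (LBINT x. indicator {a..<b} x * (g (x / e powr \<alpha>) - gbar))"
        proof (rule integral_cong_AE)
          show "AE x in lborel. indicator {a..<b} x * k e x = indicator {a..<b} x * (g (x / e powr \<alpha>) - gbar)"
            using AE_lborel_singleton[of 0] by eventually_elim (use ab in \<open>auto simp: k_def indicator_def\<close>)
        qed (use km in measurable)
        moreover have "\<bar>LBINT x. indicator {a..<b} x * (g (x / e powr \<alpha>) - gbar)\<bar> \<le> e powr \<alpha> * (2 * L * (g1 + gbar))"
          by (rule rapid_oscillation_bound[where \<phi> = "\<lambda>x. g x - gbar"]) (use L per gb mean ab e in auto)
        ultimately show "norm (LBINT x. indicator {a..<b} x * k e x) \<le> e powr \<alpha> * (2 * L * (g1 + gbar))" by simp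
      qed
      have "((\<lambda>e. e powr \<alpha> * (2 * L * (g1 + gbar))) \<longlongrightarrow> 0 * (2 * L * (g1 + gbar))) (at_right 0)"
        using \<alpha> by (intro tendsto_mult tendsto_const powr_at_right_0) auto
      then show "((\<lambda>e. e powr \<alpha> * (2 * L * (g1 + gbar))) \<longlongrightarrow> 0) (at_right 0)" by simp
    qed
    show "\<forall>\<^sub>F e in at_right 0. (\<lambda>x. w x * diffc e x) \<in> Borel_fun \<and> (\<forall>x\<in>{0..1}. \<bar>w x * diffc e x\<bar> \<le> Bw * Bv)"
      using diffc_borel diffc_bound wB Bw0 by (intro eventually_at_right_0) (auto simp: abs_mult intro!: mult_mono borel_measurable_times)
    show "\<exists>d>0. \<forall>\<^sub>F e in at_right 0. \<forall>x\<in>{0..1}. \<forall>y\<in>{0..1}. \<bar>x - y\<bar> < d \<longrightarrow> \<bar>w x * diffc e x - w y * diffc e y\<bar> < r" if r: "0 < r" for r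
    proof -
      define s where "s = r / (2 * (Bw + Bv + 1))"
      have s: "0 < s" using r Bw0 Bv0 by (simp add: s_def)
      have sB: "(Bw + Bv) * s < r"
      proof -
        have "(Bw + Bv) * s \<le> (Bw + Bv + 1) * s" using s by (intro mult_right_mono) auto
        also have "\<dots> = r / 2" using Bw0 Bv0 by (simp add: s_def field_simps)
        finally show ?thesis using r by linarith
      qed
      obtain d1 where d1: "d1 > 0" "\<And>e x y. e > 0 \<Longrightarrow> \<bar>x - y\<bar> < d1 \<Longrightarrow> \<bar>diffc e x - diffc e y\<bar> < s"
        using diffc_equicontinuous[OF s] by auto
      obtain d2 where d2: "d2 > 0" "\<And>x y. x \<in> {0..1} \<Longrightarrow> y \<in> {0..1} \<Longrightarrow> \<bar>x - y\<bar> < d2 \<Longrightarrow> \<bar>w x - w y\<bar> < s"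
        using V_flux_uniform s unfolding uniformly_continuous_on_def w_def[symmetric] dist_real_def by meson
      have "\<bar>w x * diffc e x - w y * diffc e y\<bar> < r" if e: "0 < e" and xy: "x \<in> {0..1}" "y \<in> {0..1}" "\<bar>x - y\<bar> < min d1 d2" for e x y
      proof -
        have "w x * diffc e x - w y * diffc e y = w x * (diffc e x - diffc e y) + (w x - w y) * diffc e y"
          by (simp add: algebra_simps)
        then have "\<bar>w x * diffc e x - w y * diffc e y\<bar> \<le> \<bar>w x\<bar> * \<bar>diffc e x - diffc e y\<bar> + \<bar>w x - w y\<bar> * \<bar>diffc e y\<bar>"
          using abs_triangle_ineq[of "w x * (diffc e x - diffc e y)" "(w x - w y) * diffc e y"] by (simp only: abs_mult)
        also have "\<dots> \<le> Bw * s + s * Bv"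
        proof (intro add_mono mult_mono)
          show "\<bar>diffc e x - diffc e y\<bar> \<le> s" using d1(2)[OF e, of x y] xy by simp
          show "\<bar>w x - w y\<bar> \<le> s" using d2(2)[of x y] xy by simp
        qed (use wB Bw0 s diffc_bound[OF e] in auto)
        also have "\<dots> < r" using sB by (simp add: algebra_simps)
        finally show ?thesis .
      qed
      then show ?thesis using d1 d2 by (intro exI[of _ "min d1 d2"] conjI eventually_at_right_0) auto
    qed
  qed
  moreover have "\<forall>\<^sub>F e in at_right 0. (LBINT x. k e x * (w x * diffc e x)) = (LBINT x. k e x * (pflux p (V x) * (v e x - V x)))"
  proof (rule eventually_at_right_0)
    fix e :: real assume e: "0 < e"
    have "(\<lambda>x. k e x * w x) \<in> Borel_fun" using km by simp
    from integral_diffc[OF e this] have "(LBINT x. (k e x * w x) * diffc e x) = (LBINT x. (k e x * w x) * (v e x - V x))"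
      by (simp add: k_def)
    moreover have "(k e x * w x) * (v e x - V x) = k e x * (pflux p (V x) * (v e x - V x))" for x
      by (cases "x \<in> {0<..<1}") (auto simp: k_def w_def V_def)
    ultimately show "(LBINT x. k e x * (w x * diffc e x)) = (LBINT x. k e x * (pflux p (V x) * (v e x - V x)))"
      by (simp only: mult.assoc)
  qed
  ultimately show ?thesis unfolding k_def oscillation_error_def[abs_def] by (rule Lim_transform_eventually)
qed

lemma mono_parts:
  assumes e: "0 < e"
  shows "0 \<le> (LBINT z. (pflux p (G e z) - pflux p (Gw e z)) \<bullet> (G e z - Gw e z))"
    "0 \<le> (LBINT z. (pflux p (u e z) - pflux p (Vu e z)) * (u e z - Vu e z))"
proof -
  show "0 \<le> (LBINT z. (pflux p (G e z) - pflux p (Gw e z)) \<bullet> (G e z - Gw e z))"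
    using pflux_monotone[OF pq(1)] by (intro integral_nonneg_AE AE_I2) blast
  have "0 \<le> (pflux p a - pflux p b) * (a - b)" for a b :: real using pflux_monotone[OF pq(1), of a b] by simp
  then show "0 \<le> (LBINT z. (pflux p (u e z) - pflux p (Vu e z)) * (u e z - Vu e z))"
    by (intro integral_nonneg_AE AE_I2) blast
qed

lemma excess_tendsto: "((\<lambda>e. excess e / e) \<longlongrightarrow> 0) (at_right 0)"
proof (rule tendsto_sandwich[where f = "\<lambda>_. 0"])
  show "\<forall>\<^sub>F e in at_right 0. 0 \<le> excess e / e"
    using mono_parts by (intro eventually_at_right_0) (simp add: excess_def)
  show "\<forall>\<^sub>F e in at_right 0. excess e / e \<le> rho e + load_error e - oscillation_error e"
    by (rule eventually_at_right_0) (rule excess_le)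
  show "((\<lambda>e. rho e + load_error e - oscillation_error e) \<longlongrightarrow> 0) (at_right 0)"
    using tendsto_diff[OF tendsto_add[OF rho_tendsto load_limit] oscillation_limit] by simp
qed simp

definition Mt :: real where "Mt = c powr q + (g0 * K0 + B2 1) + B4"

lemma B2_le: "0 < e \<Longrightarrow> e < 1 \<Longrightarrow> B2 e \<le> B2 1"
proof -
  assume e: "0 < e" "e < 1"
  have "e powr (\<alpha> - 1) \<le> 1 powr (\<alpha> - 1)" using e \<alpha> by (intro powr_mono2) auto
  then show ?thesis using K0_nonneg unfolding B2_def by (intro mult_left_mono) auto
qed

lemma B4_nonneg: "0 \<le> B4" using g1_pos by (simp add: B4_def)

lemma G_sum_bound:
  assumes e: "0 < e" "e < 1"
  shows "(LBINT z. norm (G e z) powr p) + (LBINT z. norm (Gw e z) powr p) \<le> e * Mt"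
proof -
  have "(LBINT z. norm (G e z) powr p) + (LBINT z. norm (Gw e z) powr p) \<le> e * c powr q + e * (g0 * K0 + B2 e)"
    using G_bound[OF e(1)] Gw_bound[OF e(1)] by linarith
  also have "\<dots> = e * (c powr q + (g0 * K0 + B2 e))" by (simp add: distrib_left)
  also have "\<dots> \<le> e * Mt" using e B2_le[OF e] B4_nonneg unfolding Mt_def by (intro mult_left_mono) auto
  finally show ?thesis .
qed

lemma u_sum_bound:
  assumes e: "0 < e" "e < 1"
  shows "(LBINT z. norm (u e z) powr p) + (LBINT z. norm (Vu e z) powr p) \<le> e * Mt"
proof -
  have "(LBINT z. norm (u e z) powr p) + (LBINT z. norm (Vu e z) powr p) \<le> e * c powr q + e * B4"
    using u_bound[OF e(1)] Vu_bound(2)[OF e(1)] by linarith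
  also have "\<dots> = e * (c powr q + B4)" by (simp add: distrib_left)
  also have "\<dots> \<le> e * Mt" using e B_nonneg(2)[of 1] K0_nonneg g0(1) unfolding Mt_def by (intro mult_left_mono) auto
  finally show ?thesis .
qed

lemma norm_diff_powr_homogeneous:
  fixes x y :: "'b::euclidean_space"
  assumes "0 < t"
  shows "norm (t *\<^sub>R x - t *\<^sub>R y) powr p = t powr p * norm (x - y) powr p"
  using assms by (simp add: powr_mult flip: scaleR_diff_right)

lemma norm_diff_powr_continuous:
  "continuous_on UNIV (\<lambda>z :: 'b::euclidean_space \<times> 'b. norm (fst z - snd z) powr p)"
  using pq by (intro continuous_on_powr' continuous_intros) auto

lemma gradient_convergence: "((\<lambda>e. (LBINT z. norm (G e z - Gw e z) powr p) / e) \<longlongrightarrow> 0) (at_right 0)"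
proof (rule scaled_convergence[OF pq, where E = "\<lambda>e. excess e / e" and M = Mt and Q = "\<lambda>x y. norm (x - y) powr p"])
  show "integrable lborel (\<lambda>z. norm (G e z - Gw e z) powr p)" if "0 < e" for e
    using GGw_bound(1)[OF that] by (simp add: Lpb_def)
  show "(LBINT z. (pflux p (G e z) - pflux p (Gw e z)) \<bullet> (G e z - Gw e z)) \<le> e * (excess e / e)" if "0 < e" for e
    using mono_parts[OF that] that by (simp add: excess_def)
  show "norm (t *\<^sub>R x - t *\<^sub>R y) powr p = t powr p * norm (x - y) powr p" if "0 < t" for t and x y :: "real \<times> real"
    by (rule norm_diff_powr_homogeneous[OF that])
  show "continuous_on UNIV (\<lambda>z :: (real \<times> real) \<times> real \<times> real. norm (fst z - snd z) powr p)" by (rule norm_diff_powr_continuous)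
qed (use Lpb_G Lpb_Gw G_sum_bound excess_tendsto in auto)

lemma flux_convergence: "((\<lambda>e. (LBINT z. norm (pflux p (G e z) - pflux p (Gw e z)) powr q) / e) \<longlongrightarrow> 0) (at_right 0)"
proof (rule scaled_convergence[OF pq, where E = "\<lambda>e. excess e / e" and M = Mt and Q = "\<lambda>x y. norm (pflux p x - pflux p y) powr q"])
  show "continuous_on UNIV (\<lambda>z :: (real \<times> real) \<times> real \<times> real. norm (pflux p (fst z) - pflux p (snd z)) powr q)"
    using q by (intro continuous_on_powr' continuous_intros continuous_on_compose2[OF continuous_pflux[OF pq(1), of UNIV]]) auto
  show "norm (pflux p (t *\<^sub>R x) - pflux p (t *\<^sub>R y)) powr q = t powr p * norm (pflux p x - pflux p y) powr q"
    if "0 < t" for t and x y :: "real \<times> real"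
    using that conjugate_exponents(2)[OF pq] by (simp add: pflux_scaleR powr_mult powr_powr flip: scaleR_diff_right)
  show "integrable lborel (\<lambda>z. norm (pflux p (G e z) - pflux p (Gw e z)) powr q)" if "0 < e" for e
    using Lpb_diff[OF _ Lpb_flux(1,2)[OF that]] q by (simp add: Lpb_def)
  show "(LBINT z. (pflux p (G e z) - pflux p (Gw e z)) \<bullet> (G e z - Gw e z)) \<le> e * (excess e / e)" if "0 < e" for e
    using mono_parts[OF that] that by (simp add: excess_def)
qed (use Lpb_G Lpb_Gw G_sum_bound excess_tendsto in auto)

lemma value_convergence: "((\<lambda>e. (LBINT z. norm (u e z - Vu e z) powr p) / e) \<longlongrightarrow> 0) (at_right 0)"
proof (rule scaled_convergence[OF pq, where E = "\<lambda>e. excess e / e" and M = Mt and Q = "\<lambda>x y. norm (x - y) powr p"])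
  show "integrable lborel (\<lambda>z. norm (u e z - Vu e z) powr p)" if "0 < e" for e
    using Lpb_diff[OF _ Lpb_u[OF that] Vu_bound(1)[OF that]] pq by (simp add: Lpb_def)
  show "(LBINT z. (pflux p (u e z) - pflux p (Vu e z)) \<bullet> (u e z - Vu e z)) \<le> e * (excess e / e)" if "0 < e" for e
    using mono_parts[OF that] that by (simp add: excess_def)
  show "norm (t *\<^sub>R x - t *\<^sub>R y) powr p = t powr p * norm (x - y) powr p" if "0 < t" for t x y :: real
    by (rule norm_diff_powr_homogeneous[OF that])
  show "continuous_on UNIV (\<lambda>z :: real \<times> real. norm (fst z - snd z) powr p)" by (rule norm_diff_powr_continuous)
qed (use Lpb_u Vu_bound(1) u_sum_bound excess_tendsto in auto)

text \<open>In the upper part the gradient of the recovery function is already small.\<close>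

lemma upper_convergence:
  "((\<lambda>e. (LBINT z. indicator {e * g0<..} (snd z) * norm (G e z) powr p) / e) \<longlongrightarrow> 0) (at_right 0)"
proof (rule tendsto_sandwich[where f = "\<lambda>_. 0"])
  show "\<forall>\<^sub>F e in at_right 0. 0 \<le> (LBINT z. indicator {e * g0<..} (snd z) * norm (G e z) powr p) / e"
    by (rule eventually_at_right_0) simp
  show "\<forall>\<^sub>F e in at_right 0. (LBINT z. indicator {e * g0<..} (snd z) * norm (G e z) powr p) / e \<le>
      2 powr p * ((LBINT z. norm (G e z - Gw e z) powr p) / e + B2 e)"
  proof (rule eventually_at_right_0)
    fix e :: real assume e: "0 < e"
    let ?I = "\<lambda>z :: real \<times> real. indicator {e * g0<..} (snd z) :: real"
    have m: "?I \<in> Borel_fun" by measurable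
    have ind: "integrable lborel (\<lambda>z. ?I z * F z)" if "integrable lborel F" for F
      using integrable_mult_bounded[OF that m, of 1] by (simp add: mult.commute indicator_def)
    have i: "integrable lborel (\<lambda>z. norm (G e z) powr p)" "integrable lborel (\<lambda>z. norm (Gw e z) powr p)"
      "integrable lborel (\<lambda>z. norm (G e z - Gw e z) powr p)"
      using Lpb_G[OF e] Lpb_Gw[OF e] GGw_bound(1)[OF e] by (auto simp: Lpb_def)
    have "(LBINT z. ?I z * norm (G e z) powr p) \<le>
        (LBINT z. 2 powr p * (norm (G e z - Gw e z) powr p + ?I z * norm (Gw e z) powr p))"
    proof (rule integral_mono)
      show "integrable lborel (\<lambda>z. ?I z * norm (G e z) powr p)" by (rule ind[OF i(1)])
      show "integrable lborel (\<lambda>z. 2 powr p * (norm (G e z - Gw e z) powr p + ?I z * norm (Gw e z) powr p))"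
        using i(3) ind[OF i(2)] by simp
      fix z
      have "norm ((G e z - Gw e z) - (- Gw e z)) powr p \<le> 2 powr p * (norm (G e z - Gw e z) powr p + norm (- Gw e z) powr p)"
        using pq by (intro powr_norm_diff_le) auto
      then show "?I z * norm (G e z) powr p \<le> 2 powr p * (norm (G e z - Gw e z) powr p + ?I z * norm (Gw e z) powr p)"
        by (auto simp: indicator_def)
    qed
    also have "\<dots> = 2 powr p * ((LBINT z. norm (G e z - Gw e z) powr p) + (LBINT z. ?I z * norm (Gw e z) powr p))"
      using i(3) ind[OF i(2)] by simp
    also have "\<dots> \<le> 2 powr p * ((LBINT z. norm (G e z - Gw e z) powr p) + e * B2 e)"
      using Gw_upper[OF e] by (intro mult_left_mono) auto
    also have "\<dots> = (2 powr p * ((LBINT z. norm (G e z - Gw e z) powr p) / e + B2 e)) * e"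
      using e by (simp add: field_simps)
    finally show "(LBINT z. ?I z * norm (G e z) powr p) / e \<le>
      2 powr p * ((LBINT z. norm (G e z - Gw e z) powr p) / e + B2 e)"
      using e by (simp add: pos_divide_le_eq)
  qed
  have "((\<lambda>e. 2 powr p * ((LBINT z. norm (G e z - Gw e z) powr p) / e + B2 e)) \<longlongrightarrow> 2 powr p * (0 + 0)) (at_right 0)"
    by (intro tendsto_mult tendsto_const tendsto_add gradient_convergence B_tendsto)
  then show "((\<lambda>e. 2 powr p * ((LBINT z. norm (G e z - Gw e z) powr p) / e + B2 e)) \<longlongrightarrow> 0) (at_right 0)" by simp
qed simp

end

section \<open>Transfer to the original functions\<close>

lemma Lp_tendsto_rep:
  fixes U :: "'a::euclidean_space set" and w :: "'a \<Rightarrow> 'b::euclidean_space"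
  assumes U: "U \<in> sets borel" and p: "0 < p" and w: "borel_rep U w W" "integrable lborel (\<lambda>z. norm (W z) powr p)"
    and v: "\<And>e. 0 < e \<Longrightarrow> borel_rep U (v e) (F e)" "\<And>e. 0 < e \<Longrightarrow> integrable lborel (\<lambda>z. norm (F e z) powr p)"
    and lim: "((\<lambda>e. LBINT z. norm (F e z - W z) powr p) \<longlongrightarrow> 0) (at_right 0)"
  shows "Lp_tendsto p U v w (at_right (0::real))"
  unfolding Lp_tendsto_def
proof (intro conjI)
  show "w \<in> Lp_space p U" using Lp_space_rep[OF U w(1)] w(2) by simp
  show "\<forall>\<^sub>F e in at_right 0. v e \<in> Lp_space p U"
    using Lp_space_rep[OF U v(1)] v(2) by (intro eventually_at_right_0) auto
  have "\<forall>\<^sub>F e in at_right 0. (LBINT z. norm (F e z - W z) powr p) powr (1 / p) = Lp_norm p U (\<lambda>z. v e z - w z)"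
  proof (rule eventually_at_right_0)
    fix e :: real assume e: "0 < e"
    have m: "(\<lambda>(x, y). x - y :: 'b) \<in> Borel_fun"
      unfolding borel_prod[symmetric] by measurable
    have "borel_rep U (\<lambda>z. v e z - w z) (\<lambda>z. F e z - W z)"
      by (rule borel_rep_compose2[OF v(1)[OF e] w(1) m]) simp
    from Lp_norm_rep[OF U this, of p]
    show "(LBINT z. norm (F e z - W z) powr p) powr (1 / p) = Lp_norm p U (\<lambda>z. v e z - w z)" by simp
  qed
  moreover have "((\<lambda>e. (LBINT z. norm (F e z - W z) powr p) powr (1 / p)) \<longlongrightarrow> 0) (at_right 0)"
    using p by (intro scaled_powr_tendsto_0[OF lim]) auto
  ultimately show "((\<lambda>e. Lp_norm p U (\<lambda>z. v e z - w z)) \<longlongrightarrow> 0) (at_right 0)"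
    by (rule Lim_transform_eventually[rotated])
qed

lemma upper_cell_borel:
  assumes [measurable]: "g \<in> Borel_fun"
  shows "{0<..<1::real} \<times> upper_cell g g0 L \<in> sets borel"
proof -
  have "{w \<in> space borel. 0 < fst w \<and> fst w < 1 \<and> 0 < fst (snd w) \<and> fst (snd w) < L \<and> g0 < snd (snd w) \<and> snd (snd w) < g (fst (snd w))}
      \<in> sets (borel :: (real \<times> real \<times> real) measure)"
    by measurable
  moreover have "{0<..<1::real} \<times> upper_cell g g0 L =
      {w \<in> space borel. 0 < fst w \<and> fst w < 1 \<and> 0 < fst (snd w) \<and> fst (snd w) < L \<and> g0 < snd (snd w) \<and> snd (snd w) < g (fst (snd w))}"
    by (auto simp: upper_cell_def)
  ultimately show ?thesis by simp
qed

text \<open>Evaluating at unfolded points is compatible with null sets: the integral bound of the unfolding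
  operator, applied to the indicator of the exceptional set, shows that almost no unfolded point falls
  into it.\<close>

lemma unfold_rep:
  fixes v F :: "real \<times> real \<Rightarrow> real"
  assumes g [measurable]: "g \<in> Borel_fun" and per: "\<And>x. g (x + L) = g x"
    and L: "0 < L" and e: "0 < e" and v: "borel_rep (thin_upper g g0 \<alpha> e) v F"
    and i: "integrable lborel (\<lambda>z. norm (F z) powr q)"
  shows "\<exists>H. borel_rep ({0<..<1} \<times> upper_cell g g0 L) (unfold_upper L \<alpha> e v) H \<and>
    integrable lborel (\<lambda>w. norm (H w) powr q) \<and>
    (LBINT w. norm (H w) powr q) \<le> L / e * (LBINT z. norm (F z) powr q)"
proof -
  let ?\<Omega> = "{0<..<1::real} \<times> upper_cell g g0 L" and ?a = "e powr \<alpha>"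
  have a: "0 < ?a" using e by simp
  have \<Omega>B: "?\<Omega> \<in> sets borel" by (rule upper_cell_borel[OF g])
  have Fm [measurable]: "F \<in> Borel_fun" using v by (simp add: borel_rep_def)
  have fc: "{w :: real \<times> real \<times> real. fst w \<in> full_cells L \<alpha> e} \<in> sets borel"
  proof -
    have "open (full_cells L \<alpha> e)" by (simp add: full_cells_def)
    then have "full_cells L \<alpha> e \<in> sets borel" by simp
    from measurable_sets[OF borel_measurable_fst_snd(1) this] show ?thesis by (simp add: vimage_def)
  qed
  define \<Omega> where "\<Omega> = ?\<Omega> \<inter> {w. fst w \<in> full_cells L \<alpha> e}"
  have \<Omega>m [measurable]: "\<Omega> \<in> sets borel" unfolding \<Omega>_def using \<Omega>B fc by auto
  define H where "H w = indicator \<Omega> w * F (unfold_point L ?a e w)" for w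
  have Hm: "H \<in> Borel_fun" unfolding H_def[abs_def] by measurable
  have point: "unfold_point L ?a e w \<in> thin_upper g g0 \<alpha> e" if w: "w \<in> \<Omega>" for w
  proof -
    obtain x y1 y2 where w': "w = (x, y1, y2)" by (cases w) auto
    have x: "x \<in> full_cells L \<alpha> e" and y: "0 < y1" "y1 < L" "g0 < y2" "y2 < g y1"
      using w by (auto simp: \<Omega>_def w' upper_cell_def)
    define k where "k = \<lfloor>x / (?a * L)\<rfloor>"
    note C = full_cells_cell[OF L e x, folded k_def]
    have pt: "unfold_point L ?a e w = (?a * (of_int k * L + y1), e * y2)"
      by (simp add: unfold_point_def w' k_def algebra_simps)
    have "0 < of_int k * L + y1" using C(1) L y(1) by (intro add_nonneg_pos) auto
    then have 1: "0 < ?a * (of_int k * L + y1)" using a by simp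
    have "?a * (of_int k * L + y1) < ?a * (of_int k * L + L)" using y(2) a by (intro mult_strict_left_mono) auto
    also have "\<dots> = ?a * L * (of_int k + 1)" by (simp add: algebra_simps)
    also have "\<dots> \<le> 1" by (rule C(2))
    finally have 2: "?a * (of_int k * L + y1) < 1" .
    have "?a * (of_int k * L + y1) / ?a = y1 + of_int k * L" using a by simp
    then have "g (?a * (of_int k * L + y1) / ?a) = g y1" using periodic_int[of g, OF per, of y1 k] by simp
    then show ?thesis
      unfolding pt thin_upper_def using 1 2 y e by simp
  qed
  have val: "unfold_upper L \<alpha> e v w = (if fst w \<in> full_cells L \<alpha> e then v (unfold_point L ?a e w) else 0)" for w
    by (cases w) (simp add: unfold_upper_def unfold_point_def cell_index_floor[OF L])
  have bound: "(\<integral>\<^sup>+w. indicator \<Omega> w * h (unfold_point L ?a e w) \<partial>lborel) \<le> ennreal (L / e) * (\<integral>\<^sup>+z. h z \<partial>lborel)"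
    if h: "h \<in> Borel_fun" for h :: "real \<times> real \<Rightarrow> ennreal"
  proof -
    have "(\<integral>\<^sup>+w. indicator \<Omega> w * h (unfold_point L ?a e w) \<partial>lborel) \<le>
        (\<integral>\<^sup>+w. indicator {0<..<L} (fst (snd w)) * h (unfold_point L ?a e w) \<partial>lborel)"
      by (intro nn_integral_mono mult_right_mono) (auto simp: \<Omega>_def upper_cell_def indicator_def)
    also have "\<dots> \<le> ennreal (L / e) * (\<integral>\<^sup>+z. h z \<partial>lborel)" by (rule nn_integral_unfold_le[OF h L a e])
    finally show ?thesis .
  qed
  have AEv: "AE z in lborel. z \<in> thin_upper g g0 \<alpha> e \<longrightarrow> v z = F z" using v by (simp add: borel_rep_def)
  then obtain N where N: "N \<in> null_sets lborel" "{z \<in> space lborel. \<not> (z \<in> thin_upper g g0 \<alpha> e \<longrightarrow> v z = F z)} \<subseteq> N"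
    by (auto simp: eventually_ae_filter)
  have Nm [measurable]: "N \<in> sets borel" using N(1) by auto
  have "(\<integral>\<^sup>+w. indicator \<Omega> w * indicator N (unfold_point L ?a e w) \<partial>lborel) \<le> ennreal (L / e) * (\<integral>\<^sup>+z. indicator N z \<partial>lborel)"
    by (rule bound) simp
  also have "\<dots> = 0" using null_setsD1[OF N(1)] by simp
  finally have "(\<integral>\<^sup>+w. indicator \<Omega> w * indicator N (unfold_point L ?a e w) \<partial>lborel) = 0" by simp
  then have ae: "AE w in lborel. indicator \<Omega> w * indicator N (unfold_point L ?a e w) = (0::ennreal)"
    by (subst (asm) nn_integral_0_iff_AE) measurable
  have "AE w in lborel. w \<in> ?\<Omega> \<longrightarrow> unfold_upper L \<alpha> e v w = H w"
    using ae
  proof eventually_elim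
    case (elim w)
    show ?case
    proof
      assume w: "w \<in> ?\<Omega>"
      show "unfold_upper L \<alpha> e v w = H w"
      proof (cases "fst w \<in> full_cells L \<alpha> e")
        case True
        then have "w \<in> \<Omega>" using w by (simp add: \<Omega>_def)
        then have "unfold_point L ?a e w \<notin> N" using elim by (auto simp: indicator_def split: if_splits)
        then have "v (unfold_point L ?a e w) = F (unfold_point L ?a e w)" using N(2) point[OF \<open>w \<in> \<Omega>\<close>] by auto
        then show ?thesis using True \<open>w \<in> \<Omega>\<close> by (simp add: val H_def)
      next
        case False
        then have "w \<notin> \<Omega>" by (simp add: \<Omega>_def)
        then show ?thesis using False by (simp add: val H_def)
      qed
    qed
  qed
  moreover have "w \<notin> ?\<Omega> \<Longrightarrow> H w = 0" for w by (simp add: H_def \<Omega>_def)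
  ultimately have rep: "borel_rep ?\<Omega> (unfold_upper L \<alpha> e v) H"
    unfolding borel_rep_def using Hm by blast
  have Hp: "norm (H w) powr q = indicator \<Omega> w * norm (F (unfold_point L ?a e w)) powr q" for w
    by (simp add: H_def indicator_def)
  have "(\<integral>\<^sup>+w. ennreal (norm (H w) powr q) \<partial>lborel) = (\<integral>\<^sup>+w. indicator \<Omega> w * ennreal (norm (F (unfold_point L ?a e w)) powr q) \<partial>lborel)"
    unfolding Hp by (intro nn_integral_cong) (simp add: indicator_def)
  also have "\<dots> \<le> ennreal (L / e) * (\<integral>\<^sup>+z. ennreal (norm (F z) powr q) \<partial>lborel)"
    by (rule bound[of "\<lambda>z. ennreal (norm (F z) powr q)"]) measurable
  also have "(\<integral>\<^sup>+z. ennreal (norm (F z) powr q) \<partial>lborel) = ennreal (LBINT z. norm (F z) powr q)"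
    by (rule nn_integral_eq_integral[OF i]) simp
  also have "ennreal (L / e) * ennreal (LBINT z. norm (F z) powr q) = ennreal (L / e * (LBINT z. norm (F z) powr q))"
    using L e by (intro ennreal_mult[symmetric]) auto
  finally have le: "(\<integral>\<^sup>+w. ennreal (norm (H w) powr q) \<partial>lborel) \<le> ennreal (L / e * (LBINT z. norm (F z) powr q))" .
  have "0 \<le> L / e * (LBINT z. norm (F z) powr q)" using L e by simp
  note fin = integrable_nn_integral_le[OF _ _ this le]
  have "integrable lborel (\<lambda>w. norm (H w) powr q)" by (rule fin(1)) (use Hm in auto)
  moreover have "(LBINT w. norm (H w) powr q) \<le> L / e * (LBINT z. norm (F z) powr q)"
    by (rule fin(2)) (use Hm in auto)
  ultimately show ?thesis using rep by blast
qed

lemma thin_domain_subgraph: "thin_domain g \<alpha> e = subgraph (\<lambda>x. e * g (x / e powr \<alpha>))"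
  by (simp add: thin_domain_def subgraph_def)

lemma thin_lower_subgraph: "thin_lower g0 e = subgraph (\<lambda>_. e * g0)"
  by (auto simp: thin_lower_def subgraph_def)

lemma fixed_lower_vscale: "0 < e \<Longrightarrow> fixed_lower g0 = vscale e -` thin_lower g0 e"
  by (auto simp: fixed_lower_def thin_lower_def vscale_def zero_less_mult_iff)

context thin_limit
begin

definition Lo :: "real \<Rightarrow> (real \<times> real) set" where "Lo e = thin_lower g0 e"
definition Up :: "real \<Rightarrow> (real \<times> real) set" where "Up e = thin_upper g g0 \<alpha> e"

lemma lsc_const: "lower_semicontinuous (\<lambda>_::real. a)"
  by (simp add: lower_semicontinuous_def)

lemma Lo_open: "open (Lo e)"
  unfolding Lo_def thin_lower_subgraph by (rule open_subgraph[OF lsc_const])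

lemma Lo_sub: "0 < e \<Longrightarrow> Lo e \<subseteq> U e"
  using gamma_bounds(2) by (auto simp: Lo_def U_def thin_lower_def subgraph_def intro: less_le_trans)

lemma Up_eq: "0 < e \<Longrightarrow> Up e = U e \<inter> {z. e * g0 < snd z}"
  using gamma_bounds(1)[of e] by (auto simp: Up_def U_def thin_upper_def subgraph_def)

lemma Up_open: "0 < e \<Longrightarrow> open (Up e)"
  unfolding Up_eq by (intro open_Int open_U open_Collect_less continuous_intros)

lemma fixed_open: "open (fixed_lower g0)"
proof -
  have "fixed_lower g0 = subgraph (\<lambda>_. g0)" by (auto simp: fixed_lower_def subgraph_def)
  then show ?thesis using open_subgraph[OF lsc_const] by simp
qed

lemma in_Lo: "0 < e \<Longrightarrow> z \<in> Lo e \<Longrightarrow> z \<in> U e \<and> snd z < e * g0 \<and> fst z \<in> {0<..<1}"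
  using Lo_sub[of e] by (auto simp: Lo_def thin_lower_def)

definition uL :: "real \<Rightarrow> real \<times> real \<Rightarrow> real" where "uL e z = indicator (Lo e) z * u e z"
definition GL :: "real \<Rightarrow> real \<times> real \<Rightarrow> real \<times> real" where "GL e z = indicator (Lo e) z *\<^sub>R G e z"
definition GU :: "real \<Rightarrow> real \<times> real \<Rightarrow> real \<times> real" where "GU e z = indicator (Up e) z *\<^sub>R G e z"
definition VL :: "real \<times> real \<Rightarrow> real" where "VL z = indicator (fixed_lower g0) z * V (fst z)"
definition DL :: "real \<times> real \<Rightarrow> real \<times> real" where "DL z = indicator (fixed_lower g0) z *\<^sub>R (D (fst z), 0)"

lemma lower_sobolev: "0 < e \<Longrightarrow> sobolev_rep p (Lo e) (uL e) (GL e)"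
  unfolding uL_def[abs_def] GL_def[abs_def] using Lo_open
  by (intro sobolev_rep_restrict[OF S_U] Lo_sub) auto

lemma limit_sobolev: "sobolev_rep p (fixed_lower g0) VL DL"
proof -
  have Lo1: "Lo 1 = fixed_lower g0" by (auto simp: Lo_def thin_lower_def fixed_lower_def)
  have "sobolev_rep p (Lo 1) (\<lambda>z. indicator (Lo 1) z * W 1 z) (\<lambda>z. indicator (Lo 1) z *\<^sub>R Gw 1 z)"
    using Lo_open by (intro sobolev_rep_restrict[OF W_sobolev] Lo_sub) auto
  moreover have "(\<lambda>z. indicator (Lo 1) z * W 1 z) = VL"
  proof
    fix z show "indicator (Lo 1) z * W 1 z = VL z"
      using in_Lo[of 1 z] Gw_lower(1)[of 1 z] by (cases "z \<in> Lo 1") (auto simp: VL_def Lo1)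
  qed
  moreover have "(\<lambda>z. indicator (Lo 1) z *\<^sub>R Gw 1 z) = DL"
  proof
    fix z show "indicator (Lo 1) z *\<^sub>R Gw 1 z = DL z"
      using in_Lo[of 1 z] Gw_lower(2)[of 1 z] by (cases "z \<in> Lo 1") (auto simp: DL_def Lo1 zero_prod_def)
  qed
  ultimately show ?thesis by (simp add: Lo1)
qed

text \<open>The chain rule gives the vertical derivative a factor \<open>e\<close>, whence the outer \<open>vscale\<close>.\<close>

lemma rescaled_sobolev:
  assumes e: "0 < e"
  shows "sobolev_rep p (fixed_lower g0) (\<lambda>z. uL e (vscale e z)) (\<lambda>z. vscale e (GL e (vscale e z)))"
  using sobolev_rep_vscale[OF lower_sobolev[OF e] e] unfolding fixed_lower_vscale[OF e] Lo_def .

lemma in_fixed: "0 < e \<Longrightarrow> z \<in> fixed_lower g0 \<longleftrightarrow> vscale e z \<in> Lo e"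
  unfolding fixed_lower_vscale[of e] Lo_def by simp

lemma rescaled_integral_le:
  fixes h k :: "real \<times> real \<Rightarrow> real"
  assumes e: "0 < e" and h: "integrable lborel h" and k: "k \<in> Borel_fun"
    "\<And>z. 0 \<le> k z" "\<And>z. k z \<le> h (vscale e z)"
  shows "(LBINT z. k z) \<le> (LBINT z. h z) / e"
proof -
  have ih: "integrable lborel (\<lambda>z. h (vscale e z))" by (rule integrable_vscale[OF h e])
  have "integrable lborel k"
    by (rule integrable_dominated[OF ih]) (use k in \<open>auto intro!: AE_I2 order_trans[OF _ abs_ge_self]\<close>)
  from integral_mono[OF this ih k(3)] show ?thesis using integral_vscale[OF h e] by simp
qed

lemma rescaled_limit_0:
  assumes lim: "((\<lambda>e. (LBINT z. h e z) / e) \<longlongrightarrow> 0) (at_right (0::real))"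
    and nn: "\<And>e. 0 \<le> r e" and le: "\<And>e. 0 < e \<Longrightarrow> e < 1 \<Longrightarrow> r e \<le> (LBINT z. h e z) / e"
  shows "(r \<longlongrightarrow> 0) (at_right 0)"
proof (rule tendsto_sandwich[where f = "\<lambda>_. 0", OF _ _ tendsto_const lim])
  show "\<forall>\<^sub>F e in at_right 0. 0 \<le> r e" using nn by simp
  show "\<forall>\<^sub>F e in at_right 0. r e \<le> (LBINT z. h e z) / e"
    unfolding eventually_at_right_field using le by (intro exI[of _ 1]) auto
qed

lemma rescaled_value_limit: "((\<lambda>e. LBINT z. norm (uL e (vscale e z) - VL z) powr p) \<longlongrightarrow> 0) (at_right 0)"
proof (rule rescaled_limit_0[OF value_convergence])
  show "0 \<le> (LBINT z. norm (uL e (vscale e z) - VL z) powr p)" for e by simp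
  fix e :: real assume e: "0 < e"
  show "(LBINT z. norm (uL e (vscale e z) - VL z) powr p) \<le> (LBINT z. norm (u e z - Vu e z) powr p) / e"
  proof (rule rescaled_integral_le[OF e])
    show "integrable lborel (\<lambda>z. norm (u e z - Vu e z) powr p)"
      using Lpb_diff[OF _ Lpb_u[OF e] Vu_bound(1)[OF e]] pq by (simp add: Lpb_def)
    have "(\<lambda>z. uL e (vscale e z)) \<in> Borel_fun" "VL \<in> Borel_fun"
      using rescaled_sobolev[OF e] limit_sobolev by (auto simp: sobolev_rep_def)
    then show "(\<lambda>z. norm (uL e (vscale e z) - VL z) powr p) \<in> Borel_fun" by simp
    show "norm (uL e (vscale e z) - VL z) powr p \<le> norm (u e (vscale e z) - Vu e (vscale e z)) powr p" for z
    proof (cases "z \<in> fixed_lower g0")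
      case True
      then have "vscale e z \<in> Lo e" using in_fixed[OF e] by simp
      then show ?thesis using True in_Lo[OF e, of "vscale e z"] by (simp add: uL_def VL_def Vu_def vscale_def)
    next
      case False
      then have "vscale e z \<notin> Lo e" using in_fixed[OF e] by simp
      then show ?thesis using False by (simp add: uL_def VL_def)
    qed
  qed simp
qed

lemma norm_vscale_le: "0 < e \<Longrightarrow> e < 1 \<Longrightarrow> norm (vscale e z) \<le> norm z"
proof -
  assume e: "0 < e" "e < 1"
  have "(e * snd z)\<^sup>2 \<le> (snd z)\<^sup>2" using e by (simp add: power_mult_distrib mult_left_le_one_le power_le_one)
  then show ?thesis by (simp add: vscale_def norm_prod_def)
qed

lemma rescaled_gradient_limit:
  "((\<lambda>e. LBINT z. norm (vscale e (GL e (vscale e z)) - DL z) powr p) \<longlongrightarrow> 0) (at_right 0)"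
proof (rule rescaled_limit_0[OF gradient_convergence])
  show "0 \<le> (LBINT z. norm (vscale e (GL e (vscale e z)) - DL z) powr p)" for e by simp
  fix e :: real assume e: "0 < e" "e < 1"
  show "(LBINT z. norm (vscale e (GL e (vscale e z)) - DL z) powr p) \<le> (LBINT z. norm (G e z - Gw e z) powr p) / e"
  proof (rule rescaled_integral_le[OF e(1)])
    show "integrable lborel (\<lambda>z. norm (G e z - Gw e z) powr p)"
      using GGw_bound(1)[OF e(1)] by (simp add: Lpb_def)
    have "(\<lambda>z. vscale e (GL e (vscale e z))) \<in> Borel_fun" "DL \<in> Borel_fun"
      using rescaled_sobolev[OF e(1)] limit_sobolev by (auto simp: sobolev_rep_def)
    then show "(\<lambda>z. norm (vscale e (GL e (vscale e z)) - DL z) powr p) \<in> Borel_fun" by simp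
    show "norm (vscale e (GL e (vscale e z)) - DL z) powr p \<le> norm (G e (vscale e z) - Gw e (vscale e z)) powr p" for z
    proof (cases "z \<in> fixed_lower g0")
      case True
      then have Lo: "vscale e z \<in> Lo e" using in_fixed[OF e(1)] by simp
      have "Gw e (vscale e z) = (D (fst z), 0)"
        using Gw_lower(2)[OF e(1), of "vscale e z"] in_Lo[OF e(1) Lo] by (simp add: vscale_def)
      then have "vscale e (GL e (vscale e z)) - DL z = vscale e (G e (vscale e z) - Gw e (vscale e z))"
        using True Lo by (simp add: GL_def DL_def vscale_def)
      then show ?thesis using norm_vscale_le[OF e] pq by (intro powr_mono2) auto
    next
      case False
      then have "vscale e z \<notin> Lo e" using in_fixed[OF e(1)] by simp
      then show ?thesis using False by (simp add: GL_def DL_def vscale_def zero_prod_def[symmetric])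
    qed
  qed simp
qed

lemma rescaled_flux_limit:
  assumes h: "h = fst \<or> h = snd"
  shows "((\<lambda>e. LBINT z. norm (h (pflux p (GL e (vscale e z))) - h (pflux p (DL z)) :: real) powr q) \<longlongrightarrow> 0) (at_right 0)"
proof (rule rescaled_limit_0[OF flux_convergence])
  have hm [measurable]: "h \<in> Borel_fun" using h by auto
  have hd: "norm (h a - h b) \<le> norm (a - b)" for a b :: "real \<times> real"
    using h abs_fst_snd_le[of "a - b"] by auto
  show "0 \<le> (LBINT z. norm (h (pflux p (GL e (vscale e z))) - h (pflux p (DL z))) powr q)" for e by simp
  fix e :: real assume e: "0 < e"
  show "(LBINT z. norm (h (pflux p (GL e (vscale e z))) - h (pflux p (DL z))) powr q) \<le>
      (LBINT z. norm (pflux p (G e z) - pflux p (Gw e z)) powr q) / e"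
  proof (rule rescaled_integral_le[OF e])
    show "integrable lborel (\<lambda>z. norm (pflux p (G e z) - pflux p (Gw e z)) powr q)"
      using Lpb_diff[OF _ Lpb_flux(1,2)[OF e]] q by (simp add: Lpb_def)
    have [measurable]: "GL e \<in> Borel_fun" "DL \<in> Borel_fun"
      using lower_sobolev[OF e] limit_sobolev by (auto simp: sobolev_rep_def)
    show "(\<lambda>z. norm (h (pflux p (GL e (vscale e z))) - h (pflux p (DL z))) powr q) \<in> Borel_fun"
      by measurable
    show "norm (h (pflux p (GL e (vscale e z))) - h (pflux p (DL z))) powr q \<le>
        norm (pflux p (G e (vscale e z)) - pflux p (Gw e (vscale e z))) powr q" for z
    proof (cases "z \<in> fixed_lower g0")
      case True
      then have Lo: "vscale e z \<in> Lo e" using in_fixed[OF e] by simp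
      have "Gw e (vscale e z) = (D (fst z), 0)"
        using Gw_lower(2)[OF e, of "vscale e z"] in_Lo[OF e Lo] by (simp add: vscale_def)
      then have "GL e (vscale e z) = G e (vscale e z)" "DL z = Gw e (vscale e z)"
        using True Lo by (simp_all add: GL_def DL_def)
      then show ?thesis using hd q by (intro powr_mono2) auto
    next
      case False
      then have "vscale e z \<notin> Lo e" using in_fixed[OF e] by simp
      then have "GL e (vscale e z) = 0" "DL z = 0" using False by (auto simp add: GL_def DL_def zero_prod_def)
      then have "h (pflux p (GL e (vscale e z))) - h (pflux p (DL z)) = 0" by simp
      then show ?thesis by (metis norm_zero powr_0 powr_ge_zero)
    qed
  qed simp
qed

lemma GU_powr: "0 < e \<Longrightarrow> norm (GU e z) powr p = indicator {e * g0<..} (snd z) * norm (G e z) powr p"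
  using zero_off_U(2)[of e z] by (cases "z \<in> U e") (auto simp: GU_def Up_eq indicator_def)

lemma GU_limit: "((\<lambda>e. (LBINT z. norm (GU e z) powr p) / e) \<longlongrightarrow> 0) (at_right 0)"
  by (rule Lim_transform_eventually[OF upper_convergence])
     (intro eventually_at_right_0, simp only: GU_powr)

lemma GU_sobolev: "0 < e \<Longrightarrow> sobolev_rep p (Up e) (\<lambda>z. indicator (Up e) z * u e z) (GU e)"
  unfolding GU_def[abs_def] using Up_open[of e] by (intro sobolev_rep_restrict[OF S_U]) (auto simp: Up_eq)


text \<open>The gradient on the lower part and the gradient on the whole domain are chosen independently, but
  agree almost everywhere by uniqueness.\<close>

lemma lower_wgrad_rep:
  assumes e: "0 < e" and r: "borel_rep (U e) \<phi> (u e)"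
  shows "borel_rep (Lo e) \<phi> (uL e)" "borel_rep (Lo e) (wgrad (Lo e) \<phi>) (GL e)"
proof -
  have "borel_rep (Lo e) \<phi> (\<lambda>z. indicator (Lo e) z *\<^sub>R u e z)"
    using Lo_open[of e] by (intro borel_rep_restrict[OF r Lo_sub[OF e]]) auto
  then show *: "borel_rep (Lo e) \<phi> (uL e)" by (simp add: uL_def[abs_def])
  show "borel_rep (Lo e) (wgrad (Lo e) \<phi>) (GL e)"
    by (rule W1p_from_rep(2)[OF Lo_open lower_sobolev[OF e] *])
qed

lemma upper_wgrad_rep:
  assumes e: "0 < e" and r: "borel_rep (U e) \<phi> (u e)"
  shows "borel_rep (Up e) (wgrad (Up e) \<phi>) (GU e)"
proof -
  have "borel_rep (Up e) \<phi> (\<lambda>z. indicator (Up e) z *\<^sub>R u e z)"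
    using Up_open[OF e] by (intro borel_rep_restrict[OF r]) (auto simp: Up_eq[OF e])
  then have "borel_rep (Up e) \<phi> (\<lambda>z. indicator (Up e) z * u e z)" by simp
  from W1p_from_rep(2)[OF Up_open[OF e] GU_sobolev[OF e] this] show ?thesis .
qed

lemma limit_rep:
  fixes \<phi> F :: "real \<Rightarrow> real"
  assumes "borel_rep {0<..<1} \<phi> F"
  shows "borel_rep (fixed_lower g0) (\<lambda>(x, y). \<phi> x) (\<lambda>z. indicator (fixed_lower g0) z * F (fst z))"
proof -
  have Fm [measurable]: "F \<in> Borel_fun" and ae: "AE x in lborel. x \<in> {0<..<1} \<longrightarrow> \<phi> x = F x"
    using assms by (auto simp: borel_rep_def)
  have [measurable]: "fixed_lower g0 \<in> sets borel" using fixed_open by simp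
  have [measurable]: "(fst :: real \<times> real \<Rightarrow> real) \<in> Borel_fun"
    by (rule borel_measurable_fst_snd(1))
  have m: "(\<lambda>z :: real \<times> real. indicator (fixed_lower g0) z * F (fst z)) \<in> Borel_fun"
    by measurable
  have "AE z in (lborel :: (real \<times> real) measure). fst z \<in> {0<..<1} \<longrightarrow> \<phi> (fst z) = F (fst z)"
    by (rule AE_lborel_fst[OF ae])
  then have "AE z in lborel. z \<in> fixed_lower g0 \<longrightarrow> (case z of (x, y) \<Rightarrow> \<phi> x) = indicator (fixed_lower g0) z * F (fst z)"
    by eventually_elim (auto simp: fixed_lower_def)
  then show ?thesis unfolding borel_rep_def using m by auto
qed

lemma W1p_limit:
  assumes r: "\<And>e. 0 < e \<Longrightarrow> borel_rep (U e) (ub e) (u e)" and r0: "borel_rep {0<..<1} u0 V"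
  shows "W1p_tendsto p (fixed_lower g0) (\<lambda>e. rescale e (ub e)) (\<lambda>(x, y). u0 x) (at_right 0)"
proof -
  let ?R = "fixed_lower g0"
  have RB: "?R \<in> sets borel" using fixed_open by simp
  have rep0: "borel_rep ?R (\<lambda>(x, y). u0 x) VL"
    using limit_rep[OF r0] by (simp add: VL_def[abs_def])
  have rep: "borel_rep ?R (rescale e (ub e)) (\<lambda>z. uL e (vscale e z))" if e: "0 < e" for e
    using borel_rep_vscale[OF lower_wgrad_rep(1)[OF e r[OF e]] e]
    unfolding rescale_vscale fixed_lower_vscale[OF e] Lo_def .
  have sob: "sobolev_rep p ?R (\<lambda>z. uL e (vscale e z) - VL z) (\<lambda>z. vscale e (GL e (vscale e z)) - DL z)" if e: "0 < e" for e
    using pq by (intro sobolev_rep_diff[OF rescaled_sobolev[OF e] limit_sobolev]) auto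
  have drep: "borel_rep ?R (\<lambda>z. rescale e (ub e) z - (case z of (x, y) \<Rightarrow> u0 x)) (\<lambda>z. uL e (vscale e z) - VL z)"
    if e: "0 < e" for e
    by (rule borel_rep_compose2[OF rep[OF e] rep0, of "\<lambda>x y. x - y"]) (simp_all add: borel_prod[symmetric])
  let ?a = "\<lambda>e. LBINT z. norm (uL e (vscale e z) - VL z) powr p"
  let ?b = "\<lambda>e. LBINT z. norm (vscale e (GL e (vscale e z)) - DL z) powr p"
  have nrm: "W1p_norm p ?R (\<lambda>z. rescale e (ub e) z - (case z of (x, y) \<Rightarrow> u0 x)) = (?a e + ?b e) powr (1 / p)"
    if e: "0 < e" for e
  proof -
    have pp: "(x powr (1 / p)) powr p = x" if "0 \<le> x" for x :: real
      using that pq by (simp add: powr_powr)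
    have 1: "Lp_norm p ?R (\<lambda>z. rescale e (ub e) z - (case z of (x, y) \<Rightarrow> u0 x)) = ?a e powr (1 / p)"
      by (rule Lp_norm_rep[OF RB drep[OF e]])
    have 2: "Lp_norm p ?R (wgrad ?R (\<lambda>z. rescale e (ub e) z - (case z of (x, y) \<Rightarrow> u0 x))) = ?b e powr (1 / p)"
      by (rule Lp_norm_rep[OF RB W1p_from_rep(2)[OF fixed_open sob[OF e] drep[OF e]]])
    show ?thesis unfolding W1p_norm_def 1 2 by (subst (1 2) pp) simp_all
  qed
  have "((\<lambda>e. ?a e + ?b e) \<longlongrightarrow> 0 + 0) (at_right 0)"
    by (rule tendsto_add[OF rescaled_value_limit rescaled_gradient_limit])
  then have "((\<lambda>e. (?a e + ?b e) powr (1 / p)) \<longlongrightarrow> 0) (at_right 0)"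
    using pq by (intro scaled_powr_tendsto_0) auto
  moreover have "\<forall>\<^sub>F e in at_right 0. (?a e + ?b e) powr (1 / p) =
      W1p_norm p ?R (\<lambda>z. rescale e (ub e) z - (case z of (x, y) \<Rightarrow> u0 x))"
    by (rule eventually_at_right_0) (rule nrm[symmetric])
  ultimately have "((\<lambda>e. W1p_norm p ?R (\<lambda>z. rescale e (ub e) z - (case z of (x, y) \<Rightarrow> u0 x))) \<longlongrightarrow> 0) (at_right 0)"
    by (rule Lim_transform_eventually)
  moreover have "(\<lambda>(x, y). u0 x) \<in> W1p p ?R" by (rule W1p_from_rep(1)[OF fixed_open limit_sobolev rep0])
  moreover have "\<forall>\<^sub>F e in at_right 0. rescale e (ub e) \<in> W1p p ?R"
    by (rule eventually_at_right_0) (rule W1p_from_rep(1)[OF fixed_open rescaled_sobolev rep])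
  ultimately show ?thesis unfolding W1p_tendsto_def by simp
qed

lemma pflux_component:
  fixes h :: "real \<times> real \<Rightarrow> real"
  assumes h: "h = fst \<or> h = snd" and r: "borel_rep A F H"
  shows "borel_rep A (\<lambda>z. h (pflux p (F z))) (\<lambda>z. h (pflux p (H z)))"
    "norm (h (pflux p (H z))) powr q \<le> norm (H z) powr p"
    "integrable lborel (\<lambda>z. norm (H z) powr p) \<Longrightarrow> integrable lborel (\<lambda>z. norm (h (pflux p (H z))) powr q)"
proof -
  have hm [measurable]: "h \<in> Borel_fun" using h by auto
  have "(\<lambda>x. h (pflux p x)) \<in> Borel_fun" by measurable
  then show "borel_rep A (\<lambda>z. h (pflux p (F z))) (\<lambda>z. h (pflux p (H z)))"
    using h by (intro borel_rep_compose[OF r, of "\<lambda>x. h (pflux p x)"]) auto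
  show le: "norm (h (pflux p (H z))) powr q \<le> norm (H z) powr p" for z
  proof -
    have "norm (h (pflux p (H z))) \<le> norm (pflux p (H z))"
      using h abs_fst_snd_le[of "pflux p (H z)"] by auto
    then have "norm (h (pflux p (H z))) powr q \<le> norm (pflux p (H z)) powr q"
      using q by (intro powr_mono2) auto
    then show ?thesis by (simp add: norm_pflux_powr[OF pq])
  qed
  have [measurable]: "H \<in> Borel_fun" using r by (simp add: borel_rep_def)
  assume "integrable lborel (\<lambda>z. norm (H z) powr p)"
  then show "integrable lborel (\<lambda>z. norm (h (pflux p (H z))) powr q)"
    by (rule integrable_dominated) (use le in auto)
qed

lemma lower_flux_limit:
  fixes h :: "real \<times> real \<Rightarrow> real"
  assumes h: "h = fst \<or> h = snd" and r: "\<And>e. 0 < e \<Longrightarrow> borel_rep (U e) (ub e) (u e)"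
    and w: "borel_rep (fixed_lower g0) w (\<lambda>z. h (pflux p (DL z)))"
  shows "Lp_tendsto q (fixed_lower g0) (\<lambda>e. rescale e (\<lambda>z. h (pflux p (wgrad (thin_lower g0 e) (ub e) z)))) w (at_right 0)"
proof (rule Lp_tendsto_rep[OF _ _ w])
  show "fixed_lower g0 \<in> sets borel" using fixed_open by simp
  show "0 < q" using q by simp
  have "borel_rep (fixed_lower g0) DL DL" using limit_sobolev by (intro borel_rep_self) (auto simp: sobolev_rep_def)
  from pflux_component(3)[OF h this] limit_sobolev
  show "integrable lborel (\<lambda>z. norm (h (pflux p (DL z))) powr q)" by (simp add: sobolev_rep_def)
  show "((\<lambda>e. LBINT z. norm (h (pflux p (GL e (vscale e z))) - h (pflux p (DL z))) powr q) \<longlongrightarrow> 0) (at_right 0)"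
    by (rule rescaled_flux_limit[OF h])
  fix e :: real assume e: "0 < e"
  note GLr = lower_wgrad_rep(2)[OF e r[OF e]]
  show "borel_rep (fixed_lower g0) (rescale e (\<lambda>z. h (pflux p (wgrad (thin_lower g0 e) (ub e) z)))) (\<lambda>z. h (pflux p (GL e (vscale e z))))"
    using borel_rep_vscale[OF pflux_component(1)[OF h GLr] e]
    unfolding rescale_vscale fixed_lower_vscale[OF e] Lo_def .
  have "integrable lborel (\<lambda>z. norm (h (pflux p (GL e z))) powr q)"
    using pflux_component(3)[OF h GLr] lower_sobolev[OF e] by (simp add: sobolev_rep_def)
  from integrable_vscale[OF this e] show "integrable lborel (\<lambda>z. norm (h (pflux p (GL e (vscale e z)))) powr q)" .
qed

text \<open>The \<open>q\<close>-th power of the flux is the \<open>p\<close>-th power of the gradient, and unfolding preserves the rescaled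
  norm up to the factor \<open>L\<close>.\<close>

lemma upper_flux_limit:
  fixes h :: "real \<times> real \<Rightarrow> real"
  assumes h: "h = fst \<or> h = snd" and r: "\<And>e. 0 < e \<Longrightarrow> borel_rep (U e) (ub e) (u e)"
  shows "Lp_tendsto q ({0<..<1} \<times> upper_cell g g0 L)
    (\<lambda>e. unfold_upper L \<alpha> e (\<lambda>z. h (pflux p (wgrad (thin_upper g g0 \<alpha> e) (ub e) z)))) (\<lambda>z. 0) (at_right 0)"
proof -
  let ?\<Omega> = "{0<..<1::real} \<times> upper_cell g g0 L"
  let ?v = "\<lambda>e. unfold_upper L \<alpha> e (\<lambda>z. h (pflux p (wgrad (thin_upper g g0 \<alpha> e) (ub e) z)))"
  have g [measurable]: "g \<in> Borel_fun" by (rule lower_semicontinuous_borel[OF lsc])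
  have "\<exists>H. borel_rep ?\<Omega> (?v e) H \<and> integrable lborel (\<lambda>w. norm (H w) powr q) \<and>
      (LBINT w. norm (H w) powr q) \<le> L * ((LBINT z. norm (GU e z) powr p) / e)" if e: "0 < e" for e
  proof -
    note GUr = upper_wgrad_rep[OF e r[OF e], unfolded Up_def]
    have iG: "integrable lborel (\<lambda>z. norm (GU e z) powr p)" using GU_sobolev[OF e] by (simp add: sobolev_rep_def)
    note iH = pflux_component(3)[OF h GUr iG]
    obtain H where H: "borel_rep ?\<Omega> (?v e) H" "integrable lborel (\<lambda>w. norm (H w) powr q)"
      "(LBINT w. norm (H w) powr q) \<le> L / e * (LBINT z. norm (h (pflux p (GU e z))) powr q)"
      using unfold_rep[OF g per L e pflux_component(1)[OF h GUr] iH] by blast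
    have "(LBINT z. norm (h (pflux p (GU e z))) powr q) \<le> (LBINT z. norm (GU e z) powr p)"
      by (rule integral_mono[OF iH iG pflux_component(2)[OF h GUr]])
    then have "L / e * (LBINT z. norm (h (pflux p (GU e z))) powr q) \<le> L / e * (LBINT z. norm (GU e z) powr p)"
      using L e by (intro mult_left_mono) auto
    with H show ?thesis by (intro exI[of _ H]) auto
  qed
  then obtain H where H: "\<And>e. 0 < e \<Longrightarrow> borel_rep ?\<Omega> (?v e) (H e)"
    "\<And>e. 0 < e \<Longrightarrow> integrable lborel (\<lambda>w. norm (H e w) powr q)"
    "\<And>e. 0 < e \<Longrightarrow> (LBINT w. norm (H e w) powr q) \<le> L * ((LBINT z. norm (GU e z) powr p) / e)"
    by metis
  have lim: "((\<lambda>e. L * ((LBINT z. norm (GU e z) powr p) / e)) \<longlongrightarrow> 0) (at_right 0)"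
    using tendsto_mult_left[OF GU_limit, of L] by simp
  show ?thesis
  proof (rule Lp_tendsto_rep[where W = "\<lambda>_. 0" and F = H])
    show "?\<Omega> \<in> sets borel" by (rule upper_cell_borel[OF g])
    show "0 < q" using q by simp
    show "((\<lambda>e. LBINT z. norm (H e z - 0) powr q) \<longlongrightarrow> 0) (at_right 0)"
      by (rule tendsto_sandwich[where f = "\<lambda>_. 0", OF _ _ tendsto_const lim])
         (use H(3) in \<open>auto intro!: eventually_at_right_0\<close>)
  qed (use H in \<open>auto simp: borel_rep_def\<close>)
qed

lemma upper_gradient_limit:
  assumes r: "\<And>e. 0 < e \<Longrightarrow> borel_rep (U e) (w e) (G e)"
  shows "((\<lambda>e. rescaled_norm e p (thin_upper g g0 \<alpha> e) (w e)) \<longlongrightarrow> 0) (at_right 0)"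
proof -
  have "((LBINT z. norm (GU e z) powr p) / e) powr (1 / p) = rescaled_norm e p (thin_upper g g0 \<alpha> e) (w e)"
    if e: "0 < e" for e
  proof -
    have B: "Up e \<in> sets borel" using Up_open[OF e] by simp
    have "borel_rep (Up e) (w e) (GU e)"
      using borel_rep_restrict[OF r[OF e] _ B] by (simp add: GU_def[abs_def] Up_eq[OF e])
    from Lp_norm_rep[OF B this, of p]
    have "Lp_norm p (thin_upper g g0 \<alpha> e) (w e) = (LBINT z. norm (GU e z) powr p) powr (1 / p)" by (simp add: Up_def)
    moreover have "e powr (- 1 / p) = 1 / e powr (1 / p)" by (simp add: powr_minus_divide)
    ultimately show ?thesis unfolding rescaled_norm_def using e by (simp add: powr_divide)
  qed
  then have "\<forall>\<^sub>F e in at_right 0. ((LBINT z. norm (GU e z) powr p) / e) powr (1 / p) =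
      rescaled_norm e p (thin_upper g g0 \<alpha> e) (w e)"
    by (rule eventually_at_right_0)
  moreover have "((\<lambda>e. ((LBINT z. norm (GU e z) powr p) / e) powr (1 / p)) \<longlongrightarrow> 0) (at_right 0)"
    using pq by (intro scaled_powr_tendsto_0[OF GU_limit]) auto
  ultimately show ?thesis by (rule Lim_transform_eventually[rotated])
qed

end

section \<open>Weak forms in terms of Borel representatives\<close>

lemma period_average_borel:
  assumes [measurable]: "g \<in> Borel_fun"
  shows "period_average L g = (1 / L) * (LBINT s. indicator {0..<L} s * g s)"
proof -
  have "borel_rep {0<..<L} g (\<lambda>s. indicator {0<..<L} s *\<^sub>R g s)"
    by (rule borel_rep_restrict[where U = UNIV]) (auto simp: borel_rep_def)
  from borel_rep_integral(2)[OF _ this]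
  have "(LINT s|lebesgue_on {0<..<L}. g s) = (LBINT s. indicator {0<..<L} s *\<^sub>R g s)" by simp
  also have "\<dots> = (LBINT s. indicator {0..<L} s * g s)"
  proof (rule integral_cong_AE)
    show "AE s in lborel. indicator {0<..<L} s *\<^sub>R g s = indicator {0..<L} s * g s"
      using AE_lborel_singleton[of "0::real"] by eventually_elim (auto simp: indicator_def)
  qed measurable
  finally show ?thesis by (simp add: period_average_def)
qed

text \<open>For almost every \<open>x\<close> the representative is correct on almost all of the fibre over \<open>x\<close>.\<close>

lemma fibre_average_rep:
  fixes f F :: "real \<times> real \<Rightarrow> real"
  assumes r: "borel_rep (thin_domain g \<alpha> e) f F"
  shows "borel_rep {0<..<1} (fibre_average g \<alpha> e f) (\<lambda>x. (1 / e) * (LBINT y. F (x, y)))"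
proof -
  have Fm: "F \<in> Borel_fun" and F0: "\<And>z. z \<notin> thin_domain g \<alpha> e \<Longrightarrow> F z = 0"
    and ae: "AE z in lborel. z \<in> thin_domain g \<alpha> e \<longrightarrow> f z = F z"
    using r by (auto simp: borel_rep_def)
  have "case_prod (\<lambda>x y. F (x, y)) \<in> borel_measurable (borel \<Otimes>\<^sub>M lborel)"
    using Fm by (simp add: borel_prod[symmetric] cong: measurable_cong_sets)
  from lborel.borel_measurable_lebesgue_integral[OF this]
  have m: "(\<lambda>x. (1 / e) * (LBINT y. F (x, y))) \<in> Borel_fun" by simp
  have "AE x in lborel. x \<in> {0<..<1} \<longrightarrow> fibre_average g \<alpha> e f x = (1 / e) * (LBINT y. F (x, y))"
    using AE_lborel_pair[OF ae]
  proof eventually_elim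
    case (elim x)
    show ?case
    proof
      assume x: "x \<in> {0<..<1}"
      have "borel_rep {0<..<e * g (x / e powr \<alpha>)} (\<lambda>y. f (x, y)) (\<lambda>y. F (x, y))"
        unfolding borel_rep_def
      proof (intro conjI allI impI)
        show "(\<lambda>y. F (x, y)) \<in> Borel_fun" by (rule slice_borel[OF Fm])
        show "F (x, y) = 0" if "y \<notin> {0<..<e * g (x / e powr \<alpha>)}" for y
          using that by (intro F0) (auto simp: thin_domain_def)
        show "AE y in lborel. y \<in> {0<..<e * g (x / e powr \<alpha>)} \<longrightarrow> f (x, y) = F (x, y)"
          using elim by eventually_elim (use x in \<open>auto simp: thin_domain_def\<close>)
      qed
      from borel_rep_integral(2)[OF _ this]
      show "fibre_average g \<alpha> e f x = (1 / e) * (LBINT y. F (x, y))" by (simp add: fibre_average_def)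
    qed
  qed
  moreover have "(1 / e) * (LBINT y. F (x, y)) = 0" if "x \<notin> {0<..<1}" for x
  proof -
    have "F (x, y) = 0" for y using that by (intro F0) (auto simp: thin_domain_def)
    then show ?thesis by simp
  qed
  ultimately show ?thesis unfolding borel_rep_def using m by blast
qed

lemma weak_form_rep:
  fixes v \<phi> F \<psi> :: "'a::euclidean_space \<Rightarrow> real" and G \<Phi> H \<Psi> :: "'a \<Rightarrow> 'a"
  assumes "borel_rep A v F" "borel_rep A G H" "borel_rep A \<phi> \<psi>" "borel_rep A \<Phi> \<Psi>"
  shows "borel_rep A (\<lambda>z. (a *\<^sub>R pflux p (G z)) \<bullet> \<Phi> z + pflux p (v z) * \<phi> z)
    (\<lambda>z. (a *\<^sub>R pflux p (H z)) \<bullet> \<Psi> z + pflux p (F z) * \<psi> z)"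
  unfolding borel_rep_def
proof (intro conjI allI impI)
  have [measurable]: "F \<in> Borel_fun" "H \<in> Borel_fun"
    "\<psi> \<in> Borel_fun" "\<Psi> \<in> Borel_fun"
    using assms by (auto simp: borel_rep_def)
  show "(\<lambda>z. (a *\<^sub>R pflux p (H z)) \<bullet> \<Psi> z + pflux p (F z) * \<psi> z) \<in> Borel_fun" by measurable
  show "(a *\<^sub>R pflux p (H z)) \<bullet> \<Psi> z + pflux p (F z) * \<psi> z = 0" if "z \<notin> A" for z
    using that assms by (auto simp: borel_rep_def)
  have "AE z in lborel. z \<in> A \<longrightarrow> v z = F z" "AE z in lborel. z \<in> A \<longrightarrow> G z = H z"
    "AE z in lborel. z \<in> A \<longrightarrow> \<phi> z = \<psi> z" "AE z in lborel. z \<in> A \<longrightarrow> \<Phi> z = \<Psi> z"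
    using assms by (auto simp: borel_rep_def)
  then show "AE z in lborel. z \<in> A \<longrightarrow> (a *\<^sub>R pflux p (G z)) \<bullet> \<Phi> z + pflux p (v z) * \<phi> z =
      (a *\<^sub>R pflux p (H z)) \<bullet> \<Psi> z + pflux p (F z) * \<psi> z"
    by eventually_elim simp
qed

text \<open>A Borel function that satisfies \<open>sobolev_rep\<close> is its own representative and belongs to the Sobolev
  space, so it is an admissible test function.\<close>

lemma weak_equation_rep:
  fixes v f F k :: "'a::euclidean_space \<Rightarrow> real" and H :: "'a \<Rightarrow> 'a"
  assumes A: "open A" and v: "borel_rep A v F" "borel_rep A (wgrad A v) H" and f: "borel_rep A f k"
    and eq: "\<And>\<phi>. \<phi> \<in> W1p p A \<Longrightarrow>
      (LINT z|lebesgue_on A. (a *\<^sub>R pflux p (wgrad A v z)) \<bullet> wgrad A \<phi> z + pflux p (v z) * \<phi> z) =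
      (LINT z|lebesgue_on A. f z * \<phi> z)"
    and \<phi>: "sobolev_rep p A \<phi> \<Phi>"
  shows "(LBINT z. (a *\<^sub>R pflux p (H z)) \<bullet> \<Phi> z + pflux p (F z) * \<phi> z) = (LBINT z. k z * \<phi> z)"
proof -
  have AB: "A \<in> sets borel" using A by simp
  have \<phi>m: "\<phi> \<in> Borel_fun" using \<phi> by (simp add: sobolev_rep_def)
  have rep: "borel_rep A \<phi> \<phi>" using \<phi> by (intro borel_rep_self) (auto simp: sobolev_rep_def)
  note R = W1p_from_rep[OF A \<phi> rep]
  show ?thesis
    using eq[OF R(1)] borel_rep_integral(2)[OF AB weak_form_rep[OF v rep R(2), of a p]]
      borel_rep_integral(2)[OF AB borel_rep_times_borel[OF f \<phi>m]]
    by simp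
qed

lemma rescaled_norm_bound:
  fixes e q I c :: real
  assumes e: "0 < e" and q: "1 < q" and B: "0 \<le> I" and le: "e powr (- 1 / q) * I powr (1 / q) \<le> c"
  shows "I \<le> e * c powr q"
proof -
  have "(I powr (1 / q)) powr q = I" using B q by (simp add: powr_powr)
  then have "I = (I powr (1 / q)) powr q" by (rule sym)
  also have "I powr (1 / q) = e powr (1 / q) * (e powr (- 1 / q) * I powr (1 / q))"
    using e by (simp add: powr_minus_divide)
  also have "\<dots> powr q \<le> (e powr (1 / q) * c) powr q"
    using q e by (intro powr_mono2 mult_left_mono le) auto
  also have "\<dots> = e * c powr q"
  proof -
    have "0 \<le> e powr (- 1 / q) * I powr (1 / q)" by simp
    then have "0 \<le> c" using le by linarith
    then show ?thesis using e q by (simp add: powr_mult powr_powr)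
  qed
  finally show ?thesis .
qed

theorem corollary5p3p1:
  fixes g :: "real \<Rightarrow> real" and L g0 \<alpha> p p' c :: real
    and f u :: "real \<Rightarrow> real \<times> real \<Rightarrow> real"
    and fhat u0 :: "real \<Rightarrow> real"
  assumes g_pos: "\<And>x. g x > 0"
    and g_bounded: "bounded (range g)"
    and g_lsc: "lower_semicontinuous g"
    and L_pos: "L > 0"
    and g_periodic: "\<And>x. g (x + L) = g x"
    and g0_min: "g0 \<in> range g" "\<And>x. g0 \<le> g x"
    and alpha: "\<alpha> > 1"
    and p: "1 < p"
    and conj: "1 / p + 1 / p' = 1"
    and f_Lp: "\<And>\<epsilon>. \<epsilon> > 0 \<Longrightarrow> f \<epsilon> \<in> Lp_space p' (thin_domain g \<alpha> \<epsilon>)"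
    and c_pos: "c > 0"
    and f_bound: "\<And>\<epsilon>. \<epsilon> > 0 \<Longrightarrow> rescaled_norm \<epsilon> p' (thin_domain g \<alpha> \<epsilon>) (f \<epsilon>) \<le> c"
    and fhat_weak: "Lp_weak_tendsto p' {0<..<1} (\<lambda>\<epsilon>. fibre_average g \<alpha> \<epsilon> (f \<epsilon>)) fhat (at_right 0)"
    and u_W1p: "\<And>\<epsilon>. \<epsilon> > 0 \<Longrightarrow> u \<epsilon> \<in> W1p p (thin_domain g \<alpha> \<epsilon>)"
    and u_eq: "\<And>\<epsilon> \<phi>. \<epsilon> > 0 \<Longrightarrow> \<phi> \<in> W1p p (thin_domain g \<alpha> \<epsilon>) \<Longrightarrow>
       (LINT z|lebesgue_on (thin_domain g \<alpha> \<epsilon>).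
           pflux p (wgrad (thin_domain g \<alpha> \<epsilon>) (u \<epsilon>) z) \<bullet> wgrad (thin_domain g \<alpha> \<epsilon>) \<phi> z
           + pflux p (u \<epsilon> z) * \<phi> z) =
       (LINT z|lebesgue_on (thin_domain g \<alpha> \<epsilon>). f \<epsilon> z * \<phi> z)"
    and u0_W1p: "u0 \<in> W1p p {0<..<1}"
    and u0_eq: "\<And>\<phi>. \<phi> \<in> W1p p {0<..<1} \<Longrightarrow>
       (LINT x|lebesgue_on {0<..<1}.
           g0 / period_average L g * pflux p (wgrad {0<..<1} u0 x) * wgrad {0<..<1} \<phi> x
           + pflux p (u0 x) * \<phi> x) =
       (LINT x|lebesgue_on {0<..<1}. fhat x / period_average L g * \<phi> x)"
  shows "W1p_tendsto p (fixed_lower g0) (\<lambda>\<epsilon>. rescale \<epsilon> (u \<epsilon>)) (\<lambda>(x, y). u0 x) (at_right 0) \<and>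
    Lp_tendsto p' (fixed_lower g0)
           (\<lambda>\<epsilon>. rescale \<epsilon> (\<lambda>z. fst (pflux p (wgrad (thin_lower g0 \<epsilon>) (u \<epsilon>) z))))
           (\<lambda>(x, y). pflux p (wgrad {0<..<1} u0 x)) (at_right 0) \<and>
    Lp_tendsto p' (fixed_lower g0)
           (\<lambda>\<epsilon>. rescale \<epsilon> (\<lambda>z. snd (pflux p (wgrad (thin_lower g0 \<epsilon>) (u \<epsilon>) z))))
           (\<lambda>z. 0) (at_right 0) \<and>
    Lp_tendsto p' ({0<..<1} \<times> upper_cell g g0 L)
           (\<lambda>\<epsilon>. unfold_upper L \<alpha> \<epsilon> (\<lambda>z. fst (pflux p (wgrad (thin_upper g g0 \<alpha> \<epsilon>) (u \<epsilon>) z))))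
           (\<lambda>z. 0) (at_right 0) \<and>
    Lp_tendsto p' ({0<..<1} \<times> upper_cell g g0 L)
           (\<lambda>\<epsilon>. unfold_upper L \<alpha> \<epsilon> (\<lambda>z. snd (pflux p (wgrad (thin_upper g g0 \<alpha> \<epsilon>) (u \<epsilon>) z))))
           (\<lambda>z. 0) (at_right 0) \<and>
    ((\<lambda>\<epsilon>. rescaled_norm \<epsilon> p (thin_upper g g0 \<alpha> \<epsilon>) (wgrad (thin_domain g \<alpha> \<epsilon>) (u \<epsilon>)))
           \<longlongrightarrow> 0) (at_right 0)"
proof -
  note q = conjugate_exponents(1)[OF p conj]
  obtain y0 where y0: "g y0 = g0" using g0_min(1) by auto
  obtain g1 where g1: "\<And>x. g x \<le> g1"
    using g_bounded unfolding bounded_iff by (auto intro: order_trans[OF abs_ge_self])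
  have gm: "g \<in> Borel_fun" by (rule lower_semicontinuous_borel[OF g_lsc])
  have U_open: "open (thin_domain g \<alpha> e)" if "0 < e" for e
    unfolding thin_domain_subgraph by (intro open_subgraph lower_semicontinuous_scaled g_lsc that)
  have U_bounded: "bounded (thin_domain g \<alpha> e)" if e: "0 < e" for e
  proof (rule bounded_subset)
    show "bounded (cbox (0, 0) (1, e * g1))" by (rule bounded_cbox)
    show "thin_domain g \<alpha> e \<subseteq> cbox (0, 0) (1, e * g1)"
    proof
      fix z assume "z \<in> thin_domain g \<alpha> e"
      moreover have "e * g (fst z / e powr \<alpha>) \<le> e * g1" using g1 e by (intro mult_left_mono) auto
      ultimately show "z \<in> cbox (0, 0) (1, e * g1)"
        by (auto simp: thin_domain_def cbox_Pair_eq)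
    qed
  qed
  have "\<exists>F H k. sobolev_rep p (thin_domain g \<alpha> e) F H \<and> borel_rep (thin_domain g \<alpha> e) (u e) F \<and>
      borel_rep (thin_domain g \<alpha> e) (wgrad (thin_domain g \<alpha> e) (u e)) H \<and>
      borel_rep (thin_domain g \<alpha> e) (f e) k \<and> integrable lborel (\<lambda>z. norm (k z) powr p')" if e: "0 < e" for e
  proof -
    obtain F H where "sobolev_rep p (thin_domain g \<alpha> e) F H" "borel_rep (thin_domain g \<alpha> e) (u e) F"
      "borel_rep (thin_domain g \<alpha> e) (wgrad (thin_domain g \<alpha> e) (u e)) H"
      using W1p_ex_rep[OF U_open[OF e] U_bounded[OF e] _ u_W1p[OF e]] p by auto
    moreover obtain k where "borel_rep (thin_domain g \<alpha> e) (f e) k" "integrable lborel (\<lambda>z. norm (k z) powr p')"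
      using Lp_space_ex_rep[OF _ f_Lp[OF e]] U_open[OF e] by auto
    ultimately show ?thesis by blast
  qed
  then obtain ub Gb fb where ub:
    "\<And>e. 0 < e \<Longrightarrow> sobolev_rep p (thin_domain g \<alpha> e) (ub e) (Gb e)"
    "\<And>e. 0 < e \<Longrightarrow> borel_rep (thin_domain g \<alpha> e) (u e) (ub e)"
    "\<And>e. 0 < e \<Longrightarrow> borel_rep (thin_domain g \<alpha> e) (wgrad (thin_domain g \<alpha> e) (u e)) (Gb e)"
    and fb: "\<And>e. 0 < e \<Longrightarrow> borel_rep (thin_domain g \<alpha> e) (f e) (fb e)"
    "\<And>e. 0 < e \<Longrightarrow> integrable lborel (\<lambda>z. norm (fb e z) powr p')"
    by metis
  obtain F0 D where D: "sobolev_rep p {0<..<1} F0 D" "borel_rep {0<..<1} u0 F0" "borel_rep {0<..<1} (wgrad {0<..<1} u0) D"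
  proof (rule W1p_ex_rep[OF _ _ _ u0_W1p])
    show "bounded {0<..<1::real}" using bounded_box[of 0 "1::real"] by simp
  qed (use p in auto)
  obtain c0 where c0: "AE x in lborel. x \<in> {0<..<1} \<longrightarrow> F0 x = c0 + primitive D x"
    using sobolev_interval_primitive[OF D(1)] by blast
  \<comment> \<open>Passing to the continuous representative of the limit solution.\<close>
  define V where "V x = indicator {0<..<1} x * (c0 + primitive D x)" for x :: real
  have [measurable]: "D \<in> Borel_fun" using D(1) by (simp add: sobolev_rep_def)
  have Vm: "V \<in> Borel_fun" unfolding V_def[abs_def] by measurable
  have F0_0: "F0 x = 0" if "x \<notin> {0<..<1}" for x using D(2) that by (auto simp: borel_rep_def)
  have aeV: "AE x in lborel. V x = F0 x"
    using c0 by eventually_elim (use F0_0 in \<open>auto simp: V_def indicator_def\<close>)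
  have S0: "sobolev_rep p {0<..<1} V D"
    by (rule sobolev_rep_cong_AE[OF D(1) Vm _ aeV]) (simp add: V_def)
  have r0: "borel_rep {0<..<1} u0 V"
    unfolding borel_rep_def
  proof (intro conjI allI impI Vm)
    have "AE x in lborel. x \<in> {0<..<1} \<longrightarrow> u0 x = F0 x" using D(2) by (simp add: borel_rep_def)
    with aeV show "AE x in lborel. x \<in> {0<..<1} \<longrightarrow> u0 x = V x" by eventually_elim simp
  qed (simp add: V_def)
  have "fhat \<in> Lp_space p' {0<..<1}" using fhat_weak by (simp add: Lp_weak_tendsto_def)
  then obtain fh where fh: "borel_rep {0<..<1} fhat fh" "integrable lborel (\<lambda>x. norm (fh x) powr p')"
    using Lp_space_ex_rep[of "{0<..<1::real}" fhat] by auto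
  have weak: "((\<lambda>e. LBINT x. indicator {a..<b} x * ((1 / e) * (LBINT y. fb e (x, y)))) \<longlongrightarrow>
      (LBINT x. indicator {a..<b} x * fh x)) (at_right 0)" for a b :: real
  proof -
    \<comment> \<open>Indicators of intervals lie in the dual space, so weak convergence applies to them.\<close>
    let ?\<psi> = "indicator {a..<b} :: real \<Rightarrow> real"
    have B: "{0<..<1::real} \<in> sets borel" by simp
    have "borel_rep {0<..<1} ?\<psi> (\<lambda>x. indicator {0<..<1} x *\<^sub>R ?\<psi> x)"
      by (rule borel_rep_restrict[where U = UNIV]) (auto simp: borel_rep_def)
    moreover have "integrable lborel (\<lambda>x. norm (indicator {0<..<1} x *\<^sub>R ?\<psi> x) powr (p' / (p' - 1)))"
    proof -
      have "norm (indicator {0<..<1} x *\<^sub>R ?\<psi> x) powr (p' / (p' - 1)) = indicator ({0<..<1} \<inter> {a..<b}) x" for x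
        by (simp add: indicator_def)
      moreover have "emeasure lborel ({0<..<1} \<inter> {a..<b}) < \<infinity>"
        by (rule le_less_trans[OF emeasure_mono[of _ "{0<..<1}"]]) auto
      ultimately show ?thesis by (simp only:) (intro integrable_real_indicator; simp)
    qed
    ultimately have "?\<psi> \<in> Lp_space (p' / (p' - 1)) {0<..<1}" using Lp_space_rep[OF B] by blast
    then have "((\<lambda>e. LINT x|lebesgue_on {0<..<1}. fibre_average g \<alpha> e (f e) x * ?\<psi> x) \<longlongrightarrow>
        (LINT x|lebesgue_on {0<..<1}. fhat x * ?\<psi> x)) (at_right 0)"
      using fhat_weak by (auto simp: Lp_weak_tendsto_def)
    moreover have "(LINT x|lebesgue_on {0<..<1}. fhat x * ?\<psi> x) = (LBINT x. ?\<psi> x * fh x)"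
      using borel_rep_integral(2)[OF B borel_rep_times_borel[OF fh(1), of ?\<psi>]] by (simp add: mult.commute)
    moreover have "\<forall>\<^sub>F e in at_right 0. (LINT x|lebesgue_on {0<..<1}. fibre_average g \<alpha> e (f e) x * ?\<psi> x) =
        (LBINT x. ?\<psi> x * ((1 / e) * (LBINT y. fb e (x, y))))"
    proof (rule eventually_at_right_0)
      fix e :: real assume "0 < e"
      from borel_rep_integral(2)[OF B borel_rep_times_borel[OF fibre_average_rep[OF fb(1)[OF this]], of ?\<psi>]]
      show "(LINT x|lebesgue_on {0<..<1}. fibre_average g \<alpha> e (f e) x * ?\<psi> x) =
        (LBINT x. ?\<psi> x * ((1 / e) * (LBINT y. fb e (x, y))))" by (simp add: ac_simps)
    qed
    ultimately show ?thesis using Lim_transform_eventually by fastforce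
  qed
  have fb_bound: "(LBINT z. norm (fb e z) powr p') \<le> e * c powr p'" if e: "0 < e" for e
  proof (rule rescaled_norm_bound[OF e q])
    have "thin_domain g \<alpha> e \<in> sets borel" using U_open[OF e] by simp
    from Lp_norm_rep[OF this fb(1)[OF e], of p'] f_bound[OF e]
    show "e powr (- 1 / p') * (LBINT z. norm (fb e z) powr p') powr (1 / p') \<le> c"
      by (simp add: rescaled_norm_def)
  qed simp
  have eq: "(LBINT z. pflux p (Gb e z) \<bullet> \<Phi> z + pflux p (ub e z) * \<phi> z) = (LBINT z. fb e z * \<phi> z)"
    if e: "0 < e" and \<phi>: "sobolev_rep p (thin_domain g \<alpha> e) \<phi> \<Phi>" for e \<phi> \<Phi>
    using weak_equation_rep[OF U_open[OF e] ub(2,3)[OF e] fb(1)[OF e], of p 1 \<phi> \<Phi>] u_eq[OF e] \<phi> by simp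
  let ?gb = "period_average L g"
  have eq0: "(LBINT x. g0 / ?gb * pflux p (D x) * \<Phi> x + pflux p (V x) * \<phi> x) = (LBINT x. fh x / ?gb * \<phi> x)"
    if \<phi>: "sobolev_rep p {0<..<1} \<phi> \<Phi>" for \<phi> \<Phi>
  proof -
    have "borel_rep {0<..<1} (\<lambda>x. fhat x / ?gb) (\<lambda>x. fh x / ?gb)"
      using borel_rep_compose[OF fh(1), of "\<lambda>x. x / ?gb"] by simp
    from weak_equation_rep[OF _ r0 D(3) this, of p "g0 / ?gb" \<phi> \<Phi>] u0_eq \<phi> show ?thesis by simp
  qed
  interpret T: thin_limit g L g0 g1 y0 \<alpha> p p' c c0 "?gb" fb ub Gb fh D
  proof
    show "Lpb p' (fb e)" if "0 < e" for e using fb[OF that] by (simp add: Lpb_def borel_rep_def)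
    show "fb e z = 0" if "0 < e" "z \<notin> subgraph (\<lambda>x. e * g (x / e powr \<alpha>))" for e z
      using fb(1)[OF that(1)] that(2) unfolding borel_rep_def thin_domain_subgraph by blast
    show "Lpb p' fh" "\<And>x. x \<notin> {0<..<1} \<Longrightarrow> fh x = 0" using fh by (auto simp: Lpb_def borel_rep_def)
    show "?gb = 1 / L * (LBINT s. indicator {0..<L} s * g s)" by (rule period_average_borel[OF gm])
    show "0 < g0" using g_pos[of y0] y0 by simp
    show "sobolev_rep p {0<..<1} (\<lambda>x. indicator {0<..<1} x * (c0 + primitive D x)) D"
      using S0 by (simp add: V_def[abs_def])
  qed (use assms y0 g1 ub(1) fb_bound eq eq0 weak in \<open>simp_all add: thin_domain_subgraph V_def\<close>)
  have r: "borel_rep (T.U e) (u e) (ub e)" if "0 < e" for e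
    using ub(2)[OF that] by (simp add: T.U_def thin_domain_subgraph)
  have rG: "borel_rep (T.U e) (wgrad (thin_domain g \<alpha> e) (u e)) (Gb e)" if "0 < e" for e
    using ub(3)[OF that] by (simp add: T.U_def thin_domain_subgraph)
  have w1: "borel_rep (fixed_lower g0) (\<lambda>(x, y). pflux p (wgrad {0<..<1} u0 x)) (\<lambda>z. fst (pflux p (T.DL z)))"
  proof -
    have "borel_rep {0<..<1} (\<lambda>x. pflux p (wgrad {0<..<1} u0 x)) (\<lambda>x. pflux p (D x))"
      by (rule borel_rep_compose[OF D(3)]) auto
    from T.limit_rep[OF this]
    have "borel_rep (fixed_lower g0) (\<lambda>(x, y). pflux p (wgrad {0<..<1} u0 x))
      (\<lambda>z. indicator (fixed_lower g0) z * pflux p (D (fst z)))" .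
    moreover have "(\<lambda>z. indicator (fixed_lower g0) z * pflux p (D (fst z))) = (\<lambda>z. fst (pflux p (T.DL z)))"
    proof
      fix z show "indicator (fixed_lower g0) z * pflux p (D (fst z)) = fst (pflux p (T.DL z))"
        by (cases "z \<in> fixed_lower g0") (simp_all add: T.DL_def pflux_pair)
    qed
    ultimately show ?thesis by simp
  qed
  have w2: "borel_rep (fixed_lower g0) (\<lambda>z. 0) (\<lambda>z. snd (pflux p (T.DL z)))"
  proof -
    have "snd (pflux p (T.DL z)) = 0" for z by (simp add: T.DL_def pflux_def)
    then show ?thesis by (simp add: borel_rep_def)
  qed
  have r0': "borel_rep {0<..<1} u0 T.V" using r0 by (simp add: V_def[abs_def] T.V_def[abs_def])
  show ?thesis
    by (intro conjI T.W1p_limit[OF r r0'] T.lower_flux_limit[OF _ r w1] T.lower_flux_limit[OF _ r w2]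
      T.upper_flux_limit[OF _ r] T.upper_gradient_limit[OF rG]) auto
qed

end
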